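(* Let $\mathbb K$ be an algebraically closed field of characteristic $3$. Let $\mathfrak e_6=\mathfrak g(A)$ with purely even Cartan matrix $$A=\begin{pmatrix}2&0&-1&0&0&0\\0&2&0&-1&0&0\\-1&0&2&-1&0&0\\0&-1&-1&2&-1&0\\0&0&0&-1&2&-1\\0&0&0&0&-1&2\end{pmatrix},$$ and let $\mathfrak z$ be the (one-dimensional) center of $\mathfrak e_6^{(1)}$. Let $\mathfrak g(3,3)=\mathfrak g(\widetilde A)$ be the Elduque and Cunha Lie superalgebra with Cartan matrix $$\widetilde A=\begin{pmatrix}0&-1&0&0\\-1&0&-1&0\\0&-1&2&-1\\0&0&-1&2\end{pmatrix}$$ in which the first two indices are odd and the last two are even, and let $\mathfrak c$ be the (one-dimensional) center of $\mathfrak g(3,3)^{(1)}$. Then the semisimplification of $\mathfrak e_6^{(1)}/\mathfrak z$, as an object in $\mathrm{Rep}\,\alpha_3$ under the adjoint action of $e_1+e_2$, is (isomorphic as a Lie superalgebra to) $\mathfrak g(3,3)^{(1)}/\mathfrak c$.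
   Context: **Contragredient Lie superalgebras.** Lie superalgebras in characteristic $3$ are required to satisfy $[x,[x,x]]=0$ for odd $x$. Let $A=(a_{ij})$ be an $n\times n$ integer matrix (a Cartan matrix) with a parity $\mathrm{par}(i)\in\mathbb Z/2$ for each index; let $\overline A=(\overline a_{ij})$ be its reduction mod $3$, of rank $s$. Let $\widetilde{\mathfrak h}$ be a $\mathbb K$-vector space of dimension $2n-s$ with linearly independent $h_1,\dots,h_n\in\widetilde{\mathfrak h}$ and linearly independent $\alpha_1,\dots,\alpha_n\in\widetilde{\mathfrak h}^*$ such that $\alpha_j(h_i)=\overline a_{ij}$. $\widetilde{\mathfrak g}(A)$ is the Lie superalgebra generated by $\widetilde{\mathfrak h}$ (even) and $e_i,f_i$ ($1\le i\le n$) of parity $\mathrm{par}(i)$, with relations $[e_i,f_j]=\delta_{ij}h_i$, $[h,e_j]=\alpha_j(h)e_j$, $[h,f_j]=-\alpha_j(h)f_j$, $[\widetilde{\mathfrak h},\widetilde{\mathfrak h}]=0$. It is graded by the free abelian group $Q=\bigoplus_k\mathbb Z\alpha_k$ with $\deg e_i=\alpha_i$, $\deg f_i=-\alpha_i$, $\deg h=0$. $\mathfrak g(A)=\widetilde{\mathfrak g}(A)/\mathfrak r$, where $\mathfrak r$ is the largest $Q$-graded ideal meeting $\widetilde{\mathfrak h}$ trivially; images of $e_i,f_i,h_i$ (also in quotients) keep their names. $X^{(1)}=[X,X]$ is the derived algebra; $\mathfrak g(A)^{(1)}$ is generated by the $e_i,f_i,h_i$. If all parities are $0$, $\mathfrak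 g(A)$ is a Lie algebra. **Semisimplification.** $\mathrm{Rep}\,\alpha_3$ (representations of the Frobenius kernel of $\mathbb G_a$) is the symmetric tensor category of finite-dimensional $\mathbb K[t]/(t^3)$-modules, with $t$ acting on $V\otimes W$ by $t\otimes1+1\otimes t$ and the flip as braiding. Its indecomposables are $J_1,J_2,J_3$, where $t$ acts on $J_n=\mathbb K^n$ as one nilpotent Jordan block. A Lie algebra $\mathfrak g$ with a derivation $d$, $d^3=0$, is a Lie algebra in $\mathrm{Rep}\,\alpha_3$ with $t$ acting by $d$; "under the adjoint action of $x$" means $d=\mathrm{ad}\,x$. The semisimplification functor $V\mapsto\overline V$ is the quotient of $\mathrm{Rep}\,\alpha_3$ by negligible morphisms ($u:V\to W$ with $\mathrm{tr}(u\circ v)=0$ for all $v:W\to V$), with target the Verlinde category $\mathrm{Ver}_3$, whose simple objects are $L_1=\overline{J_1}$, $L_2=\overline{J_2}$ ($\overline{J_3}=0$); $\mathrm{Ver}_3$ is identified with super vector spaces, $L_1$ being an even line and $L_2$ an odd line, so $\overline{\mathfrak g}$ is a Lie superalgebra. Explicitly, decompose $\mathfrak g$ into Jordan blocks $x_i$ ($i\le n_1$), $x_i\mapsto x_i'$ ($n_1<i\le n_1+n_2$), and blocks $x_i\mapsto x_i'\mapsto x_i''$ (arrows are the action of $d$). Then $\overline{\mathfrak g}$ has basis $y_i$ ($i\le n_1+n_2$), even for $i\le n_1$ and odd for $i>n_1$; the coefficient of $y_k$ in $[y_i,y_j]$ is the coefficient of $x_k$ in $[x_i,x_j]$ if the parities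 of $y_i,y_j,y_k$ are compatible and $y_i,y_j$ are not both odd; it is the coefficient of $x_k$ in $-[x_i,x_j']+[x_i',x_j]$ if $i,j>n_1$, $k\le n_1$; and $0$ otherwise. *)

theory Defs
  imports
    "HOL-Algebra.QuotRing"
    "HOL-Library.Poly_Mapping"
    "HOL-Library.Z2"
    "HOL-Computational_Algebra.Polynomial"
    "Jordan_Normal_Form.DL_Rank"
begin

text \<open>
  Superalgebras over the field \<^typ>\<open>'k\<close> extend the library's modules over \<^const>\<open>class_ring\<close>.
  The ring multiplication is used for the (nonassociative) bracket; the field \<^term>\<open>one\<close> of the
  record carries no information. \<open>part L 0\<close> and \<open>part L 1\<close> are the even and the odd part.
\<close>

record ('k, 'v) superalgebra = "('k, 'v) module" +
  part :: "bit \<Rightarrow> 'v set"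

definition koszul_sign :: "bit \<Rightarrow> bit \<Rightarrow> 'k::field"
  where "koszul_sign p q = (if p * q = 1 then - 1 else 1)"

text \<open>
  The elements that have to vanish in a Lie superalgebra in characteristic 3:
  super anticommutativity, the super Jacobi identity, and \<open>[x,[x,x]]\<close> for odd \<open>x\<close>.
\<close>

definition lie_identities :: "('k::field, 'v) superalgebra \<Rightarrow> 'v set"
  where "lie_identities L =
    {x \<otimes>\<^bsub>L\<^esub> y \<oplus>\<^bsub>L\<^esub> koszul_sign p q \<odot>\<^bsub>L\<^esub> (y \<otimes>\<^bsub>L\<^esub> x) | p q x y. x \<in> part L p \<and> y \<in> part L q} \<union>
    {x \<otimes>\<^bsub>L\<^esub> (y \<otimes>\<^bsub>L\<^esub> z) \<ominus>\<^bsub>L\<^esub> (x \<otimes>\<^bsub>L\<^esub> y) \<otimes>\<^bsub>L\<^esub> z \<ominus>\<^bsub>L\<^esub> koszul_sign p q \<odot>\<^bsub>L\<^esub> (y \<otimes>\<^bsub>L\<^esub> (x \<otimes>\<^bsub>L\<^esub> z))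
       | p q r x y z. x \<in> part L p \<and> y \<in> part L q \<and> z \<in> part L r} \<union>
    {x \<otimes>\<^bsub>L\<^esub> (x \<otimes>\<^bsub>L\<^esub> x) | x. x \<in> part L 1}"

definition sa_ideal :: "('k::field, 'v) superalgebra \<Rightarrow> 'v set \<Rightarrow> bool"
  where "sa_ideal L I \<longleftrightarrow> VectorSpace.subspace class_ring I L \<and>
    (\<forall>x\<in>carrier L. \<forall>y\<in>I. x \<otimes>\<^bsub>L\<^esub> y \<in> I \<and> y \<otimes>\<^bsub>L\<^esub> x \<in> I)"

definition sa_ideal_generated :: "('k::field, 'v) superalgebra \<Rightarrow> 'v set \<Rightarrow> 'v set"
  where "sa_ideal_generated L S = \<Inter>{I. sa_ideal L I \<and> S \<subseteq> I}"

definition sa_quotient :: "('k::field, 'v) superalgebra \<Rightarrow> 'v set \<Rightarrow> ('k, 'v set) superalgebra"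
  where "sa_quotient L I =
    \<lparr>carrier = a_rcosets\<^bsub>L\<^esub> I,
     mult = rcoset_mult L I,
     one = undefined,
     zero = I,
     add = set_add L,
     smult = (\<lambda>c X. \<Union>x\<in>X. I +>\<^bsub>L\<^esub> (c \<odot>\<^bsub>L\<^esub> x)),
     part = (\<lambda>p. (\<lambda>x. I +>\<^bsub>L\<^esub> x) ` part L p)\<rparr>"

definition derived_algebra :: "('k::field, 'v) superalgebra \<Rightarrow> ('k, 'v) superalgebra"
  where "derived_algebra L =
    (let D = LinearCombinations.module.span class_ring L
               {x \<otimes>\<^bsub>L\<^esub> y | x y. x \<in> carrier L \<and> y \<in> carrier L}
     in L\<lparr>carrier := D, part := (\<lambda>p. part L p \<inter> D)\<rparr>)"

definition sa_center :: "('k::field, 'v) superalgebra \<Rightarrow> 'v set"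
  where "sa_center L = {z \<in> carrier L. \<forall>x\<in>carrier L. z \<otimes>\<^bsub>L\<^esub> x = \<zero>\<^bsub>L\<^esub>}"

definition sa_isomorphic :: "('k::field, 'v) superalgebra \<Rightarrow> ('k, 'w) superalgebra \<Rightarrow> bool"
  where "sa_isomorphic L M \<longleftrightarrow>
    (\<exists>\<phi>. \<phi> \<in> LinearCombinations.module_hom class_ring L M \<and>
         bij_betw \<phi> (carrier L) (carrier M) \<and>
         (\<forall>x\<in>carrier L. \<forall>y\<in>carrier L. \<phi> (x \<otimes>\<^bsub>L\<^esub> y) = \<phi> x \<otimes>\<^bsub>M\<^esub> \<phi> y) \<and>
         (\<forall>p. \<phi> ` part L p = part M p))"


section \<open>Free nonassociative superalgebras\<close>

datatype (letters: 'x) magma = Letter 'x | MProd "'x magma" "'x magma"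

primrec magma_deg :: "('x \<Rightarrow> 'a::plus) \<Rightarrow> 'x magma \<Rightarrow> 'a"
  where
    "magma_deg f (Letter x) = f x"
  | "magma_deg f (MProd a b) = magma_deg f a + magma_deg f b"

type_synonym ('k, 'x) free_alg = "'x magma \<Rightarrow>\<^sub>0 'k"

definition free_scale :: "'k::field \<Rightarrow> ('k, 'x) free_alg \<Rightarrow> ('k, 'x) free_alg"
  where "free_scale c p = Poly_Mapping.map ((*) c) p"

definition free_mult :: "('k::field, 'x) free_alg \<Rightarrow> ('k, 'x) free_alg \<Rightarrow> ('k, 'x) free_alg"
  where "free_mult p q =
    (\<Sum>a\<in>Poly_Mapping.keys p. \<Sum>b\<in>Poly_Mapping.keys q.
      Poly_Mapping.single (MProd a b) (Poly_Mapping.lookup p a * Poly_Mapping.lookup q b))"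

definition free_letter :: "'x \<Rightarrow> ('k::field, 'x) free_alg"
  where "free_letter x = Poly_Mapping.single (Letter x) 1"

definition free_superalgebra :: "'x set \<Rightarrow> ('x \<Rightarrow> bit) \<Rightarrow> ('k::field, ('k, 'x) free_alg) superalgebra"
  where "free_superalgebra X par =
    \<lparr>carrier = {p. \<forall>m\<in>Poly_Mapping.keys p. letters m \<subseteq> X},
     mult = free_mult,
     one = undefined,
     zero = 0,
     add = (+),
     smult = free_scale,
     part = (\<lambda>i. {p. \<forall>m\<in>Poly_Mapping.keys p. letters m \<subseteq> X \<and> magma_deg par m = i})\<rparr>"


section \<open>Contragredient Lie superalgebras\<close>

text \<open>
  Indices run over \<open>{..<n}\<close> with \<open>n = dim_row A\<close>. Since \<^typ>\<open>'k\<close> has characteristic 3, the image of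
  \<open>A\<close> under \<^const>\<open>of_int\<close> is the reduction of \<open>A\<close> modulo 3. The space of dimension \<open>2n - s\<close> is the
  whole type \<^typ>\<open>'h\<close> with scalar multiplication \<open>scl\<close>.
\<close>

definition realization ::
  "int mat \<Rightarrow> ('k::field \<Rightarrow> 'h::ab_group_add \<Rightarrow> 'h) \<Rightarrow> (nat \<Rightarrow> 'h) \<Rightarrow> (nat \<Rightarrow> 'h \<Rightarrow> 'k) \<Rightarrow> bool"
  where "realization A scl hh \<alpha> \<longleftrightarrow>
    (let n = dim_row A; A3 = (map_mat of_int A :: 'k mat) in
      A \<in> carrier_mat n n \<and>
      (\<exists>B. finite_dimensional_vector_space scl B \<and> card B = 2 * n - vec_space.rank n A3) \<and>
      inj_on hh {..<n} \<and> \<not> Modules.module.dependent scl (hh ` {..<n}) \<and>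
      (\<forall>j<n. Vector_Spaces.linear scl (*) (\<alpha> j)) \<and>
      (\<forall>c. (\<forall>a. (\<Sum>j<n. c j * \<alpha> j a) = 0) \<longrightarrow> (\<forall>j<n. c j = 0)) \<and>
      (\<forall>i<n. \<forall>j<n. \<alpha> j (hh i) = A3 $$ (i, j)))"

datatype 'h generator = Hgen 'h | Egen nat | Fgen nat

primrec gen_parity :: "(nat \<Rightarrow> bit) \<Rightarrow> 'h generator \<Rightarrow> bit"
  where
    "gen_parity par (Hgen a) = 0"
  | "gen_parity par (Egen i) = par i"
  | "gen_parity par (Fgen i) = par i"

primrec gen_weight :: "'h generator \<Rightarrow> (nat \<Rightarrow>\<^sub>0 int)"
  where
    "gen_weight (Hgen a) = 0"
  | "gen_weight (Egen i) = Poly_Mapping.single i 1"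
  | "gen_weight (Fgen i) = - Poly_Mapping.single i 1"

definition gens :: "nat \<Rightarrow> 'h generator set"
  where "gens n = range Hgen \<union> Egen ` {..<n} \<union> Fgen ` {..<n}"

text \<open>
  The first two families say that \<^const>\<open>Hgen\<close> is linear, as the generating space is a vector space
  and not merely a set.
\<close>

definition chevalley_relations ::
  "int mat \<Rightarrow> ('k::field \<Rightarrow> 'h::ab_group_add \<Rightarrow> 'h) \<Rightarrow> (nat \<Rightarrow> 'h) \<Rightarrow> (nat \<Rightarrow> 'h \<Rightarrow> 'k) \<Rightarrow>
   ('k, 'h generator) free_alg set"
  where "chevalley_relations A scl hh \<alpha> =
    (let n = dim_row A;
         H = (\<lambda>a. free_letter (Hgen a));
         E = (\<lambda>i. free_letter (Egen i));
         F = (\<lambda>i. free_letter (Fgen i))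
     in {H (a + b) - H a - H b | a b. True} \<union>
        {H (scl c a) - free_scale c (H a) | c a. True} \<union>
        {free_mult (E i) (F j) - (if i = j then H (hh i) else 0) | i j. i < n \<and> j < n} \<union>
        {free_mult (H a) (E j) - free_scale (\<alpha> j a) (E j) | a j. j < n} \<union>
        {free_mult (H a) (F j) + free_scale (\<alpha> j a) (F j) | a j. j < n} \<union>
        {free_mult (H a) (H b) | a b. True})"

definition tilde_free ::
  "int mat \<Rightarrow> (nat \<Rightarrow> bit) \<Rightarrow> ('k::field, ('k, 'h generator) free_alg) superalgebra"
  where "tilde_free A par = free_superalgebra (gens (dim_row A)) (gen_parity par)"

definition tilde_relations ::
  "int mat \<Rightarrow> (nat \<Rightarrow> bit) \<Rightarrow> ('k::field \<Rightarrow> 'h::ab_group_add \<Rightarrow> 'h) \<Rightarrow> (nat \<Rightarrow> 'h) \<Rightarrow>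
   (nat \<Rightarrow> 'h \<Rightarrow> 'k) \<Rightarrow> ('k, 'h generator) free_alg set"
  where "tilde_relations A par scl hh \<alpha> =
    sa_ideal_generated (tilde_free A par)
      (lie_identities (tilde_free A par) \<union> chevalley_relations A scl hh \<alpha>)"

definition tilde_algebra ::
  "int mat \<Rightarrow> (nat \<Rightarrow> bit) \<Rightarrow> ('k::field \<Rightarrow> 'h::ab_group_add \<Rightarrow> 'h) \<Rightarrow> (nat \<Rightarrow> 'h) \<Rightarrow>
   (nat \<Rightarrow> 'h \<Rightarrow> 'k) \<Rightarrow> ('k, ('k, 'h generator) free_alg set) superalgebra"
  where "tilde_algebra A par scl hh \<alpha> =
    sa_quotient (tilde_free A par) (tilde_relations A par scl hh \<alpha>)"

definition tilde_class ::
  "int mat \<Rightarrow> (nat \<Rightarrow> bit) \<Rightarrow> ('k::field \<Rightarrow> 'h::ab_group_add \<Rightarrow> 'h) \<Rightarrow> (nat \<Rightarrow> 'h) \<Rightarrow>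
   (nat \<Rightarrow> 'h \<Rightarrow> 'k) \<Rightarrow> ('k, 'h generator) free_alg \<Rightarrow> ('k, 'h generator) free_alg set"
  where "tilde_class A par scl hh \<alpha> p =
    tilde_relations A par scl hh \<alpha> +>\<^bsub>tilde_free A par\<^esub> p"

text \<open>The component of weight \<open>q\<close> for the grading by the free abelian group \<^typ>\<open>nat \<Rightarrow>\<^sub>0 int\<close>.\<close>

definition tilde_component ::
  "int mat \<Rightarrow> (nat \<Rightarrow> bit) \<Rightarrow> ('k::field \<Rightarrow> 'h::ab_group_add \<Rightarrow> 'h) \<Rightarrow> (nat \<Rightarrow> 'h) \<Rightarrow>
   (nat \<Rightarrow> 'h \<Rightarrow> 'k) \<Rightarrow> (nat \<Rightarrow>\<^sub>0 int) \<Rightarrow> ('k, 'h generator) free_alg set set"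
  where "tilde_component A par scl hh \<alpha> q =
    tilde_class A par scl hh \<alpha> `
      {p \<in> carrier (tilde_free A par). \<forall>m\<in>Poly_Mapping.keys p. magma_deg gen_weight m = q}"

definition graded_ideal ::
  "int mat \<Rightarrow> (nat \<Rightarrow> bit) \<Rightarrow> ('k::field \<Rightarrow> 'h::ab_group_add \<Rightarrow> 'h) \<Rightarrow> (nat \<Rightarrow> 'h) \<Rightarrow>
   (nat \<Rightarrow> 'h \<Rightarrow> 'k) \<Rightarrow> ('k, 'h generator) free_alg set set \<Rightarrow> bool"
  where "graded_ideal A par scl hh \<alpha> I \<longleftrightarrow>
    sa_ideal (tilde_algebra A par scl hh \<alpha>) I \<and>
    I = LinearCombinations.module.span class_ring (tilde_algebra A par scl hh \<alpha>)
          (\<Union>q. I \<inter> tilde_component A par scl hh \<alpha> q)"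

definition cartan_radical ::
  "int mat \<Rightarrow> (nat \<Rightarrow> bit) \<Rightarrow> ('k::field \<Rightarrow> 'h::ab_group_add \<Rightarrow> 'h) \<Rightarrow> (nat \<Rightarrow> 'h) \<Rightarrow>
   (nat \<Rightarrow> 'h \<Rightarrow> 'k) \<Rightarrow> ('k, 'h generator) free_alg set set"
  where "cartan_radical A par scl hh \<alpha> =
    (GREATEST I. graded_ideal A par scl hh \<alpha> I \<and>
       I \<inter> range (\<lambda>a. tilde_class A par scl hh \<alpha> (free_letter (Hgen a))) =
         {\<zero>\<^bsub>tilde_algebra A par scl hh \<alpha>\<^esub>})"

definition contragredient ::
  "int mat \<Rightarrow> (nat \<Rightarrow> bit) \<Rightarrow> ('k::field \<Rightarrow> 'h::ab_group_add \<Rightarrow> 'h) \<Rightarrow> (nat \<Rightarrow> 'h) \<Rightarrow>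
   (nat \<Rightarrow> 'h \<Rightarrow> 'k) \<Rightarrow> ('k, ('k, 'h generator) free_alg set set) superalgebra"
  where "contragredient A par scl hh \<alpha> =
    sa_quotient (tilde_algebra A par scl hh \<alpha>) (cartan_radical A par scl hh \<alpha>)"

definition chevalley_e ::
  "int mat \<Rightarrow> (nat \<Rightarrow> bit) \<Rightarrow> ('k::field \<Rightarrow> 'h::ab_group_add \<Rightarrow> 'h) \<Rightarrow> (nat \<Rightarrow> 'h) \<Rightarrow>
   (nat \<Rightarrow> 'h \<Rightarrow> 'k) \<Rightarrow> nat \<Rightarrow> ('k, 'h generator) free_alg set set"
  where "chevalley_e A par scl hh \<alpha> i =
    cartan_radical A par scl hh \<alpha> +>\<^bsub>tilde_algebra A par scl hh \<alpha>\<^esub>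
      tilde_class A par scl hh \<alpha> (free_letter (Egen i))"


section \<open>Semisimplification\<close>

text \<open>
  The tops of the Jordan blocks are \<open>x i\<close> for \<open>i < n1 + n2 + n3\<close>; the first \<open>n1\<close> blocks have size 1,
  the next \<open>n2\<close> size 2, the last \<open>n3\<close> size 3, and the block of \<open>x i\<close> is \<open>x i, d (x i), d (d (x i))\<close>
  cut off at its size.
\<close>

definition block_size :: "nat \<Rightarrow> nat \<Rightarrow> nat \<Rightarrow> nat"
  where "block_size n1 n2 i = (if i < n1 then 1 else if i < n1 + n2 then 2 else 3)"

definition block_positions :: "nat \<Rightarrow> nat \<Rightarrow> nat \<Rightarrow> (nat \<times> nat) set"
  where "block_positions n1 n2 n3 = (SIGMA i:{..<n1 + n2 + n3}. {..<block_size n1 n2 i})"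

definition jordan_basis ::
  "('v \<Rightarrow> 'v) \<Rightarrow> nat \<Rightarrow> nat \<Rightarrow> nat \<Rightarrow> (nat \<Rightarrow> 'v) \<Rightarrow> 'v set"
  where "jordan_basis d n1 n2 n3 x = (\<lambda>(i, j). (d ^^ j) (x i)) ` block_positions n1 n2 n3"

definition jordan_decomposition ::
  "('k::field, 'v) superalgebra \<Rightarrow> ('v \<Rightarrow> 'v) \<Rightarrow> nat \<Rightarrow> nat \<Rightarrow> nat \<Rightarrow> (nat \<Rightarrow> 'v) \<Rightarrow> bool"
  where "jordan_decomposition L d n1 n2 n3 x \<longleftrightarrow>
    inj_on (\<lambda>(i, j). (d ^^ j) (x i)) (block_positions n1 n2 n3) \<and>
    vectorspace.basis class_ring L (jordan_basis d n1 n2 n3 x) \<and>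
    (\<forall>i<n1 + n2 + n3. (d ^^ block_size n1 n2 i) (x i) = \<zero>\<^bsub>L\<^esub>)"

definition basis_coefficient ::
  "('k::field, 'v) superalgebra \<Rightarrow> 'v set \<Rightarrow> 'v \<Rightarrow> 'v \<Rightarrow> 'k"
  where "basis_coefficient L B b v =
    (THE c. \<exists>a. LinearCombinations.module.lincomb L a B = v \<and> a b = c)"

definition block_parity :: "nat \<Rightarrow> nat \<Rightarrow> bit"
  where "block_parity n1 i = (if i < n1 then 0 else 1)"

definition semisimplification_coefficient ::
  "('k::field, 'v) superalgebra \<Rightarrow> ('v \<Rightarrow> 'v) \<Rightarrow> nat \<Rightarrow> nat \<Rightarrow> nat \<Rightarrow> (nat \<Rightarrow> 'v) \<Rightarrow>
   nat \<Rightarrow> nat \<Rightarrow> nat \<Rightarrow> 'k"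
  where "semisimplification_coefficient L d n1 n2 n3 x i j k =
    (let coeff = basis_coefficient L (jordan_basis d n1 n2 n3 x) (x k) in
      if block_parity n1 k \<noteq> block_parity n1 i + block_parity n1 j then 0
      else if block_parity n1 i = 1 \<and> block_parity n1 j = 1
      then coeff (\<ominus>\<^bsub>L\<^esub> (x i \<otimes>\<^bsub>L\<^esub> d (x j)) \<oplus>\<^bsub>L\<^esub> d (x i) \<otimes>\<^bsub>L\<^esub> x j)
      else coeff (x i \<otimes>\<^bsub>L\<^esub> x j))"

text \<open>
  The semisimplification of a Lie algebra \<open>L\<close> with derivation \<open>d\<close>, computed from a Jordan
  decomposition. A function \<open>v\<close> in the carrier stands for \<open>\<Sum>i<n1 + n2. v i * y i\<close>.
\<close>

definition semisimplification ::
  "('k::field, 'v) superalgebra \<Rightarrow> ('v \<Rightarrow> 'v) \<Rightarrow> nat \<Rightarrow> nat \<Rightarrow> nat \<Rightarrow> (nat \<Rightarrow> 'v) \<Rightarrow>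
   ('k, nat \<Rightarrow> 'k) superalgebra"
  where "semisimplification L d n1 n2 n3 x =
    \<lparr>carrier = {v. \<forall>i\<ge>n1 + n2. v i = 0},
     mult = (\<lambda>v w k. if k < n1 + n2
               then \<Sum>i<n1 + n2. \<Sum>j<n1 + n2.
                 v i * w j * semisimplification_coefficient L d n1 n2 n3 x i j k
               else 0),
     one = undefined,
     zero = (\<lambda>i. 0),
     add = (\<lambda>v w i. v i + w i),
     smult = (\<lambda>c v i. c * v i),
     part = (\<lambda>p. {v. \<forall>i. v i \<noteq> 0 \<longrightarrow> i < n1 + n2 \<and> block_parity n1 i = p})\<rparr>"


section \<open>The two Cartan matrices\<close>

definition cartan_e6 :: "int mat"
  where "cartan_e6 = mat_of_rows_list 6
    [[ 2,  0, -1,  0,  0,  0],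
     [ 0,  2,  0, -1,  0,  0],
     [-1,  0,  2, -1,  0,  0],
     [ 0, -1, -1,  2, -1,  0],
     [ 0,  0,  0, -1,  2, -1],
     [ 0,  0,  0,  0, -1,  2]]"

definition parity_e6 :: "nat \<Rightarrow> bit"
  where "parity_e6 i = 0"

definition cartan_g33 :: "int mat"
  where "cartan_g33 = mat_of_rows_list 4
    [[ 0, -1,  0,  0],
     [-1,  0, -1,  0],
     [ 0, -1,  2, -1],
     [ 0,  0, -1,  2]]"

definition parity_g33 :: "nat \<Rightarrow> bit"
  where "parity_g33 i = (if i < 2 then 1 else 0)"

end

theory Submission
  imports Defs "HOL-Library.Function_Algebras" "HOL-Library.Product_Plus"
begin

text \<open>
  The algebra \<open>e6\<close> is realised on its root lattice: a Cartan space plus root vectors \<open>E r\<close>, with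
  \<open>[E r, E s] = (-1)^b(r,s) E (r + s)\<close> for a bilinear form \<open>b\<close> with \<open>b(r,s) + b(s,r) = (r,s)\<close>.
  For two orthogonal roots \<open>a1\<close>, \<open>a2\<close> the operator \<open>d = ad (E a1 + E a2)\<close> satisfies \<open>d^3 = 0\<close>. The even part
  of the semisimplification is \<open>Ker d / (Ker d \<inter> Im d)\<close> and its odd part is the corresponding subquotient of
  \<open>Ker d^2\<close>; so it does not depend on the Jordan decomposition. Sorting the roots \<open>r\<close> by the pair
  \<open>((r,a1), (r,a2))\<close>, the even part is carried by the Cartan elements killed by \<open>a1\<close> and \<open>a2\<close> and the roots of type
  \<open>(0,0)\<close> and \<open>(1,-1)\<close>, the odd part by the roots of type \<open>(-1,0)\<close> and \<open>(0,-1)\<close>.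

  A contragredient superalgebra is recognised as follows: if a graded Lie superalgebra satisfies the Chevalley
  relations, and every nonzero homogeneous element of nonzero weight is moved to a nonzero element by a monomial in
  the generators of the opposite weight, then the kernel of the evaluation map of the free algebra is the
  kernel of the projection to the contragredient superalgebra. This applies to \<open>e6\<close>, and also to the subquotient above,
  built over a Cartan space enlarged by two dimensions, with the Cartan matrix of \<open>g(3,3)\<close>. Dividing the derived algebras by
  their centres amounts to replacing both Cartan spaces by their images in the adjoint representation, where the two agree.
\<close>

text \<open>A root of type \<open>(0,0)\<close> is a Jordan block of size 1, a root of type
  \<open>(-1,0)\<close> or \<open>(0,-1)\<close> starts one of size 2, each of \<open>- a1\<close>,
  \<open>- a2\<close> starts one of size 3 through the Cartan space, and \<open>q\<close>,
  \<open>q + a1\<close>, \<open>q + a2\<close>, \<open>q + a1 + a2\<close> with \<open>q\<close> of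
  type \<open>(-1,-1)\<close> form a product of two blocks of size 2, which splits into sizes 3 and
  1. That last block of size 1 mixes the types \<open>(1,-1)\<close> and \<open>(-1,1)\<close>; the
  former is its label. The simple roots of \<open>g(3,3)\<close> are the classes of the E6 roots 3
  to 6 modulo roots 1 and 2. Roots 3 and 4 become odd because they have product -1 with root 1,
  respectively 2. Their negatives have to be shifted by that root to get back to an odd type, and
  the brackets of the generators yield the coroots \<open>h_3 - h_1\<close> and
  \<open>h_4 - h_2\<close>, at which roots 3 and 4 take the value 2 + 1 = 0: hence the zeros on the
  diagonal. The obstacle is the form of the objects: cosets of cosets on one side, coefficients in
  an arbitrary Jordan basis on the other. Both are transported to coordinates consisting of a Cartan
  vector and a function on the root lattice.\<close>

section \<open>Presentations of superalgebras\<close>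

text \<open>Every algebra below arises from one free algebra by passing to subalgebras and
  quotients, so its elements are cosets of cosets. The locale replaces such a record by data in a
  single vector space: \<open>S\<close> is the preimage of the carrier, \<open>N\<close> the kernel,
  \<open>P p\<close> a set mapping onto the part of parity \<open>p\<close>, and
  \<open>\<pi>\<close> the possibly iterated coset map. Quotients and derived algebras then change
  only \<open>S\<close>, \<open>N\<close> and \<open>P\<close>.\<close>

locale presentation = vector_space sc
  for sc :: "'k::field \<Rightarrow> 'f::ab_group_add \<Rightarrow> 'f" +
  fixes L :: "('k, 'v) superalgebra" and mul :: "'f \<Rightarrow> 'f \<Rightarrow> 'f"
    and S N :: "'f set" and P :: "bit \<Rightarrow> 'f set" and \<pi> :: "'f \<Rightarrow> 'v"
  assumes S_sub: "subspace S" and N_sub: "subspace N" and N_S: "N \<subseteq> S" and P_S: "P p \<subseteq> S"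
    and mul_add_left: "mul (x + y) z = mul x z + mul y z"
    and mul_add_right: "mul x (y + z) = mul x y + mul x z"
    and mul_scale_left: "mul (sc c x) y = sc c (mul x y)"
    and mul_scale_right: "mul x (sc c y) = sc c (mul x y)"
    and mul_closed: "x \<in> S \<Longrightarrow> y \<in> S \<Longrightarrow> mul x y \<in> S"
    and N_ideal: "x \<in> S \<Longrightarrow> y \<in> N \<Longrightarrow> mul x y \<in> N" "x \<in> S \<Longrightarrow> y \<in> N \<Longrightarrow> mul y x \<in> N"
    and carrier: "carrier L = \<pi> ` S"
    and \<pi>_eq: "x \<in> S \<Longrightarrow> y \<in> S \<Longrightarrow> \<pi> x = \<pi> y \<longleftrightarrow> x - y \<in> N"
    and \<pi>_add: "x \<in> S \<Longrightarrow> y \<in> S \<Longrightarrow> \<pi> x \<oplus>\<^bsub>L\<^esub> \<pi> y = \<pi> (x + y)"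
    and \<pi>_mult: "x \<in> S \<Longrightarrow> y \<in> S \<Longrightarrow> \<pi> x \<otimes>\<^bsub>L\<^esub> \<pi> y = \<pi> (mul x y)"
    and \<pi>_smult: "x \<in> S \<Longrightarrow> c \<odot>\<^bsub>L\<^esub> \<pi> x = \<pi> (sc c x)"
    and \<pi>_zero: "\<zero>\<^bsub>L\<^esub> = \<pi> 0"
    and part: "part L p = \<pi> ` P p"
begin

lemma S_closed [simp, intro]: "0 \<in> S" "x \<in> S \<Longrightarrow> y \<in> S \<Longrightarrow> x + y \<in> S" "x \<in> S \<Longrightarrow> y \<in> S \<Longrightarrow> x - y \<in> S"
  "x \<in> S \<Longrightarrow> sc c x \<in> S" "x \<in> S \<Longrightarrow> - x \<in> S"
  using S_sub by (auto intro: subspace_0 subspace_add subspace_diff subspace_scale subspace_neg)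

lemma mul_zero [simp]: "mul 0 x = 0" "mul x 0 = 0"
  using mul_scale_left[of 0 0 x] mul_scale_right[of x 0 0] by auto

lemma mul_minus: "mul (- x) y = - mul x y" "mul x (- y) = - mul x y"
  using mul_scale_left[of "-1" x y] mul_scale_right[of x "-1" y] by auto

lemma mul_diff: "mul (x - y) z = mul x z - mul y z" "mul x (y - z) = mul x y - mul x z"
  using mul_add_left[of x "- y" z] mul_add_right[of x y "- z"] by (auto simp: mul_minus)

lemma vs: "vectorspace class_ring L"
  unfolding vectorspace_def
proof
  show "Module.module class_ring L"
  proof (rule module_criteria)
    show "\<forall>v\<in>carrier L. \<exists>w\<in>carrier L. v \<oplus>\<^bsub>L\<^esub> w = \<zero>\<^bsub>L\<^esub>"
    proof
      fix v assume "v \<in> carrier L"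
      then obtain x where x: "x \<in> S" "v = \<pi> x" by (auto simp: carrier)
      then have "\<pi> (- x) \<in> carrier L" "v \<oplus>\<^bsub>L\<^esub> \<pi> (- x) = \<zero>\<^bsub>L\<^esub>" by (auto simp: carrier \<pi>_add \<pi>_zero)
      then show "\<exists>w\<in>carrier L. v \<oplus>\<^bsub>L\<^esub> w = \<zero>\<^bsub>L\<^esub>" by blast
    qed
  qed (auto simp: carrier \<pi>_add \<pi>_smult \<pi>_zero algebra_simps scale_left_distrib scale_right_distrib class_cring.is_cring)
qed (rule class_field)

lemma mod: "Module.module class_ring L"
  using vs by (simp add: vectorspace_def)

lemma zero_iff: "x \<in> S \<Longrightarrow> \<pi> x = \<zero>\<^bsub>L\<^esub> \<longleftrightarrow> x \<in> N"
  using \<pi>_eq[of x 0] by (simp add: \<pi>_zero)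

lemma minus: "x \<in> S \<Longrightarrow> \<ominus>\<^bsub>L\<^esub> \<pi> x = \<pi> (- x)"
proof -
  assume x: "x \<in> S"
  interpret M: Module.module class_ring L by (rule mod)
  have "\<pi> (- x) \<oplus>\<^bsub>L\<^esub> \<pi> x = \<zero>\<^bsub>L\<^esub>" using x by (simp add: \<pi>_add \<pi>_zero)
  then show ?thesis using x by (intro M.minus_equality) (auto simp: carrier)
qed

lemma diff: "x \<in> S \<Longrightarrow> y \<in> S \<Longrightarrow> \<pi> x \<ominus>\<^bsub>L\<^esub> \<pi> y = \<pi> (x - y)"
  by (simp add: a_minus_def minus \<pi>_add)

lemma record_submodule:
  assumes "subspace T" "T \<subseteq> S"
  shows "LinearCombinations.submodule class_ring (\<pi> ` T) L"
proof (rule LinearCombinations.submodule.intro)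
  show "Module.module class_ring L" by (rule mod)
qed (use assms in \<open>auto simp: carrier \<pi>_add \<pi>_smult \<pi>_zero subspace_add subspace_scale subspace_0 subset_iff\<close>)

lemma preimage_subspace:
  assumes "LinearCombinations.submodule class_ring I L"
  shows "subspace {x \<in> S. \<pi> x \<in> I}"
proof (rule subspaceI)
  interpret I: LinearCombinations.submodule class_ring I L by (rule assms)
  show "0 \<in> {x \<in> S. \<pi> x \<in> I}" using I.zero_closed by (simp add: \<pi>_zero)
  fix x y c assume "x \<in> {x \<in> S. \<pi> x \<in> I}"
  then have x: "x \<in> S" "\<pi> x \<in> I" by auto
  show "sc c x \<in> {x \<in> S. \<pi> x \<in> I}" using x I.smult_closed[of c "\<pi> x"] by (simp add: \<pi>_smult)
  assume "y \<in> {x \<in> S. \<pi> x \<in> I}"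
  then show "x + y \<in> {x \<in> S. \<pi> x \<in> I}" using x I.m_closed[of "\<pi> x" "\<pi> y"] by (simp add: \<pi>_add)
qed

lemma record_span:
  assumes "X \<subseteq> S"
  shows "LinearCombinations.module.span class_ring L (\<pi> ` X) = \<pi> ` span X"
proof
  interpret M: Module.module class_ring L by (rule mod)
  have sS: "span X \<subseteq> S" using assms S_sub by (rule span_minimal)
  show "LinearCombinations.module.span class_ring L (\<pi> ` X) \<subseteq> \<pi> ` span X"
  proof (rule M.span_is_subset)
    show "\<pi> ` X \<subseteq> \<pi> ` span X" by (auto intro: span_base)
    show "LinearCombinations.submodule class_ring (\<pi> ` span X) L" by (rule record_submodule[OF subspace_span sS])
  qed
  have "span X \<subseteq> {x \<in> S. \<pi> x \<in> LinearCombinations.module.span class_ring L (\<pi> ` X)}"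
  proof (rule span_minimal)
    have "\<pi> ` X \<subseteq> carrier L" using assms by (auto simp: carrier)
    then show "X \<subseteq> {x \<in> S. \<pi> x \<in> LinearCombinations.module.span class_ring L (\<pi> ` X)}"
      using assms M.in_own_span[of "\<pi> ` X"] by auto
    show "subspace {x \<in> S. \<pi> x \<in> LinearCombinations.module.span class_ring L (\<pi> ` X)}"
      using assms by (intro preimage_subspace M.span_is_submodule) (auto simp: carrier)
  qed
  then show "\<pi> ` span X \<subseteq> LinearCombinations.module.span class_ring L (\<pi> ` X)" by auto
qed

lemma center: "sa_center L = \<pi> ` {x \<in> S. \<forall>y\<in>S. mul x y \<in> N}"
  by (auto simp: sa_center_def carrier \<pi>_mult zero_iff mul_closed)

lemma sa_ideal_iff:
  assumes "T \<subseteq> S" "subspace T"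
    and "\<And>x y. x \<in> S \<Longrightarrow> y \<in> T \<Longrightarrow> mul x y \<in> T" "\<And>x y. x \<in> S \<Longrightarrow> y \<in> T \<Longrightarrow> mul y x \<in> T"
  shows "sa_ideal L (\<pi> ` T)"
  using assms vs record_submodule[of T]
  by (auto simp: sa_ideal_def VectorSpace.subspace_def carrier \<pi>_mult subset_iff)

lemma sa_idealD:
  assumes "sa_ideal L I"
  shows "subspace {x \<in> S. \<pi> x \<in> I}" "I = \<pi> ` {x \<in> S. \<pi> x \<in> I}" "N \<subseteq> {x \<in> S. \<pi> x \<in> I}"
    "\<And>x y. x \<in> S \<Longrightarrow> y \<in> {x \<in> S. \<pi> x \<in> I} \<Longrightarrow> mul x y \<in> {x \<in> S. \<pi> x \<in> I}"
    "\<And>x y. x \<in> S \<Longrightarrow> y \<in> {x \<in> S. \<pi> x \<in> I} \<Longrightarrow> mul y x \<in> {x \<in> S. \<pi> x \<in> I}"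
proof -
  interpret I: LinearCombinations.submodule class_ring I L using assms by (auto simp: sa_ideal_def VectorSpace.subspace_def)
  show "subspace {x \<in> S. \<pi> x \<in> I}" by (rule preimage_subspace) (rule I.submodule_axioms)
  show "I = \<pi> ` {x \<in> S. \<pi> x \<in> I}" using I.subset by (auto simp: carrier)
  show "N \<subseteq> {x \<in> S. \<pi> x \<in> I}"
  proof
    fix x assume "x \<in> N"
    then have "x \<in> S" "\<pi> x = \<zero>\<^bsub>L\<^esub>" using N_S zero_iff by auto
    then show "x \<in> {x \<in> S. \<pi> x \<in> I}" using I.zero_closed by simp
  qed
  fix x y assume xy: "x \<in> S" "y \<in> {x \<in> S. \<pi> x \<in> I}"
  then have "\<pi> x \<otimes>\<^bsub>L\<^esub> \<pi> y \<in> I" "\<pi> y \<otimes>\<^bsub>L\<^esub> \<pi> x \<in> I" using assms by (auto simp: sa_ideal_def carrier)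
  then show "mul x y \<in> {x \<in> S. \<pi> x \<in> I}" "mul y x \<in> {x \<in> S. \<pi> x \<in> I}"
    using xy by (auto simp: \<pi>_mult mul_closed)
qed

text \<open>A further quotient keeps representatives and product and merely enlarges the kernel from
  \<open>N\<close> to \<open>T\<close>. Because \<open>T\<close> contains \<open>N\<close>, a coset
  in the record is again described by a condition \<open>y - x \<in> T\<close> on
  representatives.\<close>

lemma quotient:
  assumes TS: "T \<subseteq> S" and T: "subspace T" and NT: "N \<subseteq> T"
    and Tl: "\<And>x y. x \<in> S \<Longrightarrow> y \<in> T \<Longrightarrow> mul x y \<in> T" and Tr: "\<And>x y. x \<in> S \<Longrightarrow> y \<in> T \<Longrightarrow> mul y x \<in> T"
  shows "presentation sc (sa_quotient L (\<pi> ` T)) mul S T P (\<lambda>x. (\<pi> ` T) +>\<^bsub>L\<^esub> \<pi> x)"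
proof -
  define I where "I = \<pi> ` T"
  have coset: "I +>\<^bsub>L\<^esub> \<pi> x = \<pi> ` {y \<in> S. y - x \<in> T}" if "x \<in> S" for x
  proof -
    have "I +>\<^bsub>L\<^esub> \<pi> x = (\<lambda>t. \<pi> (t + x)) ` T"
      using that TS by (auto simp: a_r_coset_def' I_def \<pi>_add image_iff subset_iff)
    also have "\<dots> = \<pi> ` {y \<in> S. y - x \<in> T}"
    proof (intro equalityI subsetI)
      fix z assume "z \<in> (\<lambda>t. \<pi> (t + x)) ` T"
      then obtain t where "t \<in> T" "z = \<pi> (t + x)" by auto
      then show "z \<in> \<pi> ` {y \<in> S. y - x \<in> T}" using that TS by (intro image_eqI[of _ _ "t + x"]) auto
    next
      fix z assume "z \<in> \<pi> ` {y \<in> S. y - x \<in> T}"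
      then obtain y where "y - x \<in> T" "z = \<pi> y" by auto
      then show "z \<in> (\<lambda>t. \<pi> (t + x)) ` T" by (intro image_eqI[of _ _ "y - x"]) auto
    qed
    finally show ?thesis .
  qed
  have T0: "0 \<in> T" using T by (rule subspace_0)
  have eq: "I +>\<^bsub>L\<^esub> \<pi> x = I +>\<^bsub>L\<^esub> \<pi> y \<longleftrightarrow> x - y \<in> T" if x: "x \<in> S" and y: "y \<in> S" for x y
  proof
    assume "I +>\<^bsub>L\<^esub> \<pi> x = I +>\<^bsub>L\<^esub> \<pi> y"
    moreover have "\<pi> x \<in> I +>\<^bsub>L\<^esub> \<pi> x" using x T0 by (auto simp: coset)
    ultimately obtain z where z: "z \<in> S" "z - y \<in> T" "\<pi> x = \<pi> z" using y by (auto simp: coset)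
    then have "x - z \<in> T" using x NT by (auto simp: \<pi>_eq)
    then show "x - y \<in> T" using subspace_add[OF T, of "x - z" "z - y"] z by simp
  next
    assume xy: "x - y \<in> T"
    have "z - x \<in> T \<longleftrightarrow> z - y \<in> T" for z
      using subspace_add[OF T xy, of "z - x"] subspace_diff[OF T, of "z - y" "x - y"] xy by (auto simp: algebra_simps)
    then show "I +>\<^bsub>L\<^esub> \<pi> x = I +>\<^bsub>L\<^esub> \<pi> y" using x y by (auto simp: coset)
  qed
  \<comment> \<open>Scalar multiplication and product of the quotient record are unions over all
    representatives. They collapse to a single coset because the union runs over a nonempty set and
    its members do not depend on the representative.\<close>
  have const: "(\<Union>x\<in>A. f x) = c" if "A \<noteq> {}" "\<And>x. x \<in> A \<Longrightarrow> f x = c" for A :: "'v set" and f and c :: "'v set"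
    using that by auto
  have ne: "I +>\<^bsub>L\<^esub> \<pi> x \<noteq> {}" if "x \<in> S" for x using that T0 by (auto simp: coset)
  let ?Q = "sa_quotient L I"
  have "presentation sc ?Q mul S T P (\<lambda>x. I +>\<^bsub>L\<^esub> \<pi> x)"
  proof
    show "subspace S" "subspace T" "T \<subseteq> S" "\<And>p. P p \<subseteq> S" by (fact S_sub T TS P_S)+
    show "carrier ?Q = (\<lambda>x. I +>\<^bsub>L\<^esub> \<pi> x) ` S"
      by (auto simp: sa_quotient_def A_RCOSETS_def' carrier)
    show "part ?Q p = (\<lambda>x. I +>\<^bsub>L\<^esub> \<pi> x) ` P p" for p
      by (auto simp: sa_quotient_def part)
    show "\<zero>\<^bsub>?Q\<^esub> = I +>\<^bsub>L\<^esub> \<pi> 0"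
      using TS by (auto simp: coset, auto simp: sa_quotient_def I_def)
    fix x y c assume x: "x \<in> S"
    show "c \<odot>\<^bsub>?Q\<^esub> (I +>\<^bsub>L\<^esub> \<pi> x) = I +>\<^bsub>L\<^esub> \<pi> (sc c x)"
      unfolding sa_quotient_def partial_object.simps module.simps
    proof (rule const[OF ne[OF x]])
      fix v assume "v \<in> I +>\<^bsub>L\<^esub> \<pi> x"
      then obtain z where z: "z \<in> S" "z - x \<in> T" "v = \<pi> z" using x by (auto simp: coset)
      have "sc c z - sc c x \<in> T" using subspace_scale[OF T z(2), of c] by (simp add: scale_right_diff_distrib)
      then show "I +>\<^bsub>L\<^esub> c \<odot>\<^bsub>L\<^esub> v = I +>\<^bsub>L\<^esub> \<pi> (sc c x)" using x z by (simp add: \<pi>_smult eq)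
    qed
    assume y: "y \<in> S"
    show "(I +>\<^bsub>L\<^esub> \<pi> x = I +>\<^bsub>L\<^esub> \<pi> y) = (x - y \<in> T)" by (rule eq[OF x y])
    have "(I +>\<^bsub>L\<^esub> \<pi> x) <+>\<^bsub>L\<^esub> (I +>\<^bsub>L\<^esub> \<pi> y) = I +>\<^bsub>L\<^esub> \<pi> (x + y)"
    proof (intro equalityI subsetI)
      fix v assume "v \<in> (I +>\<^bsub>L\<^esub> \<pi> x) <+>\<^bsub>L\<^esub> (I +>\<^bsub>L\<^esub> \<pi> y)"
      then obtain z w where "z \<in> S" "z - x \<in> T" "w \<in> S" "w - y \<in> T" "v = \<pi> z \<oplus>\<^bsub>L\<^esub> \<pi> w"
        using x y by (auto simp: set_add_def' coset)
      then show "v \<in> I +>\<^bsub>L\<^esub> \<pi> (x + y)" using x y subspace_add[OF T, of "z - x" "w - y"]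
        by (auto simp: coset \<pi>_add algebra_simps intro!: image_eqI)
    next
      fix v assume "v \<in> I +>\<^bsub>L\<^esub> \<pi> (x + y)"
      then obtain z where z: "z \<in> S" "z - (x + y) \<in> T" "v = \<pi> z" using x y by (auto simp: coset)
      then have "v = \<pi> (z - y) \<oplus>\<^bsub>L\<^esub> \<pi> y" "z - y \<in> S" "z - y - x \<in> T" using y by (auto simp: \<pi>_add algebra_simps)
      then show "v \<in> (I +>\<^bsub>L\<^esub> \<pi> x) <+>\<^bsub>L\<^esub> (I +>\<^bsub>L\<^esub> \<pi> y)"
        using x y T0 unfolding set_add_def'
          by (simp add: coset, intro exI[of _ "z - y"] conjI exI[of _ y], simp_all)
    qed
    then show "(I +>\<^bsub>L\<^esub> \<pi> x) \<oplus>\<^bsub>?Q\<^esub> (I +>\<^bsub>L\<^esub> \<pi> y) = I +>\<^bsub>L\<^esub> \<pi> (x + y)" by (simp add: sa_quotient_def)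
    have "rcoset_mult L I (I +>\<^bsub>L\<^esub> \<pi> x) (I +>\<^bsub>L\<^esub> \<pi> y) = I +>\<^bsub>L\<^esub> \<pi> (mul x y)"
      unfolding rcoset_mult_def
    proof (intro const ne x y)
      fix v w assume "v \<in> I +>\<^bsub>L\<^esub> \<pi> x" "w \<in> I +>\<^bsub>L\<^esub> \<pi> y"
      then obtain z z' where z: "z \<in> S" "z - x \<in> T" "v = \<pi> z" "z' \<in> S" "z' - y \<in> T" "w = \<pi> z'" using x y by (auto simp: coset)
      have "mul z z' - mul x y = mul z (z' - y) + mul (z - x) y" by (simp add: mul_diff)
      then have "mul z z' - mul x y \<in> T" using Tl[OF z(1,5)] Tr[OF y z(2)] subspace_add[OF T] by simp
      then show "I +>\<^bsub>L\<^esub> v \<otimes>\<^bsub>L\<^esub> w = I +>\<^bsub>L\<^esub> \<pi> (mul x y)" using x y z by (simp add: \<pi>_mult eq mul_closed)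
    qed
    then show "(I +>\<^bsub>L\<^esub> \<pi> x) \<otimes>\<^bsub>?Q\<^esub> (I +>\<^bsub>L\<^esub> \<pi> y) = I +>\<^bsub>L\<^esub> \<pi> (mul x y)" by (simp add: sa_quotient_def)
  qed (simp_all add: mul_add_left mul_add_right mul_scale_left mul_scale_right mul_closed Tl Tr)
  then show ?thesis by (simp add: I_def)
qed

text \<open>The span of the products need not contain the kernel. Adding \<open>N\<close> makes this
  the full preimage of the derived algebra, a union of cosets of \<open>N\<close>.\<close>

definition derived_preimage :: "'f set"
  where "derived_preimage = {x \<in> S. \<exists>y\<in>span {mul a b | a b. a \<in> S \<and> b \<in> S}. x - y \<in> N}"

lemma derived_span_subset: "span {mul a b | a b. a \<in> S \<and> b \<in> S} \<subseteq> S"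
  by (rule span_minimal) (auto simp: mul_closed S_sub)

text \<open>The parity parts of the record are intersections of images. They are images of
  intersections here because \<open>derived_preimage\<close> is saturated under
  \<open>N\<close>.\<close>

lemma derived: "presentation sc (derived_algebra L) mul derived_preimage N (\<lambda>p. P p \<inter> derived_preimage) \<pi>"
proof -
  let ?X = "{mul a b | a b. a \<in> S \<and> b \<in> S}"
  let ?D = "derived_preimage"
  have "{x \<otimes>\<^bsub>L\<^esub> y | x y. x \<in> carrier L \<and> y \<in> carrier L} = \<pi> ` ?X"
  proof (intro equalityI subsetI)
    fix v assume "v \<in> {x \<otimes>\<^bsub>L\<^esub> y | x y. x \<in> carrier L \<and> y \<in> carrier L}"
    then obtain x y where "x \<in> S" "y \<in> S" "v = \<pi> (mul x y)" by (auto simp: carrier \<pi>_mult)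
    then show "v \<in> \<pi> ` ?X" by auto
  next
    fix v assume "v \<in> \<pi> ` ?X"
    then obtain x y where "x \<in> S" "y \<in> S" "v = \<pi> x \<otimes>\<^bsub>L\<^esub> \<pi> y" by (auto simp: \<pi>_mult)
    then show "v \<in> {x \<otimes>\<^bsub>L\<^esub> y | x y. x \<in> carrier L \<and> y \<in> carrier L}" by (auto simp: carrier)
  qed
  note gen = this
  have XS: "?X \<subseteq> S" using mul_closed by blast
  have sp: "LinearCombinations.module.span class_ring L {x \<otimes>\<^bsub>L\<^esub> y | x y. x \<in> carrier L \<and> y \<in> carrier L} = \<pi> ` span ?X"
    unfolding gen by (rule record_span[OF XS])
  have D: "\<pi> x \<in> \<pi> ` span ?X \<longleftrightarrow> x \<in> ?D" if "x \<in> S" for x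
  proof -
    have "\<pi> x = \<pi> y \<longleftrightarrow> x - y \<in> N" if "y \<in> span ?X" for y
      using \<pi>_eq[of x y] derived_span_subset that \<open>x \<in> S\<close> by blast
    then show ?thesis using that unfolding derived_preimage_def image_iff by blast
  qed
  have DS: "?D \<subseteq> S" by (auto simp: derived_preimage_def)
  have im: "\<pi> ` span ?X = \<pi> ` ?D"
  proof (intro equalityI subsetI)
    fix v assume "v \<in> \<pi> ` span ?X"
    then obtain y where "y \<in> span ?X" "v = \<pi> y" by blast
    then show "v \<in> \<pi> ` ?D" using D[of y] derived_span_subset by blast
  next
    fix v assume "v \<in> \<pi> ` ?D"
    then show "v \<in> \<pi> ` span ?X" using D DS by blast
  qed
  have Dsub: "subspace ?D"
  proof (rule subspaceI)
    show "0 \<in> ?D" unfolding derived_preimage_def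
      by (intro CollectI conjI bexI[of _ 0]) (simp_all add: subspace_0[OF N_sub] span_zero)
    fix x y c assume "x \<in> ?D"
    then obtain x' where x: "x \<in> S" "x' \<in> span ?X" "x - x' \<in> N" by (auto simp: derived_preimage_def)
    have "sc c x - sc c x' \<in> N" using subspace_scale[OF N_sub x(3), of c] by (simp add: scale_right_diff_distrib)
    then show "sc c x \<in> ?D" using x span_scale[OF x(2), of c] unfolding derived_preimage_def by blast
    assume "y \<in> ?D"
    then obtain y' where y: "y \<in> S" "y' \<in> span ?X" "y - y' \<in> N" by (auto simp: derived_preimage_def)
    have "(x + y) - (x' + y') \<in> N" using subspace_add[OF N_sub x(3) y(3)] by (simp add: algebra_simps)
    then show "x + y \<in> ?D" using x y span_add[OF x(2) y(2)] unfolding derived_preimage_def by blast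
  qed
  have dL: "derived_algebra L = L\<lparr>carrier := \<pi> ` ?D, part := (\<lambda>p. part L p \<inter> \<pi> ` ?D)\<rparr>"
    unfolding derived_algebra_def Let_def sp im by (rule refl)
  have mulD: "mul x y \<in> ?D" if "x \<in> S" "y \<in> S" for x y
  proof -
    have "mul x y \<in> span ?X" using that by (intro span_base) auto
    then show ?thesis unfolding derived_preimage_def
      by (intro CollectI conjI bexI[of _ "mul x y"]) (simp_all add: that mul_closed subspace_0[OF N_sub])
  qed
  show ?thesis
  proof
    show "N \<subseteq> ?D"
    proof
      fix x assume "x \<in> N"
      then show "x \<in> ?D" unfolding derived_preimage_def using N_S
        by (intro CollectI conjI bexI[of _ 0]) (auto simp: span_zero)
    qed
    show "carrier (derived_algebra L) = \<pi> ` ?D" unfolding dL by simp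
    show "part (derived_algebra L) p = \<pi> ` (P p \<inter> ?D)" for p
    proof -
      have "part (derived_algebra L) p = \<pi> ` P p \<inter> \<pi> ` ?D"
        unfolding dL by (simp add: part)
      also have "\<dots> = \<pi> ` (P p \<inter> ?D)"
      proof (intro equalityI subsetI)
        fix v assume "v \<in> \<pi> ` P p \<inter> \<pi> ` ?D"
        then obtain x where x: "x \<in> P p" "v = \<pi> x" "\<pi> x \<in> \<pi> ` ?D" by blast
        then have "x \<in> ?D" using D[of x] P_S[of p] im by blast
        then show "v \<in> \<pi> ` (P p \<inter> ?D)" using x by blast
      qed blast
      finally show ?thesis .
    qed
    show "\<zero>\<^bsub>derived_algebra L\<^esub> = \<pi> 0" unfolding dL by (simp add: \<pi>_zero)
    fix x y c assume x: "x \<in> ?D"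
    have xS: "x \<in> S" using x DS by blast
    show "c \<odot>\<^bsub>derived_algebra L\<^esub> \<pi> x = \<pi> (sc c x)" unfolding dL by (simp add: \<pi>_smult xS)
    { assume "y \<in> N" then show "mul x y \<in> N" "mul y x \<in> N" by (rule N_ideal[OF xS])+ }
    assume y: "y \<in> ?D"
    have yS: "y \<in> S" using y DS by blast
    show "mul x y \<in> ?D" by (rule mulD[OF xS yS])
    show "(\<pi> x = \<pi> y) = (x - y \<in> N)" by (rule \<pi>_eq[OF xS yS])
    show "\<pi> x \<oplus>\<^bsub>derived_algebra L\<^esub> \<pi> y = \<pi> (x + y)" "\<pi> x \<otimes>\<^bsub>derived_algebra L\<^esub> \<pi> y = \<pi> (mul x y)"
      unfolding dL by (simp_all add: \<pi>_add \<pi>_mult xS yS)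
  qed (simp_all add: mul_add_left mul_add_right mul_scale_left mul_scale_right Dsub N_sub)
qed

text \<open>\<open>sa_center\<close> asks only that products with the central element on the left
  vanish. These products therefore lie in \<open>N\<close> at once, while stability of
  \<open>Z\<close> under multiplication from the left has to be supplied, as nothing in the locale
  makes the product anticommutative.\<close>

lemma center_quotient:
  assumes Z: "Z = {x \<in> S. \<forall>y\<in>S. mul x y \<in> N}"
    and Zl: "\<And>x y. x \<in> S \<Longrightarrow> y \<in> Z \<Longrightarrow> mul x y \<in> Z"
  shows "presentation sc (sa_quotient L (sa_center L)) mul S Z P (\<lambda>x. sa_center L +>\<^bsub>L\<^esub> \<pi> x)"
proof -
  have c: "sa_center L = \<pi> ` Z" unfolding Z by (rule center)
  have ZS: "Z \<subseteq> S" unfolding Z by blast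
  have NZ: "N \<subseteq> Z" unfolding Z using N_S N_ideal(2) by blast
  have "subspace Z"
  proof (rule subspaceI)
    show "0 \<in> Z" unfolding Z by (simp add: subspace_0[OF N_sub])
    fix x y c assume x: "x \<in> Z"
    show "sc c x \<in> Z" using x unfolding Z by (simp add: mul_scale_left subspace_scale[OF N_sub])
    assume "y \<in> Z"
    then show "x + y \<in> Z" using x unfolding Z by (simp add: mul_add_left subspace_add[OF N_sub])
  qed
  then show ?thesis unfolding c
  proof (rule quotient[OF ZS _ NZ])
    fix x y assume x: "x \<in> S" and y: "y \<in> Z"
    show "mul x y \<in> Z" by (rule Zl[OF x y])
    have "mul y x \<in> N" using y x unfolding Z by blast
    then show "mul y x \<in> Z" using NZ by blast
  qed
qed

end

section \<open>Evaluation of free nonassociative algebras\<close>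

lemma lookup_free_scale [simp]: "Poly_Mapping.lookup (free_scale c p) m = c * Poly_Mapping.lookup p m"
  by (simp add: free_scale_def Poly_Mapping.map.rep_eq when_def)

interpretation free: vector_space "free_scale :: 'k::field \<Rightarrow> ('k, 'x) free_alg \<Rightarrow> _"
  by standard (rule poly_mapping_eqI, simp add: lookup_add algebra_simps)+

abbreviation mon :: "'x magma \<Rightarrow> ('k::field, 'x) free_alg" where "mon m \<equiv> Poly_Mapping.single m 1"

lemma single_eq_scale_mono: "Poly_Mapping.single m c = free_scale c (mon m)"
  by (rule poly_mapping_eqI) (simp add: lookup_single when_def)

lemma lookup_sum': "Poly_Mapping.lookup (\<Sum>i\<in>I. f i) m = (\<Sum>i\<in>I. Poly_Mapping.lookup (f i) m)"
  by (induction I rule: infinite_finite_induct) (auto simp: lookup_add)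

lemma free_expand:
  assumes "finite A" "Poly_Mapping.keys p \<subseteq> A"
  shows "p = (\<Sum>m\<in>A. free_scale (Poly_Mapping.lookup p m) (mon m))"
proof (rule poly_mapping_eqI)
  fix k
  have "(\<Sum>m\<in>A. Poly_Mapping.lookup p m * (1 when m = k)) = (\<Sum>m\<in>A. if m = k then Poly_Mapping.lookup p m else 0)"
    by (rule sum.cong) (auto simp: when_def)
  also have "\<dots> = Poly_Mapping.lookup p k" using assms by (auto simp: in_keys_iff)
  finally show "Poly_Mapping.lookup p k = Poly_Mapping.lookup (\<Sum>m\<in>A. free_scale (Poly_Mapping.lookup p m) (mon m)) k"
    by (simp add: lookup_sum' lookup_single)
qed

text \<open>The keys of a sum or a multiple may be fewer than those of its terms. Summing over a
  common finite superset turns bilinearity into termwise identities.\<close>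

lemma free_mult_superset:
  assumes "finite A" "Poly_Mapping.keys p \<subseteq> A" "finite B" "Poly_Mapping.keys q \<subseteq> B"
  shows "free_mult p q = (\<Sum>a\<in>A. \<Sum>b\<in>B. free_scale (Poly_Mapping.lookup p a * Poly_Mapping.lookup q b) (mon (MProd a b)))"
proof -
  have "free_mult p q = (\<Sum>a\<in>Poly_Mapping.keys p. \<Sum>b\<in>Poly_Mapping.keys q. free_scale (Poly_Mapping.lookup p a * Poly_Mapping.lookup q b) (mon (MProd a b)))"
    unfolding free_mult_def by (intro sum.cong refl single_eq_scale_mono)
  also have "\<dots> = (\<Sum>a\<in>Poly_Mapping.keys p. \<Sum>b\<in>B. free_scale (Poly_Mapping.lookup p a * Poly_Mapping.lookup q b) (mon (MProd a b)))"
    using assms by (intro sum.cong sum.mono_neutral_left) (auto simp: in_keys_iff)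
  also have "\<dots> = (\<Sum>a\<in>A. \<Sum>b\<in>B. free_scale (Poly_Mapping.lookup p a * Poly_Mapping.lookup q b) (mon (MProd a b)))"
    using assms by (intro sum.mono_neutral_left) (auto simp: in_keys_iff)
  finally show ?thesis .
qed

lemma free_mult_add_left: "free_mult (p + q) r = free_mult p r + free_mult q r"
proof -
  let ?A = "Poly_Mapping.keys p \<union> Poly_Mapping.keys q \<union> Poly_Mapping.keys (p + q)" and ?B = "Poly_Mapping.keys r"
  have "free_mult s r = (\<Sum>a\<in>?A. \<Sum>b\<in>?B. free_scale (Poly_Mapping.lookup s a * Poly_Mapping.lookup r b) (mon (MProd a b)))"
    if "s \<in> {p, q, p + q}" for s
    using that by (intro free_mult_superset) auto
  then show ?thesis by (simp add: lookup_add algebra_simps free.scale_left_distrib sum.distrib)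
qed

lemma free_mult_add_right: "free_mult r (p + q) = free_mult r p + free_mult r q"
proof -
  let ?A = "Poly_Mapping.keys p \<union> Poly_Mapping.keys q \<union> Poly_Mapping.keys (p + q)" and ?B = "Poly_Mapping.keys r"
  have "free_mult r s = (\<Sum>b\<in>?B. \<Sum>a\<in>?A. free_scale (Poly_Mapping.lookup r b * Poly_Mapping.lookup s a) (mon (MProd b a)))"
    if "s \<in> {p, q, p + q}" for s
    using that by (intro free_mult_superset) auto
  then show ?thesis by (simp add: lookup_add algebra_simps free.scale_left_distrib sum.distrib)
qed

lemma keys_free_scale: "Poly_Mapping.keys (free_scale c p) \<subseteq> Poly_Mapping.keys p"
  by (auto simp: in_keys_iff)

lemma free_mult_scale_left: "free_mult (free_scale c p) q = free_scale c (free_mult p q)"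
  using free_mult_superset[of "Poly_Mapping.keys p" "free_scale c p" "Poly_Mapping.keys q" q]
    free_mult_superset[of "Poly_Mapping.keys p" p "Poly_Mapping.keys q" q] keys_free_scale[of c p]
  by (simp add: free.scale_sum_right mult.assoc)

lemma free_mult_scale_right: "free_mult p (free_scale c q) = free_scale c (free_mult p q)"
  using free_mult_superset[of "Poly_Mapping.keys p" p "Poly_Mapping.keys q" "free_scale c q"]
    free_mult_superset[of "Poly_Mapping.keys p" p "Poly_Mapping.keys q" q] keys_free_scale[of c q]
  by (simp add: free.scale_sum_right mult.left_commute)

lemma free_mult_mono: "free_mult (mon a) (mon b) = mon (MProd a b)"
  by (simp add: free_mult_def)

lemma free_mult_zero [simp]: "free_mult 0 p = 0" "free_mult p 0 = 0"
  by (simp_all add: free_mult_def)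

primrec magma_eval :: "('c \<Rightarrow> 'c \<Rightarrow> 'c) \<Rightarrow> ('x \<Rightarrow> 'c) \<Rightarrow> 'x magma \<Rightarrow> 'c"
  where "magma_eval br g (Letter x) = g x"
  | "magma_eval br g (MProd a b) = br (magma_eval br g a) (magma_eval br g b)"

text \<open>The homomorphism given by the universal property of the free nonassociative
  algebra.\<close>

definition free_lift :: "('k::field \<Rightarrow> 'c::ab_group_add \<Rightarrow> 'c) \<Rightarrow> ('c \<Rightarrow> 'c \<Rightarrow> 'c) \<Rightarrow> ('x \<Rightarrow> 'c) \<Rightarrow> ('k, 'x) free_alg \<Rightarrow> 'c"
  where "free_lift sc br g p = (\<Sum>m\<in>Poly_Mapping.keys p. sc (Poly_Mapping.lookup p m) (magma_eval br g m))"

locale bilinear_mult = vector_space sc for sc :: "'k::field \<Rightarrow> 'c::ab_group_add \<Rightarrow> 'c" +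
  fixes br :: "'c \<Rightarrow> 'c \<Rightarrow> 'c"
  assumes br_add_left: "br (x + y) z = br x z + br y z"
    and br_add_right: "br x (y + z) = br x y + br x z"
    and br_scale_left: "br (sc c x) y = sc c (br x y)"
    and br_scale_right: "br x (sc c y) = sc c (br x y)"
begin

lemma br_zero [simp]: "br 0 x = 0" "br x 0 = 0"
  using br_scale_left[of 0 0 x] br_scale_right[of x 0 0] by auto

lemma br_sum_left: "br (\<Sum>i\<in>I. f i) x = (\<Sum>i\<in>I. br (f i) x)"
  by (induction I rule: infinite_finite_induct) (auto simp: br_add_left)
lemma br_sum_right: "br x (\<Sum>i\<in>I. f i) = (\<Sum>i\<in>I. br x (f i))"
  by (induction I rule: infinite_finite_induct) (auto simp: br_add_right)

context fixes g :: "'x \<Rightarrow> 'c" begin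

abbreviation "\<Phi> \<equiv> free_lift sc br g"

lemma lift_superset:
  assumes "finite A" "Poly_Mapping.keys p \<subseteq> A"
  shows "\<Phi> p = (\<Sum>m\<in>A. sc (Poly_Mapping.lookup p m) (magma_eval br g m))"
  unfolding free_lift_def using assms by (intro sum.mono_neutral_left) (auto simp: in_keys_iff)

lemma lift_add: "\<Phi> (p + q) = \<Phi> p + \<Phi> q"
proof -
  let ?A = "Poly_Mapping.keys p \<union> Poly_Mapping.keys q \<union> Poly_Mapping.keys (p + q)"
  have "\<Phi> s = (\<Sum>m\<in>?A. sc (Poly_Mapping.lookup s m) (magma_eval br g m))" if "s \<in> {p, q, p + q}" for s
    using that by (intro lift_superset) auto
  then show ?thesis by (simp add: lookup_add scale_left_distrib sum.distrib)
qed

lemma lift_scale: "\<Phi> (free_scale c p) = sc c (\<Phi> p)"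
  using lift_superset[of "Poly_Mapping.keys p" "free_scale c p"] lift_superset[of "Poly_Mapping.keys p" p] keys_free_scale[of c p]
  by (simp add: scale_sum_right)

lemma lift_mono [simp]: "\<Phi> (mon m) = magma_eval br g m"
  by (simp add: free_lift_def)

lemma lift_zero [simp]: "\<Phi> 0 = 0"
  by (simp add: free_lift_def)

lemma lift_minus: "\<Phi> (- p) = - \<Phi> p"
  using lift_add[of p "- p"] by (simp add: eq_neg_iff_add_eq_0 add.commute)

lemma lift_diff: "\<Phi> (p - q) = \<Phi> p - \<Phi> q"
  using lift_add[of p "- q"] by (simp add: lift_minus)

lemma lift_sum: "\<Phi> (\<Sum>i\<in>I. f i) = (\<Sum>i\<in>I. \<Phi> (f i))"
  by (induction I rule: infinite_finite_induct) (auto simp: lift_add)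

lemma lift_mult: "\<Phi> (free_mult p q) = br (\<Phi> p) (\<Phi> q)"
proof -
  have "\<Phi> (free_mult p q) = (\<Sum>a\<in>Poly_Mapping.keys p. \<Sum>b\<in>Poly_Mapping.keys q.
      sc (Poly_Mapping.lookup p a * Poly_Mapping.lookup q b) (br (magma_eval br g a) (magma_eval br g b)))"
    by (subst free_mult_superset[of "Poly_Mapping.keys p" _ "Poly_Mapping.keys q"])
      (simp_all add: lift_sum lift_scale)
  also have "\<dots> = br (\<Phi> p) (\<Phi> q)"
    unfolding free_lift_def by (simp add: br_sum_left br_sum_right br_scale_left br_scale_right scale_sum_right mult.commute) (rule sum.swap)
  finally show ?thesis .
qed

lemma lift_in_subspace:
  assumes "subspace T" "\<And>m. m \<in> Poly_Mapping.keys p \<Longrightarrow> magma_eval br g m \<in> T"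
  shows "\<Phi> p \<in> T"
  unfolding free_lift_def using assms by (intro subspace_sum subspace_scale)

end
end

text \<open>Carrier, parity parts and weight components of the free algebra are all cut out by a
  condition on single monomials, so one argument serves for the three.\<close>

lemma keys_prop_subspace:
  fixes R :: "'x magma \<Rightarrow> bool"
  shows "free.subspace {p :: ('k::field, 'x) free_alg. \<forall>m\<in>Poly_Mapping.keys p. R m}"
proof (rule free.subspaceI)
  fix p q :: "('k, 'x) free_alg" and c :: 'k
  assume p: "p \<in> {p. \<forall>m\<in>Poly_Mapping.keys p. R m}"
  then show "free_scale c p \<in> {p. \<forall>m\<in>Poly_Mapping.keys p. R m}" using keys_free_scale[of c p] by auto
  assume "q \<in> {p. \<forall>m\<in>Poly_Mapping.keys p. R m}"
  then show "p + q \<in> {p. \<forall>m\<in>Poly_Mapping.keys p. R m}" using p Poly_Mapping.keys_add[of p q] by auto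
qed simp

section \<open>The free superalgebra modulo Lie and Chevalley relations\<close>

locale chevalley_data = HV: vector_space scl for scl :: "'k::field \<Rightarrow> 'h::ab_group_add \<Rightarrow> 'h" +
  fixes A :: "int mat" and par :: "nat \<Rightarrow> bit" and hh :: "nat \<Rightarrow> 'h" and \<alpha> :: "nat \<Rightarrow> 'h \<Rightarrow> 'k"
begin

abbreviation "n \<equiv> dim_row A"
abbreviation "F \<equiv> tilde_free A par :: ('k, ('k, 'h generator) free_alg) superalgebra"
definition Car :: "('k, 'h generator) free_alg set"
  where "Car = {p. \<forall>m\<in>Poly_Mapping.keys p. letters m \<subseteq> gens n}"
definition Fpart :: "bit \<Rightarrow> ('k, 'h generator) free_alg set"
  where "Fpart i = {p. \<forall>m\<in>Poly_Mapping.keys p. letters m \<subseteq> gens n \<and> magma_deg (gen_parity par) m = i}"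
definition HM :: "(nat \<Rightarrow>\<^sub>0 int) \<Rightarrow> ('k, 'h generator) free_alg set"
  where "HM q = {p \<in> Car. \<forall>m\<in>Poly_Mapping.keys p. magma_deg gen_weight m = q}"

lemma Car_sub: "free.subspace Car"
  using keys_prop_subspace[of "\<lambda>m. letters m \<subseteq> gens n"] by (simp only: Car_def)
lemma Fpart_sub: "free.subspace (Fpart i)"
  using keys_prop_subspace[of "\<lambda>m. letters m \<subseteq> gens n \<and> magma_deg (gen_parity par) m = i"] by (simp only: Fpart_def)
lemma HM_alt: "HM q = {p. \<forall>m\<in>Poly_Mapping.keys p. letters m \<subseteq> gens n \<and> magma_deg gen_weight m = q}"
  unfolding HM_def Car_def by blast
lemma HM_sub: "free.subspace (HM q)"
  using keys_prop_subspace[of "\<lambda>m. letters m \<subseteq> gens n \<and> magma_deg gen_weight m = q"] by (simp only: HM_alt)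

lemma keys_free_mult: "m \<in> Poly_Mapping.keys (free_mult p q) \<Longrightarrow>
  \<exists>a\<in>Poly_Mapping.keys p. \<exists>b\<in>Poly_Mapping.keys q. m = MProd a b"
proof -
  assume m: "m \<in> Poly_Mapping.keys (free_mult p q)"
  let ?K = "{r. \<forall>m\<in>Poly_Mapping.keys r. \<exists>a\<in>Poly_Mapping.keys p. \<exists>b\<in>Poly_Mapping.keys q. m = MProd a b}"
  have "free_mult p q \<in> ?K"
    unfolding free_mult_def
  proof (intro free.subspace_sum keys_prop_subspace)
    fix a b assume "a \<in> Poly_Mapping.keys p" "b \<in> Poly_Mapping.keys q"
    then show "Poly_Mapping.single (MProd a b) (Poly_Mapping.lookup p a * Poly_Mapping.lookup q b) \<in> ?K"
      by (cases "Poly_Mapping.lookup p a * Poly_Mapping.lookup q b = 0") auto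
  qed
  then show ?thesis using m by blast
qed

lemma Car_mult: "p \<in> Car \<Longrightarrow> q \<in> Car \<Longrightarrow> free_mult p q \<in> Car"
proof -
  assume pq: "p \<in> Car" "q \<in> Car"
  have "letters m \<subseteq> gens n" if m: "m \<in> Poly_Mapping.keys (free_mult p q)" for m
  proof -
    obtain a b where ab: "a \<in> Poly_Mapping.keys p" "b \<in> Poly_Mapping.keys q" "m = MProd a b" using keys_free_mult[OF m] by blast
    then have "letters a \<subseteq> gens n" "letters b \<subseteq> gens n" using pq unfolding Car_def by blast+
    then show ?thesis using ab by simp
  qed
  then show ?thesis unfolding Car_def by blast
qed

lemma mono_Car: "mon m \<in> Car \<longleftrightarrow> letters m \<subseteq> gens n"
  by (simp add: Car_def)

lemma HM_mult: "p \<in> HM q \<Longrightarrow> p' \<in> HM q' \<Longrightarrow> free_mult p p' \<in> HM (q + q')"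
proof -
  assume pq: "p \<in> HM q" "p' \<in> HM q'"
  have "magma_deg gen_weight m = q + q'" if m: "m \<in> Poly_Mapping.keys (free_mult p p')" for m
  proof -
    obtain a b where ab: "a \<in> Poly_Mapping.keys p" "b \<in> Poly_Mapping.keys p'" "m = MProd a b" using keys_free_mult[OF m] by blast
    then have "magma_deg gen_weight a = q" "magma_deg gen_weight b = q'" using pq unfolding HM_def by blast+
    then show ?thesis using ab by simp
  qed
  moreover have "free_mult p p' \<in> Car" using pq Car_mult unfolding HM_def by blast
  ultimately show ?thesis unfolding HM_def by blast
qed

lemma Fpart_Car: "Fpart p \<subseteq> Car"
  unfolding Fpart_def Car_def by blast

lemma F_ops: "carrier F = Car" "mult F = free_mult" "add F = (+)" "zero F = 0" "smult F = free_scale" "part F = Fpart"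
  by (simp_all add: tilde_free_def free_superalgebra_def Car_def Fpart_def fun_eq_iff)

lemma free_presentation: "presentation free_scale F free_mult Car {0} Fpart id"
proof
  show "free.subspace Car" "free.subspace {0}" by (rule Car_sub, rule free.subspace_single_0)
  show "{0} \<subseteq> Car" using free.subspace_0[OF Car_sub] by simp
qed (simp_all add: free_mult_add_left free_mult_add_right free_mult_scale_left free_mult_scale_right Car_mult F_ops Fpart_Car)

interpretation FP: presentation free_scale F free_mult Car "{0}" Fpart id
  by (rule free_presentation)

definition R0 :: "('k, 'h generator) free_alg set"
  where "R0 = lie_identities F \<union> chevalley_relations A scl hh \<alpha>"

abbreviation "J \<equiv> tilde_relations A par scl hh \<alpha>"

lemma J_least:
  assumes "free.subspace T" "T \<subseteq> Car" "R0 \<subseteq> T"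
    and "\<And>x y. x \<in> Car \<Longrightarrow> y \<in> T \<Longrightarrow> free_mult x y \<in> T" "\<And>x y. x \<in> Car \<Longrightarrow> y \<in> T \<Longrightarrow> free_mult y x \<in> T"
  shows "J \<subseteq> T"
  using FP.sa_ideal_iff[OF assms(2,1,4,5)] assms(3)
  unfolding tilde_relations_def sa_ideal_generated_def R0_def by auto

text \<open>The intersection of an empty family of ideals would be everything. The hypothesis makes
  \<open>Car\<close> a member of the family, which also confines \<open>J\<close> to the
  carrier.\<close>

lemma J_facts: 
  assumes R0: "R0 \<subseteq> Car"
  shows "free.subspace J" "J \<subseteq> Car" "R0 \<subseteq> J"
    "\<And>x y. x \<in> Car \<Longrightarrow> y \<in> J \<Longrightarrow> free_mult x y \<in> J" "\<And>x y. x \<in> Car \<Longrightarrow> y \<in> J \<Longrightarrow> free_mult y x \<in> J"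
proof -
  let ?\<I> = "{I. sa_ideal F I \<and> R0 \<subseteq> I}"
  have J: "J = \<Inter>?\<I>" by (simp add: tilde_relations_def sa_ideal_generated_def R0_def)
  have C: "Car \<in> ?\<I>" using R0 FP.sa_ideal_iff[of Car] Car_sub Car_mult by simp
  then show sub: "J \<subseteq> Car" unfolding J by blast
  show "R0 \<subseteq> J" unfolding J by blast
  have i: "free.subspace {x \<in> Car. x \<in> I}" "\<And>x y. x \<in> Car \<Longrightarrow> y \<in> Car \<Longrightarrow> y \<in> I \<Longrightarrow> free_mult x y \<in> I \<and> free_mult y x \<in> I"
    if "I \<in> ?\<I>" for I
    using FP.sa_idealD(1)[of I] FP.sa_idealD(4)[of I] FP.sa_idealD(5)[of I] that by auto
  show "free.subspace J"
  proof (rule free.subspaceI)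
    show "0 \<in> J" unfolding J using i(1) free.subspace_0 by fastforce
    fix x y c assume x: "x \<in> J"
    show "free_scale c x \<in> J" unfolding J
    proof
      fix I assume I: "I \<in> ?\<I>"
      have "x \<in> {x \<in> Car. x \<in> I}" using x I sub unfolding J by blast
      then show "free_scale c x \<in> I" using free.subspace_scale[OF i(1)[OF I], of x c] by simp
    qed
    assume y: "y \<in> J"
    show "x + y \<in> J" unfolding J
    proof
      fix I assume I: "I \<in> ?\<I>"
      have "x \<in> {x \<in> Car. x \<in> I}" "y \<in> {x \<in> Car. x \<in> I}" using x y I sub unfolding J by blast+
      then show "x + y \<in> I" using free.subspace_add[OF i(1)[OF I], of x y] by simp
    qed
  qed
  fix x y assume x: "x \<in> Car" and y: "y \<in> J"
  have "y \<in> Car" using y sub by blast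
  then show "free_mult x y \<in> J" "free_mult y x \<in> J" using i(2)[OF _ x] y unfolding J by blast+
qed

lemma free_letter_Car [simp]: "free_letter (Hgen a) \<in> Car" "i < n \<Longrightarrow> free_letter (Egen i) \<in> Car" "i < n \<Longrightarrow> free_letter (Fgen i) \<in> Car"
  by (auto simp: free_letter_def mono_Car gens_def)

text \<open>Subtraction in the record adds an inverse taken inside the carrier. It agrees with the
  subtraction of the type only for elements of \<open>Car\<close>, so the Jacobi elements are
  translated here once.\<close>

lemma F_jacobi_element:
  assumes "x \<in> Car" "y \<in> Car" "z \<in> Car"
  shows "x \<otimes>\<^bsub>F\<^esub> (y \<otimes>\<^bsub>F\<^esub> z) \<ominus>\<^bsub>F\<^esub> (x \<otimes>\<^bsub>F\<^esub> y) \<otimes>\<^bsub>F\<^esub> z \<ominus>\<^bsub>F\<^esub> c \<odot>\<^bsub>F\<^esub> (y \<otimes>\<^bsub>F\<^esub> (x \<otimes>\<^bsub>F\<^esub> z)) =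
     free_mult x (free_mult y z) - free_mult (free_mult x y) z - free_scale c (free_mult y (free_mult x z))"
proof -
  have m: "x \<ominus>\<^bsub>F\<^esub> y = x - y" if "x \<in> Car" "y \<in> Car" for x y using FP.diff[OF that] by simp
  show ?thesis unfolding F_ops using assms
    by (simp add: m Car_mult free.subspace_diff[OF Car_sub] free.subspace_scale[OF Car_sub])
qed

lemma lie_identities_mem:
  "x \<in> Fpart p \<Longrightarrow> y \<in> Fpart q \<Longrightarrow> free_mult x y + free_scale (koszul_sign p q) (free_mult y x) \<in> lie_identities F"
  "x \<in> Fpart p \<Longrightarrow> y \<in> Fpart q \<Longrightarrow> z \<in> Fpart r \<Longrightarrow>
    free_mult x (free_mult y z) - free_mult (free_mult x y) z - free_scale (koszul_sign p q) (free_mult y (free_mult x z)) \<in> lie_identities F"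
proof -
  show "free_mult x y + free_scale (koszul_sign p q) (free_mult y x) \<in> lie_identities F" if "x \<in> Fpart p" "y \<in> Fpart q"
    unfolding lie_identities_def F_ops using that by blast
  assume xyz: "x \<in> Fpart p" "y \<in> Fpart q" "z \<in> Fpart r"
  then have "x \<in> Car" "y \<in> Car" "z \<in> Car" using Fpart_Car by blast+
  note eq = F_jacobi_element[OF this, symmetric]
  show "free_mult x (free_mult y z) - free_mult (free_mult x y) z - free_scale (koszul_sign p q) (free_mult y (free_mult x z)) \<in> lie_identities F"
    unfolding eq lie_identities_def using xyz unfolding F_ops(6)[symmetric] by blast
qed

lemma lie_identities_cases:
  assumes "v \<in> lie_identities F"
  obtains p q x y where "x \<in> Fpart p" "y \<in> Fpart q" "v = free_mult x y + free_scale (koszul_sign p q) (free_mult y x)"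
  | p q r x y z where "x \<in> Fpart p" "y \<in> Fpart q" "z \<in> Fpart r"
      "v = free_mult x (free_mult y z) - free_mult (free_mult x y) z - free_scale (koszul_sign p q) (free_mult y (free_mult x z))"
  | x where "x \<in> Fpart 1" "v = free_mult x (free_mult x x)"
proof -
  from assms consider (1) p q x y where "x \<in> Fpart p" "y \<in> Fpart q" "v = free_mult x y + free_scale (koszul_sign p q) (free_mult y x)"
    | (2) p q r x y z where "x \<in> part F p" "y \<in> part F q" "z \<in> part F r"
      "v = x \<otimes>\<^bsub>F\<^esub> (y \<otimes>\<^bsub>F\<^esub> z) \<ominus>\<^bsub>F\<^esub> (x \<otimes>\<^bsub>F\<^esub> y) \<otimes>\<^bsub>F\<^esub> z \<ominus>\<^bsub>F\<^esub> koszul_sign p q \<odot>\<^bsub>F\<^esub> (y \<otimes>\<^bsub>F\<^esub> (x \<otimes>\<^bsub>F\<^esub> z))"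
    | (3) x where "x \<in> Fpart 1" "v = free_mult x (free_mult x x)"
    unfolding lie_identities_def F_ops by blast
  then show thesis
  proof cases
    case 2
    then have x: "x \<in> Fpart p" "y \<in> Fpart q" "z \<in> Fpart r" by (simp_all only: F_ops)
    then have "x \<in> Car" "y \<in> Car" "z \<in> Car" using Fpart_Car by blast+
    then show thesis using that(2)[OF x] 2(4) F_jacobi_element by metis
  qed (use that in blast)+
qed

lemma chevalley_alt: "chevalley_relations A scl hh \<alpha> = 
  {mon (Letter (Hgen (a + b))) - mon (Letter (Hgen a)) - mon (Letter (Hgen b)) | a b. True} \<union>
  {mon (Letter (Hgen (scl c a))) - free_scale c (mon (Letter (Hgen a))) | c a. True} \<union>
  {mon (MProd (Letter (Egen i)) (Letter (Fgen j))) - (if i = j then mon (Letter (Hgen (hh i))) else 0) | i j. i < n \<and> j < n} \<union>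
  {mon (MProd (Letter (Hgen a)) (Letter (Egen j))) - free_scale (\<alpha> j a) (mon (Letter (Egen j))) | a j. j < n} \<union>
  {mon (MProd (Letter (Hgen a)) (Letter (Fgen j))) + free_scale (\<alpha> j a) (mon (Letter (Fgen j))) | a j. j < n} \<union>
  {mon (MProd (Letter (Hgen a)) (Letter (Hgen b))) | a b. True}"
  by (simp only: chevalley_relations_def free_letter_def free_mult_mono Let_def)

lemma R0_Car: "R0 \<subseteq> Car"
proof -
  note cl = free.subspace_add[OF Car_sub] free.subspace_diff[OF Car_sub] free.subspace_scale[OF Car_sub] Car_mult
  have "lie_identities F \<subseteq> Car"
  proof
    fix v assume "v \<in> lie_identities F"
    then show "v \<in> Car"
    proof (cases rule: lie_identities_cases)
      case (1 p q x y)
      then have "x \<in> Car" "y \<in> Car" using Fpart_Car by blast+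
      then show ?thesis unfolding 1 by (intro cl)
    next
      case (2 p q r x y z)
      then have "x \<in> Car" "y \<in> Car" "z \<in> Car" using Fpart_Car by blast+
      then show ?thesis unfolding 2 by (intro cl)
    next
      case (3 x)
      then have "x \<in> Car" using Fpart_Car by blast
      then show ?thesis unfolding 3 by (intro cl)
    qed
  qed
  moreover have "chevalley_relations A scl hh \<alpha> \<subseteq> Car" unfolding chevalley_alt
    by (auto intro!: cl free.subspace_0[OF Car_sub] simp: mono_Car gens_def)
  ultimately show ?thesis by (simp add: R0_def)
qed

lemmas J = J_facts[OF R0_Car]

lemma J_sub: "free.subspace J" and J_Car: "J \<subseteq> Car" by (fact J)+

section \<open>The weight zero component modulo the Lie and Chevalley relations\<close>

abbreviation (input) "wtm \<equiv> magma_deg gen_weight"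
abbreviation (input) "ad m x \<equiv> free_mult (mon m) x"
abbreviation (input) "Cm m \<equiv> letters m \<subseteq> gens n"

lemma Car_induct:
  assumes "free.subspace T" "\<And>m. Cm m \<Longrightarrow> mon m \<in> T" "x \<in> Car"
  shows "x \<in> T"
proof -
  have "x = (\<Sum>m\<in>Poly_Mapping.keys x. free_scale (Poly_Mapping.lookup x m) (mon m))" by (rule free_expand) auto
  also have "\<dots> \<in> T" using assms(3) by (intro free.subspace_sum free.subspace_scale assms(1,2)) (auto simp: Car_def)
  finally show ?thesis .
qed

lemma mon_Fpart: "Cm m \<Longrightarrow> mon m \<in> Fpart (magma_deg (gen_parity par) m)"
  by (simp add: Fpart_def)

lemma anti_J:
  assumes "Cm a" "Cm b"
  obtains c where "ad a (mon b) + free_scale c (ad b (mon a)) \<in> J"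
  using lie_identities_mem(1)[OF mon_Fpart[OF assms(1)] mon_Fpart[OF assms(2)]] J(3) unfolding R0_def by blast

text \<open>Only spans modulo \<open>J\<close> matter from here on, so the Koszul sign is kept as an
  unnamed scalar. It depends on the parities of \<open>a\<close> and \<open>b\<close> alone; hence
  one \<open>c\<close> works for all monomials \<open>x\<close> and, by linearity, for all of
  \<open>Car\<close>.\<close>

lemma jac_J:
  assumes ab: "Cm a" "Cm b"
  obtains c where "\<And>x. x \<in> Car \<Longrightarrow> ad a (ad b x) - free_mult (ad a (mon b)) x - free_scale c (ad b (ad a x)) \<in> J"
proof -
  define c :: 'k where "c = koszul_sign (magma_deg (gen_parity par) a) (magma_deg (gen_parity par) b)"
  let ?f = "\<lambda>x. ad a (ad b x) - free_mult (ad a (mon b)) x - free_scale c (ad b (ad a x))"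
  have add: "?f (x + y) = ?f x + ?f y" for x y by (simp add: free_mult_add_right free.scale_right_distrib)
  have sca: "?f (free_scale k x) = free_scale k (?f x)" for k x
    by (simp add: free_mult_scale_right free.scale_right_diff_distrib mult.commute)
  have "?f x \<in> J" if x: "x \<in> Car" for x
  proof -
    have "x \<in> {x. ?f x \<in> J}"
    proof (rule Car_induct[OF _ _ x])
      show "free.subspace {x. ?f x \<in> J}"
      proof (rule free.subspaceI)
        show "0 \<in> {x. ?f x \<in> J}" using free.subspace_0[OF J_sub] by simp
        fix x y k assume "x \<in> {x. ?f x \<in> J}"
        then have x: "?f x \<in> J" by simp
        show "free_scale k x \<in> {x. ?f x \<in> J}" using free.subspace_scale[OF J_sub x] by (simp only: mem_Collect_eq sca)
        assume "y \<in> {x. ?f x \<in> J}"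
        then have "?f y \<in> J" by simp
        then show "x + y \<in> {x. ?f x \<in> J}" using free.subspace_add[OF J_sub x] by (simp only: mem_Collect_eq add)
      qed
      fix m :: "'h generator magma" assume m: "Cm m"
      have "?f (mon m) \<in> R0" unfolding c_def R0_def
        using lie_identities_mem(2)[OF mon_Fpart[OF ab(1)] mon_Fpart[OF ab(2)] mon_Fpart[OF m]] by blast
      then show "mon m \<in> {x. ?f x \<in> J}" using J(3) by blast
    qed
    then show ?thesis by simp
  qed
  then show thesis using that by blast
qed

definition span_mod_J :: "('k, 'h generator) free_alg set \<Rightarrow> ('k, 'h generator) free_alg set"
  where "span_mod_J B = {x \<in> Car. \<exists>y\<in>free.span B. x - y \<in> J}"

lemma span_mod_J_mono: "B \<subseteq> B' \<Longrightarrow> span_mod_J B \<subseteq> span_mod_J B'"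
  unfolding span_mod_J_def using free.span_mono[of B B'] by blast

lemma span_mod_J_base: "x \<in> B \<Longrightarrow> x \<in> Car \<Longrightarrow> x \<in> span_mod_J B"
  unfolding span_mod_J_def by (intro CollectI conjI bexI[of _ x]) (auto intro: free.span_base simp: free.subspace_0[OF J_sub])

lemma span_mod_J_sub: "free.subspace (span_mod_J B)"
proof (rule free.subspaceI)
  show "0 \<in> span_mod_J B" unfolding span_mod_J_def
    by (intro CollectI conjI bexI[of _ 0]) (auto simp: free.subspace_0[OF J_sub] free.subspace_0[OF Car_sub] free.span_zero)
  fix x y c assume "x \<in> span_mod_J B"
  then obtain x' where x: "x \<in> Car" "x' \<in> free.span B" "x - x' \<in> J" unfolding span_mod_J_def by blast
  have "free_scale c x - free_scale c x' \<in> J" using free.subspace_scale[OF J_sub x(3), of c] by (simp add: free.scale_right_diff_distrib)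
  then show "free_scale c x \<in> span_mod_J B" unfolding span_mod_J_def using x free.span_scale free.subspace_scale[OF Car_sub] by blast
  assume "y \<in> span_mod_J B"
  then obtain y' where y: "y \<in> Car" "y' \<in> free.span B" "y - y' \<in> J" unfolding span_mod_J_def by blast
  have "(x + y) - (x' + y') \<in> J" using free.subspace_add[OF J_sub x(3) y(3)] by (simp add: algebra_simps)
  then show "x + y \<in> span_mod_J B" unfolding span_mod_J_def using x y free.span_add free.subspace_add[OF Car_sub] by blast
qed

lemma span_mod_J_J: "x \<in> J \<Longrightarrow> x \<in> span_mod_J B"
  unfolding span_mod_J_def using J_Car by (intro CollectI conjI bexI[of _ 0]) (auto simp: free.span_zero)

lemma span_mod_J_cong:
  assumes "x - y \<in> J" "y \<in> span_mod_J B"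
  shows "x \<in> span_mod_J B"
  using free.subspace_add[OF span_mod_J_sub span_mod_J_J[OF assms(1)] assms(2)] by simp

lemma span_mod_J_map:
  assumes f: "\<And>x y. f (x + y) = f x + f y" "\<And>c x. f (free_scale c x) = free_scale c (f x)"
    and J: "\<And>x. x \<in> J \<Longrightarrow> f x \<in> J" and B: "\<And>x. x \<in> B \<Longrightarrow> f x \<in> span_mod_J B'" and x: "x \<in> span_mod_J B"
  shows "f x \<in> span_mod_J B'"
proof -
  obtain y where y: "y \<in> free.span B" "x - y \<in> J" using x unfolding span_mod_J_def by blast
  have f0: "f 0 = 0" using f(1)[of 0 0] by simp
  have "free.span B \<subseteq> {y. f y \<in> span_mod_J B'}"
  proof (rule free.span_minimal)
    show "B \<subseteq> {y. f y \<in> span_mod_J B'}" using B by blast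
    show "free.subspace {y. f y \<in> span_mod_J B'}"
      by (rule free.subspaceI) (simp_all add: f f0 free.subspace_0[OF span_mod_J_sub] free.subspace_add[OF span_mod_J_sub] free.subspace_scale[OF span_mod_J_sub])
  qed
  then have fy: "f y \<in> span_mod_J B'" using y by blast
  have "f x = f (x - y) + f y" using f(1)[of "x - y" y] by simp
  then show ?thesis using span_mod_J_cong[of "f x" "f y"] fy J[OF y(2)] by simp
qed

lemma span_mod_J_ad:
  assumes "Cm a" "\<And>x. x \<in> B \<Longrightarrow> ad a x \<in> span_mod_J B'" "x \<in> span_mod_J B"
  shows "ad a x \<in> span_mod_J B'"
  using assms by (intro span_mod_J_map[of "free_mult (mon a)" B B' x]) (auto simp: free_mult_add_right free_mult_scale_right J(4) mono_Car)

lemma span_mod_J_rm: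
  assumes "Cm a" "\<And>x. x \<in> B \<Longrightarrow> free_mult x (mon a) \<in> span_mod_J B'" "x \<in> span_mod_J B"
  shows "free_mult x (mon a) \<in> span_mod_J B'"
  using assms by (intro span_mod_J_map[of "\<lambda>x. free_mult x (mon a)" B B' x]) (auto simp: free_mult_add_left free_mult_scale_left J(5) mono_Car)

lemma span_mod_J_anti:
  assumes "Cm a" "Cm b" "ad b (mon a) \<in> span_mod_J B"
  shows "ad a (mon b) \<in> span_mod_J B"
proof -
  obtain c where c: "ad a (mon b) + free_scale c (ad b (mon a)) \<in> J" using anti_J[OF assms(1,2)] by blast
  have "free_scale (- c) (ad b (mon a)) \<in> span_mod_J B" by (rule free.subspace_scale[OF span_mod_J_sub assms(3)])
  then show ?thesis using c by - (rule span_mod_J_cong[of "ad a (mon b)" "free_scale (- c) (ad b (mon a))"], simp_all)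
qed

text \<open>Jacobi as a rule for moving the action of \<open>a\<close> past that of
  \<open>b\<close>, at the price of the action of their bracket.\<close>

lemma span_mod_J_jac1:
  assumes "Cm a" "Cm b" "x \<in> Car" "free_mult (ad a (mon b)) x \<in> span_mod_J B" "ad b (ad a x) \<in> span_mod_J B"
  shows "ad a (ad b x) \<in> span_mod_J B"
proof -
  obtain c where c: "ad a (ad b x) - free_mult (ad a (mon b)) x - free_scale c (ad b (ad a x)) \<in> J"
    using jac_J[OF assms(1,2)] assms(3) by metis
  have "free_mult (ad a (mon b)) x + free_scale c (ad b (ad a x)) \<in> span_mod_J B"
    by (intro free.subspace_add[OF span_mod_J_sub] free.subspace_scale[OF span_mod_J_sub] assms)
  moreover have "ad a (ad b x) - (free_mult (ad a (mon b)) x + free_scale c (ad b (ad a x))) \<in> J"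
    using c by (simp only: diff_diff_eq)
  ultimately show ?thesis by (rule span_mod_J_cong[rotated])
qed

text \<open>Jacobi read in the other direction: a product acts as a combination of iterated actions.
  This reduces the action of an arbitrary monomial to that of letters.\<close>

lemma span_mod_J_jac2:
  assumes "Cm a" "Cm b" "x \<in> Car" "ad a (ad b x) \<in> span_mod_J B" "ad b (ad a x) \<in> span_mod_J B"
  shows "ad (MProd a b) x \<in> span_mod_J B"
proof -
  obtain c where c: "ad a (ad b x) - free_mult (ad a (mon b)) x - free_scale c (ad b (ad a x)) \<in> J"
    using jac_J[OF assms(1,2)] assms(3) by metis
  have "ad a (ad b x) - free_scale c (ad b (ad a x)) \<in> span_mod_J B"
    by (intro free.subspace_diff[OF span_mod_J_sub] free.subspace_scale[OF span_mod_J_sub] assms)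
  moreover have "free_mult (ad a (mon b)) x - (ad a (ad b x) - free_scale c (ad b (ad a x))) \<in> J"
  proof -
    have "v - (u - w) = - (u - v - w)" for u v w :: "('k, 'h generator) free_alg" by simp
    then show ?thesis using free.subspace_neg[OF J_sub c] by metis
  qed
  ultimately have "free_mult (ad a (mon b)) x \<in> span_mod_J B" by (rule span_mod_J_cong[rotated])
  then show ?thesis by (simp only: free_mult_mono)
qed

definition Xg :: "bool \<Rightarrow> nat \<Rightarrow> 'h generator" where "Xg s i = (if s then Egen i else Fgen i)"
definition pure :: "bool \<Rightarrow> 'h generator magma \<Rightarrow> bool" where "pure s m \<longleftrightarrow> letters m \<subseteq> Xg s ` {..<n}"
text \<open>\<open>True\<close> stands for the part generated by the \<open>e\<close>,
  \<open>False\<close> for the part generated by the \<open>f\<close>. Cartan letters belong to both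
  families, since a letter of the opposite sign turns a single letter into a Cartan element.\<close>

definition base :: "bool \<Rightarrow> (nat \<Rightarrow>\<^sub>0 int) \<Rightarrow> ('k, 'h generator) free_alg set"
  where "base s q = {mon m | m. (pure s m \<or> (\<exists>a. m = Letter (Hgen a))) \<and> wtm m = q}"

lemma pure_Cm: "pure s m \<Longrightarrow> Cm m"
  unfolding pure_def gens_def Xg_def by (cases s) auto
lemma H_Cm: "Cm (Letter (Hgen a))" by (simp add: gens_def)
lemma X_Cm: "i < n \<Longrightarrow> Cm (Letter (Xg s i))" by (simp add: gens_def Xg_def)
lemma pure_MProd: "pure s (MProd a b) \<longleftrightarrow> pure s a \<and> pure s b" by (auto simp: pure_def)

lemma R0_J: "x \<in> chevalley_relations A scl hh \<alpha> \<Longrightarrow> x \<in> J"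
  using J(3) by (auto simp: R0_def)

lemma rel_HX: "i < n \<Longrightarrow> ad (Letter (Hgen a)) (mon (Letter (Xg s i))) \<in> span_mod_J {mon (Letter (Xg s i))}"
proof -
  assume i: "i < n"
  have *: "mon (Letter (Xg s i)) \<in> span_mod_J {mon (Letter (Xg s i))}" using X_Cm[OF i] by (intro span_mod_J_base) (auto simp: mono_Car)
  show ?thesis
  proof (cases s)
    case True
    have "mon (MProd (Letter (Hgen a)) (Letter (Egen i))) - free_scale (\<alpha> i a) (mon (Letter (Egen i))) \<in> J"
      by (rule R0_J) (use i in \<open>unfold chevalley_alt, blast\<close>)
    then show ?thesis using * True
      by - (rule span_mod_J_cong[of _ "free_scale (\<alpha> i a) (mon (Letter (Xg s i)))"],
        simp_all add: free_mult_mono Xg_def free.subspace_scale[OF span_mod_J_sub] free.subspace_neg[OF span_mod_J_sub])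
  next
    case False
    have "mon (MProd (Letter (Hgen a)) (Letter (Fgen i))) + free_scale (\<alpha> i a) (mon (Letter (Fgen i))) \<in> J"
      by (rule R0_J) (use i in \<open>unfold chevalley_alt, blast\<close>)
    then show ?thesis using * False
      by - (rule span_mod_J_cong[of _ "free_scale (- \<alpha> i a) (mon (Letter (Xg s i)))"],
        simp_all add: free_mult_mono Xg_def free.subspace_scale[OF span_mod_J_sub] free.subspace_neg[OF span_mod_J_sub])
  qed
qed

text \<open>A Cartan letter acts modulo \<open>J\<close> as a derivation and scales every letter, so
  a monomial in letters of one sign is a weight vector. Only the line is recorded, not the
  eigenvalue.\<close>

lemma pure_H: "pure s m \<Longrightarrow> ad (Letter (Hgen h)) (mon m) \<in> span_mod_J {mon m}"
proof (induction m)
  case (Letter x)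
  then obtain i where "i < n" "x = Xg s i" by (auto simp: pure_def)
  then show ?case using rel_HX by simp
next
  case (MProd a b)
  then have p: "pure s a" "pure s b" by (auto simp: pure_MProd)
  have ab: "mon (MProd a b) \<in> span_mod_J {mon (MProd a b)}" using pure_Cm[OF MProd.prems] by (intro span_mod_J_base) (auto simp: mono_Car)
  have "free_mult (ad (Letter (Hgen h)) (mon a)) (mon b) \<in> span_mod_J {mon (MProd a b)}"
    using p MProd.IH(1) ab by - (rule span_mod_J_rm[where B = "{mon a}"], auto simp: pure_Cm free_mult_mono)
  moreover have "ad a (ad (Letter (Hgen h)) (mon b)) \<in> span_mod_J {mon (MProd a b)}"
    using p MProd.IH(2) ab by - (rule span_mod_J_ad[where B = "{mon b}"], auto simp: pure_Cm free_mult_mono)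
  ultimately have "ad (Letter (Hgen h)) (ad a (mon b)) \<in> span_mod_J {mon (MProd a b)}"
    using p H_Cm by - (rule span_mod_J_jac1, simp_all add: pure_Cm mono_Car)
  then show ?case by (simp add: free_mult_mono)
qed

lemma pure_base: "pure s m \<Longrightarrow> q = wtm m \<Longrightarrow> mon m \<in> span_mod_J (base s q)"
  using pure_Cm[of s m] by (intro span_mod_J_base) (auto simp: base_def mono_Car)

lemma pure_H_base: "pure s m \<Longrightarrow> q = wtm m \<Longrightarrow> ad (Letter (Hgen h)) (mon m) \<in> span_mod_J (base s q)"
  using pure_H[of s m h] span_mod_J_mono[of "{mon m}" "base s q"] by (auto simp: base_def)

lemma pure_on_base:
  assumes "pure s a" "x \<in> span_mod_J (base s q)"
  shows "ad a x \<in> span_mod_J (base s (q + wtm a))"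
proof (rule span_mod_J_ad[OF pure_Cm[OF assms(1)] _ assms(2)])
  fix x assume "x \<in> base s q"
  then obtain m where m: "x = mon m" "wtm m = q" "pure s m \<or> (\<exists>h. m = Letter (Hgen h))" by (auto simp: base_def)
  from m(3) show "ad a x \<in> span_mod_J (base s (q + wtm a))"
  proof
    assume "pure s m"
    then have "pure s (MProd a m)" using assms by (simp add: pure_MProd)
    then show ?thesis unfolding m(1) free_mult_mono by (rule pure_base) (simp add: m(2) add.commute)
  next
    assume "\<exists>h. m = Letter (Hgen h)"
    then obtain h where h: "m = Letter (Hgen h)" by blast
    then have q: "q = 0" using m by simp
    show ?thesis unfolding m(1) h
      by (rule span_mod_J_anti[OF pure_Cm[OF assms(1)] H_Cm]) (rule pure_H_base[OF assms(1)], simp add: q)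
  qed
qed

lemma base_on_pure:
  assumes "pure s b" "x \<in> span_mod_J (base s q)"
  shows "free_mult x (mon b) \<in> span_mod_J (base s (q + wtm b))"
proof (rule span_mod_J_rm[OF pure_Cm[OF assms(1)] _ assms(2)])
  fix x assume "x \<in> base s q"
  then obtain m where m: "x = mon m" "wtm m = q" "pure s m \<or> (\<exists>h. m = Letter (Hgen h))" by (auto simp: base_def)
  from m(3) show "free_mult x (mon b) \<in> span_mod_J (base s (q + wtm b))"
  proof
    assume "pure s m"
    then have "pure s (MProd m b)" using assms by (simp add: pure_MProd)
    then show ?thesis unfolding m(1) free_mult_mono by (rule pure_base) (simp add: m(2))
  next
    assume "\<exists>h. m = Letter (Hgen h)"
    then obtain h where h: "m = Letter (Hgen h)" by blast
    then have q: "q = 0" using m by simp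
    show ?thesis unfolding m(1) h by (rule pure_H_base[OF assms(1)]) (simp add: q)
  qed
qed

lemma rel_EF:
  assumes "i < n" "j < n"
  shows "ad (Letter (Egen i)) (mon (Letter (Fgen j))) \<in> span_mod_J (base s (gen_weight (Egen i) + gen_weight (Fgen j)))"
proof -
  have r: "mon (MProd (Letter (Egen i)) (Letter (Fgen j))) - (if i = j then mon (Letter (Hgen (hh i))) else 0) \<in> J"
    by (rule R0_J) (use assms in \<open>unfold chevalley_alt, blast\<close>)
  show ?thesis
  proof (cases "i = j")
    case True
    have "mon (Letter (Hgen (hh i))) \<in> span_mod_J (base s 0)" using H_Cm by (intro span_mod_J_base) (auto simp: base_def mono_Car)
    then show ?thesis using r True by - (rule span_mod_J_cong[of _ "mon (Letter (Hgen (hh i)))"], simp_all add: free_mult_mono)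
  next
    case False
    then show ?thesis using r by (intro span_mod_J_J) (simp add: free_mult_mono)
  qed
qed

text \<open>A letter of the opposite sign acts as a derivation modulo \<open>J\<close>. On a single
  letter it gives a Cartan element or zero, and the neighbouring pure factors absorb this by
  \<open>pure_on_base\<close> and \<open>base_on_pure\<close>; so no mixed monomials arise. This is
  the heart of the triangular decomposition.\<close>

lemma letter_on_pure:
  assumes "j < n"
  shows "pure s m \<Longrightarrow> ad (Letter (Xg (\<not> s) j)) (mon m) \<in> span_mod_J (base s (wtm m + gen_weight (Xg (\<not> s) j)))"
proof (induction m)
  case (Letter x)
  then obtain i where i: "i < n" "x = Xg s i" by (auto simp: pure_def)
  show ?case
  proof (cases s)
    case True
    then show ?thesis using i assms X_Cm[of i True] X_Cm[of j False] rel_EF[of i j s]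
      by - (simp only:, rule span_mod_J_anti, simp_all add: Xg_def)
  next
    case False
    then show ?thesis using i assms rel_EF[of j i s] by (simp add: Xg_def add.commute)
  qed
next
  case (MProd a b)
  then have p: "pure s a" "pure s b" by (auto simp: pure_MProd)
  let ?x = "Letter (Xg (\<not> s) j)" and ?w = "gen_weight (Xg (\<not> s) j)"
  have e: "wtm (MProd a b) + ?w = (wtm a + ?w) + wtm b" "wtm (MProd a b) + ?w = (wtm b + ?w) + wtm a"
    by (simp_all add: algebra_simps)
  have "free_mult (ad ?x (mon a)) (mon b) \<in> span_mod_J (base s (wtm (MProd a b) + ?w))"
    unfolding e(1) by (rule base_on_pure[OF p(2) MProd.IH(1)[OF p(1)]])
  moreover have "ad a (ad ?x (mon b)) \<in> span_mod_J (base s (wtm (MProd a b) + ?w))"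
    unfolding e(2) by (rule pure_on_base[OF p(1) MProd.IH(2)[OF p(2)]])
  ultimately have "ad ?x (ad a (mon b)) \<in> span_mod_J (base s (wtm (MProd a b) + ?w))"
    using p X_Cm[OF assms] by - (rule span_mod_J_jac1, simp_all add: pure_Cm mono_Car)
  then show ?case by (simp only: free_mult_mono)
qed

definition TT :: "(nat \<Rightarrow>\<^sub>0 int) \<Rightarrow> ('k, 'h generator) free_alg set"
  where "TT q = span_mod_J (base True q \<union> base False q)"

lemma base_TT: "span_mod_J (base s q) \<subseteq> TT q"
  unfolding TT_def by (rule span_mod_J_mono) (cases s, auto)

lemma TT_ad:
  assumes "Cm a" "\<And>s m. pure s m \<Longrightarrow> wtm m = q \<Longrightarrow> ad a (mon m) \<in> TT q'"
    "\<And>h. q = 0 \<Longrightarrow> ad a (mon (Letter (Hgen h))) \<in> TT q'" "x \<in> TT q"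
  shows "ad a x \<in> TT q'"
  unfolding TT_def
proof (rule span_mod_J_ad[OF assms(1) _ assms(4)[unfolded TT_def]])
  fix x assume "x \<in> base True q \<union> base False q"
  then obtain m s where "x = mon m" "wtm m = q" "pure s m \<or> (\<exists>h. m = Letter (Hgen h))" by (auto simp: base_def)
  then show "ad a x \<in> span_mod_J (base True q' \<union> base False q')" using assms(2,3) unfolding TT_def by force
qed

text \<open>Letters of the same sign lengthen a pure monomial, letters of the opposite sign are
  treated by \<open>letter_on_pure\<close>, and Cartan letters scale. The rule
  \<open>span_mod_J_jac2\<close> passes from letters to monomials.\<close>

lemma ad_TT: "Cm m \<Longrightarrow> x \<in> TT q \<Longrightarrow> ad m x \<in> TT (q + wtm m)"
proof (induction m arbitrary: q x)
  case (Letter g)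
  then consider h where "g = Hgen h" | s i where "i < n" "g = Xg s i"
    by (auto simp: gens_def Xg_def split: if_splits) (metis (full_types))+
  then show ?case
  proof cases
    case 1
    show ?thesis
    proof (rule TT_ad[OF Letter.prems(1) _ _ Letter.prems(2)])
      fix s m assume "pure s m" "wtm m = q"
      then show "ad (Letter g) (mon m) \<in> TT (q + wtm (Letter g))"
        using pure_H_base[of s m q h] base_TT[of s q] unfolding 1 by auto
    next
      fix h'
      have "mon (MProd (Letter (Hgen h)) (Letter (Hgen h'))) \<in> J"
        by (rule R0_J) (unfold chevalley_alt, blast)
      then show "ad (Letter g) (mon (Letter (Hgen h'))) \<in> TT (q + wtm (Letter g))"
        unfolding 1 TT_def by (intro span_mod_J_J) (simp add: free_mult_mono)
    qed
  next
    case (2 s i)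
    have pg: "pure s (Letter g)" using 2 by (simp add: pure_def)
    show ?thesis
    proof (rule TT_ad[OF Letter.prems(1) _ _ Letter.prems(2)])
      fix s' m assume m: "pure s' m" "wtm m = q"
      show "ad (Letter g) (mon m) \<in> TT (q + wtm (Letter g))"
      proof (cases "s' = s")
        case True
        then show ?thesis using pure_on_base[OF pg pure_base[of s m q]] m base_TT by blast
      next
        case False
        then have "s = (\<not> s')" by auto
        then show ?thesis using letter_on_pure[OF 2(1) m(1)] m base_TT 2(2) by auto
      qed
    next
      fix h assume q: "q = 0"
      have "mon (Letter (Hgen h)) \<in> span_mod_J (base s q)" using H_Cm q by (intro span_mod_J_base) (auto simp: base_def mono_Car)
      then show "ad (Letter g) (mon (Letter (Hgen h))) \<in> TT (q + wtm (Letter g))"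
        using pure_on_base[OF pg] base_TT by blast
    qed
  qed
next
  case (MProd a b)
  then have ab: "Cm a" "Cm b" by auto
  have "x \<in> Car" using MProd.prems(2) unfolding TT_def span_mod_J_def by blast
  moreover have "ad a (ad b x) \<in> TT (q + wtm (MProd a b))" "ad b (ad a x) \<in> TT (q + wtm (MProd a b))"
    using MProd.IH(1)[OF ab(1) MProd.IH(2)[OF ab(2) MProd.prems(2)]] MProd.IH(2)[OF ab(2) MProd.IH(1)[OF ab(1) MProd.prems(2)]]
    by (simp_all add: algebra_simps)
  ultimately show ?case using span_mod_J_jac2[OF ab] unfolding TT_def by blast
qed

lemma mon_TT: "Cm m \<Longrightarrow> mon m \<in> TT (wtm m)"
proof (induction m)
  case (Letter g)
  then consider h where "g = Hgen h" | s i where "i < n" "g = Xg s i"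
    by (auto simp: gens_def Xg_def split: if_splits) (metis (full_types))+
  then show ?case
  proof cases
    case 1
    then have "mon (Letter g) \<in> span_mod_J (base True (wtm (Letter g)))" using H_Cm by (intro span_mod_J_base) (auto simp: base_def mono_Car)
    then show ?thesis using base_TT by blast
  next
    case (2 s i)
    then have "pure s (Letter g)" by (simp add: pure_def)
    then show ?thesis using pure_base[of s] base_TT by blast
  qed
next
  case (MProd a b)
  then have "ad a (mon b) \<in> TT (wtm b + wtm a)" by (intro ad_TT) auto
  then show ?case by (simp add: free_mult_mono add.commute)
qed

text \<open>All letters contribute to the weight with the same sign, so nothing cancels. This
  excludes pure monomials from weight zero.\<close>

lemma pure_weight: "pure s m \<Longrightarrow> (\<forall>i. (if s then 1 else - 1) * Poly_Mapping.lookup (wtm m) i \<ge> 0) \<and>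
   (\<exists>i. (if s then 1 else - 1) * Poly_Mapping.lookup (wtm m) i > 0)"
proof (induction m)
  case (Letter x)
  then obtain i where i: "x = Xg s i" by (auto simp: pure_def)
  have "\<exists>i'. (0::int) < (1 when i = i')" by (rule exI[of _ i]) simp
  then show ?case unfolding i by (cases s) (auto simp: Xg_def lookup_single when_def)
next
  case (MProd a b)
  then have "pure s a" "pure s b" by (auto simp: pure_MProd)
  note IH = MProd.IH(1)[OF this(1)] MProd.IH(2)[OF this(2)]
  then obtain i where i: "(if s then 1 else - 1) * Poly_Mapping.lookup (wtm a) i > 0" by blast
  show ?case
  proof (intro conjI allI exI[of _ i])
    show "0 \<le> (if s then 1 else - 1) * Poly_Mapping.lookup (wtm (MProd a b)) k" for k
      using IH by (simp add: lookup_add distrib_left add_nonneg_nonneg)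
    show "0 < (if s then 1 else - 1) * Poly_Mapping.lookup (wtm (MProd a b)) i"
      using i IH by (simp add: lookup_add distrib_left add_pos_nonneg)
  qed
qed

text \<open>By \<open>mon_TT\<close> the element is, modulo \<open>J\<close>, a combination of base
  monomials of weight zero, and \<open>pure_weight\<close> leaves only Cartan letters among them.
  The linearity relations merge these into a single one.\<close>

lemma weight_zero:
  assumes "x \<in> HM 0"
  shows "\<exists>a. x - mon (Letter (Hgen a)) \<in> J"
proof -
  have xC: "x \<in> Car" "\<And>m. m \<in> Poly_Mapping.keys x \<Longrightarrow> wtm m = 0" using assms unfolding HM_def by auto
  have "x = (\<Sum>m\<in>Poly_Mapping.keys x. free_scale (Poly_Mapping.lookup x m) (mon m))" by (rule free_expand) auto
  also have "\<dots> \<in> TT 0" unfolding TT_def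
  proof (intro free.subspace_sum free.subspace_scale span_mod_J_sub)
    fix m assume m: "m \<in> Poly_Mapping.keys x"
    then have "Cm m" using xC(1) by (auto simp: Car_def)
    then show "mon m \<in> span_mod_J (base True 0 \<union> base False 0)" using mon_TT[of m] xC(2)[OF m] by (simp add: TT_def)
  qed
  finally obtain y where y: "y \<in> free.span (base True 0 \<union> base False 0)" "x - y \<in> J" unfolding TT_def span_mod_J_def by blast
  let ?H = "{y. \<exists>a. y - mon (Letter (Hgen a)) \<in> J}"
  have "free.span (base True 0 \<union> base False 0) \<subseteq> ?H"
  proof (rule free.span_minimal)
    show "base True 0 \<union> base False 0 \<subseteq> ?H"
    proof
      fix z assume "z \<in> base True 0 \<union> base False 0"
      then obtain m s where m: "z = mon m" "wtm m = 0" "pure s m \<or> (\<exists>h. m = Letter (Hgen h))" by (auto simp: base_def)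
      then have "\<exists>h. m = Letter (Hgen h)" using pure_weight[of s m] by (auto split: if_splits)
      then obtain h where "z = mon (Letter (Hgen h))" using m by blast
      then have "z - mon (Letter (Hgen h)) \<in> J" using free.subspace_0[OF J_sub] by simp
      then show "z \<in> ?H" by blast
    qed
    have add: "mon (Letter (Hgen (a + b))) - mon (Letter (Hgen a)) - mon (Letter (Hgen b)) \<in> J" for a b
      by (rule R0_J) (unfold chevalley_alt, blast)
    have sca: "mon (Letter (Hgen (scl c a))) - free_scale c (mon (Letter (Hgen a))) \<in> J" for a c
      by (rule R0_J) (unfold chevalley_alt, blast)
    show "free.subspace ?H"
    proof (rule free.subspaceI)
      have "mon (Letter (Hgen 0)) \<in> J" using free.subspace_neg[OF J_sub add[of 0 0]] by simp
      then show "0 \<in> ?H" using free.subspace_neg[OF J_sub] by (auto intro!: exI[of _ 0])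
      fix u v c assume "u \<in> ?H"
      then obtain a where a: "u - mon (Letter (Hgen a)) \<in> J" by blast
      have "free_scale c (u - mon (Letter (Hgen a))) - (mon (Letter (Hgen (scl c a))) - free_scale c (mon (Letter (Hgen a)))) \<in> J"
        by (intro free.subspace_diff[OF J_sub] free.subspace_scale[OF J_sub] a sca)
      then show "free_scale c u \<in> ?H" by (auto simp: free.scale_right_diff_distrib)
      assume "v \<in> ?H"
      then obtain b where b: "v - mon (Letter (Hgen b)) \<in> J" by blast
      have "(u - mon (Letter (Hgen a))) + (v - mon (Letter (Hgen b))) - (mon (Letter (Hgen (a + b))) - mon (Letter (Hgen a)) - mon (Letter (Hgen b))) \<in> J"
        by (intro free.subspace_diff[OF J_sub] free.subspace_add[OF J_sub] a b add)
      moreover have "(u - mon (Letter (Hgen a))) + (v - mon (Letter (Hgen b))) - (mon (Letter (Hgen (a + b))) - mon (Letter (Hgen a)) - mon (Letter (Hgen b)))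
         = u + v - mon (Letter (Hgen (a + b)))" by simp
      ultimately show "u + v \<in> ?H" by auto
    qed
  qed
  then obtain a where "y - mon (Letter (Hgen a)) \<in> J" using y by blast
  then have "x - mon (Letter (Hgen a)) \<in> J" using free.subspace_add[OF J_sub y(2)] by fastforce
  then show ?thesis by blast
qed

lemma tilde_presentation:
  "presentation free_scale (tilde_algebra A par scl hh \<alpha>) free_mult Car J Fpart (tilde_class A par scl hh \<alpha>)"
proof -
  have "presentation free_scale (sa_quotient F (id ` J)) free_mult Car J Fpart (\<lambda>x. (id ` J) +>\<^bsub>F\<^esub> id x)"
    by (rule presentation.quotient[OF free_presentation J_Car J_sub _ J(4) J(5)]) (simp add: free.subspace_0[OF J_sub])
  moreover have "tilde_class A par scl hh \<alpha> = (\<lambda>x. J +>\<^bsub>F\<^esub> x)" by (simp add: fun_eq_iff tilde_class_def)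
  ultimately show ?thesis by (simp add: tilde_algebra_def)
qed

lemma H0_J: "mon (Letter (Hgen 0)) \<in> J"
proof -
  have "mon (Letter (Hgen (0 + 0))) - mon (Letter (Hgen 0)) - mon (Letter (Hgen 0)) \<in> J"
    by (rule R0_J) (unfold chevalley_alt, blast)
  then have "- mon (Letter (Hgen 0)) \<in> J" by simp
  then show ?thesis using free.subspace_neg[OF J_sub] by fastforce
qed

end

primrec generator_image :: "('h \<Rightarrow> 'c) \<Rightarrow> (nat \<Rightarrow> 'c) \<Rightarrow> (nat \<Rightarrow> 'c) \<Rightarrow> 'h generator \<Rightarrow> 'c"
  where "generator_image H E F (Hgen a) = H a"
  | "generator_image H E F (Egen i) = E i"
  | "generator_image H E F (Fgen i) = F i"

section \<open>Recognising contragredient superalgebras\<close>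

text \<open>The axioms make the kernel of evaluation the largest graded ideal that meets the Cartan
  space trivially: the relations place it above \<open>J\<close>, \<open>proj\<close> separates the
  spaces \<open>cc q\<close> so that it is graded, \<open>Hc_inj\<close> keeps the Cartan space out
  of it, and \<open>nondeg\<close> leaves no room for a larger ideal. The subspaces
  \<open>Cp\<close> and \<open>cc\<close> only have to receive the images of the generators, so the
  model may live in a type of pairs that is larger than their sum.\<close>

locale contragredient_model = chevalley_data scl A par hh \<alpha> + bilinear_mult sc br
  for scl :: "'k::field \<Rightarrow> 'h::ab_group_add \<Rightarrow> 'h" and A par hh \<alpha>
    and sc :: "'k \<Rightarrow> 'c::ab_group_add \<Rightarrow> 'c" and br +
  fixes Hc :: "'h \<Rightarrow> 'c" and Ec Fc :: "nat \<Rightarrow> 'c" and Cp :: "bit \<Rightarrow> 'c set"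
    and cc :: "(nat \<Rightarrow>\<^sub>0 int) \<Rightarrow> 'c set" and proj :: "(nat \<Rightarrow>\<^sub>0 int) \<Rightarrow> 'c \<Rightarrow> 'c"
  assumes Hc_add: "Hc (a + a') = Hc a + Hc a'" and Hc_scale: "Hc (scl c a) = sc c (Hc a)"
    and Hc_inj: "Hc a = 0 \<Longrightarrow> a = 0"
    and Cp_sub: "subspace (Cp p)" and Cp_br: "x \<in> Cp p \<Longrightarrow> y \<in> Cp p' \<Longrightarrow> br x y \<in> Cp (p + p')"
    and Cp_gen: "Hc a \<in> Cp 0" "i < dim_row A \<Longrightarrow> Ec i \<in> Cp (par i)" "i < dim_row A \<Longrightarrow> Fc i \<in> Cp (par i)"
    and C_anti: "x \<in> Cp p \<Longrightarrow> y \<in> Cp p' \<Longrightarrow> br x y + sc (koszul_sign p p') (br y x) = 0"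
    and C_jac: "x \<in> Cp p \<Longrightarrow> y \<in> Cp p' \<Longrightarrow> z \<in> Cp r \<Longrightarrow>
       br x (br y z) - br (br x y) z - sc (koszul_sign p p') (br y (br x z)) = 0"
    and C_cube: "x \<in> Cp 1 \<Longrightarrow> br x (br x x) = 0"
    and rel_EF: "i < dim_row A \<Longrightarrow> j < dim_row A \<Longrightarrow> br (Ec i) (Fc j) = (if i = j then Hc (hh i) else 0)"
    and rel_HE: "j < dim_row A \<Longrightarrow> br (Hc a) (Ec j) = sc (\<alpha> j a) (Ec j)"
    and rel_HF: "j < dim_row A \<Longrightarrow> br (Hc a) (Fc j) = - sc (\<alpha> j a) (Fc j)"
    and rel_HH: "br (Hc a) (Hc a') = 0"
    and cc_sub: "subspace (cc q)" and cc_br: "x \<in> cc q \<Longrightarrow> y \<in> cc q' \<Longrightarrow> br x y \<in> cc (q + q')"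
    and cc_gen: "Hc a \<in> cc 0" "i < dim_row A \<Longrightarrow> Ec i \<in> cc (Poly_Mapping.single i 1)"
      "i < dim_row A \<Longrightarrow> Fc i \<in> cc (- Poly_Mapping.single i 1)"
    and proj_add: "proj q (x + y) = proj q x + proj q y"
    and proj_cc: "x \<in> cc q \<Longrightarrow> proj q' x = (if q = q' then x else 0)"
    and nondeg: "q \<noteq> 0 \<Longrightarrow> v \<in> cc q \<Longrightarrow> v \<noteq> 0 \<Longrightarrow>
       \<exists>m. letters m \<subseteq> gens (dim_row A) \<and> magma_deg gen_weight m = - q \<and>
         br (magma_eval br (generator_image Hc Ec Fc) m) v \<noteq> 0"
begin

abbreviation "g \<equiv> generator_image Hc Ec Fc"
abbreviation "ev \<equiv> magma_eval br g"
definition lift :: "('k, 'h generator) free_alg \<Rightarrow> 'c" where "lift = free_lift sc br g"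

lemmas lift_simps = lift_add[of g, folded lift_def] lift_scale[of g, folded lift_def] lift_mono[of g, folded lift_def]
  lift_zero[of g, folded lift_def] lift_minus[of g, folded lift_def] lift_diff[of g, folded lift_def] lift_mult[of g, folded lift_def]

lemma ev_Cp: "letters m \<subseteq> gens n \<Longrightarrow> ev m \<in> Cp (magma_deg (gen_parity par) m)"
proof (induction m)
  case (Letter x)
  then show ?case by (auto simp: gens_def Cp_gen)
next
  case (MProd a b)
  then show ?case using Cp_br[of "ev a" _ "ev b"] by simp
qed

lemma ev_cc: "letters m \<subseteq> gens n \<Longrightarrow> ev m \<in> cc (magma_deg gen_weight m)"
  by (induction m) (auto simp: gens_def cc_gen cc_br)

lemma lift_Fpart: "p \<in> Fpart i \<Longrightarrow> lift p \<in> Cp i"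
  unfolding lift_def Fpart_def by (rule lift_in_subspace[OF Cp_sub]) (use ev_Cp in auto)

lemma lift_HM: "p \<in> HM q \<Longrightarrow> lift p \<in> cc q"
  unfolding lift_def HM_alt by (rule lift_in_subspace[OF cc_sub]) (use ev_cc in auto)

definition K :: "('k, 'h generator) free_alg set" where "K = {p \<in> Car. lift p = 0}"

lemma K_sub: "free.subspace K"
  by (rule free.subspaceI) (auto simp: K_def lift_simps free.subspace_add[OF Car_sub] free.subspace_scale[OF Car_sub] free.subspace_0[OF Car_sub])

lemma K_Car: "K \<subseteq> Car" unfolding K_def by blast

lemma K_ideal: "x \<in> Car \<Longrightarrow> y \<in> K \<Longrightarrow> free_mult x y \<in> K" "x \<in> Car \<Longrightarrow> y \<in> K \<Longrightarrow> free_mult y x \<in> K"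
  by (auto simp: K_def Car_mult lift_simps)

lemma R0_K: "R0 \<subseteq> K"
proof
  fix v assume v: "v \<in> R0"
  have "lift v = 0"
  proof (cases "v \<in> lie_identities F")
    case True
    then show ?thesis
    proof (cases rule: lie_identities_cases)
      case (1 p q x y)
      then show ?thesis using C_anti[OF lift_Fpart lift_Fpart] by (simp add: lift_simps)
    next
      case (2 p q r x y z)
      then show ?thesis using C_jac[OF lift_Fpart lift_Fpart lift_Fpart] by (simp only: lift_simps)
    next
      case (3 x)
      then show ?thesis using C_cube[OF lift_Fpart] by (simp add: lift_simps)
    qed
  next
    case False
    then have "v \<in> chevalley_relations A scl hh \<alpha>" using v by (simp add: R0_def)
    then show ?thesis unfolding chevalley_alt
      by (auto simp: lift_simps Hc_add Hc_scale rel_EF rel_HE rel_HF rel_HH)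
  qed
  then show "v \<in> K" using v R0_Car unfolding K_def by blast
qed

lemma J_K: "J \<subseteq> K"
  by (rule J_least[OF K_sub K_Car R0_K K_ideal])

abbreviation "TA \<equiv> tilde_algebra A par scl hh \<alpha>"
abbreviation "tc \<equiv> tilde_class A par scl hh \<alpha>"

interpretation TP: presentation free_scale TA free_mult Car J Fpart tc
  by (rule tilde_presentation)

definition part_of :: "(nat \<Rightarrow>\<^sub>0 int) \<Rightarrow> ('k, 'h generator) free_alg \<Rightarrow> ('k, 'h generator) free_alg"
  where "part_of q p = (\<Sum>m | m \<in> Poly_Mapping.keys p \<and> magma_deg gen_weight m = q. free_scale (Poly_Mapping.lookup p m) (mon m))"

lemma part_of_HM: "p \<in> Car \<Longrightarrow> part_of q p \<in> HM q"
  unfolding part_of_def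
  by (intro free.subspace_sum[OF HM_sub] free.subspace_scale[OF HM_sub]) (auto simp: HM_alt Car_def)

lemma sum_part_of: "p = (\<Sum>q\<in>magma_deg gen_weight ` Poly_Mapping.keys p. part_of q p)"
proof -
  have "p = (\<Sum>m\<in>Poly_Mapping.keys p. free_scale (Poly_Mapping.lookup p m) (mon m))" by (rule free_expand) auto
  also have "\<dots> = (\<Sum>q\<in>magma_deg gen_weight ` Poly_Mapping.keys p. part_of q p)"
    unfolding part_of_def by (rule sum.image_gen) simp
  finally show ?thesis .
qed

lemma proj_sum: "proj q (\<Sum>i\<in>I. f i) = (\<Sum>i\<in>I. proj q (f i))"
proof -
  have "proj q 0 = 0" using proj_add[of q 0 0] by simp
  then show ?thesis by (induction I rule: infinite_finite_induct) (auto simp: proj_add)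
qed

text \<open>Evaluation respects weights, and \<open>proj q\<close> picks the summand of weight
  \<open>q\<close> out of a sum of homogeneous elements. Applied to \<open>lift p = 0\<close> it
  shows that every homogeneous part of \<open>p\<close> evaluates to zero.\<close>

lemma part_of_K:
  assumes p: "p \<in> K"
  shows "part_of q p \<in> K"
proof -
  let ?Q = "magma_deg gen_weight ` Poly_Mapping.keys p"
  have pc: "p \<in> Car" using p K_Car by blast
  have "lift p = (\<Sum>r\<in>?Q. lift (part_of r p))"
    by (subst sum_part_of) (simp add: lift_def lift_sum)
  then have "0 = proj q (\<Sum>r\<in>?Q. lift (part_of r p))" using p proj_sum[of q "\<lambda>_. 0" "{}"] by (simp add: K_def)
  also have "\<dots> = (\<Sum>r\<in>?Q. if r = q then lift (part_of r p) else 0)"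
    unfolding proj_sum by (intro sum.cong refl proj_cc lift_HM part_of_HM pc)
  also have "\<dots> = lift (part_of q p)"
  proof (cases "q \<in> ?Q")
    case False
    then have "part_of q p = 0" unfolding part_of_def by (intro sum.neutral) auto
    then show ?thesis using False by (simp add: lift_simps)
  qed simp
  finally show ?thesis using part_of_HM[OF pc, of q] by (simp add: K_def HM_def)
qed

lemma tilde_component_eq: "tilde_component A par scl hh \<alpha> q = tc ` HM q"
  by (simp add: tilde_component_def HM_def F_ops)

lemma tc_H: "tc (free_letter (Hgen a)) \<in> tc ` K \<longleftrightarrow> a = 0"
proof
  assume "tc (free_letter (Hgen a)) \<in> tc ` K"
  then obtain p where "p \<in> K" "tc (free_letter (Hgen a)) = tc p" by blast
  then have "free_letter (Hgen a) - p \<in> J" "p \<in> K" using TP.\<pi>_eq[of "free_letter (Hgen a)" p] K_Car by auto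
  then have "lift (free_letter (Hgen a)) = 0" using J_K by (force simp: K_def lift_simps)
  then show "a = 0" using Hc_inj by (simp add: free_letter_def lift_simps)
next
  assume "a = 0"
  then have "free_letter (Hgen a) \<in> K" using H0_J J_K by (auto simp: free_letter_def)
  then show "tc (free_letter (Hgen a)) \<in> tc ` K" by blast
qed

lemma tc_H0: "tc (free_letter (Hgen 0)) = \<zero>\<^bsub>TA\<^esub>"
  using TP.zero_iff[of "free_letter (Hgen 0)"] H0_J by (simp add: free_letter_def mono_Car gens_def)

lemma graded_K: "graded_ideal A par scl hh \<alpha> (tc ` K)"
  unfolding graded_ideal_def
proof
  show "sa_ideal TA (tc ` K)" by (rule TP.sa_ideal_iff[OF K_Car K_sub K_ideal])
  have "(\<Union>q. tc ` K \<inter> tilde_component A par scl hh \<alpha> q) = tc ` (\<Union>q. K \<inter> HM q)"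
  proof (intro equalityI subsetI)
    fix v assume "v \<in> (\<Union>q. tc ` K \<inter> tilde_component A par scl hh \<alpha> q)"
    then obtain q p p' where p: "p \<in> K" "v = tc p" "p' \<in> HM q" "v = tc p'" unfolding tilde_component_eq by blast
    have c: "p \<in> Car" "p' \<in> Car" using p K_Car by (auto simp: HM_def)
    then have "p' - p \<in> K" using TP.\<pi>_eq[of p' p] p J_K by auto
    then have "p' \<in> K" using free.subspace_add[OF K_sub _ p(1), of "p' - p"] by simp
    then show "v \<in> tc ` (\<Union>q. K \<inter> HM q)" using p by blast
  qed (unfold tilde_component_eq, blast)
  moreover have KC: "(\<Union>q. K \<inter> HM q) \<subseteq> Car" using K_Car by blast
  ultimately have "LinearCombinations.module.span class_ring TA (\<Union>q. tc ` K \<inter> tilde_component A par scl hh \<alpha> q) = tc ` free.span (\<Union>q. K \<inter> HM q)"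
    using TP.record_span[OF KC] by simp
  moreover have "free.span (\<Union>q. K \<inter> HM q) = K"
  proof
    show "free.span (\<Union>q. K \<inter> HM q) \<subseteq> K" by (rule free.span_minimal[OF _ K_sub]) blast
    show "K \<subseteq> free.span (\<Union>q. K \<inter> HM q)"
    proof
      fix p assume p: "p \<in> K"
      then have "part_of q p \<in> (\<Union>q. K \<inter> HM q)" for q using part_of_K[OF p] part_of_HM[of p q] K_Car by blast
      then have "(\<Sum>q\<in>magma_deg gen_weight ` Poly_Mapping.keys p. part_of q p) \<in> free.span (\<Union>q. K \<inter> HM q)"
        by (intro free.span_sum free.span_base)
      then show "p \<in> free.span (\<Union>q. K \<inter> HM q)" by (subst sum_part_of)
    qed
  qed
  ultimately show "tc ` K = LinearCombinations.module.span class_ring TA (\<Union>q. tc ` K \<inter> tilde_component A par scl hh \<alpha> q)" by simp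
qed

text \<open>In weight zero \<open>p\<close> agrees modulo \<open>J\<close> with a Cartan letter,
  which then lies in \<open>I\<close> and must vanish. In any other weight, if \<open>lift p\<close>
  were nonzero, \<open>nondeg\<close> would move \<open>p\<close> inside \<open>I\<close> to weight
  zero without making its evaluation zero, against the first case.\<close>

lemma homogeneous_in_K:
  assumes I: "sa_ideal TA I" "I \<inter> range (\<lambda>a. tc (free_letter (Hgen a))) \<subseteq> {\<zero>\<^bsub>TA\<^esub>}"
    and p: "p \<in> HM q" "tc p \<in> I"
  shows "p \<in> K"
proof -
  have zero: "lift p = 0" if p: "p \<in> HM 0" "tc p \<in> I" for p
  proof -
    have pc: "p \<in> Car" using p by (simp add: HM_def)
    obtain a where a: "p - mon (Letter (Hgen a)) \<in> J" using weight_zero[OF p(1)] by blast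
    have hc: "mon (Letter (Hgen a)) \<in> Car" by (simp add: mono_Car gens_def)
    have eq: "tc p = tc (mon (Letter (Hgen a)))" using TP.\<pi>_eq[OF pc hc] a by simp
    then have "tc p = \<zero>\<^bsub>TA\<^esub>" using I(2) p(2) unfolding free_letter_def by blast
    then show "lift p = 0" using TP.zero_iff[OF pc] J_K by (auto simp: K_def)
  qed
  have pc: "p \<in> Car" using p by (simp add: HM_def)
  have "lift p = 0"
  proof (rule ccontr)
    assume nz: "lift p \<noteq> 0"
    then have "q \<noteq> 0" using zero p by blast
    then obtain m where m: "letters m \<subseteq> gens n" "magma_deg gen_weight m = - q" "br (ev m) (lift p) \<noteq> 0"
      using nondeg[OF _ lift_HM[OF p(1)] nz] by blast
    have mc: "mon m \<in> Car" using m by (simp add: mono_Car)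
    have "mon m \<in> HM (- q)" using m by (simp add: HM_alt)
    then have "free_mult (mon m) p \<in> HM 0" using HM_mult[of "mon m" "- q" p q] p by simp
    moreover have "tc (free_mult (mon m) p) \<in> I"
      using TP.sa_idealD(4)[OF I(1) mc, of p] p pc by simp
    ultimately have "lift (free_mult (mon m) p) = 0" by (rule zero)
    then show False using m by (simp add: lift_simps)
  qed
  then show ?thesis using pc by (simp add: K_def)
qed

lemma cartan_radical_eq: "cartan_radical A par scl hh \<alpha> = tc ` K"
  unfolding cartan_radical_def
proof (rule Greatest_equality, intro conjI graded_K)
  show "tc ` K \<inter> range (\<lambda>a. tc (free_letter (Hgen a))) = {\<zero>\<^bsub>TA\<^esub>}"
    using tc_H tc_H0 by (auto simp: image_iff) (metis tc_H0)+
  fix I assume I: "graded_ideal A par scl hh \<alpha> I \<and> I \<inter> range (\<lambda>a. tc (free_letter (Hgen a))) = {\<zero>\<^bsub>TA\<^esub>}"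
  then have sa: "sa_ideal TA I" and sp: "I = LinearCombinations.module.span class_ring TA (\<Union>q. I \<inter> tilde_component A par scl hh \<alpha> q)"
    and H: "I \<inter> range (\<lambda>a. tc (free_letter (Hgen a))) \<subseteq> {\<zero>\<^bsub>TA\<^esub>}"
    by (simp_all add: graded_ideal_def)
  interpret M: Module.module class_ring TA by (rule TP.mod)
  \<comment> \<open>A competing ideal is graded, hence spanned by its homogeneous elements, so it
    suffices to compare these.\<close>
  have "(\<Union>q. I \<inter> tilde_component A par scl hh \<alpha> q) \<subseteq> tc ` K"
    unfolding tilde_component_eq using homogeneous_in_K[OF sa H] by blast
  then have "LinearCombinations.module.span class_ring TA (\<Union>q. I \<inter> tilde_component A par scl hh \<alpha> q) \<subseteq> tc ` K"
    by (rule M.span_is_subset) (rule TP.record_submodule[OF K_sub K_Car])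
  then show "I \<le> tc ` K" using sp by simp
qed

definition cg :: "('k, 'h generator) free_alg \<Rightarrow> ('k, 'h generator) free_alg set set"
  where "cg x = cartan_radical A par scl hh \<alpha> +>\<^bsub>TA\<^esub> tc x"

lemma contragredient_presentation:
  "presentation free_scale (contragredient A par scl hh \<alpha>) free_mult Car K Fpart cg"
  using TP.quotient[OF K_Car K_sub J_K K_ideal]
  unfolding contragredient_def cartan_radical_eq[symmetric] cg_def[abs_def] .

lemma chevalley_e_eq: "chevalley_e A par scl hh \<alpha> i = cg (free_letter (Egen i))"
  by (simp add: chevalley_e_def cg_def)

end

section \<open>Jordan decompositions and semisimplification\<close>

locale vector_families = vector_space sc for sc :: "'k::field \<Rightarrow> 'd::ab_group_add \<Rightarrow> 'd"
begin

text \<open>Independence of an indexed family rather than of its range: a Jordan basis is indexed by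
  positions in blocks, and repetitions among its vectors have to be excluded together with linear
  relations.\<close>

definition family_indep :: "'i set \<Rightarrow> ('i \<Rightarrow> 'd) \<Rightarrow> bool"
  where "family_indep I f \<longleftrightarrow> (\<forall>c. (\<Sum>i\<in>I. sc (c i) (f i)) = 0 \<longrightarrow> (\<forall>i\<in>I. c i = 0))"

lemma family_indepD: "family_indep I f \<Longrightarrow> (\<Sum>i\<in>I. sc (c i) (f i)) = 0 \<Longrightarrow> i \<in> I \<Longrightarrow> c i = 0"
  unfolding family_indep_def by blast

lemma family_indep_cong: "(\<And>i. i \<in> I \<Longrightarrow> f i = g i) \<Longrightarrow> family_indep I f \<longleftrightarrow> family_indep I g"
  unfolding family_indep_def by (simp cong: sum.cong)

lemma family_indep_inj:
  assumes "finite I" "family_indep I f"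
  shows "inj_on f I"
proof
  fix i j assume ij: "i \<in> I" "j \<in> I" "f i = f j"
  show "i = j"
  proof (rule ccontr)
    assume n: "i \<noteq> j"
    let ?c = "\<lambda>k. if k = i then 1 else if k = j then - 1 else 0"
    have "(\<Sum>k\<in>I. sc (?c k) (f k)) = (\<Sum>k\<in>I. (if k = i then f k else 0) - (if k = j then f k else 0))"
      using n by (intro sum.cong) auto
    also have "\<dots> = 0" using ij assms by (simp add: sum_subtractf)
    finally have z: "(\<Sum>k\<in>I. sc (?c k) (f k)) = 0" .
    show False using family_indepD[OF assms(2) z ij(1)] by simp
  qed
qed

lemma family_indep_iff:
  assumes "finite I" "inj_on f I"
  shows "family_indep I f \<longleftrightarrow> independent (f ` I)"
proof
  assume fi: "family_indep I f"
  show "independent (f ` I)"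
  proof (rule independent_if_scalars_zero)
    fix g x assume g: "(\<Sum>x\<in>f ` I. sc (g x) x) = 0" "x \<in> f ` I"
    then have "(\<Sum>i\<in>I. sc (g (f i)) (f i)) = 0" using assms by (simp add: sum.reindex)
    then show "g x = 0" using family_indepD[OF fi, of "\<lambda>i. g (f i)"] g by auto
  qed (use assms in simp)
next
  assume ind: "independent (f ` I)"
  show "family_indep I f"
    unfolding family_indep_def
  proof (intro allI impI ballI)
    fix c i assume c: "(\<Sum>i\<in>I. sc (c i) (f i)) = 0" and i: "i \<in> I"
    have "(\<Sum>x\<in>f ` I. sc (c (inv_into I f x)) x) = 0" using assms c by (simp add: sum.reindex)
    then have "c (inv_into I f (f i)) = 0"
      using independentD[OF ind _ _ , of "f ` I" "\<lambda>x. c (inv_into I f x)" "f i"] assms i by simp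
    then show "c i = 0" using assms i by simp
  qed
qed

lemma family_span:
  assumes "finite I" "v \<in> span (f ` I)"
  obtains c where "v = (\<Sum>i\<in>I. sc (c i) (f i))"
proof -
  have "span (f ` I) \<subseteq> range (\<lambda>c. \<Sum>i\<in>I. sc (c i) (f i))"
  proof (rule span_minimal)
    show "f ` I \<subseteq> range (\<lambda>c. \<Sum>i\<in>I. sc (c i) (f i))"
    proof
      fix x assume "x \<in> f ` I"
      then obtain i where i: "i \<in> I" "x = f i" by blast
      have "(\<Sum>k\<in>I. sc (if k = i then 1 else 0) (f k)) = (\<Sum>k\<in>I. if k = i then f k else 0)" by (intro sum.cong) auto
      then have "x = (\<Sum>k\<in>I. sc (if k = i then 1 else 0) (f k))" using i assms by simp
      then show "x \<in> range (\<lambda>c. \<Sum>i\<in>I. sc (c i) (f i))"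
        by (rule range_eqI[where f = "\<lambda>c. \<Sum>i\<in>I. sc (c i) (f i)" and x = "\<lambda>k. if k = i then 1 else 0"])
    qed
    show "subspace (range (\<lambda>c. \<Sum>i\<in>I. sc (c i) (f i)))"
    proof (rule subspaceI)
      have "(0::'d) = (\<Sum>i\<in>I. sc 0 (f i))" by simp
      then show "0 \<in> range (\<lambda>c. \<Sum>i\<in>I. sc (c i) (f i))" by (rule image_eqI[of _ _ "\<lambda>_. 0"]) simp
      fix x y k assume "x \<in> range (\<lambda>c. \<Sum>i\<in>I. sc (c i) (f i))"
      then obtain c where c: "x = (\<Sum>i\<in>I. sc (c i) (f i))" by blast
      show "sc k x \<in> range (\<lambda>c. \<Sum>i\<in>I. sc (c i) (f i))"
        by (rule image_eqI[of _ _ "\<lambda>i. k * c i"]) (simp_all add: c scale_sum_right)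
      assume "y \<in> range (\<lambda>c. \<Sum>i\<in>I. sc (c i) (f i))"
      then obtain e where e: "y = (\<Sum>i\<in>I. sc (e i) (f i))" by blast
      show "x + y \<in> range (\<lambda>c. \<Sum>i\<in>I. sc (c i) (f i))"
        by (rule image_eqI[of _ _ "\<lambda>i. c i + e i"]) (simp_all add: c e sum.distrib scale_left_distrib)
    qed
  qed
  then show thesis using assms that by blast
qed

end

lemma finite_block_positions [simp]: "finite (block_positions n1 n2 n3)"
  by (simp add: block_positions_def)

lemma block_positions_mem: "(i, j) \<in> block_positions n1 n2 n3 \<longleftrightarrow> i < n1 + n2 + n3 \<and> j < block_size n1 n2 i"
  by (simp add: block_positions_def)

locale nilpotent_op = vector_families sc for sc :: "'k::field \<Rightarrow> 'd::ab_group_add \<Rightarrow> 'd" +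
  fixes D :: "'d set" and d :: "'d \<Rightarrow> 'd"
  assumes D_sub: "subspace D" and d_D: "x \<in> D \<Longrightarrow> d x \<in> D"
    and d_add: "d (x + y) = d x + d y" and d_scale: "d (sc c x) = sc c (d x)"
begin

lemma d_zero [simp]: "d 0 = 0" using d_scale[of 0 0] by simp
lemma d_minus: "d (- x) = - d x" using d_scale[of "-1" x] by simp
lemma d_diff: "d (x - y) = d x - d y" using d_add[of x "- y"] by (simp add: d_minus)
lemma d_sum: "d (\<Sum>i\<in>I. f i) = (\<Sum>i\<in>I. d (f i))"
  by (induction I rule: infinite_finite_induct) (auto simp: d_add)
lemma dj_D: "x \<in> D \<Longrightarrow> (d ^^ j) x \<in> D" by (induction j) (auto simp: d_D)
lemma dj_zero [simp]: "(d ^^ j) 0 = 0" by (induction j) auto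
definition decomposition :: "nat \<Rightarrow> nat \<Rightarrow> nat \<Rightarrow> (nat \<Rightarrow> 'd) \<Rightarrow> bool"
  where "decomposition n1 n2 n3 X \<longleftrightarrow> (\<forall>i<n1 + n2 + n3. X i \<in> D \<and> (d ^^ block_size n1 n2 i) (X i) = 0) \<and>
    family_indep (block_positions n1 n2 n3) (\<lambda>(i, j). (d ^^ j) (X i)) \<and>
    D \<subseteq> span ((\<lambda>(i, j). (d ^^ j) (X i)) ` block_positions n1 n2 n3)"

lemma pos_sum: "(\<Sum>p\<in>block_positions n1 n2 n3. f p) = (\<Sum>i<n1 + n2 + n3. \<Sum>j<block_size n1 n2 i. f (i, j))"
  unfolding block_positions_def by (simp add: sum.Sigma)

text \<open>The image of \<open>d\<close> squared, the image under \<open>d\<close> of the kernel of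
  \<open>d\<close> squared, and the kernel of \<open>d\<close> form a flag; they are to be spanned
  by the bottoms of the blocks of size 3, at least 2, and at least 1. Nested bases
  \<open>C3\<close>, \<open>C2\<close>, \<open>C1\<close> of this flag are chosen and lifted to
  tops.\<close>

lemma decomposition_exists:
  assumes d3: "\<And>x. x \<in> D \<Longrightarrow> d (d (d x)) = 0" and fin: "finite F" "D \<subseteq> span F"
  shows "\<exists>n1 n2 n3 X. decomposition n1 n2 n3 X"
proof -
  let ?K1 = "{x \<in> D. d x = 0}" and ?K2 = "{x \<in> D. d (d x) = 0}"
  let ?V = "(\<lambda>x. d (d x)) ` D" and ?E = "d ` ?K2"
  have VE: "?V \<subseteq> ?E" using d_D d3 by blast
  have EK: "?E \<subseteq> ?K1" using d_D by auto
  obtain C3 where C3: "C3 \<subseteq> ?V" "independent C3" "?V \<subseteq> span C3"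
    by (rule maximal_independent_subset)
  obtain C2 where C2: "C3 \<subseteq> C2" "C2 \<subseteq> ?E" "independent C2" "?E \<subseteq> span C2"
    by (rule maximal_independent_subset_extend[OF order_trans[OF C3(1) VE] C3(2)])
  obtain C1 where C1: "C2 \<subseteq> C1" "C1 \<subseteq> ?K1" "independent C1" "?K1 \<subseteq> span C1"
    by (rule maximal_independent_subset_extend[OF order_trans[OF C2(2) EK] C2(3)])
  have "C1 \<subseteq> span F" using C1(2) fin(2) by blast
  then have fC1: "finite C1" using independent_span_bound[OF fin(1) C1(3)] by blast
  define n1 n2 n3 where "n1 = card (C1 - C2)" and "n2 = card (C2 - C3)" and "n3 = card C3"
  have fC2: "finite C2" by (rule finite_subset[OF C1(1) fC1])
  have f: "finite (C1 - C2)" "finite (C2 - C3)" "finite C3" using fC1 fC2 finite_subset[OF C2(1) fC2] by auto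
  obtain e1 where e1: "bij_betw e1 {0..<n1} (C1 - C2)" using ex_bij_betw_nat_finite[OF f(1)] n1_def by blast
  obtain e2 where e2: "bij_betw e2 {0..<n2} (C2 - C3)" using ex_bij_betw_nat_finite[OF f(2)] n2_def by blast
  obtain e3 where e3: "bij_betw e3 {0..<n3} C3" using ex_bij_betw_nat_finite[OF f(3)] n3_def by blast
  have "\<forall>c\<in>C3. \<exists>x. x \<in> D \<and> d (d x) = c" using C3(1) by blast
  then obtain t3 where t3: "\<And>c. c \<in> C3 \<Longrightarrow> t3 c \<in> D \<and> d (d (t3 c)) = c" by metis
  have "\<forall>c\<in>C2. \<exists>x. x \<in> D \<and> d (d x) = 0 \<and> d x = c" using C2(2) by blast
  then obtain t2 where t2: "\<And>c. c \<in> C2 \<Longrightarrow> t2 c \<in> D \<and> d (d (t2 c)) = 0 \<and> d (t2 c) = c" by metis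
  define X where "X i = (if i < n1 then e1 i else if i < n1 + n2 then t2 (e2 (i - n1)) else t3 (e3 (i - n1 - n2)))" for i
  \<comment> \<open>\<open>bot i\<close> is the last nonzero vector of block \<open>i\<close>;
    together the bottoms enumerate the basis \<open>C1\<close>.\<close>
  define bot where "bot i = (if i < n1 then e1 i else if i < n1 + n2 then e2 (i - n1) else e3 (i - n1 - n2))" for i
  let ?n = "n1 + n2 + n3"
  have m1: "e1 i \<in> C1 - C2" if "i < n1" for i using e1 that by (auto dest: bij_betwE)
  have m2: "e2 (i - n1) \<in> C2 - C3" if "\<not> i < n1" "i < n1 + n2" for i using e2 that by (auto dest: bij_betwE)
  have m3: "e3 (i - n1 - n2) \<in> C3" if "\<not> i < n1 + n2" "i < ?n" for i using e3 that by (auto dest: bij_betwE)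
  have X1: "X i \<in> D" "d (X i) = 0" "X i = bot i" if "i < n1" for i
    using m1[OF that] C1(2) that by (auto simp: X_def bot_def)
  have X2: "X i \<in> D" "d (d (X i)) = 0" "d (X i) = bot i" if "\<not> i < n1" "i < n1 + n2" for i
    using t2[of "e2 (i - n1)"] m2[OF that] that by (auto simp: X_def bot_def)
  have X3: "X i \<in> D" "d (d (d (X i))) = 0" "d (d (X i)) = bot i" if "\<not> i < n1 + n2" "i < ?n" for i
    using t3[of "e3 (i - n1 - n2)"] m3[OF that] that d3[of "X i"] by (auto simp: X_def bot_def)
  have im3: "bot ` {n1 + n2..<?n} = C3"
  proof -
    have "bot ` {n1 + n2..<?n} = e3 ` (\<lambda>i. i - n1 - n2) ` {n1 + n2..<?n}" by (force simp: bot_def image_image intro!: image_cong)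
    also have "(\<lambda>i. i - n1 - n2) ` {n1 + n2..<?n} = {0..<n3}"
      by (auto simp: image_iff) (rule_tac x = "x + n1 + n2" in bexI, auto)
    finally show ?thesis using e3 by (simp add: bij_betw_def)
  qed
  have im2: "bot ` {n1..<n1 + n2} = C2 - C3"
  proof -
    have "bot ` {n1..<n1 + n2} = e2 ` (\<lambda>i. i - n1) ` {n1..<n1 + n2}" by (force simp: bot_def image_image intro!: image_cong)
    also have "(\<lambda>i. i - n1) ` {n1..<n1 + n2} = {0..<n2}"
      by (auto simp: image_iff) (rule_tac x = "x + n1" in bexI, auto)
    finally show ?thesis using e2 by (simp add: bij_betw_def)
  qed
  have im1: "bot ` {0..<n1} = C1 - C2"
  proof -
    have "bot ` {0..<n1} = e1 ` {0..<n1}" by (auto simp: bot_def)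
    then show ?thesis using e1 by (simp add: bij_betw_def)
  qed
  have split2: "{n1..<?n} = {n1..<n1 + n2} \<union> {n1 + n2..<?n}" by auto
  have split1: "{..<?n} = {0..<n1} \<union> {n1..<n1 + n2} \<union> {n1 + n2..<?n}" by auto
  have im2': "bot ` {n1..<?n} = C2" unfolding split2 image_Un im2 im3 using C2(1) by blast
  have im1': "bot ` {..<?n} = C1" unfolding split1 image_Un im1 im2 im3 using C1(1) C2(1) by blast
  have "card C1 = card (C1 - C2) + card (C2 - C3) + card C3"
  proof -
    have "card (C1 - C2) = card C1 - card C2" using C1(1) fC1 by (intro card_Diff_subset) (auto intro: finite_subset)
    moreover have "card (C2 - C3) = card C2 - card C3" using C2(1) C1(1) fC1 by (intro card_Diff_subset) (auto intro: finite_subset)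
    moreover have "card C3 \<le> card C2" "card C2 \<le> card C1" using C1(1) C2(1) fC1 by (auto intro!: card_mono intro: finite_subset)
    ultimately show ?thesis by simp
  qed
  then have "card (bot ` {..<?n}) = card {..<?n}" unfolding im1' by (simp add: n1_def n2_def n3_def)
  then have binj: "inj_on bot {..<?n}" by (rule eq_card_imp_inj_on[rotated]) simp
  have bind: "family_indep {..<?n} bot" using C1(3) by (subst family_indep_iff) (auto simp: binj im1')
  have size: "block_size n1 n2 i = (if i < n1 then 1 else if i < n1 + n2 then 2 else 3)" for i by (simp add: block_size_def)
  let ?B = "(\<lambda>(i, j). (d ^^ j) (X i)) ` block_positions n1 n2 n3"
  have n23: "Suc (Suc 0) = 2" "Suc 2 = 3" by simp_all
  have d23: "(d ^^ 2) x = d (d x)" "(d ^^ 3) x = d (d (d x))" for x by (simp_all add: numeral_2_eq_2 numeral_3_eq_3)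
  have sz: "X i \<in> D" "(d ^^ block_size n1 n2 i) (X i) = 0" "bot i = (d ^^ (block_size n1 n2 i - 1)) (X i)" if "i < ?n" for i
  proof -
    consider "i < n1" | "\<not> i < n1" "i < n1 + n2" | "\<not> i < n1 + n2" by blast
    then have "X i \<in> D \<and> (d ^^ block_size n1 n2 i) (X i) = 0 \<and> bot i = (d ^^ (block_size n1 n2 i - 1)) (X i)"
    proof cases
      case 1 then show ?thesis using X1[OF 1] by (simp add: size)
    next
      case 2 then show ?thesis using X2[OF 2] by (simp add: size d23)
    next
      case 3 then show ?thesis using X3[OF 3 that] by (simp add: size d23)
    qed
    then show "X i \<in> D" "(d ^^ block_size n1 n2 i) (X i) = 0" "bot i = (d ^^ (block_size n1 n2 i - 1)) (X i)" by blast+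
  qed
  have Bmem: "(d ^^ j) (X i) \<in> ?B" if "i < ?n" "j < block_size n1 n2 i" for i j
    using that by (force simp: block_positions_mem)
  have botB: "bot i \<in> span ?B" if "i < ?n" for i
    using Bmem[OF that, of "block_size n1 n2 i - 1"] sz(3)[OF that] by (auto simp: size intro!: span_base)
  have indep: "family_indep (block_positions n1 n2 n3) (\<lambda>(i, j). (d ^^ j) (X i))"
    unfolding family_indep_def
  proof (intro allI impI)
    fix c assume "(\<Sum>p\<in>block_positions n1 n2 n3. sc (c p) (case p of (i, j) \<Rightarrow> (d ^^ j) (X i))) = 0"
    then have s0: "(\<Sum>i<?n. \<Sum>j<block_size n1 n2 i. sc (c (i, j)) ((d ^^ j) (X i))) = 0" by (simp add: pos_sum)
    \<comment> \<open>Applying \<open>d\<close> twice, once and not at all to the relation gives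
      each time, after removing the coefficients already known to vanish, a relation among the
      bottoms.\<close>
    have s2: "(\<Sum>i<?n. sc (if i < n1 + n2 then 0 else c (i, 0)) (bot i)) = 0"
    proof -
      have "d (d (\<Sum>i<?n. \<Sum>j<block_size n1 n2 i. sc (c (i, j)) ((d ^^ j) (X i)))) =
         (\<Sum>i<?n. \<Sum>j<block_size n1 n2 i. sc (c (i, j)) ((d ^^ (j + 2)) (X i)))" by (simp add: d_sum d_scale)
      also have "\<dots> = (\<Sum>i<?n. sc (if i < n1 + n2 then 0 else c (i, 0)) (bot i))"
        by (intro sum.cong refl) (use X1 X2 X3 in \<open>auto simp: size lessThan_Suc numeral_2_eq_2 numeral_3_eq_3\<close>)
      finally show ?thesis unfolding s0 by simp
    qed
    have c2: "c (i, 0) = 0" if "i < ?n" "\<not> i < n1 + n2" for i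
      using family_indepD[OF bind s2, of i] that by simp
    have s1: "(\<Sum>i<?n. sc (if i < n1 then 0 else if i < n1 + n2 then c (i, 0) else c (i, 1)) (bot i)) = 0"
    proof -
      have "d (\<Sum>i<?n. \<Sum>j<block_size n1 n2 i. sc (c (i, j)) ((d ^^ j) (X i))) =
         (\<Sum>i<?n. \<Sum>j<block_size n1 n2 i. sc (c (i, j)) ((d ^^ (j + 1)) (X i)))" by (simp add: d_sum d_scale)
      also have "\<dots> = (\<Sum>i<?n. sc (if i < n1 then 0 else if i < n1 + n2 then c (i, 0) else c (i, 1)) (bot i))"
        by (intro sum.cong refl) (use X1 X2 X3 c2 in \<open>auto simp: size lessThan_Suc numeral_2_eq_2 numeral_3_eq_3\<close>)
      finally show ?thesis unfolding s0 by simp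
    qed
    have c1: "(if i < n1 then 0 else if i < n1 + n2 then c (i, 0) else c (i, 1)) = 0" if "i < ?n" for i
      using family_indepD[OF bind s1, of i] that by simp
    have c1a: "c (i, 0) = 0" if "\<not> i < n1" "i < n1 + n2" for i using c1[of i] that by simp
    have c1b: "c (i, Suc 0) = 0" if "\<not> i < n1 + n2" "i < ?n" for i using c1[of i] that by simp
    have s: "(\<Sum>i<?n. sc (c (i, block_size n1 n2 i - 1)) (bot i)) = 0"
    proof -
      have "(\<Sum>i<?n. \<Sum>j<block_size n1 n2 i. sc (c (i, j)) ((d ^^ j) (X i))) = (\<Sum>i<?n. sc (c (i, block_size n1 n2 i - 1)) (bot i))"
        by (intro sum.cong refl) (use X1(3) X2(3) X3(3) c2 c1a c1b in \<open>auto simp: size lessThan_Suc numeral_2_eq_2 numeral_3_eq_3\<close>)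
      then show ?thesis unfolding s0 by simp
    qed
    have c0: "c (i, block_size n1 n2 i - 1) = 0" if "i < ?n" for i
      using family_indepD[OF bind s, of i] that by simp
    show "\<forall>p\<in>block_positions n1 n2 n3. c p = 0"
    proof
      fix p assume "p \<in> block_positions n1 n2 n3"
      then obtain i j where p: "p = (i, j)" "i < ?n" "j < block_size n1 n2 i" by (cases p) (auto simp: block_positions_mem)
      then have "j = block_size n1 n2 i - 1 \<or> (j = 0 \<and> \<not> i < n1 \<and> i < n1 + n2) \<or> (j = 0 \<and> \<not> i < n1 + n2) \<or> (j = 1 \<and> \<not> i < n1 + n2)"
        by (auto simp: size split: if_splits)
      then show "c p = 0" using c0[OF p(2)] c1a[of i] c1b[of i] c2[of i] p by auto
    qed
  qed
  have span: "D \<subseteq> span ?B"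
  proof
    fix v assume v: "v \<in> D"
    have "d (d v) \<in> span (bot ` {n1 + n2..<?n})" unfolding im3 using C3(3) v by blast
    from family_span[OF finite_atLeastLessThan this]
    obtain a where a: "d (d v) = (\<Sum>i\<in>{n1 + n2..<?n}. sc (a i) (bot i))" by blast
    \<comment> \<open>Subtracting tops of blocks of size 3 achieves \<open>d (d v1) = 0\<close>.
      Subtracting the vectors one step above the bottom, at position \<open>block_size - 2\<close>,
      then achieves \<open>d v2 = 0\<close>, and the rest is a combination of bottoms.\<close>
    define v1 where "v1 = v - (\<Sum>i\<in>{n1 + n2..<?n}. sc (a i) (X i))"
    have "v1 \<in> D" unfolding v1_def by (intro subspace_diff[OF D_sub] v subspace_sum[OF D_sub] subspace_scale[OF D_sub]) (auto intro: X3(1))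
    moreover have "d (d v1) = 0" unfolding v1_def d_diff d_sum d_scale a
      using X3(3) by simp
    ultimately have "d v1 \<in> ?E" by blast
    then have "d v1 \<in> span (bot ` {n1..<?n})" unfolding im2' using C2(4) by blast
    from family_span[OF finite_atLeastLessThan this]
    obtain b where b: "d v1 = (\<Sum>i\<in>{n1..<?n}. sc (b i) (bot i))" by blast
    define v2 where "v2 = v1 - (\<Sum>i\<in>{n1..<?n}. sc (b i) ((d ^^ (block_size n1 n2 i - 2)) (X i)))"
    have "v2 \<in> D" unfolding v2_def
      by (intro subspace_diff[OF D_sub] \<open>v1 \<in> D\<close> subspace_sum[OF D_sub] subspace_scale[OF D_sub] dj_D) (auto intro: sz(1))
    moreover have "d v2 = 0"
    proof -
      have "d ((d ^^ (block_size n1 n2 i - 2)) (X i)) = bot i" if "i \<in> {n1..<?n}" for i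
        using X2(3)[of i] X3(3)[of i] that by (auto simp: size)
      then show ?thesis unfolding v2_def d_diff d_sum d_scale b by simp
    qed
    ultimately have "v2 \<in> span (bot ` {..<?n})" unfolding im1' using C1(4) by blast
    moreover have "span (bot ` {..<?n}) \<subseteq> span ?B" using botB by (intro span_minimal) auto
    ultimately have "v2 \<in> span ?B" by blast
    moreover have "(\<Sum>i\<in>{n1..<?n}. sc (b i) ((d ^^ (block_size n1 n2 i - 2)) (X i))) \<in> span ?B"
      by (intro span_sum span_scale span_base Bmem) (auto simp: size)
    moreover have "(\<Sum>i\<in>{n1 + n2..<?n}. sc (a i) (X i)) \<in> span ?B"
      using Bmem[of _ 0] by (intro span_sum span_scale span_base) (auto simp: size)
    ultimately have "v2 + (\<Sum>i\<in>{n1..<?n}. sc (b i) ((d ^^ (block_size n1 n2 i - 2)) (X i))) + (\<Sum>i\<in>{n1 + n2..<?n}. sc (a i) (X i)) \<in> span ?B"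
      by (intro span_add)
    then show "v \<in> span ?B" by (simp add: v1_def v2_def)
  qed
  show ?thesis unfolding decomposition_def using sz indep span by blast
qed

end

text \<open>\<open>P0\<close> on \<open>Ker d\<close> and \<open>P1\<close> on the kernel of
  \<open>d\<close> squared are the projections to the even and the odd subquotient: the elements
  they kill there are those of \<open>Im d\<close> and those of \<open>Ker d + Im d\<close>. Both
  have values in one space, with images \<open>Me\<close> and \<open>Mo\<close> meeting trivially,
  and the rules \<open>compat00\<close> to \<open>compat11\<close> say that the brackets of the
  semisimplification, including the twisted one of two odd elements, all become
  \<open>mulW\<close>.\<close>

locale semisimplification_target = nilpotent_op sc D d + W: vector_space scw
  for sc :: "'k::field \<Rightarrow> 'd::ab_group_add \<Rightarrow> 'd" and D d
    and scw :: "'k \<Rightarrow> 'w::ab_group_add \<Rightarrow> 'w" +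
  fixes mul :: "'d \<Rightarrow> 'd \<Rightarrow> 'd" and P0 P1 :: "'d \<Rightarrow> 'w" and mulW :: "'w \<Rightarrow> 'w \<Rightarrow> 'w" and Me Mo :: "'w set"
  assumes P_add: "P0 (x + y) = P0 x + P0 y" "P1 (x + y) = P1 x + P1 y"
    and P_scale: "P0 (sc c x) = scw c (P0 x)" "P1 (sc c x) = scw c (P1 x)"
    and P0_zero: "u \<in> D \<Longrightarrow> d u = 0 \<Longrightarrow> P0 u = 0 \<Longrightarrow> \<exists>v\<in>D. u = d v"
    and P0_im: "v \<in> D \<Longrightarrow> d (d v) = 0 \<Longrightarrow> P0 (d v) = 0"
    and P1_zero: "u \<in> D \<Longrightarrow> d (d u) = 0 \<Longrightarrow> P1 u = 0 \<Longrightarrow> \<exists>k\<in>D. \<exists>v\<in>D. d k = 0 \<and> u = k + d v"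
    and P1_im: "v \<in> D \<Longrightarrow> P1 (d v) = 0" and P1_ker: "k \<in> D \<Longrightarrow> d k = 0 \<Longrightarrow> P1 k = 0"
    and Me_eq: "Me = P0 ` {u \<in> D. d u = 0}" and Mo_eq: "Mo = P1 ` {u \<in> D. d (d u) = 0}"
    and MeMo: "Me \<inter> Mo = {0}"
    and mulW_add: "mulW (a + a') b = mulW a b + mulW a' b" "mulW b (a + a') = mulW b a + mulW b a'"
    and mulW_scale: "mulW (scw c a) b = scw c (mulW a b)" "mulW b (scw c a) = scw c (mulW b a)"
    and compat00: "u \<in> D \<Longrightarrow> d u = 0 \<Longrightarrow> u' \<in> D \<Longrightarrow> d u' = 0 \<Longrightarrow>
      mul u u' \<in> D \<and> d (mul u u') = 0 \<and> P0 (mul u u') = mulW (P0 u) (P0 u')"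
    and compat01: "u \<in> D \<Longrightarrow> d u = 0 \<Longrightarrow> x \<in> D \<Longrightarrow> d (d x) = 0 \<Longrightarrow>
      mul u x \<in> D \<and> d (d (mul u x)) = 0 \<and> P1 (mul u x) = mulW (P0 u) (P1 x)"
    and compat10: "u \<in> D \<Longrightarrow> d u = 0 \<Longrightarrow> x \<in> D \<Longrightarrow> d (d x) = 0 \<Longrightarrow>
      mul x u \<in> D \<and> d (d (mul x u)) = 0 \<and> P1 (mul x u) = mulW (P1 x) (P0 u)"
    and compat11: "x \<in> D \<Longrightarrow> d (d x) = 0 \<Longrightarrow> y \<in> D \<Longrightarrow> d (d y) = 0 \<Longrightarrow>
      - mul x (d y) + mul (d x) y \<in> D \<and> d (- mul x (d y) + mul (d x) y) = 0 \<and>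
      P0 (- mul x (d y) + mul (d x) y) = mulW (P1 x) (P1 y)"
begin

lemma P_sum: "P0 (\<Sum>i\<in>I. f i) = (\<Sum>i\<in>I. P0 (f i))" "P1 (\<Sum>i\<in>I. f i) = (\<Sum>i\<in>I. P1 (f i))"
proof -
  have "P0 0 = 0" "P1 0 = 0" using P_scale[of 0 0] by simp_all
  then show "P0 (\<Sum>i\<in>I. f i) = (\<Sum>i\<in>I. P0 (f i))" "P1 (\<Sum>i\<in>I. f i) = (\<Sum>i\<in>I. P1 (f i))"
    by (induction I rule: infinite_finite_induct) (simp_all add: P_add)
qed

lemma mulW_zero: "mulW 0 a = 0" "mulW a 0 = 0"
  using mulW_scale(1)[of 0 0 a] mulW_scale(2)[of a 0 0] by simp_all

lemma mulW_sum: "mulW (\<Sum>i\<in>I. f i) b = (\<Sum>i\<in>I. mulW (f i) b)" "mulW b (\<Sum>i\<in>I. f i) = (\<Sum>i\<in>I. mulW b (f i))"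
  by (induction I rule: infinite_finite_induct) (simp_all add: mulW_add mulW_zero)

context
  fixes n1 n2 n3 :: nat and X :: "nat \<Rightarrow> 'd"
  assumes dec: "decomposition n1 n2 n3 X"
begin

abbreviation (input) "pos \<equiv> block_positions n1 n2 n3"
abbreviation (input) "bs \<equiv> (\<lambda>(i, j). (d ^^ j) (X i))"

lemma X_D: "i < n1 + n2 + n3 \<Longrightarrow> X i \<in> D"
  and X_top: "i < n1 + n2 + n3 \<Longrightarrow> (d ^^ block_size n1 n2 i) (X i) = 0"
  and bs_indep: "family_indep pos bs" and bs_span: "D \<subseteq> span (bs ` pos)"
  using dec by (auto simp: decomposition_def)

lemma bs_inj: "inj_on bs pos" by (rule family_indep_inj[OF finite_block_positions bs_indep])
lemma bs_independent: "independent (bs ` pos)"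
  using bs_indep by (simp add: family_indep_iff[OF finite_block_positions bs_inj])

definition cf :: "nat \<times> nat \<Rightarrow> 'd \<Rightarrow> 'k" where "cf p v = representation (bs ` pos) v (bs p)"

lemma cf_expand: "v \<in> D \<Longrightarrow> v = (\<Sum>p\<in>pos. sc (cf p v) (bs p))"
proof -
  assume v: "v \<in> D"
  then have vs: "v \<in> span (bs ` pos)" using bs_span by blast
  have "(\<Sum>b\<in>bs ` pos. sc (representation (bs ` pos) v b) b) = v"
    by (rule sum_representation_eq[OF bs_independent vs]) auto
  then show ?thesis using bs_inj by (simp add: sum.reindex cf_def)
qed

lemma cf_unique:
  assumes "v \<in> D" "v = (\<Sum>p\<in>pos. sc (c p) (bs p))" "p \<in> pos"
  shows "cf p v = c p"
proof -
  have "(\<Sum>p\<in>pos. sc (cf p v) (bs p)) - (\<Sum>p\<in>pos. sc (c p) (bs p)) = 0"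
    using cf_expand[OF assms(1)] assms(2) by simp
  then have "(\<Sum>p\<in>pos. sc (cf p v - c p) (bs p)) = 0"
    by (simp add: scale_left_diff_distrib sum_subtractf)
  then show ?thesis using family_indepD[OF bs_indep, of "\<lambda>p. cf p v - c p" p] assms(3) by simp
qed

lemma cf_add: "v \<in> D \<Longrightarrow> w \<in> D \<Longrightarrow> p \<in> pos \<Longrightarrow> cf p (v + w) = cf p v + cf p w"
  using subspace_add[OF D_sub] cf_expand[of v] cf_expand[of w]
  by (intro cf_unique) (simp_all add: scale_left_distrib sum.distrib)

text \<open>In Jordan coordinates \<open>d\<close> shifts every block by one step and loses the
  bottom. In particular an image of \<open>d\<close> has coefficient zero at every top.\<close>

lemma cf_d:
  assumes v: "v \<in> D" and p: "(i, j) \<in> pos"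
  shows "cf (i, j) (d v) = (if j = 0 then 0 else cf (i, j - 1) v)"
proof -
  have "d v = (\<Sum>p\<in>pos. sc (cf p v) (d (bs p)))"
    by (subst cf_expand[OF v]) (simp add: d_sum d_scale)
  also have "\<dots> = (\<Sum>i<n1 + n2 + n3. \<Sum>j<block_size n1 n2 i. sc (cf (i, j) v) ((d ^^ Suc j) (X i)))"
    by (simp add: pos_sum)
  also have "\<dots> = (\<Sum>i<n1 + n2 + n3. \<Sum>j<block_size n1 n2 i. sc (if j = 0 then 0 else cf (i, j - 1) v) ((d ^^ j) (X i)))"
  proof (rule sum.cong[OF refl])
    fix i assume "i \<in> {..<n1 + n2 + n3}"
    then have t: "(d ^^ block_size n1 n2 i) (X i) = 0" using X_top by simp
    obtain s where s: "block_size n1 n2 i = Suc s" by (cases "block_size n1 n2 i") (auto simp: block_size_def split: if_splits)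
    have "(\<Sum>j<Suc s. sc (cf (i, j) v) ((d ^^ Suc j) (X i))) = (\<Sum>j<s. sc (cf (i, j) v) ((d ^^ Suc j) (X i)))"
      using t s by simp
    also have "\<dots> = (\<Sum>j<Suc s. sc (if j = 0 then 0 else cf (i, j - 1) v) ((d ^^ j) (X i)))"
      by (subst sum.lessThan_Suc_shift) simp
    finally show "(\<Sum>j<block_size n1 n2 i. sc (cf (i, j) v) ((d ^^ Suc j) (X i))) =
      (\<Sum>j<block_size n1 n2 i. sc (if j = 0 then 0 else cf (i, j - 1) v) ((d ^^ j) (X i)))" by (simp add: s)
  qed
  also have "\<dots> = (\<Sum>p\<in>pos. sc (case p of (i, j) \<Rightarrow> if j = 0 then 0 else cf (i, j - 1) v) (bs p))"
    by (simp add: pos_sum)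
  finally have "cf (i, j) (d v) = (case (i, j) of (i, j) \<Rightarrow> if j = 0 then 0 else cf (i, j - 1) v)"
    by (rule cf_unique[OF d_D[OF v] _ p])
  then show ?thesis by simp
qed

text \<open>The coordinate of \<open>d u\<close> at \<open>j + 1\<close> is that of \<open>u\<close>
  at \<open>j\<close>. So for \<open>u\<close> in the kernel only the last coordinate of each block
  can be nonzero, and for the kernel of \<open>d\<close> squared only the last two.\<close>

lemma cf_K1: "u \<in> D \<Longrightarrow> d u = 0 \<Longrightarrow> i < n1 + n2 + n3 \<Longrightarrow> j + 1 < block_size n1 n2 i \<Longrightarrow> cf (i, j) u = 0"
  using cf_d[of u i "j + 1"] cf_unique[of 0 "\<lambda>_. 0" "(i, j + 1)"] subspace_0[OF D_sub] by (simp add: block_positions_mem)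

lemma cf_K2: "u \<in> D \<Longrightarrow> d (d u) = 0 \<Longrightarrow> i < n1 + n2 + n3 \<Longrightarrow> j + 2 < block_size n1 n2 i \<Longrightarrow> cf (i, j) u = 0"
  using cf_K1[of "d u" i "j + 1"] cf_d[of u i "j + 1"] d_D[of u] by (simp add: block_positions_mem)

definition PX :: "nat \<Rightarrow> 'w" where "PX k = (if k < n1 then P0 (X k) else P1 (X k))"

lemma X_K1: "i < n1 \<Longrightarrow> d (X i) = 0"
  using X_top[of i] by (simp add: block_size_def)
lemma X_K2: "i < n1 + n2 \<Longrightarrow> d (d (X i)) = 0"
  using X_top[of i] X_K1[of i] by (auto simp: block_size_def numeral_2_eq_2 split: if_splits)

lemma split_sum: "(\<Sum>i<n1 + n2 + n3. if i < n1 + n2 then g i else 0) = (\<Sum>i<n1 + n2. g i)" for g :: "nat \<Rightarrow> 'w"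
  by (rule sum.mono_neutral_cong_right) auto

text \<open>In a block of size at least 2 all coordinates of \<open>u\<close> but the last vanish,
  and the last basis vector is \<open>d\<close> of a vector killed by \<open>d\<close> squared, so
  \<open>P0\<close> sends it to zero. Only the blocks of size 1 remain.\<close>

lemma P0_expand:
  assumes u: "u \<in> D" "d u = 0"
  shows "P0 u = (\<Sum>k<n1 + n2. if k < n1 then scw (cf (k, 0) u) (PX k) else 0)"
proof -
  have "P0 u = (\<Sum>i<n1 + n2 + n3. \<Sum>j<block_size n1 n2 i. scw (cf (i, j) u) (P0 ((d ^^ j) (X i))))"
    by (subst cf_expand[OF u(1)]) (simp add: P_sum P_scale pos_sum)
  also have "\<dots> = (\<Sum>i<n1 + n2 + n3. if i < n1 + n2 then if i < n1 then scw (cf (i, 0) u) (PX i) else 0 else 0)"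
  proof (rule sum.cong[OF refl])
    fix i assume i: "i \<in> {..<n1 + n2 + n3}"
    show "(\<Sum>j<block_size n1 n2 i. scw (cf (i, j) u) (P0 ((d ^^ j) (X i)))) =
      (if i < n1 + n2 then if i < n1 then scw (cf (i, 0) u) (PX i) else 0 else 0)"
    proof (cases "i < n1")
      case True
      then show ?thesis by (simp add: block_size_def PX_def)
    next
      case False
      have nz: "scw (cf (i, j) u) (P0 ((d ^^ j) (X i))) = 0" if j: "j < block_size n1 n2 i" for j
      proof (cases "j + 1 < block_size n1 n2 i")
        case True
        then show ?thesis using cf_K1[OF u] i by simp
      next
        case b: False
        then have j1: "Suc j = block_size n1 n2 i" using j by simp
        then obtain j' where j': "j = Suc j'" using False by (cases j) (auto simp: block_size_def split: if_splits)
        have "d (d ((d ^^ j') (X i))) = 0" using X_top[of i] i j1 j' by (metis comp_apply funpow.simps(2) lessThan_iff)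
        then have "P0 (d ((d ^^ j') (X i))) = 0" using P0_im dj_D X_D i by simp
        then show ?thesis by (simp add: j')
      qed
      have "(\<Sum>j<block_size n1 n2 i. scw (cf (i, j) u) (P0 ((d ^^ j) (X i)))) = 0"
        by (rule sum.neutral) (use nz in blast)
      then show ?thesis using False by simp
    qed
  qed
  finally show ?thesis unfolding split_sum .
qed

text \<open>Every basis vector below a top is an image of \<open>d\<close> and is killed by
  \<open>P1\<close>; a top of size 3 has coefficient zero by \<open>cf_K2\<close>, and a top of size
  1 lies in the kernel of \<open>d\<close>. The tops of size 2 remain.\<close>

lemma P1_expand:
  assumes u: "u \<in> D" "d (d u) = 0"
  shows "P1 u = (\<Sum>k<n1 + n2. if k < n1 then 0 else scw (cf (k, 0) u) (PX k))"
proof -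
  have "P1 u = (\<Sum>i<n1 + n2 + n3. \<Sum>j<block_size n1 n2 i. scw (cf (i, j) u) (P1 ((d ^^ j) (X i))))"
    by (subst cf_expand[OF u(1)]) (simp add: P_sum P_scale pos_sum)
  also have "\<dots> = (\<Sum>i<n1 + n2 + n3. if i < n1 + n2 then if i < n1 then 0 else scw (cf (i, 0) u) (PX i) else 0)"
  proof (rule sum.cong[OF refl])
    fix i assume "i \<in> {..<n1 + n2 + n3}"
    then have i: "i < n1 + n2 + n3" by simp
    have s: "scw (cf (i, Suc j) u) (P1 ((d ^^ Suc j) (X i))) = 0" for j
      using P1_im[of "(d ^^ j) (X i)"] dj_D X_D[OF i] by simp
    obtain s where bz: "block_size n1 n2 i = Suc s" by (cases "block_size n1 n2 i") (auto simp: block_size_def split: if_splits)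
    have "(\<Sum>j<block_size n1 n2 i. scw (cf (i, j) u) (P1 ((d ^^ j) (X i)))) = scw (cf (i, 0) u) (P1 (X i))"
      unfolding bz by (subst sum.lessThan_Suc_shift) (simp only: s sum.neutral_const, simp)
    also have "\<dots> = (if i < n1 + n2 then if i < n1 then 0 else scw (cf (i, 0) u) (PX i) else 0)"
      using cf_K2[OF u i, of 0] P1_ker[OF X_D[OF i]] X_K1[of i] by (auto simp: block_size_def PX_def)
    finally show "(\<Sum>j<block_size n1 n2 i. scw (cf (i, j) u) (P1 ((d ^^ j) (X i)))) =
       (if i < n1 + n2 then if i < n1 then 0 else scw (cf (i, 0) u) (PX i) else 0)" .
  qed
  finally show ?thesis unfolding split_sum .
qed

definition ssc :: "nat \<Rightarrow> nat \<Rightarrow> nat \<Rightarrow> 'k"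
  where "ssc i j k = (if block_parity n1 k \<noteq> block_parity n1 i + block_parity n1 j then 0
     else if block_parity n1 i = 1 \<and> block_parity n1 j = 1 then cf (k, 0) (- mul (X i) (d (X j)) + mul (d (X i)) (X j))
     else cf (k, 0) (mul (X i) (X j)))"

text \<open>The structure constants are coordinates of an actual bracket, and
  \<open>P0_expand\<close> or \<open>P1_expand\<close> reassembles them. After that the
  decomposition enters only through the vectors \<open>PX\<close>, which is why the resulting
  algebra does not depend on it.\<close>

lemma ssc_sum:
  assumes i: "i < n1 + n2" and j: "j < n1 + n2"
  shows "(\<Sum>k<n1 + n2. scw (ssc i j k) (PX k)) = mulW (PX i) (PX j)"
proof -
  have D: "X i \<in> D" "X j \<in> D" using X_D i j by auto
  note K2 = X_K2[OF i] X_K2[OF j]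
  consider "i < n1" "j < n1" | "i < n1" "\<not> j < n1" | "\<not> i < n1" "j < n1" | "\<not> i < n1" "\<not> j < n1" by blast
  then show ?thesis
  proof cases
    case 1
    note c = compat00[OF D(1) X_K1[OF 1(1)] D(2) X_K1[OF 1(2)]]
    have "(\<Sum>k<n1 + n2. scw (ssc i j k) (PX k)) = P0 (mul (X i) (X j))"
      using c 1 by (subst P0_expand) (auto simp: ssc_def block_parity_def intro!: sum.cong)
    then show ?thesis using c 1 by (simp add: PX_def)
  next
    case 2
    note c = compat01[OF D(1) X_K1[OF 2(1)] D(2) K2(2)]
    have "(\<Sum>k<n1 + n2. scw (ssc i j k) (PX k)) = P1 (mul (X i) (X j))"
      using c 2 by (subst P1_expand) (auto simp: ssc_def block_parity_def intro!: sum.cong)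
    then show ?thesis using c 2 by (simp add: PX_def)
  next
    case 3
    note c = compat10[OF D(2) X_K1[OF 3(2)] D(1) K2(1)]
    have "(\<Sum>k<n1 + n2. scw (ssc i j k) (PX k)) = P1 (mul (X i) (X j))"
      using c 3 by (subst P1_expand) (auto simp: ssc_def block_parity_def intro!: sum.cong)
    then show ?thesis using c 3 by (simp add: PX_def)
  next
    case 4
    note c = compat11[OF D(1) K2(1) D(2) K2(2)]
    have "(\<Sum>k<n1 + n2. scw (ssc i j k) (PX k)) = P0 (- mul (X i) (d (X j)) + mul (d (X i)) (X j))"
      using c 4 by (subst P0_expand) (auto simp: ssc_def block_parity_def intro!: sum.cong)
    then show ?thesis using c 4 by (simp add: PX_def)
  qed
qed

definition phi :: "(nat \<Rightarrow> 'k) \<Rightarrow> 'w" where "phi v = (\<Sum>k<n1 + n2. scw (v k) (PX k))"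

lemma phi_add: "phi (\<lambda>i. v i + w i) = phi v + phi w"
  by (simp add: phi_def W.scale_left_distrib sum.distrib)
lemma phi_scale: "phi (\<lambda>i. c * v i) = scw c (phi v)"
  by (simp add: phi_def W.scale_sum_right)

lemma phi_mult:
  "phi (\<lambda>k. if k < n1 + n2 then \<Sum>i<n1 + n2. \<Sum>j<n1 + n2. v i * w j * ssc i j k else 0) = mulW (phi v) (phi w)"
proof -
  have "phi (\<lambda>k. if k < n1 + n2 then \<Sum>i<n1 + n2. \<Sum>j<n1 + n2. v i * w j * ssc i j k else 0) =
     (\<Sum>k<n1 + n2. \<Sum>i<n1 + n2. \<Sum>j<n1 + n2. scw (v i * w j) (scw (ssc i j k) (PX k)))"
    by (simp add: phi_def W.scale_sum_left)
  also have "\<dots> = (\<Sum>i<n1 + n2. \<Sum>k<n1 + n2. \<Sum>j<n1 + n2. scw (v i * w j) (scw (ssc i j k) (PX k)))"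
    by (rule sum.swap)
  also have "\<dots> = (\<Sum>i<n1 + n2. \<Sum>j<n1 + n2. \<Sum>k<n1 + n2. scw (v i * w j) (scw (ssc i j k) (PX k)))"
    by (intro sum.cong refl sum.swap)
  also have "\<dots> = (\<Sum>i<n1 + n2. \<Sum>j<n1 + n2. scw (v i * w j) (mulW (PX i) (PX j)))"
    unfolding W.scale_sum_right[symmetric] by (intro sum.cong refl arg_cong2[where f = scw] ssc_sum) auto
  also have "\<dots> = mulW (phi v) (phi w)"
    by (simp add: phi_def mulW_sum mulW_scale W.scale_sum_right) (subst sum.swap, simp add: mult.commute)
  finally show ?thesis .
qed

definition lc :: "(nat \<Rightarrow> bool) \<Rightarrow> (nat \<Rightarrow> 'k) \<Rightarrow> 'd" where "lc Q v = (\<Sum>k<n1 + n2. sc (if Q k then v k else 0) (X k))"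

lemma lc_D: "lc Q v \<in> D"
  unfolding lc_def by (intro subspace_sum[OF D_sub] subspace_scale[OF D_sub]) (auto intro: X_D)

lemma lc_cf: "k < n1 + n2 \<Longrightarrow> cf (k, 0) (lc Q v) = (if Q k then v k else 0)"
proof -
  assume k: "k < n1 + n2"
  let ?c = "\<lambda>p. if snd p = 0 \<and> fst p < n1 + n2 \<and> Q (fst p) then v (fst p) else 0"
  have "lc Q v = (\<Sum>i<n1 + n2 + n3. if i < n1 + n2 then sc (if Q i then v i else 0) (X i) else 0)"
    unfolding lc_def by (rule sum.mono_neutral_cong_left) auto
  also have "\<dots> = (\<Sum>i<n1 + n2 + n3. \<Sum>j<block_size n1 n2 i. sc (?c (i, j)) (bs (i, j)))"
  proof (rule sum.cong[OF refl])
    fix i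
    obtain s where bz: "block_size n1 n2 i = Suc s" by (cases "block_size n1 n2 i") (auto simp: block_size_def split: if_splits)
    show "(if i < n1 + n2 then sc (if Q i then v i else 0) (X i) else 0) = (\<Sum>j<block_size n1 n2 i. sc (?c (i, j)) (bs (i, j)))"
      unfolding bz by (subst sum.lessThan_Suc_shift) auto
  qed
  finally have eq: "lc Q v = (\<Sum>p\<in>pos. sc (?c p) (bs p))" by (simp add: pos_sum)
  show ?thesis using cf_unique[OF lc_D eq, of "(k, 0)"] k
    by (cases "Q k") (simp_all add: block_positions_mem block_size_def)
qed

lemma lc_K: "d (lc (\<lambda>k. k < n1) v) = 0" "d (d (lc Q v)) = 0"
  unfolding lc_def d_sum d_scale by (auto intro!: sum.neutral simp: X_K1 X_K2)

lemma phi_even: "P0 (lc (\<lambda>k. k < n1) v) = (\<Sum>k<n1 + n2. if k < n1 then scw (v k) (PX k) else 0)"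
  by (subst P0_expand[OF lc_D lc_K(1)]) (auto simp: lc_cf intro!: sum.cong)

lemma phi_odd: "P1 (lc (\<lambda>k. \<not> k < n1) v) = (\<Sum>k<n1 + n2. if k < n1 then 0 else scw (v k) (PX k))"
  by (subst P1_expand[OF lc_D lc_K(2)]) (auto simp: lc_cf intro!: sum.cong)

lemma phi_split: "phi v = P0 (lc (\<lambda>k. k < n1) v) + P1 (lc (\<lambda>k. \<not> k < n1) v)"
  unfolding phi_even phi_odd phi_def sum.distrib[symmetric] by (intro sum.cong) auto

lemma even_Me: "P0 (lc (\<lambda>k. k < n1) v) \<in> Me" unfolding Me_eq using lc_D lc_K(1) by blast
lemma odd_Mo: "P1 (lc Q v) \<in> Mo" unfolding Mo_eq using lc_D lc_K(2) by blast

lemma Me_Mo_sub: "W.subspace Me" "W.subspace Mo"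
proof -
  have z: "P0 0 = 0" "P1 0 = 0" using P_scale[of 0 0] by simp_all
  show "W.subspace Me"
  proof (rule W.subspaceI)
    show "0 \<in> Me" unfolding Me_eq by (rule image_eqI[of _ _ 0]) (simp_all add: z subspace_0[OF D_sub])
    fix x y c assume "x \<in> Me"
    then obtain u where u: "u \<in> D" "d u = 0" "x = P0 u" unfolding Me_eq by blast
    show "scw c x \<in> Me" unfolding Me_eq
      by (rule image_eqI[of _ _ "sc c u"]) (simp_all add: u P_scale subspace_scale[OF D_sub] d_scale)
    assume "y \<in> Me"
    then obtain w where w: "w \<in> D" "d w = 0" "y = P0 w" unfolding Me_eq by blast
    show "x + y \<in> Me" unfolding Me_eq
      by (rule image_eqI[of _ _ "u + w"]) (simp_all add: u w P_add subspace_add[OF D_sub] d_add)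
  qed
  show "W.subspace Mo"
  proof (rule W.subspaceI)
    show "0 \<in> Mo" unfolding Mo_eq by (rule image_eqI[of _ _ 0]) (simp_all add: z subspace_0[OF D_sub])
    fix x y c assume "x \<in> Mo"
    then obtain u where u: "u \<in> D" "d (d u) = 0" "x = P1 u" unfolding Mo_eq by blast
    show "scw c x \<in> Mo" unfolding Mo_eq
      by (rule image_eqI[of _ _ "sc c u"]) (simp_all add: u P_scale subspace_scale[OF D_sub] d_scale)
    assume "y \<in> Mo"
    then obtain w where w: "w \<in> D" "d (d w) = 0" "y = P1 w" unfolding Mo_eq by blast
    show "x + y \<in> Mo" unfolding Mo_eq
      by (rule image_eqI[of _ _ "u + w"]) (simp_all add: u w P_add subspace_add[OF D_sub] d_add)
  qed
qed

lemma Me_Mo_unique: "a \<in> Me \<Longrightarrow> b \<in> Mo \<Longrightarrow> a + b = 0 \<Longrightarrow> a = 0 \<and> b = 0"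
proof -
  assume ab: "a \<in> Me" "b \<in> Mo" "a + b = 0"
  then have "a = - b" by (simp add: eq_neg_iff_add_eq_0)
  then have "a \<in> Me \<inter> Mo" using ab W.subspace_neg[OF Me_Mo_sub(2)] by simp
  then show ?thesis using MeMo ab by simp
qed

text \<open>By \<open>P0_zero\<close> and \<open>P1_zero\<close> the even combination of tops is an
  image of \<open>d\<close> and the odd one lies in \<open>Ker d + Im d\<close>. Neither has a
  coefficient at the top in question: an image of \<open>d\<close> has none at any top, and a kernel
  element has none at the top of a block of size 2.\<close>

lemma phi_zero:
  assumes "phi v = 0" "k < n1 + n2"
  shows "v k = 0"
proof -
  have z: "P0 (lc (\<lambda>k. k < n1) v) = 0" "P1 (lc (\<lambda>k. \<not> k < n1) v) = 0"
    using Me_Mo_unique[OF even_Me odd_Mo] assms(1) unfolding phi_split by blast+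
  have k0: "(k, 0) \<in> pos" using assms(2) by (simp add: block_positions_mem block_size_def)
  show ?thesis
  proof (cases "k < n1")
    case True
    obtain w where w: "w \<in> D" "lc (\<lambda>k. k < n1) v = d w" using P0_zero[OF lc_D lc_K(1) z(1)] by blast
    have "v k = cf (k, 0) (d w)" using lc_cf[OF assms(2), of "\<lambda>k. k < n1" v] True w by simp
    then show ?thesis using cf_d[OF w(1) k0] by simp
  next
    case False
    obtain q w where w: "q \<in> D" "w \<in> D" "d q = 0" "lc (\<lambda>k. \<not> k < n1) v = q + d w" using P1_zero[OF lc_D lc_K(2) z(2)] by blast
    have "v k = cf (k, 0) (q + d w)" using lc_cf[OF assms(2), of "\<lambda>k. \<not> k < n1" v] False w by simp
    also have "\<dots> = cf (k, 0) q" using cf_add[OF w(1) d_D[OF w(2)] k0] cf_d[OF w(2) k0] by simp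
    also have "\<dots> = 0" using cf_K1[OF w(1,3), of k 0] False assms(2) by (simp add: block_size_def)
    finally show ?thesis .
  qed
qed

lemma phi_Me: "{phi v | v. \<forall>i. v i \<noteq> 0 \<longrightarrow> i < n1 + n2 \<and> block_parity n1 i = 0} = Me"
proof (intro equalityI subsetI)
  fix x assume "x \<in> {phi v | v. \<forall>i. v i \<noteq> 0 \<longrightarrow> i < n1 + n2 \<and> block_parity n1 i = 0}"
  then obtain v where v: "x = phi v" "\<forall>i. v i \<noteq> 0 \<longrightarrow> i < n1 + n2 \<and> block_parity n1 i = 0" by blast
  have "phi v = P0 (lc (\<lambda>k. k < n1) v)"
    unfolding phi_even phi_def using v(2) by (intro sum.cong) (auto simp: block_parity_def)
  then show "x \<in> Me" using even_Me v(1) by simp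
next
  fix x assume "x \<in> Me"
  then obtain u where u: "u \<in> D" "d u = 0" "x = P0 u" unfolding Me_eq by blast
  have "x = phi (\<lambda>k. if k < n1 then cf (k, 0) u else 0)"
    unfolding u(3) P0_expand[OF u(1,2)] phi_def by (intro sum.cong) auto
  then show "x \<in> {phi v | v. \<forall>i. v i \<noteq> 0 \<longrightarrow> i < n1 + n2 \<and> block_parity n1 i = 0}"
    by (intro CollectI exI[of _ "\<lambda>k. if k < n1 then cf (k, 0) u else 0"]) (auto simp: block_parity_def)
qed

lemma phi_Mo: "{phi v | v. \<forall>i. v i \<noteq> 0 \<longrightarrow> i < n1 + n2 \<and> block_parity n1 i = 1} = Mo"
proof (intro equalityI subsetI)
  fix x assume "x \<in> {phi v | v. \<forall>i. v i \<noteq> 0 \<longrightarrow> i < n1 + n2 \<and> block_parity n1 i = 1}"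
  then obtain v where v: "x = phi v" "\<forall>i. v i \<noteq> 0 \<longrightarrow> i < n1 + n2 \<and> block_parity n1 i = 1" by blast
  have "phi v = P1 (lc (\<lambda>k. \<not> k < n1) v)"
    unfolding phi_odd phi_def using v(2) by (intro sum.cong) (auto simp: block_parity_def split: if_splits)
  then show "x \<in> Mo" using odd_Mo v(1) by simp
next
  fix x assume "x \<in> Mo"
  then obtain u where u: "u \<in> D" "d (d u) = 0" "x = P1 u" unfolding Mo_eq by blast
  have "x = phi (\<lambda>k. if k < n1 \<or> \<not> k < n1 + n2 then 0 else cf (k, 0) u)"
    unfolding u(3) P1_expand[OF u(1,2)] phi_def by (intro sum.cong) auto
  then show "x \<in> {phi v | v. \<forall>i. v i \<noteq> 0 \<longrightarrow> i < n1 + n2 \<and> block_parity n1 i = 1}"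
    by (intro CollectI exI[of _ "\<lambda>k. if k < n1 \<or> \<not> k < n1 + n2 then 0 else cf (k, 0) u"]) (auto simp: block_parity_def)
qed

lemma phi_image: "phi ` {v. \<forall>i\<ge>n1 + n2. v i = 0} = {a + b | a b. a \<in> Me \<and> b \<in> Mo}"
proof (intro equalityI subsetI)
  fix x assume "x \<in> phi ` {v. \<forall>i\<ge>n1 + n2. v i = 0}"
  then show "x \<in> {a + b | a b. a \<in> Me \<and> b \<in> Mo}" using phi_split even_Me odd_Mo by blast
next
  fix x assume "x \<in> {a + b | a b. a \<in> Me \<and> b \<in> Mo}"
  then obtain a b where ab: "a \<in> Me" "b \<in> Mo" "x = a + b" by blast
  obtain v where v: "a = phi v" "\<forall>i. v i \<noteq> 0 \<longrightarrow> i < n1 + n2 \<and> block_parity n1 i = 0" using ab(1) phi_Me by blast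
  obtain w where w: "b = phi w" "\<forall>i. w i \<noteq> 0 \<longrightarrow> i < n1 + n2 \<and> block_parity n1 i = 1" using ab(2) phi_Mo by blast
  have "x = phi (\<lambda>i. v i + w i)" by (simp add: phi_add ab v w)
  moreover have "\<forall>i\<ge>n1 + n2. v i + w i = 0" using v w by (metis add_0 not_less)
  ultimately show "x \<in> phi ` {v. \<forall>i\<ge>n1 + n2. v i = 0}" by blast
qed

lemma phi_inj: "inj_on phi {v. \<forall>i\<ge>n1 + n2. v i = 0}"
proof
  fix v w assume v: "v \<in> {v. \<forall>i\<ge>n1 + n2. v i = 0}" and w: "w \<in> {v. \<forall>i\<ge>n1 + n2. v i = 0}" and e: "phi v = phi w"
  have "phi (\<lambda>i. v i + - 1 * w i) = 0" unfolding phi_add phi_scale using e by simp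
  then have "v i + - 1 * w i = 0" if "i < n1 + n2" for i using phi_zero[of "\<lambda>i. v i + - 1 * w i" i] that by simp
  then show "v = w" using v w by (intro ext) (metis (mono_tags, lifting) add_eq_0_iff linorder_not_less mem_Collect_eq minus_minus mult_minus1)
qed

end
end

text \<open>\<open>\<psi>\<close> puts the record \<open>L\<close> into coordinates, while
  \<open>\<rho>\<close> leads from coordinates to the record \<open>M\<close>. With these directions
  the isomorphism is simply \<open>\<rho>\<close> after \<open>phi\<close>.\<close>

locale semisimplification_iso = semisimplification_target sc D d scw mul P0 P1 mulW Me Mo
  for sc :: "'k::field \<Rightarrow> 'd::ab_group_add \<Rightarrow> 'd" and D d
    and scw :: "'k \<Rightarrow> 'w::ab_group_add \<Rightarrow> 'w" and mul P0 P1 mulW Me Mo +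
  fixes L :: "('k, 'v) superalgebra" and dL :: "'v \<Rightarrow> 'v" and \<psi> :: "'v \<Rightarrow> 'd"
    and M :: "('k, 'm) superalgebra" and \<rho> :: "'w \<Rightarrow> 'm"
  assumes L_vs: "vectorspace class_ring L" and \<psi>_bij: "bij_betw \<psi> (carrier L) D"
    and \<psi>_add: "x \<in> carrier L \<Longrightarrow> y \<in> carrier L \<Longrightarrow> \<psi> (x \<oplus>\<^bsub>L\<^esub> y) = \<psi> x + \<psi> y"
    and \<psi>_smult: "x \<in> carrier L \<Longrightarrow> \<psi> (c \<odot>\<^bsub>L\<^esub> x) = sc c (\<psi> x)"
    and \<psi>_mult: "x \<in> carrier L \<Longrightarrow> y \<in> carrier L \<Longrightarrow> x \<otimes>\<^bsub>L\<^esub> y \<in> carrier L \<and> \<psi> (x \<otimes>\<^bsub>L\<^esub> y) = mul (\<psi> x) (\<psi> y)"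
    and dL: "x \<in> carrier L \<Longrightarrow> dL x \<in> carrier L \<and> \<psi> (dL x) = d (\<psi> x)"
    and \<rho>_bij: "bij_betw \<rho> {a + b | a b. a \<in> Me \<and> b \<in> Mo} (carrier M)"
    and \<rho>_add: "r \<in> {a + b | a b. a \<in> Me \<and> b \<in> Mo} \<Longrightarrow> r' \<in> {a + b | a b. a \<in> Me \<and> b \<in> Mo} \<Longrightarrow> \<rho> (r + r') = \<rho> r \<oplus>\<^bsub>M\<^esub> \<rho> r'"
    and \<rho>_mult: "r \<in> {a + b | a b. a \<in> Me \<and> b \<in> Mo} \<Longrightarrow> r' \<in> {a + b | a b. a \<in> Me \<and> b \<in> Mo} \<Longrightarrow> \<rho> (mulW r r') = \<rho> r \<otimes>\<^bsub>M\<^esub> \<rho> r'"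
    and \<rho>_smult: "r \<in> {a + b | a b. a \<in> Me \<and> b \<in> Mo} \<Longrightarrow> \<rho> (scw c r) = c \<odot>\<^bsub>M\<^esub> \<rho> r"
    and \<rho>_part: "part M 0 = \<rho> ` Me" "part M 1 = \<rho> ` Mo"
begin

sublocale LV: vectorspace class_ring L by (rule L_vs)

lemma \<psi>_inj: "inj_on \<psi> (carrier L)" and \<psi>_image: "\<psi> ` carrier L = D"
  using \<psi>_bij by (auto simp: bij_betw_def)

lemma \<psi>_zero: "\<psi> \<zero>\<^bsub>L\<^esub> = 0"
  using \<psi>_add[of "\<zero>\<^bsub>L\<^esub>" "\<zero>\<^bsub>L\<^esub>"] by simp

lemma \<psi>_eq_0: "x \<in> carrier L \<Longrightarrow> \<psi> x = 0 \<longleftrightarrow> x = \<zero>\<^bsub>L\<^esub>"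
  using \<psi>_inj \<psi>_zero by (metis LV.zero_closed inj_onD)

lemma \<psi>_minus: "x \<in> carrier L \<Longrightarrow> \<psi> (\<ominus>\<^bsub>L\<^esub> x) = - \<psi> x"
  using \<psi>_add[of x "\<ominus>\<^bsub>L\<^esub> x"] by (simp add: LV.r_neg \<psi>_zero eq_neg_iff_add_eq_0 add.commute)

lemma \<psi>_lincomb:
  assumes "finite B" "B \<subseteq> carrier L"
  shows "\<psi> (LinearCombinations.module.lincomb L a B) = (\<Sum>b\<in>B. sc (a b) (\<psi> b))"
  using assms
proof (induction B rule: finite_induct)
  case empty
  then show ?case by (simp add: LV.lincomb_def \<psi>_zero)
next
  case (insert b B)
  then have b: "b \<in> carrier L" "B \<subseteq> carrier L" by auto
  have "LV.lincomb a (insert b B) = (a b \<odot>\<^bsub>L\<^esub> b) \<oplus>\<^bsub>L\<^esub> LV.lincomb a B"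
    unfolding LV.lincomb_def using insert b by (subst LV.finsum_insert) auto
  moreover have "a b \<odot>\<^bsub>L\<^esub> b \<in> carrier L" "LV.lincomb a B \<in> carrier L"
    using b by (auto intro!: LV.lincomb_closed)
  ultimately show ?case using insert b by (simp add: \<psi>_add \<psi>_smult)
qed

lemma basis_iff:
  assumes "finite I" "inj_on f I" "f ` I \<subseteq> carrier L"
  shows "vectorspace.basis class_ring L (f ` I) \<longleftrightarrow> family_indep I (\<lambda>i. \<psi> (f i)) \<and> D \<subseteq> span ((\<lambda>i. \<psi> (f i)) ` I)"
proof -
  have fin: "finite (f ` I)" using assms by simp
  have lc: "\<psi> (LV.lincomb a (f ` I)) = (\<Sum>i\<in>I. sc (a (f i)) (\<psi> (f i)))" for a
    using \<psi>_lincomb[OF fin assms(3)] assms(2) by (simp add: sum.reindex)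
  have lcC: "LV.lincomb a (f ` I) \<in> carrier L" for a using assms(3) by (intro LV.lincomb_closed) auto
  have ind: "LV.lin_indpt (f ` I) \<longleftrightarrow> family_indep I (\<lambda>i. \<psi> (f i))"
  proof
    assume li: "LV.lin_indpt (f ` I)"
    show "family_indep I (\<lambda>i. \<psi> (f i))" unfolding family_indep_def
    proof (intro allI impI ballI)
      fix c i assume c: "(\<Sum>i\<in>I. sc (c i) (\<psi> (f i))) = 0" and i: "i \<in> I"
      let ?a = "\<lambda>v. c (inv_into I f v)"
      have "\<psi> (LV.lincomb ?a (f ` I)) = 0" unfolding lc using c assms(2) by (simp cong: sum.cong)
      then have z: "LV.lincomb ?a (f ` I) = \<zero>\<^bsub>L\<^esub>" using \<psi>_eq_0[OF lcC] by simp
      show "c i = 0"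
      proof (rule ccontr)
        assume "c i \<noteq> 0"
        then have "LV.lin_dep (f ` I)" unfolding LV.lin_dep_def
          using fin z i assms(2) by (intro exI[of _ "f ` I"] exI[of _ ?a] exI[of _ "f i"]) auto
        then show False using li by simp
      qed
    qed
  next
    assume fi: "family_indep I (\<lambda>i. \<psi> (f i))"
    show "LV.lin_indpt (f ` I)"
    proof
      assume "LV.lin_dep (f ` I)"
      then obtain a v where a: "LV.lincomb a (f ` I) = \<zero>\<^bsub>L\<^esub>" "v \<in> f ` I" "a v \<noteq> 0"
        using LV.finite_lin_dep[OF fin _ assms(3)] by auto
      then have "(\<Sum>i\<in>I. sc (a (f i)) (\<psi> (f i))) = 0" using lc[of a] \<psi>_zero by simp
      then show False using family_indepD[OF fi, of "\<lambda>i. a (f i)"] a by auto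
    qed
  qed
  have spn: "LV.span (f ` I) = carrier L \<longleftrightarrow> D \<subseteq> span ((\<lambda>i. \<psi> (f i)) ` I)"
  proof
    assume s: "LV.span (f ` I) = carrier L"
    show "D \<subseteq> span ((\<lambda>i. \<psi> (f i)) ` I)"
    proof
      fix v assume "v \<in> D"
      then obtain x where "x \<in> carrier L" "v = \<psi> x" using \<psi>_image by blast
      then obtain a where "v = \<psi> (LV.lincomb a (f ` I))" using s LV.finite_in_span[OF fin assms(3)] by metis
      then show "v \<in> span ((\<lambda>i. \<psi> (f i)) ` I)" unfolding lc
          by (simp only:) (intro span_sum span_scale span_base imageI)
    qed
  next
    assume s: "D \<subseteq> span ((\<lambda>i. \<psi> (f i)) ` I)"
    show "LV.span (f ` I) = carrier L"
    proof
      show "LV.span (f ` I) \<subseteq> carrier L" using LV.span_is_subset2[OF assms(3)] .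
      show "carrier L \<subseteq> LV.span (f ` I)"
      proof
        fix x assume x: "x \<in> carrier L"
        then have "\<psi> x \<in> span ((\<lambda>i. \<psi> (f i)) ` I)" using s \<psi>_image by blast
        then obtain c where c: "\<psi> x = (\<Sum>i\<in>I. sc (c i) (\<psi> (f i)))" by (rule family_span[OF assms(1)])
        let ?a = "\<lambda>v. c (inv_into I f v)"
        have "\<psi> (LV.lincomb ?a (f ` I)) = \<psi> x" unfolding lc c using assms(2) by (simp cong: sum.cong)
        then have "LV.lincomb ?a (f ` I) = x" using \<psi>_inj lcC x by (auto dest: inj_onD)
        then show "x \<in> LV.span (f ` I)" unfolding LV.finite_span[OF fin assms(3)] by auto
      qed
    qed
  qed
  show ?thesis unfolding LV.basis_def ind spn using assms(3) by blast
qed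

lemma dLj: "x \<in> carrier L \<Longrightarrow> (dL ^^ j) x \<in> carrier L \<and> \<psi> ((dL ^^ j) x) = (d ^^ j) (\<psi> x)"
  by (induction j) (auto simp: dL)

lemma jordan_iff:
  "jordan_decomposition L dL n1 n2 n3 x \<longleftrightarrow> (\<forall>i<n1 + n2 + n3. x i \<in> carrier L) \<and> decomposition n1 n2 n3 (\<lambda>i. \<psi> (x i))"
proof -
  let ?f = "\<lambda>(i, j). (dL ^^ j) (x i)" and ?P = "block_positions n1 n2 n3"
  have c: "\<forall>i<n1 + n2 + n3. x i \<in> carrier L" if "jordan_decomposition L dL n1 n2 n3 x"
  proof (intro allI impI)
    fix i assume i: "i < n1 + n2 + n3"
    have "?f ` ?P \<subseteq> carrier L" using that by (auto simp: jordan_decomposition_def LV.basis_def jordan_basis_def)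
    moreover have "(i, 0) \<in> ?P" using i by (simp add: block_positions_mem block_size_def)
    ultimately show "x i \<in> carrier L" by (force simp: image_subset_iff)
  qed
  have "jordan_decomposition L dL n1 n2 n3 x \<longleftrightarrow> decomposition n1 n2 n3 (\<lambda>i. \<psi> (x i))"
    if x: "\<forall>i<n1 + n2 + n3. x i \<in> carrier L"
  proof -
    have fC: "?f ` ?P \<subseteq> carrier L" using x dLj by (auto simp: block_positions_mem)
    have \<psi>f: "\<psi> (?f p) = (case p of (i, j) \<Rightarrow> (d ^^ j) (\<psi> (x i)))" if "p \<in> ?P" for p
      using that x dLj by (cases p) (simp add: block_positions_mem)
    have fi: "family_indep ?P (\<lambda>p. \<psi> (?f p)) \<longleftrightarrow> family_indep ?P (\<lambda>(i, j). (d ^^ j) (\<psi> (x i)))"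
      unfolding family_indep_def using \<psi>f by (simp cong: sum.cong)
    have im: "(\<lambda>p. \<psi> (?f p)) ` ?P = (\<lambda>(i, j). (d ^^ j) (\<psi> (x i))) ` ?P"
      using \<psi>f by (rule image_cong[OF refl])
    have top: "(\<forall>i<n1 + n2 + n3. (dL ^^ block_size n1 n2 i) (x i) = \<zero>\<^bsub>L\<^esub>) \<longleftrightarrow>
        (\<forall>i<n1 + n2 + n3. \<psi> (x i) \<in> D \<and> (d ^^ block_size n1 n2 i) (\<psi> (x i)) = 0)"
      using x dLj \<psi>_eq_0 \<psi>_image by (metis image_eqI)
    have inj: "inj_on ?f ?P" if "family_indep ?P (\<lambda>p. \<psi> (?f p))"
      using family_indep_inj[OF finite_block_positions that] by (auto simp: inj_on_def)
    show ?thesis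
    proof
      assume j: "jordan_decomposition L dL n1 n2 n3 x"
      then have i: "inj_on ?f ?P" and b: "vectorspace.basis class_ring L (?f ` ?P)"
        by (simp_all add: jordan_decomposition_def jordan_basis_def)
      from b have "family_indep ?P (\<lambda>p. \<psi> (?f p))" "D \<subseteq> span ((\<lambda>p. \<psi> (?f p)) ` ?P)"
        unfolding basis_iff[OF finite_block_positions i fC] by blast+
      then show "decomposition n1 n2 n3 (\<lambda>i. \<psi> (x i))"
        using j top unfolding decomposition_def fi im jordan_decomposition_def by blast
    next
      assume dc: "decomposition n1 n2 n3 (\<lambda>i. \<psi> (x i))"
      then have f: "family_indep ?P (\<lambda>p. \<psi> (?f p))" and s: "D \<subseteq> span ((\<lambda>p. \<psi> (?f p)) ` ?P)"
        unfolding decomposition_def fi im by blast+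
      have "vectorspace.basis class_ring L (?f ` ?P)"
        unfolding basis_iff[OF finite_block_positions inj[OF f] fC] using f s by blast
      then show "jordan_decomposition L dL n1 n2 n3 x"
        using inj[OF f] top dc unfolding jordan_decomposition_def jordan_basis_def decomposition_def by blast
    qed
  qed
  then show ?thesis using c by blast
qed

lemma jordan_exists:
  assumes "\<And>x. x \<in> D \<Longrightarrow> d (d (d x)) = 0" "finite F" "D \<subseteq> span F"
  shows "\<exists>n1 n2 n3 x. jordan_decomposition L dL n1 n2 n3 x"
proof -
  obtain n1 n2 n3 X where X: "decomposition n1 n2 n3 X" using decomposition_exists[OF assms] by blast
  \<comment> \<open>Beyond the last index the vector 0 is substituted. It lies in the range of
    \<open>\<psi>\<close>, so \<open>inv_into\<close> returns a true preimage for every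
    \<open>i\<close>.\<close>
  define x where "x i = inv_into (carrier L) \<psi> (if i < n1 + n2 + n3 then X i else 0)" for i
  have XD: "(if i < n1 + n2 + n3 then X i else 0) \<in> \<psi> ` carrier L" for i
    using X subspace_0[OF D_sub] unfolding \<psi>_image decomposition_def by simp
  then have x: "x i \<in> carrier L" "\<psi> (x i) = (if i < n1 + n2 + n3 then X i else 0)" for i
    unfolding x_def by (rule inv_into_into, intro f_inv_into_f) 
  have e: "\<And>p. p \<in> block_positions n1 n2 n3 \<Longrightarrow> (case p of (i, j) \<Rightarrow> (d ^^ j) (\<psi> (x i))) = (case p of (i, j) \<Rightarrow> (d ^^ j) (X i))"
    using x(2) by (auto simp: block_positions_mem)
  have "decomposition n1 n2 n3 (\<lambda>i. \<psi> (x i))"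
  proof -
    have "family_indep (block_positions n1 n2 n3) (\<lambda>(i, j). (d ^^ j) (\<psi> (x i))) \<longleftrightarrow>
        family_indep (block_positions n1 n2 n3) (\<lambda>(i, j). (d ^^ j) (X i))"
      by (rule family_indep_cong[OF e])
    moreover have "(\<lambda>(i, j). (d ^^ j) (\<psi> (x i))) ` block_positions n1 n2 n3 = (\<lambda>(i, j). (d ^^ j) (X i)) ` block_positions n1 n2 n3"
      by (rule image_cong[OF refl e])
    ultimately show ?thesis using X x(2) unfolding decomposition_def by simp
  qed
  then show ?thesis using jordan_iff x(1) by blast
qed

lemma semisimplification_isomorphic:
  assumes "jordan_decomposition L dL n1 n2 n3 x"
  shows "sa_isomorphic (semisimplification L dL n1 n2 n3 x) M"
proof -
  let ?X = "\<lambda>i. \<psi> (x i)" and ?P = "block_positions n1 n2 n3" and ?f = "\<lambda>(i, j). (dL ^^ j) (x i)"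
  have xC: "\<And>i. i < n1 + n2 + n3 \<Longrightarrow> x i \<in> carrier L" and dec: "decomposition n1 n2 n3 ?X"
    using assms jordan_iff by blast+
  have fin: "finite (?f ` ?P)" by simp
  have fC: "?f ` ?P \<subseteq> carrier L" using xC dLj by (auto simp: block_positions_mem)
  have inj: "inj_on ?f ?P" using assms by (simp add: jordan_decomposition_def)
  have \<psi>f: "\<psi> (?f p) = (case p of (i, j) \<Rightarrow> (d ^^ j) (?X i))" if "p \<in> ?P" for p
    using that xC dLj by (cases p) (simp add: block_positions_mem)
  have bc: "basis_coefficient L (jordan_basis dL n1 n2 n3 x) (x k) v = cf n1 n2 n3 ?X (k, 0) (\<psi> v)"
    if k: "k < n1 + n2 + n3" and v: "v \<in> carrier L" for k v
  proof -
    have k0: "(k, 0) \<in> ?P" using k by (simp add: block_positions_mem block_size_def)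
    have vD: "\<psi> v \<in> D" using v \<psi>_image by blast
    have lc: "LV.lincomb a (?f ` ?P) = v \<longleftrightarrow> \<psi> v = (\<Sum>p\<in>?P. sc (a (?f p)) (case p of (i, j) \<Rightarrow> (d ^^ j) (?X i)))" for a
    proof -
      have "LV.lincomb a (?f ` ?P) \<in> carrier L" using fC by (intro LV.lincomb_closed) auto
      then have "LV.lincomb a (?f ` ?P) = v \<longleftrightarrow> \<psi> (LV.lincomb a (?f ` ?P)) = \<psi> v" using inj_on_eq_iff[OF \<psi>_inj _ v] by simp
      also have "\<psi> (LV.lincomb a (?f ` ?P)) = (\<Sum>p\<in>?P. sc (a (?f p)) (\<psi> (?f p)))"
        using \<psi>_lincomb[OF fin fC] inj by (simp add: sum.reindex)
      also have "\<dots> = (\<Sum>p\<in>?P. sc (a (?f p)) (case p of (i, j) \<Rightarrow> (d ^^ j) (?X i)))" using \<psi>f by (intro sum.cong) auto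
      finally show ?thesis by (simp only: eq_commute[of "\<psi> v"])
    qed
    have fk: "?f (k, 0) = x k" by simp
    \<comment> \<open>\<open>basis_coefficient\<close> is a definite description. The coefficient
      function \<open>a\<close> is determined only on the basis, but \<open>x k\<close> belongs to
      the basis, so its value there is unique.\<close>
    have u: "c = cf n1 n2 n3 ?X (k, 0) (\<psi> v)" if "\<exists>a. LV.lincomb a (?f ` ?P) = v \<and> a (x k) = c" for c
    proof -
      from that obtain a where a: "LV.lincomb a (?f ` ?P) = v" "a (x k) = c" by blast
      have "cf n1 n2 n3 ?X (k, 0) (\<psi> v) = a (?f (k, 0))" by (rule cf_unique[OF dec vD a(1)[unfolded lc] k0])
      then show ?thesis using a(2) by simp
    qed
    let ?a = "\<lambda>w. cf n1 n2 n3 ?X (inv_into ?P ?f w) (\<psi> v)"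
    have inv: "inv_into ?P ?f (?f p) = p" if "p \<in> ?P" for p using inj that by (rule inv_into_f_f)
    have "\<psi> v = (\<Sum>p\<in>?P. sc (?a (?f p)) (case p of (i, j) \<Rightarrow> (d ^^ j) (?X i)))"
      using cf_expand[OF dec vD] inv by (simp cong: sum.cong)
    then have "LV.lincomb ?a (?f ` ?P) = v" unfolding lc .
    moreover have "?a (x k) = cf n1 n2 n3 ?X (k, 0) (\<psi> v)" using inv[OF k0] by simp
    ultimately show ?thesis unfolding basis_coefficient_def jordan_basis_def using u by (intro the_equality) blast+
  qed
  have coord: "semisimplification_coefficient L dL n1 n2 n3 x i j k = ssc n1 n2 n3 ?X i j k"
    if "i < n1 + n2" "j < n1 + n2" "k < n1 + n2" for i j k
  proof -
    have C: "x i \<in> carrier L" "x j \<in> carrier L" using xC that by auto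
    note dC = dL[OF C(1)] dL[OF C(2)]
    have m: "x i \<otimes>\<^bsub>L\<^esub> x j \<in> carrier L" "\<psi> (x i \<otimes>\<^bsub>L\<^esub> x j) = mul (?X i) (?X j)" using \<psi>_mult C by auto
    have m1: "x i \<otimes>\<^bsub>L\<^esub> dL (x j) \<in> carrier L" "\<psi> (x i \<otimes>\<^bsub>L\<^esub> dL (x j)) = mul (?X i) (d (?X j))" using \<psi>_mult C dC by auto
    have m2: "dL (x i) \<otimes>\<^bsub>L\<^esub> x j \<in> carrier L" "\<psi> (dL (x i) \<otimes>\<^bsub>L\<^esub> x j) = mul (d (?X i)) (?X j)" using \<psi>_mult C dC by auto
    have o: "\<ominus>\<^bsub>L\<^esub> (x i \<otimes>\<^bsub>L\<^esub> dL (x j)) \<oplus>\<^bsub>L\<^esub> dL (x i) \<otimes>\<^bsub>L\<^esub> x j \<in> carrier L"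
      "\<psi> (\<ominus>\<^bsub>L\<^esub> (x i \<otimes>\<^bsub>L\<^esub> dL (x j)) \<oplus>\<^bsub>L\<^esub> dL (x i) \<otimes>\<^bsub>L\<^esub> x j) = - mul (?X i) (d (?X j)) + mul (d (?X i)) (?X j)"
      using m1 m2 by (simp_all add: \<psi>_add \<psi>_minus)
    show ?thesis unfolding semisimplification_coefficient_def ssc_def[OF dec] Let_def
      using that bc[of k] m o by simp
  qed
  let ?S = "semisimplification L dL n1 n2 n3 x"
  let ?\<phi> = "\<lambda>v. \<rho> (phi n1 n2 ?X v)"
  let ?C = "{v :: nat \<Rightarrow> 'k. \<forall>i\<ge>n1 + n2. v i = 0}" and ?M = "{a + b | a b. a \<in> Me \<and> b \<in> Mo}"
  note im = phi_image[OF dec]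
  have cS: "carrier ?S = ?C" by (simp add: semisimplification_def)
  have pM: "phi n1 n2 ?X v \<in> ?M" if "v \<in> ?C" for v using im that by blast
  have "sa_isomorphic ?S M"
    unfolding sa_isomorphic_def
  proof (intro exI[of _ ?\<phi>] conjI ballI allI)
    show "bij_betw ?\<phi> (carrier ?S) (carrier M)"
      using bij_betw_trans[of "phi n1 n2 ?X" ?C ?M \<rho> "carrier M"] phi_inj[OF dec] im \<rho>_bij
      by (simp add: cS bij_betw_def comp_def)
    show "?\<phi> \<in> LinearCombinations.module_hom class_ring ?S M"
      unfolding LinearCombinations.module_hom_def
    proof (intro CollectI conjI allI impI)
      show "?\<phi> \<in> carrier ?S \<rightarrow> carrier M" using pM \<rho>_bij by (auto simp: cS bij_betw_def)
      fix v w assume "v \<in> carrier ?S \<and> w \<in> carrier ?S"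
      then have vw: "v \<in> ?C" "w \<in> ?C" by (simp_all add: cS)
      have "v \<oplus>\<^bsub>?S\<^esub> w = (\<lambda>i. v i + w i)" by (simp add: semisimplification_def)
      then show "?\<phi> (v \<oplus>\<^bsub>?S\<^esub> w) = ?\<phi> v \<oplus>\<^bsub>M\<^esub> ?\<phi> w" using \<rho>_add[OF pM[OF vw(1)] pM[OF vw(2)]] by (simp add: phi_add[OF dec])
    next
      fix c :: 'k and v assume "c \<in> carrier class_ring \<and> v \<in> carrier ?S"
      then have v: "v \<in> ?C" by (simp add: cS)
      have "c \<odot>\<^bsub>?S\<^esub> v = (\<lambda>i. c * v i)" by (simp add: semisimplification_def)
      then show "?\<phi> (c \<odot>\<^bsub>?S\<^esub> v) = c \<odot>\<^bsub>M\<^esub> ?\<phi> v" using \<rho>_smult[OF pM[OF v]] by (simp add: phi_scale[OF dec])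
    qed
    fix v w assume "v \<in> carrier ?S" "w \<in> carrier ?S"
    then have vw: "v \<in> ?C" "w \<in> ?C" by (simp_all add: cS)
    have "v \<otimes>\<^bsub>?S\<^esub> w = (\<lambda>k. if k < n1 + n2 then \<Sum>i<n1 + n2. \<Sum>j<n1 + n2. v i * w j * ssc n1 n2 n3 ?X i j k else 0)"
      by (auto simp: semisimplification_def coord intro!: ext sum.cong)
    then show "?\<phi> (v \<otimes>\<^bsub>?S\<^esub> w) = ?\<phi> v \<otimes>\<^bsub>M\<^esub> ?\<phi> w"
      using phi_mult[OF dec, of v w] \<rho>_mult[OF pM[OF vw(1)] pM[OF vw(2)]] by simp
  next
    fix p
    have "part ?S p = {v. \<forall>i. v i \<noteq> 0 \<longrightarrow> i < n1 + n2 \<and> block_parity n1 i = p}" by (simp add: semisimplification_def)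
    then have "?\<phi> ` part ?S p = \<rho> ` {phi n1 n2 ?X v | v. \<forall>i. v i \<noteq> 0 \<longrightarrow> i < n1 + n2 \<and> block_parity n1 i = p}" by blast
    also have "\<dots> = part M p" by (cases p) (simp_all only: phi_Me[OF dec] phi_Mo[OF dec] \<rho>_part)
    finally show "?\<phi> ` part ?S p = part M p" .
  qed
  then show ?thesis .
qed

end

section \<open>Lie algebras of simply laced root lattices\<close>

locale root_lattice =
  fixes b :: "'q::ab_group_add \<Rightarrow> 'q \<Rightarrow> int"
  assumes b_add_left: "b (x + y) z = b x z + b y z"
    and b_add_right: "b x (y + z) = b x y + b x z"
    and b_pos: "x \<noteq> 0 \<Longrightarrow> b x x > 0"
    and finite_norm_one: "finite {x. b x x = 1}"
begin

definition roots :: "'q set" where "roots = {x. b x x = 1}"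
definition ip :: "'q \<Rightarrow> 'q \<Rightarrow> int" where "ip x y = b x y + b y x"
text \<open>The sign cocycle of the root lattice: multiplicative in each argument, equal to -1 at a
  pair of equal roots, and changed by \<open>(-1)^(x,y)\<close> when its arguments are exchanged.
  These are the properties that the Jacobi identity uses.\<close>

definition eps :: "'q \<Rightarrow> 'q \<Rightarrow> 'k::field" where "eps x y = (if even (b x y) then 1 else - 1)"

lemma b_zero [simp]: "b 0 x = 0" "b x 0 = 0"
  using b_add_left[of 0 0 x] b_add_right[of x 0 0] by auto

lemma b_minus [simp]: "b (- x) y = - b x y" "b x (- y) = - b x y"
  using b_add_left[of x "- x" y] b_add_right[of x y "- y"] by auto

lemma b_diff: "b (x - y) z = b x z - b y z" "b x (y - z) = b x y - b x z"
  using b_add_left[of x "- y" z] b_add_right[of x y "- z"] by auto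

lemmas b_lin = b_add_left b_add_right b_diff

lemma ip_lin: "ip (x + y) z = ip x z + ip y z" "ip x (y + z) = ip x y + ip x z"
  "ip (x - y) z = ip x z - ip y z" "ip x (y - z) = ip x y - ip x z"
  "ip (- x) y = - ip x y" "ip x (- y) = - ip x y" "ip 0 x = 0" "ip x 0 = 0"
  by (auto simp: ip_def b_lin)

lemma ip_commute: "ip x y = ip y x"
  by (simp add: ip_def)

lemma finite_roots [simp, intro]: "finite roots"
  using finite_norm_one by (simp add: roots_def)

lemma ip_self: "x \<in> roots \<Longrightarrow> ip x x = 2"
  by (simp add: roots_def ip_def)

lemma roots_minus [simp]: "- x \<in> roots \<longleftrightarrow> x \<in> roots"
  by (simp add: roots_def)

lemma zero_not_root [simp]: "0 \<notin> roots"
  by (simp add: roots_def)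

lemma add_root_iff: "x \<in> roots \<Longrightarrow> y \<in> roots \<Longrightarrow> x + y \<in> roots \<longleftrightarrow> ip x y = - 1"
  by (auto simp: roots_def ip_def b_lin)

lemma diff_root_iff: "x \<in> roots \<Longrightarrow> y \<in> roots \<Longrightarrow> x - y \<in> roots \<longleftrightarrow> ip x y = 1"
  by (auto simp: roots_def ip_def b_lin)

lemma root_neq_minus: "x \<in> roots \<Longrightarrow> x \<noteq> - x"
  using ip_self[of x] ip_lin(6)[of x x] by auto

lemma b_nonneg: "b x x \<ge> 0"
  by (cases "x = 0") (auto intro: less_imp_le b_pos)

lemma b_eq_0: "b x x = 0 \<longleftrightarrow> x = 0"
  using b_pos by fastforce

text \<open>Positivity of \<open>b\<close> at \<open>x + y\<close> and at \<open>x - y\<close>. At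
  the extreme values one of these vectors has norm zero, which gives \<open>ip_eq_m2\<close> and
  \<open>ip_eq_2\<close> below.\<close>

lemma ip_bounds:
  assumes "x \<in> roots" "y \<in> roots"
  shows "- 2 \<le> ip x y" "ip x y \<le> 2"
  using b_nonneg[of "x + y"] b_nonneg[of "x - y"] assms by (auto simp: roots_def ip_def b_lin)

lemma ip_eq_m2: "x \<in> roots \<Longrightarrow> y \<in> roots \<Longrightarrow> ip x y = - 2 \<longleftrightarrow> y = - x"
  using b_eq_0[of "x + y"] by (auto simp: roots_def ip_def b_lin add_eq_0_iff)

lemma ip_eq_2: "x \<in> roots \<Longrightarrow> y \<in> roots \<Longrightarrow> ip x y = 2 \<longleftrightarrow> y = x"
  using b_eq_0[of "x - y"] by (auto simp: roots_def ip_def b_lin)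

lemma eps_add_left: "eps (x + y) z = (eps x z * eps y z :: 'k::field)"
  by (auto simp: eps_def b_lin)
lemma eps_add_right: "eps x (y + z) = (eps x y * eps x z :: 'k::field)"
  by (auto simp: eps_def b_lin)
lemma eps_minus [simp]: "eps (- x) y = eps x y" "eps x (- y) = eps x y"
  by (auto simp: eps_def)
lemma eps_diff: "eps (x - y) z = (eps x z * eps y z :: 'k::field)" "eps x (y - z) = (eps x y * eps x z :: 'k::field)"
  by (auto simp: eps_def b_lin)
lemmas eps_lin = eps_add_left eps_add_right eps_diff

lemma eps_root [simp]: "x \<in> roots \<Longrightarrow> eps x x = - 1"
  by (simp add: eps_def roots_def)

lemma eps_sq [simp]: "eps x y * eps x y = 1" "eps x y * (eps x y * z) = z"
  by (auto simp: eps_def)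

lemma eps_nonzero [simp]: "eps x y \<noteq> 0"
  by (simp add: eps_def)

lemma eps_swap: "eps y x = (if even (ip x y) then eps x y else - eps x y)"
  by (auto simp: eps_def ip_def)

end

text \<open>The Cartan space is kept abstract, because several of them occur with the same root
  system. Only the pairing of the coroots \<open>hm\<close> with the weights \<open>wt\<close> is
  prescribed; the coroots may be dependent, as they are for the adjoint Cartan space of E6 in
  characteristic 3.\<close>

locale lattice_lie = root_lattice b + vector_space sc
  for b :: "'q::ab_group_add \<Rightarrow> 'q \<Rightarrow> int"
    and sc :: "'k::field \<Rightarrow> 'h::ab_group_add \<Rightarrow> 'h" +
  fixes hm :: "'q \<Rightarrow> 'h" and wt :: "'q \<Rightarrow> 'h \<Rightarrow> 'k"
  assumes hm_add: "hm (x + y) = hm x + hm y"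
    and wt_add: "wt (x + y) h = wt x h + wt y h"
    and wt_add2: "wt x (h + h') = wt x h + wt x h'"
    and wt_scale: "wt x (sc c h) = c * wt x h"
    and wt_hm: "wt x (hm y) = of_int (ip x y)"
begin

definition sca :: "'k \<Rightarrow> 'h \<times> ('q \<Rightarrow> 'k) \<Rightarrow> 'h \<times> ('q \<Rightarrow> 'k)"
  where "sca c x = (sc c (fst x), \<lambda>q. c * snd x q)"

text \<open>Coefficients are functions on the whole lattice. \<open>br\<close> reads only their
  values at roots and its result is supported on roots, so identities can be tested on
  \<open>Hh h\<close> and \<open>Ee r\<close>. The minus sign in the Cartan part is
  \<open>eps r (- r)\<close>.\<close>

definition br :: "'h \<times> ('q \<Rightarrow> 'k) \<Rightarrow> 'h \<times> ('q \<Rightarrow> 'k) \<Rightarrow> 'h \<times> ('q \<Rightarrow> 'k)"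
  where "br x y =
    (\<Sum>r\<in>roots. sc (- (snd x r * snd y (- r))) (hm r),
     \<lambda>q. if q \<in> roots then wt q (fst x) * snd y q - wt q (fst y) * snd x q +
            (\<Sum>r | r \<in> roots \<and> q - r \<in> roots. eps r (q - r) * snd x r * snd y (q - r))
          else 0)"

definition Hh :: "'h \<Rightarrow> 'h \<times> ('q \<Rightarrow> 'k)" where "Hh h = (h, 0)"
definition Ee :: "'q \<Rightarrow> 'h \<times> ('q \<Rightarrow> 'k)" where "Ee r = (0, \<lambda>q. if q = r then 1 else 0)"

lemma hm_zero [simp]: "hm 0 = 0"
  using hm_add[of 0 0] by simp
lemma hm_minus [simp]: "hm (- x) = - hm x"
  using hm_add[of x "- x"] by (simp add: eq_neg_iff_add_eq_0 add.commute)
lemma wt_zero [simp]: "wt 0 h = 0" "wt x 0 = 0"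
  by (metis add_0 add_cancel_right_left wt_add, metis add_0 add_cancel_right_left wt_add2)
lemma wt_minus [simp]: "wt (- x) h = - wt x h" "wt x (- h) = - wt x h"
  using wt_add[of x "- x" h] wt_add2[of x h "- h"] by (auto simp: eq_neg_iff_add_eq_0 add.commute)
lemma wt_diff: "wt (x - y) h = wt x h - wt y h" "wt x (h - h') = wt x h - wt x h'"
  using wt_add[of x "- y" h] wt_add2[of x h "- h'"] by auto
sublocale V: vector_space sca
  by standard (auto simp: sca_def algebra_simps plus_fun_def)

lemma br_add_left: "br (x + y) z = br x z + br y z"
  by (auto simp: br_def plus_fun_def algebra_simps sum.distrib wt_add2 sum_negf sum_subtractf)

lemma br_add_right: "br x (y + z) = br x y + br x z"
  by (auto simp: br_def plus_fun_def algebra_simps sum.distrib wt_add2 sum_negf sum_subtractf)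

lemma br_scale_left: "br (sca c x) y = sca c (br x y)"
  by (auto simp: br_def sca_def algebra_simps wt_scale sum_distrib_left scale_sum_right)

lemma br_scale_right: "br x (sca c y) = sca c (br x y)"
  by (auto simp: br_def sca_def algebra_simps wt_scale sum_distrib_left scale_sum_right)

lemma br_zero [simp]: "br 0 x = 0" "br x 0 = 0"
  using br_add_left[of 0 0 x] br_add_right[of x 0 0] by auto
lemma br_minus [simp]: "br (- x) y = - br x y" "br x (- y) = - br x y"
  using br_add_left[of x "- x" y] br_add_right[of x y "- y"]
  by (auto simp: eq_neg_iff_add_eq_0 add.commute)
lemma br_diff: "br (x - y) z = br x z - br y z" "br x (y - z) = br x y - br x z"
  using br_add_left[of x "- y" z] br_add_right[of x y "- z"] by auto
lemmas br_lin = br_add_left br_add_right br_diff br_scale_left br_scale_right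

lemma br_HH: "br (Hh h) (Hh h') = 0"
  by (simp add: br_def Hh_def zero_prod_def fun_eq_iff)

lemma br_HE: "r \<in> roots \<Longrightarrow> br (Hh h) (Ee r) = sca (wt r h) (Ee r)"
  by (auto simp: br_def Hh_def Ee_def sca_def fun_eq_iff)

lemma br_EH: "r \<in> roots \<Longrightarrow> br (Ee r) (Hh h) = - sca (wt r h) (Ee r)"
  by (auto simp: br_def Hh_def Ee_def sca_def fun_eq_iff)

lemma br_EE:
  assumes r: "r \<in> roots" "s \<in> roots"
  shows "br (Ee r) (Ee s) =
    (if ip r s = - 1 then sca (eps r s) (Ee (r + s)) else if s = - r then - Hh (hm r) else 0)"
proof -
  have "fst (br (Ee r) (Ee s)) = (\<Sum>t\<in>roots. if t = r then (if - t = s then - hm t else 0) else 0)"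
    unfolding br_def Ee_def fst_conv snd_conv by (rule sum.cong) auto
  also have "\<dots> = (if s = - r then - hm r else 0)"
    using r by (auto simp: sum.delta)
  finally have 1: "fst (br (Ee r) (Ee s)) = (if s = - r then - hm r else 0)" .
  have "snd (br (Ee r) (Ee s)) q = (if q = r + s \<and> ip r s = - 1 then eps r s else 0)" for q
  proof (cases "q \<in> roots")
    case True
    have "(\<Sum>t | t \<in> roots \<and> q - t \<in> roots. eps t (q - t) * snd (Ee r) t * snd (Ee s) (q - t))
       = (\<Sum>t | t \<in> roots \<and> q - t \<in> roots. if t = r then if q - t = s then eps t s else 0 else 0 :: 'k)"
      unfolding Ee_def snd_conv by (rule sum.cong) auto
    also have "\<dots> = (if q = r + s then eps r s else 0)"
      using r by (auto simp: sum.delta' sum.delta)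
    finally show ?thesis using True r add_root_iff[OF r] by (auto simp: br_def Ee_def)
  next
    case False
    then show ?thesis using add_root_iff[OF r] by (auto simp: br_def)
  qed
  then have 2: "snd (br (Ee r) (Ee s)) = (\<lambda>q. if q = r + s \<and> ip r s = - 1 then eps r s else 0)" by auto
  have 3: "s = - r \<Longrightarrow> ip r s \<noteq> - 1" using r ip_self by (auto simp: ip_lin)
  show ?thesis using 1 2 3
    by (auto simp: prod_eq_iff Ee_def Hh_def sca_def fun_eq_iff)
qed

definition rs :: "'h \<times> ('q \<Rightarrow> 'k) \<Rightarrow> 'h \<times> ('q \<Rightarrow> 'k)"
  where "rs x = (fst x, \<lambda>q. if q \<in> roots then snd x q else 0)"

lemma sum_fun_apply: "(\<Sum>i\<in>I. g i) x = (\<Sum>i\<in>I. g i x)" for g :: "'i \<Rightarrow> 'x \<Rightarrow> 'k"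
  by (induction I rule: infinite_finite_induct) auto

lemma fst_sum': "fst (\<Sum>i\<in>I. g i) = (\<Sum>i\<in>I. fst (g i))" for g :: "'i \<Rightarrow> 'h \<times> ('q \<Rightarrow> 'k)"
  by (induction I rule: infinite_finite_induct) auto
lemma snd_sum': "snd (\<Sum>i\<in>I. g i) = (\<Sum>i\<in>I. snd (g i))" for g :: "'i \<Rightarrow> 'h \<times> ('q \<Rightarrow> 'k)"
  by (induction I rule: infinite_finite_induct) auto

lemma rs_decompose: "rs x = Hh (fst x) + (\<Sum>r\<in>roots. sca (snd x r) (Ee r))"
  by (auto simp: rs_def Hh_def Ee_def sca_def prod_eq_iff fst_sum' snd_sum' sum_fun_apply fun_eq_iff
      if_distrib cong: if_cong)

lemma br_rs: "br (rs x) y = br x y" "br x (rs y) = br x y"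
  by (auto simp: br_def rs_def intro!: sum.cong)

lemma linear_vanish:
  assumes "\<And>x y. F (x + y) = F x + F y" "\<And>c x. F (sca c x) = sca c (F x)"
    and "\<And>h. F (Hh h) = 0" "\<And>r. r \<in> roots \<Longrightarrow> F (Ee r) = (0 :: 'h \<times> ('q \<Rightarrow> 'k))"
  shows "F (rs x) = 0"
proof -
  have z: "F 0 = 0" using assms(1)[of 0 0] by simp
  have "F (\<Sum>r\<in>roots. sca (snd x r) (Ee r)) = 0"
  proof -
    have "finite R \<Longrightarrow> R \<subseteq> roots \<Longrightarrow> F (\<Sum>r\<in>R. sca (snd x r) (Ee r)) = 0" for R
      by (induction R rule: finite_induct) (auto simp: assms z)
    then show ?thesis by auto
  qed
  then show ?thesis by (simp add: rs_decompose assms)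
qed

lemma br_antisym: "br x y = - br y x"
proof -
  have EE: "br (Ee r) (Ee s) + br (Ee s) (Ee r) = 0" if rs: "r \<in> roots" "s \<in> roots" for r s
  proof -
    have e: "eps s r = (if even (ip r s) then eps r s else - eps r s :: 'k)" by (rule eps_swap)
    show ?thesis using rs by (auto simp: br_EE ip_commute[of s r] add.commute[of s r] e Hh_def zero_prod_def[symmetric])
  qed
  have "br (rs x) y + br y (rs x) = 0" for x y
  proof (rule linear_vanish[where F = "\<lambda>x. br x y + br y x"])
    fix h
    have "br (Hh h) (rs y) + br (rs y) (Hh h) = 0"
      by (rule linear_vanish[where F = "\<lambda>y. br (Hh h) y + br y (Hh h)"])
        (simp_all add: br_lin br_HH br_HE br_EH V.scale_right_distrib add_ac)
    then show "br (Hh h) y + br y (Hh h) = 0" by (simp add: br_rs)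
  next
    fix r assume r: "r \<in> roots"
    have "br (Ee r) (rs y) + br (rs y) (Ee r) = 0"
      by (rule linear_vanish[where F = "\<lambda>y. br (Ee r) y + br y (Ee r)"])
        (simp_all add: br_lin br_HH br_HE br_EH r EE V.scale_right_distrib add_ac)
    then show "br (Ee r) y + br y (Ee r) = 0" by (simp add: br_rs)
  qed (simp_all add: br_lin V.scale_right_distrib add_ac)
  then show ?thesis unfolding br_rs by (metis eq_neg_iff_add_eq_0)
qed

definition jac :: "'h \<times> ('q \<Rightarrow> 'k) \<Rightarrow> 'h \<times> ('q \<Rightarrow> 'k) \<Rightarrow> 'h \<times> ('q \<Rightarrow> 'k) \<Rightarrow> 'h \<times> ('q \<Rightarrow> 'k)"
  where "jac x y z = br x (br y z) - br (br x y) z - br y (br x z)"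

text \<open>Antisymmetry of the bracket makes the Jacobiator alternating, so triples of basis
  vectors have to be treated only up to order.\<close>

lemma jac_swap: "jac y x z = - jac x y z" "jac x z y = - jac x y z"
proof -
  show "jac y x z = - jac x y z"
    unfolding jac_def using br_antisym[of y x] by (auto simp: algebra_simps)
  show "jac x z y = - jac x y z"
    unfolding jac_def using br_antisym[of z y] br_antisym[of "br x z" y] br_antisym[of z "br x y"]
    by (auto simp: algebra_simps)
qed

lemma jac_cyc: "jac x y z = jac y z x"
  by (metis jac_swap minus_minus)

lemma wt_br_EE:
  "r \<in> roots \<Longrightarrow> s \<in> roots \<Longrightarrow> br (Hh h) (br (Ee r) (Ee s)) = sca (wt r h + wt s h) (br (Ee r) (Ee s))"
  by (auto simp: br_EE br_lin br_HE br_HH add_root_iff wt_add)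

lemma jac_HEE: "r \<in> roots \<Longrightarrow> s \<in> roots \<Longrightarrow> jac (Hh h) (Ee r) (Ee s) = 0"
  by (simp add: jac_def wt_br_EE br_HE br_lin V.scale_left_distrib)

text \<open>Here \<open>[E s, E (- s)]\<close> is a Cartan element acting on \<open>E r\<close>
  through \<open>ip r s\<close>. The five possible values of \<open>ip r s\<close> decide whether
  \<open>r + s\<close> or \<open>r - s\<close> is a root, and a path through that root supplies the
  matching term.\<close>

lemma jac_EEE_neg:
  assumes r: "r \<in> roots" and s: "s \<in> roots"
  shows "jac (Ee r) (Ee s) (Ee (- s)) = 0"
proof -
  have e2: "eps s r = (if even (ip r s) then eps r s else - eps r s :: 'k)" by (rule eps_swap)
  have "ip r s \<in> {-2, -1, 0, 1, 2}" using ip_bounds[OF r s] by auto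
  then consider "ip r s = 0" | "ip r s = - 1" | "ip r s = 1" | "r = s" | "s = - r"
    using ip_eq_2[OF r s] ip_eq_m2[OF r s] by auto
  then show ?thesis
  proof cases
    case 1
    then have "s \<noteq> - r" "s \<noteq> r" using r s ip_self by (auto simp: ip_lin)
    then show ?thesis using 1 r s ip_self[OF s]
      by (auto simp: jac_def br_EE ip_lin br_EH wt_hm)
  next
    case 2
    then have "s \<noteq> - r" "s \<noteq> r" using r s ip_self by (auto simp: ip_lin)
    then show ?thesis using 2 r s ip_self[OF s] add_root_iff[OF r s]
      by (auto simp: jac_def br_EE ip_lin br_EH wt_hm br_lin eps_lin)
  next
    case 3
    then have "s \<noteq> - r" "s \<noteq> r" using r s ip_self by (auto simp: ip_lin)
    moreover have "r - s \<in> roots" using 3 diff_root_iff[OF r s] by simp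
    ultimately show ?thesis using 3 r s ip_self[OF s] e2 ip_commute[of s r]
      by (auto simp: jac_def br_EE ip_lin br_EH wt_hm br_lin eps_lin)
  next
    case 4
    then show ?thesis using r ip_self[OF r] root_neq_minus[OF r]
      by (auto simp: jac_def br_EE ip_lin br_EH wt_hm br_lin)
  next
    case 5
    then show ?thesis using r ip_self[OF r] root_neq_minus[OF r]
      by (auto simp: jac_def br_EE ip_lin br_EH br_HE wt_hm br_lin)
  qed
qed

lemma jac_EEE:
  assumes r: "r \<in> roots" and s: "s \<in> roots" and t: "t \<in> roots"
  shows "jac (Ee r) (Ee s) (Ee t) = 0"
proof -
  consider "t = - s" | "s = - r" | "t = - r" | "t \<noteq> - s" "s \<noteq> - r" "t \<noteq> - r" by blast
  then show ?thesis
  proof cases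
    case 1 then show ?thesis using jac_EEE_neg[OF r s] by simp
  next
    case 2 then show ?thesis
      using jac_EEE_neg[OF t r] by (simp add: jac_cyc[of "Ee t"])
  next
    case 3 then show ?thesis
      using jac_EEE_neg[OF s r] by (simp add: jac_swap(1)[of "Ee s"])
  next
    case 4
    define x y z where xyz: "x = ip r s" "y = ip s t" "z = ip r t"
    have sy: "ip s r = x" "ip t s = y" "ip t r = z" by (simp_all add: xyz ip_commute)
    have bd: "x \<in> {-1,0,1,2}" "y \<in> {-1,0,1,2}" "z \<in> {-1,0,1,2}"
      using ip_bounds[OF r s] ip_bounds[OF s t] ip_bounds[OF r t] ip_eq_m2[OF r s] ip_eq_m2[OF s t] ip_eq_m2[OF r t] 4
      unfolding xyz by (auto; linarith)+
    have e: "eps s r = (if even x then eps r s else - eps r s :: 'k)"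
      unfolding xyz by (rule eps_swap)
    have st: "br (Ee s) (Ee t) = (if y = -1 then sca (eps s t) (Ee (s + t)) else 0)"
      using 4 by (simp add: br_EE[OF s t] xyz)
    have rs: "br (Ee r) (Ee s) = (if x = -1 then sca (eps r s) (Ee (r + s)) else 0)"
      using 4 by (simp add: br_EE[OF r s] xyz)
    have rt: "br (Ee r) (Ee t) = (if z = -1 then sca (eps r t) (Ee (r + t)) else 0)"
      using 4 by (simp add: br_EE[OF r t] xyz)
    have sum: "s + t \<in> roots" if "y = -1" using that add_root_iff[OF s t] by (simp add: xyz)
    have sum2: "r + s \<in> roots" if "x = -1" using that add_root_iff[OF r s] by (simp add: xyz)
    have sum3: "r + t \<in> roots" if "z = -1" using that add_root_iff[OF r t] by (simp add: xyz)
    have i: "ip r (s + t) = x + z" "ip (r + s) t = y + z" "ip s (r + t) = x + y"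
      by (simp_all add: ip_lin xyz ip_commute[of s r])
    have T1: "br (Ee r) (br (Ee s) (Ee t)) = (if y = -1 then sca (eps s t)
         (if x + z = -1 then sca (eps r s * eps r t) (Ee (r + s + t)) else if r + s + t = 0 then - Hh (hm r) else 0) else 0)"
    proof (cases "y = -1")
      case True
      have "s + t = - r \<longleftrightarrow> r + s + t = 0" by (auto simp: eq_neg_iff_add_eq_0 algebra_simps)
      then show ?thesis
        using True by (simp add: st br_scale_right br_EE[OF r sum] i eps_lin add.assoc)
    qed (simp add: st)
    have T2: "br (br (Ee r) (Ee s)) (Ee t) = (if x = -1 then sca (eps r s)
         (if y + z = -1 then sca (eps r t * eps s t) (Ee (r + s + t)) else if r + s + t = 0 then - Hh (hm (r + s)) else 0) else 0)"
    proof (cases "x = -1")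
      case True
      have "t = - (r + s) \<longleftrightarrow> r + s + t = 0" by (auto simp: eq_neg_iff_add_eq_0 algebra_simps)
      then show ?thesis
        using True by (simp add: rs br_scale_left br_EE[OF sum2 t] i eps_lin)
    qed (simp add: rs)
    have T3: "br (Ee s) (br (Ee r) (Ee t)) = (if z = -1 then sca (eps r t)
         (if x + y = -1 then sca (eps s r * eps s t) (Ee (r + s + t)) else if r + s + t = 0 then - Hh (hm s) else 0) else 0)"
    proof (cases "z = -1")
      case True
      have "r + t = - s \<longleftrightarrow> r + s + t = 0" by (auto simp: eq_neg_iff_add_eq_0 algebra_simps)
      then show ?thesis
        using True by (simp add: rt br_scale_right br_EE[OF s sum3] i eps_lin add.left_commute[of s r t] add.assoc)
    qed (simp add: rt)
    \<comment> \<open>The norm of \<open>r + s + t\<close> detects the remaining Cartan case: it is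
      0 exactly if all three products are -1. Otherwise all terms are multiples of one root vector,
      and the signs cancel because \<open>eps\<close> is multiplicative in each argument.\<close>
    have q: "b (r + s + t) (r + s + t) = 3 + (x + y + z)"
      using r s t by (simp add: xyz ip_def roots_def b_lin)
    show ?thesis
    proof (cases "x + y + z = - 3")
      case True
      then have m: "x = -1" "y = -1" "z = -1" using bd by auto
      have z: "r + s + t = 0" using q True b_eq_0[of "r + s + t"] by simp
      then have tt: "t = - (r + s)" using minus_unique by metis
      have e1: "eps s t = (eps r s :: 'k)" using e m r s t
        unfolding tt eps_minus by (simp add: eps_lin)
      have e2: "eps r t = (- eps r s :: 'k)" using r s unfolding tt eps_minus by (simp add: eps_lin)
      have "Hh (hm (r + s)) = Hh (hm r) + Hh (hm s)" by (simp add: Hh_def hm_add)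
      then show ?thesis unfolding jac_def T1 T2 T3 by (simp add: m z e1 e2 V.scale_right_distrib V.scale_right_diff_distrib)
    next
      case False
      have z: "r + s + t \<noteq> 0" using q False by auto
      show ?thesis unfolding jac_def T1 T2 T3 using bd False z e by (auto simp: mult_ac)
    qed
  qed
qed

lemma jac_lin:
  "jac (x + x') y z = jac x y z + jac x' y z" "jac (sca c x) y z = sca c (jac x y z)"
  "jac x (y + y') z = jac x y z + jac x y' z" "jac x (sca c y) z = sca c (jac x y z)"
  "jac x y (z + z') = jac x y z + jac x y z'" "jac x y (sca c z) = sca c (jac x y z)"
  by (simp_all add: jac_def br_lin V.scale_right_diff_distrib)

lemma jac_rs: "jac (rs x) y z = jac x y z" "jac x (rs y) z = jac x y z" "jac x y (rs z) = jac x y z"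
  by (simp_all add: jac_def br_rs)

lemma jac_HH: "jac (Hh g) (Hh h) z = 0"
proof -
  have "jac (Hh g) (Hh h) (rs z) = 0"
  proof (rule linear_vanish[where F = "\<lambda>z. jac (Hh g) (Hh h) z"])
    show "jac (Hh g) (Hh h) (Hh k) = 0" for k by (simp add: jac_def br_HH)
    show "jac (Hh g) (Hh h) (Ee r) = 0" if "r \<in> roots" for r
      using that by (simp add: jac_def br_HH br_HE br_lin V.scale_left_commute)
  qed (simp_all add: jac_lin)
  then show ?thesis by (simp add: jac_rs)
qed

lemma jac_HE: 
  assumes "r \<in> roots"
  shows "jac (Hh h) (Ee r) z = 0"
proof -
  have "jac (Hh h) (Ee r) (rs z) = 0"
  proof (rule linear_vanish[where F = "\<lambda>z. jac (Hh h) (Ee r) z"])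
    show "jac (Hh h) (Ee r) (Hh k) = 0" for k using jac_HH[of k h "Ee r"] jac_cyc by metis
  qed (simp_all add: jac_lin jac_HEE assms)
  then show ?thesis by (simp add: jac_rs)
qed

lemma jac_H: "jac (Hh h) y z = 0"
proof -
  have "jac (Hh h) (rs y) z = 0"
    by (rule linear_vanish[where F = "\<lambda>y. jac (Hh h) y z"]) (simp_all add: jac_lin jac_HH jac_HE)
  then show ?thesis by (simp add: jac_rs)
qed

lemma jac_EE:
  assumes "r \<in> roots" "s \<in> roots"
  shows "jac (Ee r) (Ee s) z = 0"
proof -
  have "jac (Ee r) (Ee s) (rs z) = 0"
  proof (rule linear_vanish[where F = "\<lambda>z. jac (Ee r) (Ee s) z"])
    show "jac (Ee r) (Ee s) (Hh k) = 0" for k using jac_H[of k "Ee r" "Ee s"] jac_cyc by metis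
  qed (simp_all add: jac_lin jac_EEE assms)
  then show ?thesis by (simp add: jac_rs)
qed

lemma jac_E:
  assumes "r \<in> roots"
  shows "jac (Ee r) y z = 0"
proof -
  have "jac (Ee r) (rs y) z = 0"
  proof (rule linear_vanish[where F = "\<lambda>y. jac (Ee r) y z"])
    show "jac (Ee r) (Hh k) z = 0" for k using jac_H[of k z "Ee r"] jac_cyc by metis
  qed (simp_all add: jac_lin jac_EE assms)
  then show ?thesis by (simp add: jac_rs)
qed

lemma jacobi: "br x (br y z) = br (br x y) z + br y (br x z)"
proof -
  have "jac (rs x) y z = 0"
    by (rule linear_vanish[where F = "\<lambda>x. jac x y z"]) (simp_all add: jac_lin jac_H jac_E)
  then show ?thesis by (simp add: jac_rs) (simp add: jac_def algebra_simps)
qed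

end

section \<open>The subquotient attached to two orthogonal roots\<close>

locale lattice_sem = lattice_lie b sc hm wt
  for b :: "'q::ab_group_add \<Rightarrow> 'q \<Rightarrow> int"
    and sc :: "'k::field \<Rightarrow> 'h::ab_group_add \<Rightarrow> 'h"
    and hm :: "'q \<Rightarrow> 'h" and wt :: "'q \<Rightarrow> 'h \<Rightarrow> 'k" +
  fixes a1 a2 :: 'q
  assumes char3: "(3::'k) = 0"
    and a_roots [simp]: "a1 \<in> roots" "a2 \<in> roots"
    and a_orth: "b a1 a2 = 0" "b a2 a1 = 0"
begin

definition dd :: "'h \<times> ('q \<Rightarrow> 'k) \<Rightarrow> 'h \<times> ('q \<Rightarrow> 'k)" where "dd = br (Ee a1 + Ee a2)"

text \<open>An element of the kernel of \<open>dd\<close> has coefficients that determine each other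
  at a root of type \<open>(-1,1)\<close> and at its translate by \<open>a1 - a2\<close>, of type
  \<open>(1,-1)\<close>. The latter serves as label of the pair.\<close>

definition S0 :: "'q set"
  where "S0 = {q \<in> roots. ip q a1 = 0 \<and> ip q a2 = 0 \<or> ip q a1 = 1 \<and> ip q a2 = - 1}"
text \<open>The tops of the blocks of size 2: orthogonality to one of \<open>a1\<close>,
  \<open>a2\<close> leaves a single step, by the other.\<close>

definition S1 :: "'q set"
  where "S1 = {q \<in> roots. ip q a1 = - 1 \<and> ip q a2 = 0 \<or> ip q a1 = 0 \<and> ip q a2 = - 1}"

definition pr0 :: "'h \<times> ('q \<Rightarrow> 'k) \<Rightarrow> 'h \<times> ('q \<Rightarrow> 'k)"
  where "pr0 x = (fst x, \<lambda>q. if q \<in> S0 then snd x q else 0)"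
definition pr1 :: "'h \<times> ('q \<Rightarrow> 'k) \<Rightarrow> 'h \<times> ('q \<Rightarrow> 'k)"
  where "pr1 x = (0, \<lambda>q. if q \<in> S1 then snd x q else 0)"
text \<open>\<open>l0\<close> lifts \<open>pr0 ` Ker dd\<close> back to \<open>Ker dd\<close>.\<close>

definition l0 :: "'h \<times> ('q \<Rightarrow> 'k) \<Rightarrow> 'h \<times> ('q \<Rightarrow> 'k)"
  where "l0 x = (fst x, \<lambda>q. if q \<in> S0 then snd x q
     else if q \<in> roots \<and> ip q a1 = - 1 \<and> ip q a2 = 1 then eps a1 q * eps a2 q * snd x (q + a1 - a2) else 0)"

text \<open>On \<open>WP\<close>, \<open>l0\<close> and \<open>pr1\<close> extract the even and odd
  components and lift them to the kernels of \<open>dd\<close> and of its square, so that one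
  bilinear formula covers all parities. The two terms with \<open>dd\<close> are the twisted bracket
  of odd elements in a semisimplification.\<close>

definition brW :: "'h \<times> ('q \<Rightarrow> 'k) \<Rightarrow> 'h \<times> ('q \<Rightarrow> 'k) \<Rightarrow> 'h \<times> ('q \<Rightarrow> 'k)"
  where "brW x y =
     pr0 (br (l0 x) (l0 y) - br (pr1 x) (dd (pr1 y)) + br (dd (pr1 x)) (pr1 y)) +
     pr1 (br (l0 x) (pr1 y) + br (pr1 x) (l0 y))"

definition WP :: "bit \<Rightarrow> ('h \<times> ('q \<Rightarrow> 'k)) set"
  where "WP p = (if p = 0 then {x. wt a1 (fst x) = 0 \<and> wt a2 (fst x) = 0 \<and> (\<forall>q. q \<notin> S0 \<longrightarrow> snd x q = 0)}
     else {x. fst x = 0 \<and> (\<forall>q. q \<notin> S1 \<longrightarrow> snd x q = 0)})"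

lemma two_eq: "(2::'k) = - 1"
proof -
  have "(2::'k) + 1 = 0" using char3 by simp
  then show ?thesis by (simp add: eq_neg_iff_add_eq_0)
qed

lemma two_nonzero [simp]: "(2::'k) \<noteq> 0" "(-1::'k) \<noteq> 0" "(1::'k) \<noteq> -1"
proof -
  show "(2::'k) \<noteq> 0" by (simp add: two_eq)
  then show "(1::'k) \<noteq> -1" by (metis add.right_inverse one_add_one)
qed auto

lemma ip_a [simp]: "ip a1 a2 = 0" "ip a2 a1 = 0" "ip a1 a1 = 2" "ip a2 a2 = 2"
  using a_orth by (auto simp: ip_def ip_self[unfolded ip_def])

lemma eps_a [simp]: "eps a1 a2 = 1" "eps a2 a1 = 1"
  using a_orth by (auto simp: eps_def)

lemma a_neq [simp]: "a1 \<noteq> a2" "a2 \<noteq> a1" "a1 \<noteq> - a2" "a2 \<noteq> - a1" "- a1 \<noteq> a2" "- a2 \<noteq> a1"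
    "a1 \<noteq> - a1" "- a1 \<noteq> a1" "a2 \<noteq> - a2" "- a2 \<noteq> a2"
  using ip_a root_neq_minus[of a1] root_neq_minus[of a2] by (auto simp: ip_lin dest: arg_cong[where f = "ip a1"])

lemma fst_br_E: "r \<in> roots \<Longrightarrow> fst (br (Ee r) x) = - sc (snd x (- r)) (hm r)"
proof -
  assume r: "r \<in> roots"
  have "fst (br (Ee r) x) = (\<Sum>t\<in>roots. if t = r then - sc (snd x (- t)) (hm t) else 0)"
    unfolding br_def Ee_def fst_conv snd_conv by (rule sum.cong) auto
  then show ?thesis using r by simp
qed

lemma snd_br_E:
  assumes "r \<in> roots"
  shows "snd (br (Ee r) x) q = (if q \<in> roots then (if q = r then - wt r (fst x) else 0) +
      (if ip q r = 1 then - eps r q * snd x (q - r) else 0) else 0)"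
proof (cases "q \<in> roots")
  case True
  have "(\<Sum>t | t \<in> roots \<and> q - t \<in> roots. eps t (q - t) * snd (Ee r) t * snd x (q - t))
     = (\<Sum>t | t \<in> roots \<and> q - t \<in> roots. if t = r then eps t (q - t) * snd x (q - t) else 0 :: 'k)"
    unfolding Ee_def snd_conv by (rule sum.cong) auto
  also have "\<dots> = (if ip q r = 1 then - eps r q * snd x (q - r) else 0)"
    using assms True diff_root_iff[OF True assms] by (auto simp: eps_lin)
  finally show ?thesis using True by (simp add: br_def) (simp add: Ee_def)
qed (simp add: br_def)

lemma fst_dd: "fst (dd x) = - sc (snd x (- a1)) (hm a1) - sc (snd x (- a2)) (hm a2)"
  by (simp add: dd_def br_lin fst_br_E)

definition dd_coeff :: "'q \<Rightarrow> ('q \<Rightarrow> 'k) \<Rightarrow> 'k"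
  where "dd_coeff q f = (if ip q a1 = 1 then - eps a1 q * f (q - a1) else 0) +
      (if ip q a2 = 1 then - eps a2 q * f (q - a2) else 0)"

lemma snd_dd: "snd (dd x) q = (if q = a1 then - wt a1 (fst x) else if q = a2 then - wt a2 (fst x)
    else if q \<in> roots then dd_coeff q (snd x) else 0)"
  by (auto simp: dd_def br_lin snd_br_E dd_coeff_def)

lemma snd_dd_vals [simp]:
  "snd (dd x) a1 = - wt a1 (fst x)" "snd (dd x) a2 = - wt a2 (fst x)"
  "snd (dd x) (- a1) = 0" "snd (dd x) (- a2) = 0"
  by (auto simp: snd_dd dd_coeff_def ip_lin)

text \<open>Pairing with \<open>a1\<close> and \<open>a2\<close> separates the two coroots, as 2 is
  nonzero. Independence of more coroots cannot be expected over a general Cartan space.\<close>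

lemma hm_a_zero: "sc c (hm a1) + sc d (hm a2) = 0 \<longleftrightarrow> c = 0 \<and> d = 0"
proof
  assume *: "sc c (hm a1) + sc d (hm a2) = 0"
  have "wt a1 (sc c (hm a1) + sc d (hm a2)) = c * 2" "wt a2 (sc c (hm a1) + sc d (hm a2)) = d * 2"
    by (simp_all add: wt_add2 wt_scale wt_hm)
  then show "c = 0 \<and> d = 0" unfolding * by simp
qed simp

lemma dd_eq_0_iff: "dd x = 0 \<longleftrightarrow> wt a1 (fst x) = 0 \<and> wt a2 (fst x) = 0 \<and>
    snd x (- a1) = 0 \<and> snd x (- a2) = 0 \<and> (\<forall>q\<in>roots. dd_coeff q (snd x) = 0)"
proof -
  have D: "dd_coeff a1 f = 0" "dd_coeff a2 f = 0" for f by (auto simp: dd_coeff_def)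
  have "fst (dd x) = 0 \<longleftrightarrow> snd x (- a1) = 0 \<and> snd x (- a2) = 0"
    using hm_a_zero[of "- snd x (- a1)" "- snd x (- a2)"] by (simp add: fst_dd)
  moreover have "snd (dd x) = 0 \<longleftrightarrow> wt a1 (fst x) = 0 \<and> wt a2 (fst x) = 0 \<and> (\<forall>q\<in>roots. dd_coeff q (snd x) = 0)"
  proof
    assume *: "snd (dd x) = 0"
    then have "\<And>q. snd (dd x) q = 0" by simp
    then show "wt a1 (fst x) = 0 \<and> wt a2 (fst x) = 0 \<and> (\<forall>q\<in>roots. dd_coeff q (snd x) = 0)"
      using D by (metis neg_equal_0_iff_equal snd_dd snd_dd_vals(1,2))
  qed (auto simp: snd_dd fun_eq_iff)
  ultimately show ?thesis by (auto simp: prod_eq_iff)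
qed

text \<open>The two root vectors commute, so the square of \<open>dd\<close> consists of the two
  squares and twice the mixed product. The squares see only the coordinates at \<open>- a1\<close>
  and \<open>- a2\<close>, the mixed product leads from type \<open>(-1,-1)\<close> to type
  \<open>(1,1)\<close>, and twice means minus in characteristic 3.\<close>

lemma snd_dd_dd: "snd (dd (dd x)) q = (if q = a1 then - snd x (- a1) else if q = a2 then - snd x (- a2)
    else if q \<in> roots \<and> ip q a1 = 1 \<and> ip q a2 = 1 then - (eps a1 q * eps a2 q * snd x (q - a1 - a2)) else 0)"
proof -
  have w: "wt a1 (fst (dd x)) = snd x (- a1)" "wt a2 (fst (dd x)) = snd x (- a2)"
    by (simp_all add: fst_dd wt_diff wt_scale wt_hm two_eq)
  have "dd_coeff q (snd (dd x)) = (if ip q a1 = 1 \<and> ip q a2 = 1 then - (eps a1 q * eps a2 q * snd x (q - a1 - a2)) else 0)"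
    if q: "q \<in> roots"
  proof -
    have 1: "snd (dd x) (q - a1) = (if ip q a2 = 1 then - (eps a2 q * snd x (q - a1 - a2)) else 0)" if "ip q a1 = 1"
    proof -
      have "q - a1 \<noteq> a1" "q - a1 \<noteq> a2" using that by (auto simp: algebra_simps ip_lin)
      then show ?thesis using that diff_root_iff[OF q, of a1] by (simp add: snd_dd dd_coeff_def ip_lin eps_lin)
    qed
    have 2: "snd (dd x) (q - a2) = (if ip q a1 = 1 then - (eps a1 q * snd x (q - a1 - a2)) else 0)" if "ip q a2 = 1"
    proof -
      have "q - a2 \<noteq> a1" "q - a2 \<noteq> a2" using that by (auto simp: algebra_simps ip_lin)
      then show ?thesis using that diff_root_iff[OF q, of a2] by (simp add: snd_dd dd_coeff_def ip_lin eps_lin cancel_ab_semigroup_add_class.diff_right_commute[of q a2 a1])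
    qed
    have 3: "z + z = - z" for z :: 'k using two_eq by (metis mult_2 mult_minus1)
    show ?thesis using 1 2 by (auto simp: dd_coeff_def 3 mult_ac)
  qed
  then show ?thesis by (auto simp: snd_dd[of "dd x"] w)
qed

lemma fst_dd_dd: "fst (dd (dd x)) = 0"
  by (simp add: fst_dd[of "dd x"])

lemma dd_dd_eq_0_iff: "dd (dd x) = 0 \<longleftrightarrow> snd x (- a1) = 0 \<and> snd x (- a2) = 0 \<and>
   (\<forall>q\<in>roots. ip q a1 = - 1 \<longrightarrow> ip q a2 = - 1 \<longrightarrow> snd x q = 0)"
proof
  assume "dd (dd x) = 0"
  then have *: "snd (dd (dd x)) q = 0" for q by simp
  have "snd x q = 0" if q: "q \<in> roots" "ip q a1 = - 1" "ip q a2 = - 1" for q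
  proof -
    have 1: "q + a1 \<in> roots" using q add_root_iff[of q a1] by simp
    have 2: "q + a1 + a2 \<in> roots" using q 1 add_root_iff[of "q + a1" a2] by (simp add: ip_lin)
    have "q \<noteq> - a1" "q \<noteq> - a2" using q by (auto simp: ip_lin)
    moreover have "q + a1 + a2 = a1 \<Longrightarrow> q = - a2" "q + a1 + a2 = a2 \<Longrightarrow> q = - a1"
      by (simp_all add: eq_neg_iff_add_eq_0 algebra_simps)
    ultimately have "q + a1 + a2 \<noteq> a1" "q + a1 + a2 \<noteq> a2" by blast+
    then show ?thesis using *[of "q + a1 + a2"] 2 q by (simp add: snd_dd_dd ip_lin)
  qed
  then show "snd x (- a1) = 0 \<and> snd x (- a2) = 0 \<and> (\<forall>q\<in>roots. ip q a1 = - 1 \<longrightarrow> ip q a2 = - 1 \<longrightarrow> snd x q = 0)"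
    using *[of a1] *[of a2] by (simp add: snd_dd_dd del: snd_dd_vals)
next
  assume *: "snd x (- a1) = 0 \<and> snd x (- a2) = 0 \<and> (\<forall>q\<in>roots. ip q a1 = - 1 \<longrightarrow> ip q a2 = - 1 \<longrightarrow> snd x q = 0)"
  have "snd x (q - a1 - a2) = 0" if q: "q \<in> roots" "ip q a1 = 1" "ip q a2 = 1" for q
  proof -
    have 1: "q - a1 \<in> roots" using q diff_root_iff[of q a1] by simp
    have 2: "q - a1 - a2 \<in> roots" using q 1 diff_root_iff[of "q - a1" a2] by (simp add: ip_lin)
    then show ?thesis using * q by (auto simp: ip_lin)
  qed
  then have "snd (dd (dd x)) q = 0" for q using * by (simp add: snd_dd_dd)
  then show "dd (dd x) = 0" by (simp add: prod_eq_iff fst_dd_dd fun_eq_iff)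
qed

text \<open>The square of \<open>dd\<close> sees only the coordinates at \<open>- a1\<close>,
  \<open>- a2\<close> and at type \<open>(-1,-1)\<close>. An image of \<open>dd\<close> has none of
  these, since a step by \<open>a1\<close> or \<open>a2\<close> that ends at a root ends at one
  having positive product with it.\<close>

lemma dd3: "dd (dd (dd x)) = 0"
  unfolding dd_dd_eq_0_iff by (auto simp: snd_dd dd_coeff_def ip_lin)

lemma dd_lin: "dd (x + y) = dd x + dd y" "dd (x - y) = dd x - dd y" "dd (- x) = - dd x"
  "dd (sca c x) = sca c (dd x)" "dd 0 = 0"
  by (simp_all add: dd_def br_lin)

lemma dd_br: "dd (br x y) = br (dd x) y + br x (dd y)"
  unfolding dd_def by (rule jacobi)

lemma pr_lin: "pr0 (x + y) = pr0 x + pr0 y" "pr0 (sca c x) = sca c (pr0 x)"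
  "pr1 (x + y) = pr1 x + pr1 y" "pr1 (sca c x) = sca c (pr1 x)"
  "l0 (x + y) = l0 x + l0 y" "l0 (sca c x) = sca c (l0 x)"
  "pr0 (x - y) = pr0 x - pr0 y" "pr1 (x - y) = pr1 x - pr1 y" "l0 (x - y) = l0 x - l0 y"
  "pr0 (- x) = - pr0 x" "pr1 (- x) = - pr1 x" "l0 (- x) = - l0 x"
  "pr0 0 = 0" "pr1 0 = 0" "l0 0 = 0"
  by (auto simp: pr0_def pr1_def l0_def sca_def fun_eq_iff prod_eq_iff algebra_simps)

lemma S01: "q \<in> S0 \<Longrightarrow> q \<notin> S1" "q \<in> S1 \<Longrightarrow> q \<notin> S0"
  by (auto simp: S0_def S1_def)

lemma pr_pr [simp]: "pr0 (pr0 x) = pr0 x" "pr1 (pr1 x) = pr1 x" "pr0 (pr1 x) = 0" "l0 (pr1 x) = 0"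
  "pr0 (l0 x) = pr0 x" "l0 (pr0 x) = l0 x" "pr1 (pr0 x) = 0" "pr1 (l0 x) = 0"
proof -
  have 1: "q + a1 - a2 \<in> S0" if "q \<in> roots" "ip q a1 = - 1" "ip q a2 = 1" for q
    using that add_root_iff[of q a1] diff_root_iff[of "q + a1" a2] by (auto simp: S0_def ip_lin)
  have 2: "q \<in> S1 \<Longrightarrow> \<not> (ip q a1 = - 1 \<and> ip q a2 = 1)" for q by (auto simp: S1_def)
  show "l0 (pr0 x) = l0 x" using 1 by (auto simp: pr0_def l0_def fun_eq_iff)
  show "l0 (pr1 x) = 0" using 1 S01(1) by (auto simp: pr1_def l0_def fun_eq_iff prod_eq_iff)
  show "pr1 (l0 x) = 0" using 2 S01(1) by (auto simp: pr1_def l0_def fun_eq_iff prod_eq_iff)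
qed (auto simp: pr0_def pr1_def l0_def S01 fun_eq_iff prod_eq_iff)

text \<open>At a root \<open>q\<close> of type \<open>(1,1)\<close> two contributions meet, from
  \<open>q - a2\<close> of type \<open>(1,-1)\<close> and from \<open>q - a1\<close> of type
  \<open>(-1,1)\<close>. The sign in \<open>l0\<close> is the one that cancels them.\<close>

lemma dd_l0: 
  assumes "wt a1 (fst w) = 0" "wt a2 (fst w) = 0"
  shows "dd (l0 w) = 0"
proof -
  have S: "- a1 \<notin> S0" "- a2 \<notin> S0" by (auto simp: S0_def ip_lin)
  have "dd_coeff q (snd (l0 w)) = 0" if q: "q \<in> roots" for q
  proof -
    have 1: "snd (l0 w) (q - a1) = (if ip q a2 = 1 then eps a1 (q - a1) * eps a2 (q - a1) * snd w (q - a2) else 0)" if "ip q a1 = 1"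
      using that q diff_root_iff[of q a1] by (auto simp: l0_def S0_def ip_lin)
    have 2: "snd (l0 w) (q - a2) = (if ip q a1 = 1 then snd w (q - a2) else 0)" if "ip q a2 = 1"
      using that q diff_root_iff[of q a2] by (auto simp: l0_def S0_def ip_lin)
    show ?thesis using 1 2 by (auto simp: dd_coeff_def eps_lin mult_ac)
  qed
  then show ?thesis using S assms by (simp add: dd_eq_0_iff) (simp add: l0_def ip_lin)
qed

lemma dd_pr1: "dd (dd (pr1 w)) = 0"
  by (auto simp: dd_dd_eq_0_iff pr1_def S1_def ip_lin)

lemma ip_root_cases:
  assumes "q \<in> roots"
  shows "q = a1 \<or> q = - a1 \<or> q = a2 \<or> q = - a2 \<or> (ip q a1 \<in> {-1, 0, 1} \<and> ip q a2 \<in> {-1, 0, 1})"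
proof -
  have "ip q a1 \<in> {-2,-1,0,1,2}" "ip q a2 \<in> {-2,-1,0,1,2}"
    using ip_bounds[OF assms, of a1] ip_bounds[OF assms, of a2] by auto
  moreover have "ip q a1 = -2 \<Longrightarrow> q = - a1" "ip q a2 = -2 \<Longrightarrow> q = - a2"
    "ip q a1 = 2 \<Longrightarrow> q = a1" "ip q a2 = 2 \<Longrightarrow> q = a2"
    using ip_eq_m2[of a1 q] ip_eq_m2[of a2 q] ip_eq_2[of a1 q] ip_eq_2[of a2 q] assms by (auto simp: ip_commute)
  ultimately show ?thesis by auto
qed

text \<open>Each relation is a vanishing coefficient of \<open>dd u\<close>, taken at
  \<open>q + a1\<close> or \<open>q + a2\<close>; at most two coordinates of \<open>u\<close>
  contribute to it.\<close>

lemma K1_vals: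
  assumes "dd u = 0" "q \<in> roots"
  shows "ip q a1 = - 1 \<Longrightarrow> ip q a2 \<noteq> 1 \<Longrightarrow> snd u q = 0"
    and "ip q a2 = - 1 \<Longrightarrow> ip q a1 \<noteq> 1 \<Longrightarrow> snd u q = 0"
    and "ip q a1 = - 1 \<Longrightarrow> ip q a2 = 1 \<Longrightarrow> snd u q = eps a1 q * eps a2 q * snd u (q + a1 - a2)"
proof -
  have D: "dd_coeff r (snd u) = 0" if "r \<in> roots" for r using assms(1) that by (simp add: dd_eq_0_iff)
  { assume *: "ip q a1 = - 1"
    have "dd_coeff (q + a1) (snd u) = 0" using * assms add_root_iff[of q a1] by (intro D) auto
    then show "ip q a2 \<noteq> 1 \<Longrightarrow> snd u q = 0" using * by (simp add: dd_coeff_def ip_lin)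
    assume q2: "ip q a2 = 1"
    have "eps a1 (q + a1) = (- eps a1 q :: 'k)" "eps a2 (q + a1) = (eps a2 q :: 'k)" by (simp_all add: eps_lin)
    then have "eps a1 q * snd u q = eps a2 q * snd u (q + a1 - a2)"
      using * q2 \<open>dd_coeff (q + a1) (snd u) = 0\<close> by (simp add: dd_coeff_def ip_lin)
    then have "eps a1 q * (eps a1 q * snd u q) = eps a1 q * (eps a2 q * snd u (q + a1 - a2))" by (rule arg_cong)
    then show "snd u q = eps a1 q * eps a2 q * snd u (q + a1 - a2)" by (simp add: mult.assoc) }
  { assume *: "ip q a2 = - 1"
    have "dd_coeff (q + a2) (snd u) = 0" using * assms add_root_iff[of q a2] by (intro D) auto
    then show "ip q a1 \<noteq> 1 \<Longrightarrow> snd u q = 0" using * by (simp add: dd_coeff_def ip_lin) }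
qed

text \<open>What remains of \<open>u\<close> sits at \<open>a1\<close>, \<open>a2\<close> and at the
  types \<open>(1,0)\<close>, \<open>(0,1)\<close>, \<open>(1,1)\<close>, all reached by one step of
  \<open>dd\<close>; for type \<open>(1,1)\<close> the step by \<open>a1\<close> is taken. The
  coefficients at \<open>a1\<close> and \<open>a2\<close> come from the coroots, because
  \<open>- wt a1 (hm a1)\<close> is -2 = 1. The Cartan part of the preimage is stated explicitly
  since it will have to lie in the span of the coroots.\<close>

lemma K1_pr0_zero:
  assumes u: "dd u = 0" "pr0 u = 0"
  obtains g where "rs u = dd (sc (snd u a1) (hm a1) + sc (snd u a2) (hm a2), g)" "\<And>q. q \<notin> roots \<Longrightarrow> g q = 0"
proof -
  define f where "f = snd u"
  define g where "g = (\<lambda>q. if q \<in> roots \<and> ip q a1 = - 1 \<and> (ip q a2 = 0 \<or> ip q a2 = 1) then eps a1 q * f (q + a1)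
     else if q \<in> roots \<and> ip q a1 = 0 \<and> ip q a2 = - 1 then eps a2 q * f (q + a2) else 0)"
  define v where "v = (sc (f a1) (hm a1) + sc (f a2) (hm a2), g)"
  have fu: "fst u = 0" using u(2) by (simp add: pr0_def prod_eq_iff)
  have fS: "f q = 0" if "q \<in> S0" for q
    using arg_cong[OF u(2), of "\<lambda>x. snd x q"] that by (simp add: pr0_def f_def)
  have "fst (dd v) = 0" by (simp add: fst_dd v_def g_def ip_lin)
  moreover have "snd (dd v) q = (if q \<in> roots then f q else 0)" for q
  proof (cases "q \<in> roots")
    case True
    have m: "(eps a1 a1 :: 'k) = - 1" "(eps a2 a2 :: 'k) = - 1" by simp_all
    have G1: "g (q - a1) = (if ip q a2 = 0 \<or> ip q a2 = 1 then - eps a1 q * f q else 0)" if "ip q a1 = 1"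
      using that True diff_root_iff[of q a1] by (auto simp: g_def ip_lin eps_lin)
    have G2: "g (q - a2) = (if ip q a1 = 0 then - eps a2 q * f q else 0)" if "ip q a2 = 1"
      using that True diff_root_iff[of q a2] by (auto simp: g_def ip_lin eps_lin)
    have z: "- wt a1 (fst v) = f a1" "- wt a2 (fst v) = f a2"
      by (simp_all add: v_def wt_add2 wt_scale wt_hm two_eq)
    have f0: "f (- a1) = 0" "f (- a2) = 0" using u(1) by (auto simp: dd_eq_0_iff f_def)
    have S: "ip q a1 = 0 \<Longrightarrow> ip q a2 = 0 \<Longrightarrow> f q = 0" "ip q a1 = 1 \<Longrightarrow> ip q a2 = - 1 \<Longrightarrow> f q = 0"
      using fS[of q] True by (auto simp: S0_def)
    have S': "f q = 0" if "ip q a1 = - 1" "ip q a2 = 1"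
    proof -
      have "q + a1 - a2 \<in> S0" using that True add_root_iff[of q a1] diff_root_iff[of "q + a1" a2]
        by (auto simp: S0_def ip_lin)
      then show ?thesis using K1_vals(3)[OF u(1) True that] fS by (simp add: f_def)
    qed
    note K = K1_vals(1,2)[OF u(1) True, folded f_def]
    from ip_root_cases[OF True] show ?thesis
    proof (elim disjE)
      assume *: "ip q a1 \<in> {-1, 0, 1} \<and> ip q a2 \<in> {-1, 0, 1}"
      then have "q \<noteq> a1" "q \<noteq> a2" by auto
      then show ?thesis using * True G1 G2 S S' K by (auto simp: snd_dd dd_coeff_def v_def)
    qed (use z f0 in auto)
  qed (simp add: snd_dd, metis a_roots)
  ultimately have "rs u = dd v" by (simp add: rs_def fu prod_eq_iff fun_eq_iff f_def)
  then show thesis using that[of g] by (simp add: v_def f_def g_def)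
qed

text \<open>As the tops of the blocks of size 2 are absent from \<open>u\<close>, the element
  \<open>dd u\<close> is supported at \<open>a1\<close>, \<open>a2\<close> and at type
  \<open>(1,1)\<close>. These are the places where the square of \<open>dd\<close> takes its values,
  and \<open>v\<close> is read off from \<open>snd_dd_dd\<close>.\<close>

lemma K2_pr1_zero:
  assumes u: "dd (dd u) = 0" "pr1 u = 0"
  obtains v where "dd (dd v) = dd u"
proof -
  define f where "f = snd u"
  define v where "v = (0 :: 'h, \<lambda>q. if q = - a1 then wt a1 (fst u) else if q = - a2 then wt a2 (fst u)
     else eps a1 q * eps a2 q * (- dd_coeff (q + a1 + a2) f))"
  have fS: "f q = 0" if "q \<in> S1" for q
    using arg_cong[OF u(2), of "\<lambda>x. snd x q"] that by (simp add: pr1_def f_def)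
  have f0: "f (- a1) = 0" "f (- a2) = 0" "\<And>q. q \<in> roots \<Longrightarrow> ip q a1 = - 1 \<Longrightarrow> ip q a2 = - 1 \<Longrightarrow> f q = 0"
    using u(1) by (auto simp: dd_dd_eq_0_iff f_def)
  have "fst (dd u) = 0" using f0 by (simp add: fst_dd f_def)
  moreover have "snd (dd (dd v)) q = snd (dd u) q" for q
  proof -
    consider "q = a1" | "q = a2" | "q \<noteq> a1" "q \<noteq> a2" "q \<notin> roots" | "q \<noteq> a1" "q \<noteq> a2" "q \<in> roots" by blast
    then show ?thesis
    proof cases
      case 4
      have *: "dd_coeff q f = 0" if n11: "\<not> (ip q a1 = 1 \<and> ip q a2 = 1)"
      proof -
        have 1: "f (q - a1) = 0" if "ip q a1 = 1"
        proof -
          have "q - a1 \<in> roots" using that 4 diff_root_iff[of q a1] by simp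
          moreover have "ip q a2 \<in> {-1, 0}" using ip_root_cases[OF 4(3)] 4 that n11 by (auto simp: ip_lin)
          ultimately show ?thesis using that fS[of "q - a1"] f0(3)[of "q - a1"] by (auto simp: S1_def ip_lin)
        qed
        have 2: "f (q - a2) = 0" if "ip q a2 = 1"
        proof -
          have "q - a2 \<in> roots" using that 4 diff_root_iff[of q a2] by simp
          moreover have "ip q a1 \<in> {-1, 0}" using ip_root_cases[OF 4(3)] 4 that n11 by (auto simp: ip_lin)
          ultimately show ?thesis using that fS[of "q - a2"] f0(3)[of "q - a2"] by (auto simp: S1_def ip_lin)
        qed
        show ?thesis using 1 2 by (simp add: dd_coeff_def)
      qed
      show ?thesis
      proof (cases "ip q a1 = 1 \<and> ip q a2 = 1")
        case True
        then have n: "q - a1 - a2 \<noteq> - a1" "q - a1 - a2 \<noteq> - a2" using 4 by (auto simp: algebra_simps)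
        have e: "eps a1 (q - a1 - a2) = (- eps a1 q :: 'k)" "eps a2 (q - a1 - a2) = (- eps a2 q :: 'k)"
          by (simp_all add: eps_lin)
        show ?thesis using True 4 n by (simp add: snd_dd_dd[of v] snd_dd[of u] f_def) (simp add: v_def e mult_ac f_def)
      next
        case False
        then show ?thesis using * 4 by (auto simp: snd_dd_dd[of v] snd_dd[of u] f_def)
      qed
    qed (auto simp: snd_dd_dd snd_dd[of u] v_def simp del: snd_dd_vals)
  qed
  ultimately have "dd (dd v) = dd u" by (simp add: prod_eq_iff fst_dd_dd fun_eq_iff)
  then show thesis using that by blast
qed

text \<open>The hypothesis removes the coordinates of type \<open>(-1,-1)\<close>, from which
  \<open>dd\<close> would reach type \<open>(1,-1)\<close>, and those at \<open>- a1\<close>,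
  \<open>- a2\<close>, from which it would reach the Cartan space.\<close>

lemma pr0_dd: "dd (dd v) = 0 \<Longrightarrow> pr0 (dd v) = 0"
proof -
  assume v: "dd (dd v) = 0"
  have "snd (dd v) q = 0" if q: "q \<in> S0" for q
  proof -
    have r: "q \<in> roots" "q \<noteq> a1" "q \<noteq> a2" using q by (auto simp: S0_def)
    have "snd v (q - a1) = 0" if "ip q a1 = 1"
      using v that q r diff_root_iff[of q a1] by (auto simp: dd_dd_eq_0_iff S0_def ip_lin)
    then show ?thesis using r q by (auto simp: snd_dd dd_coeff_def S0_def)
  qed
  then show ?thesis using v[unfolded dd_dd_eq_0_iff] by (simp add: pr0_def prod_eq_iff fun_eq_iff fst_dd)
qed

lemma pr1_dd: "pr1 (dd v) = 0"
  by (auto simp: pr1_def prod_eq_iff fun_eq_iff snd_dd dd_coeff_def S1_def)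

lemma pr1_K1: "dd v = 0 \<Longrightarrow> pr1 v = 0"
  using K1_vals(1,2)[of v] by (fastforce simp: pr1_def prod_eq_iff fun_eq_iff S1_def)

lemma three_zero: "x + x + x = (0 :: 'h \<times> ('q \<Rightarrow> 'k))"
proof -
  have "sca (1 + 1 + 1) x = x + x + x" by (simp only: V.scale_left_distrib V.scale_one)
  moreover have "(1 + 1 + 1 :: 'k) = 0" using char3 by simp
  ultimately show ?thesis by simp
qed

text \<open>Outside the roots the functions are arbitrary, so \<open>u\<close> is
  \<open>l0 u + dd v\<close> only as far as \<open>br\<close> can see. Hence the formulation through
  brackets.\<close>

lemma K1_decompose:
  assumes "dd u = 0"
  obtains v where "\<And>y. br u y = br (l0 u) y + br (dd v) y" "\<And>y. br y u = br y (l0 u) + br y (dd v)" "dd (dd v) = 0"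
proof -
  have w: "wt a1 (fst u) = 0" "wt a2 (fst u) = 0" using assms by (auto simp: dd_eq_0_iff)
  then have l: "dd (l0 u) = 0" using dd_l0[of u] by simp
  then have "dd (u - l0 u) = 0" "pr0 (u - l0 u) = 0" by (simp_all add: assms dd_lin pr_lin)
  then obtain v where v: "rs (u - l0 u) = dd v" by (rule K1_pr0_zero)
  have y: "br (u - l0 u) y = br (dd v) y" "br y (u - l0 u) = br y (dd v)" for y
    unfolding v[symmetric] by (simp_all add: br_rs)
  have "dd (dd v) = dd (rs (u - l0 u))" using v by simp
  also have "\<dots> = dd (u - l0 u)" by (simp add: dd_def br_rs)
  finally have "dd (dd v) = dd (u - l0 u)" .
  then have "dd (dd v) = 0" using assms l by (simp add: dd_lin)
  moreover have "br u y = br (l0 u) y + br (dd v) y" "br y u = br y (l0 u) + br y (dd v)" for y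
    using y[of y] by (simp_all add: br_diff algebra_simps)
  ultimately show thesis using that by blast
qed

lemma K2_decompose:
  assumes "dd (dd u) = 0"
  obtains k v where "u = pr1 u + k + dd v" "dd k = 0"
proof -
  have "dd (dd (u - pr1 u)) = 0" "pr1 (u - pr1 u) = 0" by (simp_all add: assms dd_lin pr_lin dd_pr1)
  then obtain v where v: "dd (dd v) = dd (u - pr1 u)" by (rule K2_pr1_zero)
  have "u = pr1 u + (u - pr1 u - dd v) + dd v" by simp
  moreover have "dd (u - pr1 u - dd v) = 0" using v by (simp add: dd_lin)
  ultimately show thesis using that by blast
qed

definition odd_br :: "'h \<times> ('q \<Rightarrow> 'k) \<Rightarrow> 'h \<times> ('q \<Rightarrow> 'k) \<Rightarrow> 'h \<times> ('q \<Rightarrow> 'k)"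
  where "odd_br x y = br (dd x) y - br x (dd y)"

lemma odd_br_lin: "odd_br (x + y) z = odd_br x z + odd_br y z" "odd_br z (x + y) = odd_br z x + odd_br z y"
  by (simp_all add: odd_br_def br_lin dd_lin)

lemma odd_br_commute: "odd_br x y = odd_br y x"
  unfolding odd_br_def using br_antisym[of "dd x" y] br_antisym[of x "dd y"] by simp

lemma brW_alt: "brW x y = pr0 (br (l0 x) (l0 y)) + pr0 (odd_br (pr1 x) (pr1 y)) + pr1 (br (l0 x) (pr1 y)) + pr1 (br (pr1 x) (l0 y))"
  by (simp add: brW_def pr_lin odd_br_def algebra_simps)

text \<open>By the Leibniz rule twice the bracket is an image of \<open>dd\<close> plus an element
  of its kernel. Both are killed by \<open>pr1\<close>, and 2 is invertible.\<close>

lemma pr1_mixed: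
  assumes v: "dd (dd v) = 0" and x: "dd (dd x) = 0"
  shows "pr1 (br (dd v) x) = 0"
proof -
  define z where "z = br (dd v) x"
  have 0: "dd (br (dd v) x - br v (dd x)) = 0" by (simp add: dd_lin dd_br v x)
  have "z + z = dd (br v x) + (br (dd v) x - br v (dd x))" by (simp add: dd_br z_def)
  then have "pr1 (z + z) = 0" using pr1_K1[OF 0] by (simp add: pr_lin pr1_dd)
  then have "pr1 z + pr1 z = 0" by (simp add: pr_lin)
  then show ?thesis using three_zero[of "pr1 z"] by (simp add: z_def)
qed

text \<open>Passing from \<open>u\<close> to its standard lift changes \<open>u\<close> by some
  \<open>dd v\<close> with \<open>dd (dd v) = 0\<close>. Bracketed with a kernel element this
  becomes an image of \<open>dd\<close> of the kind that \<open>pr0_dd\<close> kills, so the bracket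
  descends to the subquotient.\<close>

lemma compat00:
  assumes "dd u = 0" "dd u' = 0"
  shows "brW (pr0 u) (pr0 u') = pr0 (br u u')"
proof -
  obtain v where v: "\<And>y. br u y = br (l0 u) y + br (dd v) y" "dd (dd v) = 0" by (rule K1_decompose[OF assms(1)]) blast
  obtain v' where v': "\<And>y. br y u' = br y (l0 u') + br y (dd v')" "dd (dd v') = 0" by (rule K1_decompose[OF assms(2)]) blast
  have l: "dd (l0 u) = 0" using assms(1) dd_l0[of u] by (simp add: dd_eq_0_iff[of u])
  have "br (dd v) u' = dd (br v u')" "br (l0 u) (dd v') = dd (br (l0 u) v')"
    using assms l by (simp_all add: dd_br)
  moreover have "dd (dd (br v u')) = 0" "dd (dd (br (l0 u) v')) = 0"
    using assms(2) l v(2) v'(2) by (simp_all add: dd_br br_lin dd_lin)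
  ultimately have "pr0 (br (dd v) u') = 0" "pr0 (br (l0 u) (dd v')) = 0" by (simp_all add: pr0_dd)
  then have "pr0 (br u u') = pr0 (br (l0 u) (l0 u'))" using v(1)[of u'] v'(1)[of "l0 u"] by (simp add: pr_lin)
  then show ?thesis by (simp add: brW_alt odd_br_def pr_lin dd_lin)
qed

lemma compat01:
  assumes u: "dd u = 0" and x: "dd (dd x) = 0"
  shows "brW (pr0 u) (pr1 x) = pr1 (br u x)"
proof -
  obtain v where v: "\<And>y. br u y = br (l0 u) y + br (dd v) y" "dd (dd v) = 0" by (rule K1_decompose[OF u]) blast
  obtain k w where w: "x = pr1 x + k + dd w" "dd k = 0" by (rule K2_decompose[OF x])
  have l: "dd (l0 u) = 0" using u dd_l0[of u] by (simp add: dd_eq_0_iff[of u])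
  have "br (l0 u) x = br (l0 u) (pr1 x) + br (l0 u) k + br (l0 u) (dd w)"
    by (subst w(1)) (simp add: br_lin)
  moreover have "pr1 (br (l0 u) k) = 0" by (rule pr1_K1) (simp add: dd_br l w)
  moreover have "br (l0 u) (dd w) = dd (br (l0 u) w)" by (simp add: dd_br l)
  ultimately have "pr1 (br u x) = pr1 (br (l0 u) (pr1 x))"
    using v(1)[of x] pr1_mixed[OF v(2) x] by (simp add: pr_lin pr1_dd)
  then show ?thesis by (simp add: brW_alt odd_br_def pr_lin dd_lin)
qed

lemma brW_10: "brW (pr1 x) (pr0 u) = - brW (pr0 u) (pr1 x)"
  using br_antisym[of "pr1 x" "l0 u"] by (simp add: brW_alt odd_br_def pr_lin dd_lin)

lemma compat10:
  assumes u: "dd u = 0" and x: "dd (dd x) = 0"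
  shows "brW (pr1 x) (pr0 u) = pr1 (br x u)"
  using compat01[OF assms] br_antisym[of x u] by (simp add: brW_10 pr_lin)

lemma odd_br_K1: "dd (dd x) = 0 \<Longrightarrow> dd (dd y) = 0 \<Longrightarrow> dd (odd_br x y) = 0"
  by (simp add: odd_br_def dd_lin dd_br)

lemma odd_br_reduce:
  assumes x: "dd (dd x) = 0" and y: "dd (dd y) = 0"
  shows "pr0 (odd_br x y) = pr0 (odd_br (pr1 x) y)"
proof -
  obtain k w where w: "x = pr1 x + k + dd w" "dd k = 0" by (rule K2_decompose[OF x])
  have k: "odd_br k y = - dd (br k y)" using w by (simp add: odd_br_def dd_br)
  have "dd (dd (br k y)) = 0" using w y by (simp add: dd_br dd_lin br_lin)
  then have k0: "pr0 (odd_br k y) = 0" unfolding k by (simp add: pr_lin pr0_dd)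
  \<comment> \<open>Since \<open>dd (dd y) = 0\<close>, the Leibniz rule exhibits this bracket as an
    image of \<open>dd\<close>, to which \<open>pr0_dd\<close> can be applied.\<close>
  have d: "odd_br (dd w) y = dd (br (dd w) y - br w (dd y) - br w (dd y))"
  proof -
    have t: "br (dd w) (dd y) + br (dd w) (dd y) + br (dd w) (dd y) = 0" by (rule three_zero)
    have "odd_br (dd w) y = br (dd (dd w)) y - br (dd w) (dd y)" by (simp add: odd_br_def)
    also have "\<dots> = br (dd (dd w)) y + (br (dd w) (dd y) + br (dd w) (dd y)) - (br (dd w) (dd y) + br (dd w) (dd y) + br (dd w) (dd y))" by simp
    also have "\<dots> = br (dd (dd w)) y + br (dd w) (dd y) + br (dd w) (dd y)" unfolding t by simp
    finally have "odd_br (dd w) y = br (dd (dd w)) y + br (dd w) (dd y) + br (dd w) (dd y)" .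
    moreover have "dd (br (dd w) y - br w (dd y) - br w (dd y)) = br (dd (dd w)) y - br (dd w) (dd y)"
      using y by (simp add: dd_br dd_lin)
    ultimately show ?thesis by (simp add: \<open>odd_br (dd w) y = br (dd (dd w)) y - br (dd w) (dd y)\<close>)
  qed
  have "dd (dd (dd w)) = 0" by (rule dd3)
  then have "dd (odd_br (dd w) y) = 0" by (intro odd_br_K1 y) simp
  then have d0: "pr0 (odd_br (dd w) y) = 0" unfolding d by (rule pr0_dd)
  have "odd_br x y = odd_br (pr1 x) y + odd_br k y + odd_br (dd w) y" by (subst w(1)) (simp add: odd_br_lin)
  then show ?thesis by (simp add: pr_lin k0 d0)
qed

lemma compat11:
  assumes x: "dd (dd x) = 0" and y: "dd (dd y) = 0"
  shows "brW (pr1 x) (pr1 y) = pr0 (odd_br x y)"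
proof -
  have "pr0 (odd_br x y) = pr0 (odd_br (pr1 x) (pr1 y))"
    using odd_br_reduce[OF x y] odd_br_reduce[OF y dd_pr1[of x]] by (simp add: odd_br_commute[of _ "pr1 x"])
  then show ?thesis by (simp add: brW_alt pr_lin)
qed

lemma brW_add: "brW (x + y) z = brW x z + brW y z" "brW z (x + y) = brW z x + brW z y"
  by (simp_all add: brW_alt pr_lin br_lin odd_br_lin algebra_simps)

lemma brW_scale: "brW (sca c x) y = sca c (brW x y)" "brW x (sca c y) = sca c (brW x y)"
  by (simp_all add: brW_def pr_lin br_lin dd_lin V.scale_right_distrib V.scale_right_diff_distrib)

lemma restrict_eq_iff: "(\<forall>q. (if q \<in> S then f q else 0) = f q) \<longleftrightarrow> (\<forall>q. q \<notin> S \<longrightarrow> f q = (0::'k))"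
  by metis

lemma WP_0: "x \<in> WP 0 \<longleftrightarrow> wt a1 (fst x) = 0 \<and> wt a2 (fst x) = 0 \<and> pr0 x = x"
  by (simp add: WP_def pr0_def prod_eq_iff fun_eq_iff restrict_eq_iff)

lemma WP_1: "x \<in> WP 1 \<longleftrightarrow> pr1 x = x"
  by (auto simp: WP_def pr1_def prod_eq_iff fun_eq_iff restrict_eq_iff)

lemma WP_E: 
  assumes "x \<in> WP p"
  obtains u where "p = 0" "dd u = 0" "x = pr0 u" | u where "p = 1" "dd (dd u) = 0" "x = pr1 u"
proof (cases p)
  case zero
  then have "dd (l0 x) = 0" "x = pr0 (l0 x)" using assms dd_l0[of x] by (auto simp: WP_0)
  then show ?thesis using that(1) zero by blast
next
  case one
  then show ?thesis using that(2)[of "pr1 x"] assms by (simp add: WP_1 dd_pr1)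
qed

lemma pr0_WP: "dd u = 0 \<Longrightarrow> pr0 u \<in> WP 0"
  by (simp add: WP_0 dd_eq_0_iff) (simp add: pr0_def)

lemma pr1_WP: "pr1 u \<in> WP 1"
  by (simp add: WP_1)

lemma br_K1: "dd u = 0 \<Longrightarrow> dd v = 0 \<Longrightarrow> dd (br u v) = 0"
  by (simp add: dd_br)
lemma br_K12: "dd u = 0 \<Longrightarrow> dd (dd v) = 0 \<Longrightarrow> dd (dd (br u v)) = 0"
  by (simp add: dd_br)
lemma br_K21: "dd u = 0 \<Longrightarrow> dd (dd v) = 0 \<Longrightarrow> dd (dd (br v u)) = 0"
  by (simp add: dd_br)

lemmas compat = compat00 compat01 compat10 compat11
lemmas Kclosed = br_K1 br_K12 br_K21 odd_br_K1

lemma brW_WP: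
  assumes "x \<in> WP p" "y \<in> WP q"
  shows "brW x y \<in> WP (p + q)"
  using assms by (elim WP_E) (simp_all add: compat pr0_WP pr1_WP Kclosed)

lemma brW_antisym:
  assumes "x \<in> WP p" "y \<in> WP q"
  shows "brW x y + sca (koszul_sign p q) (brW y x) = 0"
proof -
  have "pr0 (br u v) + pr0 (br v u) = 0" "pr1 (br u v) + pr1 (br v u) = 0" for u v
    using br_antisym[of u v] by (simp_all add: pr_lin)
  then show ?thesis
    using assms by (elim WP_E) (simp_all add: compat koszul_sign_def odd_br_commute)
qed

text \<open>\<open>WP_E\<close> represents the arguments by elements of the kernel of
  \<open>dd\<close> or of its square, and \<open>compat\<close> turns \<open>brW\<close> into
  brackets of these. With at most one odd argument the identity is the Jacobi identity of
  \<open>br\<close>; with two it says that an element of the kernel of \<open>dd\<close> acts as a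
  derivation of \<open>odd_br\<close>.\<close>

lemma brW_jacobi:
  assumes "x \<in> WP p" "y \<in> WP q" "z \<in> WP r"
  shows "brW x (brW y z) - brW (brW x y) z - sca (koszul_sign p q) (brW y (brW x z)) = 0"
  using assms
proof (elim WP_E, goal_cases)
  case (1 u v w)
  then show ?case using jacobi[of u v w] by (simp add: compat Kclosed koszul_sign_def pr_lin)
next
  case (2 u v w)
  then show ?case using jacobi[of u v w] by (simp add: compat Kclosed koszul_sign_def pr_lin)
next
  case (3 u v w)
  then show ?case using jacobi[of u v w] by (simp add: compat Kclosed koszul_sign_def pr_lin)
next
  case (4 u v w)
  have "br u (odd_br v w) = odd_br (br u v) w + odd_br v (br u w)"
    using 4 by (simp add: odd_br_def dd_br br_lin jacobi[of u])
  then show ?case using 4 by (simp add: compat Kclosed koszul_sign_def pr_lin)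
next
  case (5 u v w)
  then show ?case using jacobi[of u v w] by (simp add: compat Kclosed koszul_sign_def pr_lin)
next
  case (6 u v w)
  have "br v (odd_br u w) = odd_br (br v u) w + odd_br u (br v w)"
    using 6 by (simp add: odd_br_def dd_br br_lin jacobi[of v])
  moreover have "odd_br (br u v) w = - odd_br (br v u) w" using br_antisym[of u v] by (simp add: odd_br_def dd_lin)
  ultimately show ?case using 6 by (simp add: compat Kclosed koszul_sign_def pr_lin)
next
  case (7 u v w)
  have "br w (odd_br u v) = odd_br (br w u) v + odd_br u (br w v)"
    using 7 by (simp add: odd_br_def dd_br br_lin jacobi[of w])
  moreover have "br w (odd_br u v) = - br (odd_br u v) w" by (rule br_antisym)
  moreover have "odd_br (br w u) v = - odd_br v (br u w)"
    unfolding odd_br_commute[of v] using br_antisym[of w u] by (simp add: odd_br_def dd_lin)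
  moreover have "odd_br u (br w v) = - odd_br u (br v w)" using br_antisym[of w v] by (simp add: odd_br_def dd_lin)
  ultimately have "odd_br u (br v w) - br (odd_br u v) w + odd_br v (br u w) = 0" by (simp add: algebra_simps)
  then have "pr0 (odd_br u (br v w) - br (odd_br u v) w + odd_br v (br u w)) = 0" by (simp add: pr_lin)
  then have "pr0 (odd_br u (br v w)) - pr0 (br (odd_br u v) w) + pr0 (odd_br v (br u w)) = 0" by (simp add: pr_lin)
  then show ?case using 7 by (simp add: compat Kclosed koszul_sign_def)
next
  case (8 u v w)
  \<comment> \<open>Three odd arguments: after adding an image of \<open>dd\<close> to the Jacobi
    sum every term occurs three times, so the total is zero in characteristic 3, and
    \<open>pr1\<close> does not see what was added.\<close>
  let ?t = "br u (odd_br v w) - br (odd_br u v) w + br v (odd_br u w)"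
  let ?d = "dd (br u (br v w)) + dd (br v (br u w))"
  have j1: "br (br u (dd v)) w = br u (br (dd v) w) - br (dd v) (br u w)" using jacobi[of u "dd v" w] by simp
  have j2: "br (br (dd u) v) w = br (dd u) (br v w) - br v (br (dd u) w)" using jacobi[of "dd u" v w] by simp
  have "?t + ?d = (br u (br (dd v) w) + br u (br (dd v) w) + br u (br (dd v) w)) +
      (br v (br (dd u) w) + br v (br (dd u) w) + br v (br (dd u) w))"
    unfolding odd_br_def br_lin dd_br j1 j2 by (simp add: algebra_simps)
  then have "pr1 (?t + ?d) = 0" unfolding three_zero by (simp add: pr_lin)
  then have "pr1 ?t = 0" by (simp add: pr_lin pr1_dd)
  then show ?case using 8 by (simp add: compat Kclosed koszul_sign_def pr_lin)
qed

end

section \<open>Supports and gradings of the lattice Lie algebra\<close>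

context lattice_lie begin

definition supported :: "'h \<times> ('q \<Rightarrow> 'k) \<Rightarrow> bool" where "supported x \<longleftrightarrow> (\<forall>q. q \<notin> roots \<longrightarrow> snd x q = 0)"

lemma supported_br [simp]: "supported (br x y)"
  by (simp add: supported_def br_def)
lemma supported_lin: "supported x \<Longrightarrow> supported y \<Longrightarrow> supported (x + y)" "supported x \<Longrightarrow> supported (sca c x)"
  "supported x \<Longrightarrow> supported (- x)" "supported 0"
  by (simp_all add: supported_def sca_def)
lemma supported_H [simp]: "supported (Hh h)" and supported_E: "r \<in> roots \<Longrightarrow> supported (Ee r)"
  by (auto simp: supported_def Hh_def Ee_def)
lemma supported_sub: "V.subspace {x. supported x}"
  by (rule V.subspaceI) (auto simp: supported_lin)

lemma supported_expand: "supported x \<Longrightarrow> x = Hh (fst x) + (\<Sum>r\<in>roots. sca (snd x r) (Ee r))"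
proof -
  assume "supported x"
  then have "rs x = x" by (auto simp: rs_def supported_def prod_eq_iff fun_eq_iff)
  then show ?thesis using rs_decompose[of x] by simp
qed

text \<open>The weight \<open>w\<close> is left open: besides the full weight of E6 it will be a
  weight that forgets \<open>a1\<close> and \<open>a2\<close>.\<close>

definition graded :: "('q \<Rightarrow> 'z::ab_group_add) \<Rightarrow> 'z \<Rightarrow> ('h \<times> ('q \<Rightarrow> 'k)) set"
  where "graded w z = {x. (z \<noteq> 0 \<longrightarrow> fst x = 0) \<and> (\<forall>q. snd x q \<noteq> 0 \<longrightarrow> w q = z)}"

lemma graded_sub: "V.subspace (graded w z)"
  by (rule V.subspaceI) (auto simp: graded_def sca_def, (metis add_0)+)

lemma graded_H: "Hh h \<in> graded w 0" by (simp add: graded_def Hh_def)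
lemma graded_E: "Ee r \<in> graded w (w r)" by (auto simp: graded_def Ee_def)

lemma graded_br:
  assumes w: "\<And>x y. w (x + y) = w x + w y" and x: "x \<in> graded w z" and y: "y \<in> graded w z'"
  shows "br x y \<in> graded w (z + z')"
proof -
  have w0: "w 0 = 0" using w[of 0 0] by simp
  have wm: "w (- q) = - w q" for q using w[of q "- q"] w0 by (simp add: eq_neg_iff_add_eq_0 add.commute)
  have "fst (br x y) = 0" if "z + z' \<noteq> 0"
  proof -
    have "snd x r * snd y (- r) = 0" for r
    proof (rule ccontr)
      assume "snd x r * snd y (- r) \<noteq> 0"
      then have "w r = z" "w (- r) = z'" using x y by (auto simp: graded_def)
      then have "z' = - z" using wm[of r] by simp
      then show False using that by simp
    qed
    note z = this
    show ?thesis unfolding br_def fst_conv by (rule sum.neutral) (simp add: z del: mult_eq_0_iff)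
  qed
  moreover have "w q = z + z'" if q: "snd (br x y) q \<noteq> 0" for q
  proof (rule ccontr)
    assume n: "w q \<noteq> z + z'"
    have 1: "wt q (fst x) * snd y q = 0"
    proof (cases "z = 0")
      case True then show ?thesis using y n by (auto simp: graded_def)
    next
      case False then show ?thesis using x by (simp add: graded_def)
    qed
    have 2: "wt q (fst y) * snd x q = 0"
    proof (cases "z' = 0")
      case True then show ?thesis using x n by (auto simp: graded_def)
    next
      case False then show ?thesis using y by (simp add: graded_def)
    qed
    have 3: "eps r (q - r) * snd x r * snd y (q - r) = 0" for r
    proof (rule ccontr)
      assume "eps r (q - r) * snd x r * snd y (q - r) \<noteq> 0"
      then have "w r = z" "w (q - r) = z'" using x y by (auto simp: graded_def)
      then show False using n w[of r "q - r"] by simp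
    qed
    have "snd (br x y) q = 0" unfolding br_def snd_conv 1 2 3 by simp
    then show False using q by simp
  qed
  ultimately show ?thesis by (auto simp: graded_def)
qed

definition grade_proj :: "('q \<Rightarrow> 'z::ab_group_add) \<Rightarrow> 'z \<Rightarrow> 'h \<times> ('q \<Rightarrow> 'k) \<Rightarrow> 'h \<times> ('q \<Rightarrow> 'k)"
  where "grade_proj w z x = (if z = 0 then fst x else 0, \<lambda>q. if w q = z then snd x q else 0)"

lemma grade_proj_add: "grade_proj w z (x + y) = grade_proj w z x + grade_proj w z y"
  by (auto simp: grade_proj_def fun_eq_iff)

lemma grade_proj_graded: "x \<in> graded w z \<Longrightarrow> grade_proj w z' x = (if z = z' then x else 0)"
  by (auto simp: grade_proj_def graded_def prod_eq_iff fun_eq_iff)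

end

section \<open>The root lattice of type E6\<close>

type_synonym e6 = "int \<times> int \<times> int \<times> int \<times> int \<times> int"

text \<open>Half of the Cartan matrix with an orientation of the Dynkin diagram: each edge
  contributes -1 to the form in one order of its two simple roots and 0 in the other. Symmetrising
  gives the usual form, so the roots have norm 1 here.\<close>

fun e6_form :: "e6 \<Rightarrow> e6 \<Rightarrow> int"
  where "e6_form (x1, x2, x3, x4, x5, x6) (y1, y2, y3, y4, y5, y6) =
    x1 * y1 + x2 * y2 + x3 * y3 + x4 * y4 + x5 * y5 + x6 * y6 - x1 * y3 - x3 * y4 - x2 * y4 - x4 * y5 - x5 * y6"

text \<open>Squares are completed first at the end nodes \<open>x1\<close>, \<open>x2\<close>,
  \<open>x6\<close>, then at \<open>x3\<close> and \<open>x5\<close>, and \<open>x4\<close> remains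
  with coefficient 1/12; the factor 12 clears the denominators. Positivity and the finiteness of the
  set of roots follow.\<close>

lemma e6_form_squares:
  "12 * e6_form (x1, x2, x3, x4, x5, x6) (x1, x2, x3, x4, x5, x6) =
    3 * (2 * x1 - x3)\<^sup>2 + 3 * (2 * x2 - x4)\<^sup>2 + 3 * (2 * x6 - x5)\<^sup>2 + (3 * x3 - 2 * x4)\<^sup>2 + (3 * x5 - 2 * x4)\<^sup>2 + x4\<^sup>2"
  by (simp add: power2_eq_square algebra_simps)

lemma int_square_bound:
  assumes "(z::int)\<^sup>2 \<le> 12" shows "z \<in> {-3..3}"
proof -
  have "\<not> 4 \<le> \<bar>z\<bar>"
  proof
    assume "4 \<le> \<bar>z\<bar>"
    then have "4\<^sup>2 \<le> \<bar>z\<bar>\<^sup>2" by (rule power_mono) simp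
    then show False using assms by simp
  qed
  then show ?thesis by auto
qed

lemma e6_form_root_bounds:
  assumes "e6_form (x1, x2, x3, x4, x5, x6) (x1, x2, x3, x4, x5, x6) = 1"
  shows "2 * x1 - x3 \<in> {-3..3}" "2 * x2 - x4 \<in> {-3..3}" "2 * x6 - x5 \<in> {-3..3}" "3 * x3 - 2 * x4 \<in> {-3..3}"
    "3 * x5 - 2 * x4 \<in> {-3..3}" "x4 \<in> {-3..3}"
proof -
  have s: "3 * (2 * x1 - x3)\<^sup>2 + 3 * (2 * x2 - x4)\<^sup>2 + 3 * (2 * x6 - x5)\<^sup>2 + (3 * x3 - 2 * x4)\<^sup>2 + (3 * x5 - 2 * x4)\<^sup>2 + x4\<^sup>2 = 12"
    using e6_form_squares[of x1 x2 x3 x4 x5 x6] assms by simp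
  have p: "(2 * x1 - x3)\<^sup>2 \<ge> 0" "(2 * x2 - x4)\<^sup>2 \<ge> 0" "(2 * x6 - x5)\<^sup>2 \<ge> 0" "(3 * x3 - 2 * x4)\<^sup>2 \<ge> 0" "(3 * x5 - 2 * x4)\<^sup>2 \<ge> 0" "x4\<^sup>2 \<ge> 0"
    by simp_all
  show "2 * x1 - x3 \<in> {-3..3}" "2 * x2 - x4 \<in> {-3..3}" "2 * x6 - x5 \<in> {-3..3}" "3 * x3 - 2 * x4 \<in> {-3..3}"
    "3 * x5 - 2 * x4 \<in> {-3..3}" "x4 \<in> {-3..3}"
    by (rule int_square_bound, use s p in linarith)+
qed

interpretation E: root_lattice e6_form
proof
  fix x y z :: e6
  show "e6_form (x + y) z = e6_form x z + e6_form y z" "e6_form x (y + z) = e6_form x y + e6_form x z"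
    by (cases x; cases y; cases z; simp add: algebra_simps)+
  show "x \<noteq> 0 \<Longrightarrow> 0 < e6_form x x"
  proof (cases x)
    case (fields x1 x2 x3 x4 x5 x6)
    assume nz: "x \<noteq> 0"
    let ?s = "3 * (2 * x1 - x3)\<^sup>2 + 3 * (2 * x2 - x4)\<^sup>2 + 3 * (2 * x6 - x5)\<^sup>2 + (3 * x3 - 2 * x4)\<^sup>2 + (3 * x5 - 2 * x4)\<^sup>2 + x4\<^sup>2"
    have p: "(2 * x1 - x3)\<^sup>2 \<ge> 0" "(2 * x2 - x4)\<^sup>2 \<ge> 0" "(2 * x6 - x5)\<^sup>2 \<ge> 0" "(3 * x3 - 2 * x4)\<^sup>2 \<ge> 0" "(3 * x5 - 2 * x4)\<^sup>2 \<ge> 0" "x4\<^sup>2 \<ge> 0"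
      by simp_all
    show "0 < e6_form x x"
    proof (rule ccontr)
      assume "\<not> 0 < e6_form x x"
      then have "?s \<le> 0" using e6_form_squares[of x1 x2 x3 x4 x5 x6] by (simp add: fields)
      then have "(2 * x1 - x3)\<^sup>2 = 0" "(2 * x2 - x4)\<^sup>2 = 0" "(2 * x6 - x5)\<^sup>2 = 0" "(3 * x3 - 2 * x4)\<^sup>2 = 0" "(3 * x5 - 2 * x4)\<^sup>2 = 0" "x4\<^sup>2 = 0"
        using p by linarith+
      then have "x1 = 0 \<and> x2 = 0 \<and> x3 = 0 \<and> x4 = 0 \<and> x5 = 0 \<and> x6 = 0" by simp
      then show False using nz by (simp add: fields zero_prod_def)
    qed
  qed
next
  let ?I = "{-9..9} :: int set"
  have "{x. e6_form x x = 1} \<subseteq> ?I \<times> ?I \<times> ?I \<times> ?I \<times> ?I \<times> ?I"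
  proof
    fix x assume "x \<in> {x. e6_form x x = 1}"
    then show "x \<in> ?I \<times> ?I \<times> ?I \<times> ?I \<times> ?I \<times> ?I"
    proof (cases x)
      case (fields x1 x2 x3 x4 x5 x6)
      assume "x \<in> {x. e6_form x x = 1}"
      then have "e6_form (x1, x2, x3, x4, x5, x6) (x1, x2, x3, x4, x5, x6) = 1" by (simp add: fields)
      note b = e6_form_root_bounds[OF this]
      show ?thesis unfolding fields mem_Times_iff fst_conv snd_conv using b by auto
    qed
  qed
  then show "finite {x. e6_form x x = 1}" by (rule finite_subset) simp
qed

definition simple_root :: "nat \<Rightarrow> e6"
  where "simple_root i = (if i = 0 then 1 else 0, if i = 1 then 1 else 0, if i = 2 then 1 else 0,
     if i = 3 then 1 else 0, if i = 4 then 1 else 0, if i = 5 then 1 else 0)"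

fun coord :: "nat \<Rightarrow> e6 \<Rightarrow> int"
  where "coord i (x1, x2, x3, x4, x5, x6) =
    (if i = 0 then x1 else if i = 1 then x2 else if i = 2 then x3 else if i = 3 then x4 else if i = 4 then x5 else if i = 5 then x6 else 0)"

definition sA :: e6 where "sA = simple_root 0"
definition sB :: e6 where "sB = simple_root 1"

lemma sum6: "(\<Sum>i<6. f i) = f 0 + f 1 + f 2 + f 3 + f 4 + f (5::nat)" for f :: "nat \<Rightarrow> 'a::comm_monoid_add"
  by (simp add: eval_nat_numeral add_ac)

lemma less6: "i < 6 \<longleftrightarrow> i = 0 \<or> i = 1 \<or> i = 2 \<or> i = 3 \<or> i = 4 \<or> i = (5::nat)"
  by auto

lemma coord_add: "coord i (x + y) = coord i x + coord i y"
  by (cases x; cases y) simp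

lemma coord_zero: "coord i 0 = 0"
  by (simp add: zero_prod_def)

lemma coord_simple_root: "coord i (simple_root j) = (if i = j \<and> j < 6 then 1 else 0)"
proof (cases "i < 6")
  case True
  then consider "i = 0" | "i = 1" | "i = 2" | "i = 3" | "i = 4" | "i = 5" unfolding less6 by blast
  then show ?thesis by cases (simp_all add: simple_root_def)
next
  case False
  then have "i \<noteq> 0" "i \<noteq> 1" "i \<noteq> 2" "i \<noteq> 3" "i \<noteq> 4" "i \<noteq> 5" by auto
  then have "coord i (simple_root j) = 0" unfolding simple_root_def coord.simps by (simp only: if_False)
  then show ?thesis using False by auto
qed

lemma coord_minus: "coord i (- x) = - coord i x"
  by (cases x) simp

lemma coord_inject: "(\<And>i. i < 6 \<Longrightarrow> coord i x = coord i y) \<Longrightarrow> x = y"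
proof -
  assume *: "\<And>i. i < 6 \<Longrightarrow> coord i x = coord i y"
  show "x = y" using *[of 0] *[of 1] *[of 2] *[of 3] *[of 4] *[of 5] by (cases x; cases y) simp
qed

lemma ip_simple_root_left:
  "E.ip (simple_root 0) (y1, y2, y3, y4, y5, y6) = 2 * y1 - y3"
  "E.ip (simple_root 1) (y1, y2, y3, y4, y5, y6) = 2 * y2 - y4"
  "E.ip (simple_root 2) (y1, y2, y3, y4, y5, y6) = 2 * y3 - y1 - y4"
  "E.ip (simple_root 3) (y1, y2, y3, y4, y5, y6) = 2 * y4 - y2 - y3 - y5"
  "E.ip (simple_root 4) (y1, y2, y3, y4, y5, y6) = 2 * y5 - y4 - y6"
  "E.ip (simple_root 5) (y1, y2, y3, y4, y5, y6) = 2 * y6 - y5"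
  by (simp_all add: E.ip_def simple_root_def)

lemma dim_e6: "dim_row cartan_e6 = 6"
  by (simp add: cartan_e6_def mat_of_rows_list_def)

lemma cartan_e6_entry: "i < 6 \<Longrightarrow> j < 6 \<Longrightarrow> cartan_e6 $$ (i, j) =
  [[2, 0, -1, 0, 0, 0], [0, 2, 0, -1, 0, 0], [-1, 0, 2, -1, 0, 0], [0, -1, -1, 2, -1, 0],
   [0, 0, 0, -1, 2, -1], [0, 0, 0, 0, -1, 2]] ! i ! j"
  by (simp add: cartan_e6_def mat_of_rows_list_def)

lemma ip_expand: "E.ip x y = (\<Sum>i<6. coord i x * E.ip (simple_root i) y)"
proof (cases x; cases y)
  fix x1 x2 x3 x4 x5 x6 y1 y2 y3 y4 y5 y6
  assume x: "x = (x1, x2, x3, x4, x5, x6)" and y: "y = (y1, y2, y3, y4, y5, y6)"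
  have "E.ip x y = x1 * (2 * y1 - y3) + x2 * (2 * y2 - y4) + x3 * (2 * y3 - y1 - y4) +
      x4 * (2 * y4 - y2 - y3 - y5) + x5 * (2 * y5 - y4 - y6) + x6 * (2 * y6 - y5)"
    unfolding x y E.ip_def e6_form.simps by (simp add: algebra_simps)
  also have "\<dots> = (\<Sum>i<6. coord i x * E.ip (simple_root i) y)"
    unfolding x y sum6 ip_simple_root_left by simp
  finally show ?thesis .
qed

lemma simple_root_root: "i < 6 \<Longrightarrow> simple_root i \<in> E.roots"
  by (auto simp: less6 E.roots_def simple_root_def)

lemma ip_simple_root_row: "i < 6 \<Longrightarrow> E.ip (simple_root i) y = (\<Sum>k<6. cartan_e6 $$ (i, k) * coord k y)"
proof -
  obtain y1 y2 y3 y4 y5 y6 where y: "y = (y1, y2, y3, y4, y5, y6)" by (cases y)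
  have c: "coord 0 y = y1" "coord 1 y = y2" "coord 2 y = y3" "coord 3 y = y4" "coord 4 y = y5" "coord 5 y = y6" by (simp_all add: y)
  assume "i < 6"
  then consider "i = 0" | "i = 1" | "i = 2" | "i = 3" | "i = 4" | "i = 5" unfolding less6 by blast
  then show ?thesis
  proof cases
    case 1 show ?thesis unfolding 1 sum6 c unfolding y ip_simple_root_left by (simp add: cartan_e6_entry)
  next
    case 2 show ?thesis unfolding 2 sum6 c unfolding y ip_simple_root_left by (simp add: cartan_e6_entry)
  next
    case 3 show ?thesis unfolding 3 sum6 c unfolding y ip_simple_root_left by (simp add: cartan_e6_entry)
  next
    case 4 show ?thesis unfolding 4 sum6 c unfolding y ip_simple_root_left by (simp add: cartan_e6_entry)
  next
    case 5 show ?thesis unfolding 5 sum6 c unfolding y ip_simple_root_left by (simp add: cartan_e6_entry)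
  next
    case 6 show ?thesis unfolding 6 sum6 c unfolding y ip_simple_root_left by (simp add: cartan_e6_entry)
  qed
qed

lemma ip_simple_root: "i < 6 \<Longrightarrow> j < 6 \<Longrightarrow> E.ip (simple_root i) (simple_root j) = cartan_e6 $$ (i, j)"
proof -
  assume i: "i < 6" and j: "j < 6"
  have "E.ip (simple_root i) (simple_root j) = (\<Sum>k<6. if k = j then cartan_e6 $$ (i, k) else 0)"
    unfolding ip_simple_root_row[OF i] by (rule sum.cong) (auto simp: coord_simple_root j)
  then show ?thesis using j by simp
qed

lemma cartan_e6_offdiag: "i < 6 \<Longrightarrow> j < 6 \<Longrightarrow> cartan_e6 $$ (i, j) \<noteq> 1"
proof -
  assume i: "i < 6" and j: "j < 6"
  have "\<forall>j<6. [[2, 0, -1, 0, 0, 0], [0, 2, 0, -1, 0, 0], [-1, 0, 2, -1, 0, 0], [0, -1, -1, 2, -1, 0],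
   [0, 0, 0, -1, 2, -1], [0, 0, 0, 0, -1, 2 :: int]] ! i ! j \<noteq> 1"
    using i unfolding less6 by (elim disjE; simp only:; simp add: all_conj_distrib imp_disjL)
  then show ?thesis using i j by (simp add: cartan_e6_entry)
qed

lemma simple_root_inj: "i < 6 \<Longrightarrow> j < 6 \<Longrightarrow> simple_root i = simple_root j \<longleftrightarrow> i = j"
  using coord_simple_root[of i i] coord_simple_root[of i j] by (auto split: if_splits)

definition e6_weight :: "e6 \<Rightarrow> nat \<Rightarrow>\<^sub>0 int" where "e6_weight x = (\<Sum>i<6. Poly_Mapping.single i (coord i x))"

lemma e6_weight_add: "e6_weight (x + y) = e6_weight x + e6_weight y"
  by (simp add: e6_weight_def coord_add single_add sum.distrib)

lemma lookup_e6_weight: "Poly_Mapping.lookup (e6_weight x) i = coord i x"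
proof -
  have "Poly_Mapping.lookup (e6_weight x) i = (\<Sum>j<6. if j = i then coord j x else 0)"
    unfolding e6_weight_def lookup_sum' by (rule sum.cong) (auto simp: lookup_single when_def)
  also have "\<dots> = coord i x" by (cases x) auto
  finally show ?thesis .
qed

lemma e6_weight_inj: "e6_weight x = e6_weight y \<Longrightarrow> x = y"
  by (rule coord_inject) (metis lookup_e6_weight)

lemma e6_weight_simple_root: "i < 6 \<Longrightarrow> e6_weight (simple_root i) = Poly_Mapping.single i 1"
  by (rule poly_mapping_eqI) (auto simp: lookup_e6_weight coord_simple_root lookup_single when_def)

lemma e6_weight_0: "e6_weight 0 = 0" and e6_weight_minus: "e6_weight (- x) = - e6_weight x"
  using e6_weight_add[of 0 0] e6_weight_add[of x "- x"] by (auto simp: eq_neg_iff_add_eq_0 add.commute)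

text \<open>Only the pairing of coroots and roots is fixed, so that the same constructions run over
  the given Cartan space of \<open>e6\<close>, over the enlarged one for \<open>g(3,3)\<close>, and
  over the adjoint one, in which the coroots are dependent.\<close>

locale e6_realization = vector_space scl for scl :: "'k::field \<Rightarrow> 'h::ab_group_add \<Rightarrow> 'h" +
  fixes hh :: "nat \<Rightarrow> 'h" and \<alpha> :: "nat \<Rightarrow> 'h \<Rightarrow> 'k"
  assumes char3: "(3::'k) = 0"
    and \<alpha>_add: "j < 6 \<Longrightarrow> \<alpha> j (x + y) = \<alpha> j x + \<alpha> j y"
    and \<alpha>_scale: "j < 6 \<Longrightarrow> \<alpha> j (scl c x) = c * \<alpha> j x"
    and \<alpha>_hh: "i < 6 \<Longrightarrow> j < 6 \<Longrightarrow> \<alpha> j (hh i) = of_int (cartan_e6 $$ (i, j))"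
begin

definition hmE :: "e6 \<Rightarrow> 'h" where "hmE x = (\<Sum>i<6. scl (of_int (coord i x)) (hh i))"
definition wtE :: "e6 \<Rightarrow> 'h \<Rightarrow> 'k" where "wtE x h = (\<Sum>j<6. of_int (coord j x) * \<alpha> j h)"

lemma \<alpha>_zero: "j < 6 \<Longrightarrow> \<alpha> j 0 = 0"
  using \<alpha>_scale[of j 0 0] by simp
lemma \<alpha>_sum: "j < 6 \<Longrightarrow> \<alpha> j (\<Sum>i\<in>I. g i) = (\<Sum>i\<in>I. \<alpha> j (g i))"
  by (induction I rule: infinite_finite_induct) (auto simp: \<alpha>_add \<alpha>_zero)

sublocale lattice_sem e6_form scl hmE wtE sA sB
proof
  fix x y h h' c
  show "hmE (x + y) = hmE x + hmE y" by (simp add: hmE_def coord_add scale_left_distrib sum.distrib)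
  show "wtE (x + y) h = wtE x h + wtE y h" by (simp add: wtE_def coord_add algebra_simps sum.distrib)
  show "wtE x (h + h') = wtE x h + wtE x h'" by (simp add: wtE_def \<alpha>_add algebra_simps sum.distrib)
  show "wtE x (scl c h) = c * wtE x h" by (simp add: wtE_def \<alpha>_scale sum_distrib_left mult.left_commute)
  show "wtE x (hmE y) = of_int (E.ip x y)"
  proof -
    have "wtE x (hmE y) = (\<Sum>j<6. of_int (coord j x) * (\<Sum>i<6. of_int (coord i y) * of_int (cartan_e6 $$ (i, j))))"
      unfolding wtE_def hmE_def by (intro sum.cong refl) (simp add: \<alpha>_sum \<alpha>_scale \<alpha>_hh)
    also have "\<dots> = of_int (\<Sum>j<6. coord j x * (\<Sum>i<6. coord i y * (cartan_e6 $$ (i, j))))" by simp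
    also have "(\<Sum>j<6. coord j x * (\<Sum>i<6. coord i y * (cartan_e6 $$ (i, j)))) = (\<Sum>j<6. coord j x * E.ip (simple_root j) y)"
      by (intro sum.cong refl arg_cong2[where f = "(*)"])
        (subst E.ip_commute, subst ip_expand, intro sum.cong refl, simp add: ip_simple_root)
    also have "\<dots> = E.ip x y" by (rule ip_expand[symmetric])
    finally show ?thesis .
  qed
  show "(3::'k) = 0" by (rule char3)
  show "sA \<in> E.roots" "sB \<in> E.roots" by (simp_all add: simple_root_root sA_def sB_def)
  show "e6_form sA sB = 0" "e6_form sB sA = 0" by (simp_all add: simple_root_def sA_def sB_def)
qed

lemma hmE_simple_root: "i < 6 \<Longrightarrow> hmE (simple_root i) = hh i"
  by (auto simp: hmE_def coord_simple_root less6 sum6)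
lemma wtE_simple_root: "i < 6 \<Longrightarrow> wtE (simple_root i) = \<alpha> i"
  by (auto simp: wtE_def coord_simple_root less6 sum6)

definition e6_e :: "nat \<Rightarrow> 'h \<times> (e6 \<Rightarrow> 'k)" where "e6_e i = Ee (simple_root i)"
text \<open>The sign compensates the one in \<open>br_EE\<close>, by which \<open>E r\<close> and
  \<open>E (- r)\<close> have bracket \<open>- Hh (hm r)\<close>.\<close>

definition e6_f :: "nat \<Rightarrow> 'h \<times> (e6 \<Rightarrow> 'k)" where "e6_f i = - Ee (- simple_root i)"

abbreviation (input) "ev6 \<equiv> magma_eval br (generator_image Hh e6_e e6_f)"

text \<open>A single monomial is asked for rather than a combination, because both
  \<open>nondeg\<close> and the description of the derived algebra evaluate monomials.\<close>

definition reach6 :: "e6 \<Rightarrow> bool"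
  where "reach6 r \<longleftrightarrow> (\<exists>m. letters m \<subseteq> gens 6 \<and> magma_deg gen_weight m = e6_weight r \<and> (\<exists>c. c \<noteq> 0 \<and> ev6 m = sca c (Ee r)))"

lemma reach6_step:
  assumes r: "r \<in> E.roots" "reach6 r" and i: "i < 6"
  shows "E.ip (simple_root i) r = - 1 \<Longrightarrow> reach6 (simple_root i + r)" "E.ip (simple_root i) r = 1 \<Longrightarrow> reach6 (r - simple_root i)"
proof -
  obtain m c where m: "letters m \<subseteq> gens 6" "magma_deg gen_weight m = e6_weight r" "c \<noteq> 0" "ev6 m = sca c (Ee r)"
    using r unfolding reach6_def by blast
  { assume p: "E.ip (simple_root i) r = - 1"
    have "ev6 (MProd (Letter (Egen i)) m) = sca (c * E.eps (simple_root i) r) (Ee (simple_root i + r))"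
      using p by (simp add: e6_e_def m br_lin br_EE simple_root_root i r)
    moreover have "letters (MProd (Letter (Egen i)) m) \<subseteq> gens 6" using m i by (auto simp: gens_def)
    moreover have "magma_deg gen_weight (MProd (Letter (Egen i)) m) = e6_weight (simple_root i + r)" by (simp add: m e6_weight_add e6_weight_simple_root i)
    moreover have "c * E.eps (simple_root i) r \<noteq> 0" using m by simp
    ultimately show "reach6 (simple_root i + r)" unfolding reach6_def by blast }
  { assume p: "E.ip (simple_root i) r = 1"
    have "E.ip (- simple_root i) r = - 1" using p by (simp add: E.ip_lin)
    then have "ev6 (MProd (Letter (Fgen i)) m) = sca (- (c * E.eps (simple_root i) r)) (Ee (r - simple_root i))"
      by (simp add: e6_f_def m br_lin br_EE simple_root_root i r)
    moreover have "letters (MProd (Letter (Fgen i)) m) \<subseteq> gens 6" using m i by (auto simp: gens_def)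
    moreover have "magma_deg gen_weight (MProd (Letter (Fgen i)) m) = e6_weight (r - simple_root i)"
      using e6_weight_add[of r "- simple_root i"] by (simp add: m e6_weight_minus e6_weight_simple_root i)
    moreover have "- (c * E.eps (simple_root i) r) \<noteq> 0" using m by simp
    ultimately show "reach6 (r - simple_root i)" unfolding reach6_def by blast }
qed

lemma reach6_simple:
  assumes i: "i < 6"
  shows "reach6 (simple_root i)" "reach6 (- simple_root i)"
proof -
  have "ev6 (Letter (Egen i)) = sca 1 (Ee (simple_root i))" "ev6 (Letter (Fgen i)) = sca (- 1) (Ee (- simple_root i))"
    by (simp_all add: e6_e_def e6_f_def)
  moreover have "letters (Letter (Egen i)) \<subseteq> gens 6" "letters (Letter (Fgen i)) \<subseteq> gens 6" using i by (auto simp: gens_def)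
  moreover have "magma_deg gen_weight (Letter (Egen i)) = e6_weight (simple_root i)" "magma_deg gen_weight (Letter (Fgen i)) = e6_weight (- simple_root i)"
    using i by (simp_all add: e6_weight_simple_root e6_weight_minus)
  moreover have "(1::'k) \<noteq> 0" "(- 1::'k) \<noteq> 0" by simp_all
  ultimately show "reach6 (simple_root i)" "reach6 (- simple_root i)" unfolding reach6_def by blast+
qed

text \<open>Since \<open>2 = \<Sum>i. c\<^sub>i (\<beta>, \<alpha>\<^sub>i)\<close> for a root \<open>\<beta> = \<Sum>i. c\<^sub>i \<alpha>\<^sub>i\<close>, some simple root can be split off so as to decrease \<open>\<Sum>i. \<bar>c\<^sub>i\<bar>\<close>.\<close>

lemma reach6_all: "r \<in> E.roots \<Longrightarrow> reach6 r"
proof (induction "nat (\<Sum>i<6. \<bar>coord i r\<bar>)" arbitrary: r rule: less_induct)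
  case less
  have "(\<Sum>i<6. coord i r * E.ip (simple_root i) r) = 2" using ip_expand[of r r] E.ip_self[OF less.prems] by simp
  then have "\<exists>i\<in>{..<6}. coord i r * E.ip (simple_root i) r > 0"
    by (metis (no_types, lifting) linorder_not_less sum_nonpos zero_less_numeral)
  then obtain i where i: "i < 6" "coord i r * E.ip (simple_root i) r > 0" by auto
  have smaller: "nat (\<Sum>k<6. \<bar>coord k (r + s)\<bar>) < nat (\<Sum>k<6. \<bar>coord k r\<bar>)"
    if s: "s = simple_root i \<and> coord i r < 0 \<or> s = - simple_root i \<and> coord i r > 0" for s
  proof -
    have "(\<Sum>k<6. \<bar>coord k (r + s)\<bar>) < (\<Sum>k<6. \<bar>coord k r\<bar>)"
    proof (rule sum_strict_mono_ex1)
      show "\<forall>k\<in>{..<6}. \<bar>coord k (r + s)\<bar> \<le> \<bar>coord k r\<bar>" using s i by (auto simp: coord_add coord_minus coord_simple_root)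
      show "\<exists>k\<in>{..<6}. \<bar>coord k (r + s)\<bar> < \<bar>coord k r\<bar>" using s i by (intro bexI[of _ i]) (auto simp: coord_add coord_minus coord_simple_root)
    qed simp
    moreover have "0 \<le> (\<Sum>k<6. \<bar>coord k (r + s)\<bar>)" by (intro sum_nonneg) simp
    ultimately show ?thesis by linarith
  qed
  have bd: "E.ip (simple_root i) r \<in> {-2,-1,0,1,2}" using E.ip_bounds[OF simple_root_root[OF i(1)] less.prems] by auto
  show ?case
  proof (cases "coord i r > 0")
    case True
    then have "E.ip (simple_root i) r = 1 \<or> E.ip (simple_root i) r = 2" using i bd by (auto simp: zero_less_mult_iff)
    then show ?thesis
    proof
      assume p: "E.ip (simple_root i) r = 1"
      have R: "r - simple_root i \<in> E.roots" using E.diff_root_iff[OF less.prems simple_root_root[OF i(1)]] p by (simp add: E.ip_commute)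
      have "reach6 (r - simple_root i)" using less.hyps[OF _ R] smaller[of "- simple_root i"] True by simp
      moreover have "E.ip (simple_root i) (r - simple_root i) = - 1" using p E.ip_self[OF simple_root_root[OF i(1)]] by (simp add: E.ip_lin)
      ultimately show ?thesis using reach6_step(1)[OF R _ i(1)] by simp
    next
      assume "E.ip (simple_root i) r = 2"
      then have "r = simple_root i" using E.ip_eq_2[OF simple_root_root[OF i(1)] less.prems] by simp
      then show ?thesis using reach6_simple[OF i(1)] by simp
    qed
  next
    case False
    then have neg: "coord i r < 0" using i by (auto simp: zero_less_mult_iff)
    then have "E.ip (simple_root i) r = - 1 \<or> E.ip (simple_root i) r = - 2" using i bd by (auto simp: zero_less_mult_iff)
    then show ?thesis
    proof
      assume p: "E.ip (simple_root i) r = - 1"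
      have R: "r + simple_root i \<in> E.roots" using E.add_root_iff[OF less.prems simple_root_root[OF i(1)]] p by (simp add: E.ip_commute)
      have "reach6 (r + simple_root i)" using less.hyps[OF _ R] smaller[of "simple_root i"] neg by simp
      moreover have "E.ip (simple_root i) (r + simple_root i) = 1" using p E.ip_self[OF simple_root_root[OF i(1)]] by (simp add: E.ip_lin)
      ultimately show ?thesis using reach6_step(2)[OF R _ i(1)] by simp
    next
      assume "E.ip (simple_root i) r = - 2"
      then have "r = - simple_root i" using E.ip_eq_m2[OF simple_root_root[OF i(1)] less.prems] by simp
      then show ?thesis using reach6_simple[OF i(1)] by simp
    qed
  qed
qed

definition e6_parity :: "bit \<Rightarrow> ('h \<times> (e6 \<Rightarrow> 'k)) set" where "e6_parity p = (if p = 0 then {x. supported x} else {0})"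
definition e6_component :: "(nat \<Rightarrow>\<^sub>0 int) \<Rightarrow> ('h \<times> (e6 \<Rightarrow> 'k)) set" where "e6_component q = {x. supported x} \<inter> graded e6_weight q"

lemma e6_component_one_dim:
  assumes v: "v \<in> e6_component q" "q \<noteq> 0" "v \<noteq> 0"
  obtains r c where "r \<in> E.roots" "e6_weight r = q" "c \<noteq> 0" "v = sca c (Ee r)"
proof -
  have f: "fst v = 0" using v by (auto simp: e6_component_def graded_def)
  then have "snd v \<noteq> 0" using v by (auto simp: prod_eq_iff)
  then obtain r where r: "snd v r \<noteq> 0" by (auto simp: fun_eq_iff)
  have w: "e6_weight r' = q" if "snd v r' \<noteq> 0" for r' using v(1) that unfolding e6_component_def graded_def by blast
  have "r \<in> E.roots" using r v(1) unfolding e6_component_def supported_def by blast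
  moreover have "snd v r' = 0" if "r' \<noteq> r" for r' using w[of r'] w[OF r] e6_weight_inj that by metis
  then have "v = sca (snd v r) (Ee r)" using f by (auto simp: prod_eq_iff sca_def Ee_def fun_eq_iff)
  ultimately show thesis using that[of r "snd v r"] w[OF r] r by blast
qed

text \<open>For nondegeneracy: a vector of nonzero weight is a multiple of some \<open>E s\<close>,
  a monomial evaluates to a multiple of \<open>E (- s)\<close>, and their bracket is a multiple of
  the coroot of \<open>s\<close>. The hypothesis says that this coroot survives in characteristic
  3.\<close>

lemma e6_model:
  assumes hm_nz: "\<And>r. r \<in> E.roots \<Longrightarrow> hmE r \<noteq> 0"
  shows "contragredient_model scl cartan_e6 parity_e6 hh \<alpha> sca br Hh e6_e e6_f e6_parity e6_component (grade_proj e6_weight)"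
proof
  fix x y z :: "'h \<times> (e6 \<Rightarrow> 'k)" and a a' :: 'h and c :: 'k and i j :: nat and p p' r :: bit and q q' :: "nat \<Rightarrow>\<^sub>0 int"
  show "Hh (a + a') = Hh a + Hh a'" "Hh (scl c a) = sca c (Hh a)" by (simp_all add: Hh_def sca_def fun_eq_iff)
  show "Hh a = 0 \<Longrightarrow> a = 0" by (simp add: Hh_def prod_eq_iff)
  show "V.subspace (e6_parity p)" using supported_sub V.subspace_single_0 by (simp add: e6_parity_def)
  show "x \<in> e6_parity p \<Longrightarrow> y \<in> e6_parity p' \<Longrightarrow> br x y \<in> e6_parity (p + p')" by (cases p; cases p') (auto simp: e6_parity_def supported_lin)
  show "Hh a \<in> e6_parity 0" by (simp add: e6_parity_def)
  show "i < dim_row cartan_e6 \<Longrightarrow> e6_e i \<in> e6_parity (parity_e6 i)" "i < dim_row cartan_e6 \<Longrightarrow> e6_f i \<in> e6_parity (parity_e6 i)"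
    by (auto simp: e6_parity_def parity_e6_def e6_e_def e6_f_def supported_lin supported_E simple_root_root dim_e6)
  show "x \<in> e6_parity p \<Longrightarrow> y \<in> e6_parity p' \<Longrightarrow> br x y + sca (koszul_sign p p') (br y x) = 0"
    using br_antisym[of x y] by (cases p; cases p') (auto simp: koszul_sign_def e6_parity_def)
  show "x \<in> e6_parity p \<Longrightarrow> y \<in> e6_parity p' \<Longrightarrow> z \<in> e6_parity r \<Longrightarrow> br x (br y z) - br (br x y) z - sca (koszul_sign p p') (br y (br x z)) = 0"
    using jacobi[of x y z] by (cases p; cases p') (auto simp: koszul_sign_def e6_parity_def)
  show "x \<in> e6_parity 1 \<Longrightarrow> br x (br x x) = 0" by (simp add: e6_parity_def)
  { assume ij: "i < dim_row cartan_e6" "j < dim_row cartan_e6"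
    have "E.ip (simple_root i) (- simple_root j) \<noteq> - 1"
      using ij cartan_e6_offdiag[of i j] by (simp add: E.ip_lin ip_simple_root dim_e6)
    then show "br (e6_e i) (e6_f j) = (if i = j then Hh (hh i) else 0)"
      using ij by (auto simp: e6_e_def e6_f_def dim_e6 br_EE simple_root_root hmE_simple_root simple_root_inj) }
  { assume j: "j < dim_row cartan_e6"
    show "br (Hh a) (e6_e j) = sca (\<alpha> j a) (e6_e j)" "br (Hh a) (e6_f j) = - sca (\<alpha> j a) (e6_f j)"
      using j by (simp_all add: e6_e_def e6_f_def dim_e6 br_HE simple_root_root wtE_simple_root) }
  show "br (Hh a) (Hh a') = 0" by (rule br_HH)
  show "V.subspace (e6_component q)" unfolding e6_component_def by (intro V.subspace_inter supported_sub graded_sub)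
  show "x \<in> e6_component q \<Longrightarrow> y \<in> e6_component q' \<Longrightarrow> br x y \<in> e6_component (q + q')" unfolding e6_component_def using graded_br[OF e6_weight_add] by simp
  show "Hh a \<in> e6_component 0" by (simp add: e6_component_def graded_H)
  { assume "i < dim_row cartan_e6"
    then have i: "i < 6" by (simp add: dim_e6)
    show "e6_e i \<in> e6_component (Poly_Mapping.single i 1)"
      using graded_E[of "simple_root i" e6_weight] i by (simp add: e6_component_def e6_e_def supported_E simple_root_root e6_weight_simple_root)
    show "e6_f i \<in> e6_component (- Poly_Mapping.single i 1)"
      using V.subspace_neg[OF graded_sub graded_E[of "- simple_root i" e6_weight]] i
      by (simp add: e6_component_def e6_f_def supported_E supported_lin simple_root_root e6_weight_minus e6_weight_simple_root) }
  show "grade_proj e6_weight q (x + y) = grade_proj e6_weight q x + grade_proj e6_weight q y" by (rule grade_proj_add)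
  show "x \<in> e6_component q \<Longrightarrow> grade_proj e6_weight q' x = (if q = q' then x else 0)" unfolding e6_component_def by (simp add: grade_proj_graded)
  assume v: "q \<noteq> 0" "x \<in> e6_component q" "x \<noteq> 0"
  obtain s c where s: "s \<in> E.roots" "e6_weight s = q" "c \<noteq> 0" "x = sca c (Ee s)" using e6_component_one_dim[OF v(2,1,3)] by blast
  obtain m c' where m: "letters m \<subseteq> gens 6" "magma_deg gen_weight m = e6_weight (- s)" "c' \<noteq> 0" "ev6 m = sca c' (Ee (- s))"
    using reach6_all[of "- s"] s unfolding reach6_def by auto
  have "E.ip (- s) s \<noteq> - 1" using E.ip_self[OF s(1)] by (simp add: E.ip_lin)
  then have "br (Ee (- s)) (Ee s) = Hh (hmE s)" using s by (simp add: br_EE Hh_def fun_eq_iff)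
  then have "br (ev6 m) x = sca (c' * c) (Hh (hmE s))" using s m by (simp add: br_lin mult.commute)
  moreover have "fst (sca (c' * c) (Hh (hmE s))) \<noteq> 0" using hm_nz[OF s(1)] s m by (simp add: sca_def Hh_def)
  ultimately have "br (ev6 m) x \<noteq> 0" by (metis fst_zero)
  then show "\<exists>m. letters m \<subseteq> gens (dim_row cartan_e6) \<and> magma_deg gen_weight m = - q \<and> br (ev6 m) x \<noteq> 0"
    using m s by (intro exI[of _ m]) (simp add: dim_e6 e6_weight_minus)
qed (simp_all add: br_lin)

end

section \<open>Brackets of root vectors in the subquotient\<close>

context lattice_sem begin

lemma E_parts: 
  "pr0 (Ee r) = (if r \<in> S0 then Ee r else 0)" "pr1 (Ee r) = (if r \<in> S1 then Ee r else 0)"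
  by (auto simp: pr0_def pr1_def Ee_def prod_eq_iff fun_eq_iff)

lemma ip_neq: "ip x a \<noteq> ip y a \<Longrightarrow> x \<noteq> y"
  by blast

lemma l0_E:
  assumes "r \<in> roots"
  shows "r \<in> S1 \<Longrightarrow> l0 (Ee r) = 0"
    and "ip r a1 = 0 \<Longrightarrow> ip r a2 = 0 \<Longrightarrow> l0 (Ee r) = Ee r"
    and "ip r a1 = 1 \<Longrightarrow> ip r a2 = - 1 \<Longrightarrow> l0 (Ee r) = Ee r + sca (eps a1 r * eps a2 r) (Ee (r - a1 + a2))"
proof -
  have *: "l0 (Ee r) = 0" if "r \<in> S1"
  proof -
    have "r \<notin> S0" using that by (rule S01)
    moreover have "q + a1 - a2 \<noteq> r" if "ip q a1 = - 1" "ip q a2 = 1" for q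
      using that \<open>r \<in> S1\<close> by (auto simp: S1_def ip_lin)
    ultimately show ?thesis by (auto simp: l0_def Ee_def prod_eq_iff fun_eq_iff)
  qed
  show "r \<in> S1 \<Longrightarrow> l0 (Ee r) = 0" by (rule *)
  show "l0 (Ee r) = Ee r" if "ip r a1 = 0" "ip r a2 = 0"
  proof -
    have "r \<in> S0" using that assms by (simp add: S0_def)
    moreover have "q + a1 - a2 \<noteq> r" if "ip q a1 = - 1" "ip q a2 = 1" for q
      using that \<open>ip r a1 = 0\<close> by (auto simp: ip_lin)
    ultimately show ?thesis by (auto simp: l0_def Ee_def prod_eq_iff fun_eq_iff)
  qed
  show "l0 (Ee r) = Ee r + sca (eps a1 r * eps a2 r) (Ee (r - a1 + a2))" if p: "ip r a1 = 1" "ip r a2 = - 1"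
  proof -
    have r: "r \<in> S0" using p assms by (simp add: S0_def)
    have r': "r - a1 + a2 \<in> roots" "ip (r - a1 + a2) a1 = - 1" "ip (r - a1 + a2) a2 = 1"
      using p assms diff_root_iff[of r a1] add_root_iff[of "r - a1" a2] by (simp_all add: ip_lin)
    then have r'': "r - a1 + a2 \<notin> S0" "r - a1 + a2 \<noteq> r" using ip_neq[of "r - a1 + a2" a1 r] p by (simp_all add: S0_def)
    have e: "eps a1 (r - a1 + a2) * eps a2 (r - a1 + a2) = (eps a1 r * eps a2 r :: 'k)" by (simp add: eps_lin)
    have q: "q + a1 - a2 = r \<longleftrightarrow> q = r - a1 + a2" for q by (auto simp: algebra_simps)
    have "snd (l0 (Ee r)) q = snd (Ee r + sca (eps a1 r * eps a2 r) (Ee (r - a1 + a2))) q" for q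
    proof -
      consider "q = r" | "q = r - a1 + a2" | "q \<noteq> r" "q \<noteq> r - a1 + a2" by blast
      then show ?thesis
      proof cases
        case 2 show ?thesis unfolding 2 using r r' r'' e by (simp add: l0_def Ee_def sca_def)
      qed (use r r' r'' q in \<open>auto simp: l0_def Ee_def sca_def\<close>)
    qed
    then show ?thesis by (simp add: prod_eq_iff fun_eq_iff) (simp add: l0_def Ee_def sca_def)
  qed
qed

lemma dd_E:
  assumes "r \<in> roots"
  shows "ip r a1 = - 1 \<Longrightarrow> ip r a2 = 0 \<Longrightarrow> dd (Ee r) = sca (eps a1 r) (Ee (r + a1))"
    and "ip r a1 = 0 \<Longrightarrow> ip r a2 = - 1 \<Longrightarrow> dd (Ee r) = sca (eps a2 r) (Ee (r + a2))"
proof -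
  have c: "ip a1 r = ip r a1" "ip a2 r = ip r a2" "a1 + r = r + a1" "a2 + r = r + a2"
    by (simp_all only: ip_commute add.commute)
  have n: "ip r a1 = 0 \<Longrightarrow> r \<noteq> - a1" "ip r a2 = 0 \<Longrightarrow> r \<noteq> - a2"
    using ip_neq[of r a1 "- a1"] ip_neq[of r a2 "- a2"] by (simp_all add: ip_lin)
  show "ip r a1 = - 1 \<Longrightarrow> ip r a2 = 0 \<Longrightarrow> dd (Ee r) = sca (eps a1 r) (Ee (r + a1))"
    "ip r a1 = 0 \<Longrightarrow> ip r a2 = - 1 \<Longrightarrow> dd (Ee r) = sca (eps a2 r) (Ee (r + a2))"
    by (simp_all add: dd_def br_lin br_EE assms c n)
qed

lemma brW_E:
  assumes "s \<in> roots" "t \<in> roots"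
  shows "s \<in> S0 \<Longrightarrow> t \<in> S0 \<Longrightarrow> brW (Ee s) (Ee t) = pr0 (br (l0 (Ee s)) (l0 (Ee t)))"
    and "s \<in> S0 \<Longrightarrow> t \<in> S1 \<Longrightarrow> brW (Ee s) (Ee t) = pr1 (br (l0 (Ee s)) (Ee t))"
    and "s \<in> S1 \<Longrightarrow> t \<in> S0 \<Longrightarrow> brW (Ee s) (Ee t) = pr1 (br (Ee s) (l0 (Ee t)))"
    and "s \<in> S1 \<Longrightarrow> t \<in> S1 \<Longrightarrow> brW (Ee s) (Ee t) = pr0 (br (dd (Ee s)) (Ee t) - br (Ee s) (dd (Ee t)))"
  using assms by (simp_all add: brW_alt E_parts S01 l0_E(1) pr_lin odd_br_def dd_lin)

lemma S_type:
  "r \<in> S0 \<longleftrightarrow> r \<in> roots \<and> (ip r a1 = 0 \<and> ip r a2 = 0 \<or> ip r a1 = 1 \<and> ip r a2 = - 1)"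
  "r \<in> S1 \<longleftrightarrow> r \<in> roots \<and> (ip r a1 = - 1 \<and> ip r a2 = 0 \<or> ip r a1 = 0 \<and> ip r a2 = - 1)"
  by (auto simp: S0_def S1_def)

text \<open>The lift of a root vector of type \<open>(1,-1)\<close> has two terms, so a bracket with
  it has two candidates for its value; the type of the resulting root decides which one the
  projection keeps. In the third rule it is the second term.\<close>

lemma brW_sum_root:
  assumes s: "s \<in> roots" and t: "t \<in> roots"
  shows "ip s a1 = 0 \<Longrightarrow> ip s a2 = 0 \<Longrightarrow> t \<in> S0 \<union> S1 \<Longrightarrow> ip s t = - 1 \<Longrightarrow> brW (Ee s) (Ee t) = sca (eps s t) (Ee (s + t))"
    and "s \<in> S1 \<Longrightarrow> ip t a1 = 0 \<Longrightarrow> ip t a2 = 0 \<Longrightarrow> ip s t = - 1 \<Longrightarrow> brW (Ee s) (Ee t) = sca (eps s t) (Ee (s + t))"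
    and "ip s a1 = 0 \<Longrightarrow> ip s a2 = - 1 \<Longrightarrow> ip t a1 = 1 \<Longrightarrow> ip t a2 = - 1 \<Longrightarrow> ip s (t - a1 + a2) = - 1 \<Longrightarrow>
      brW (Ee s) (Ee t) = sca (eps a1 t * eps a2 t * eps s (t - a1 + a2)) (Ee (s + t - a1 + a2))"
    and "ip s a1 = - 1 \<Longrightarrow> ip s a2 = 0 \<Longrightarrow> ip t a1 = 1 \<Longrightarrow> ip t a2 = - 1 \<Longrightarrow> ip s t = - 1 \<Longrightarrow>
      brW (Ee s) (Ee t) = sca (eps s t) (Ee (s + t))"
proof -
  have st: "ip s t = - 1 \<Longrightarrow> s + t \<in> roots" using add_root_iff[OF s t] by simp
  show "brW (Ee s) (Ee t) = sca (eps s t) (Ee (s + t))"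
    if p: "ip s a1 = 0" "ip s a2 = 0" "t \<in> S0 \<union> S1" "ip s t = - 1"
  proof -
    have sS: "s \<in> S0" using p s by (simp add: S_type)
    consider "ip t a1 = 0" "ip t a2 = 0" | "ip t a1 = 1" "ip t a2 = - 1" | "t \<in> S1"
      using p by (auto simp: S_type)
    then show ?thesis
    proof cases
      case 1
      then have "t \<in> S0" "s + t \<in> S0" using t p st by (auto simp: S_type ip_lin)
      then show ?thesis using 1 p by (simp add: brW_E s t sS l0_E br_EE pr_lin E_parts)
    next
      case 2
      then have m: "t \<in> S0" "s + t \<in> S0" "s + (t - a1 + a2) \<notin> S0" using t p st by (auto simp: S_type ip_lin)
      have "t - a1 + a2 \<in> roots"
        using 2 t diff_root_iff[of t a1] add_root_iff[of "t - a1" a2] by (simp add: ip_lin)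
      moreover have "t - a1 + a2 \<noteq> - s" using ip_neq[of "t - a1 + a2" a1 "- s"] 2 p by (simp add: ip_lin)
      then have "pr0 (br (Ee s) (Ee (t - a1 + a2))) = 0" using m(3) calculation
        by (simp add: br_EE s E_parts pr_lin)
      ultimately show ?thesis using 2 p m by (simp add: brW_E s t sS l0_E br_lin pr_lin) (simp add: br_EE s t pr_lin E_parts)
    next
      case 3
      then have "s + t \<in> S1" using t p st by (auto simp: S_type ip_lin)
      then show ?thesis using 3 p by (simp add: brW_E s t sS l0_E br_EE pr_lin E_parts)
    qed
  qed
  show "brW (Ee s) (Ee t) = sca (eps s t) (Ee (s + t))"
    if p: "s \<in> S1" "ip t a1 = 0" "ip t a2 = 0" "ip s t = - 1"
  proof -
    have "s + t \<in> S1" "t \<in> S0" using t p st by (auto simp: S_type ip_lin)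
    then show ?thesis using p by (simp add: brW_E s t l0_E br_EE pr_lin E_parts)
  qed
  show "brW (Ee s) (Ee t) = sca (eps a1 t * eps a2 t * eps s (t - a1 + a2)) (Ee (s + t - a1 + a2))"
    if p: "ip s a1 = 0" "ip s a2 = - 1" "ip t a1 = 1" "ip t a2 = - 1" "ip s (t - a1 + a2) = - 1"
  proof -
    have t': "t - a1 + a2 \<in> roots"
      using p t diff_root_iff[of t a1] add_root_iff[of "t - a1" a2] by (simp add: ip_lin)
    have m: "t \<in> S0" "s \<in> S1" "s + t \<notin> S1" "s + (t - a1 + a2) \<in> S1"
      using t s p add_root_iff[OF s t'] by (auto simp: S_type ip_lin)
    have "s \<noteq> - t" "t \<noteq> - s" using p by (auto simp: ip_lin)
    then have "pr1 (br (Ee s) (Ee t)) = 0" using m by (simp add: br_EE s t E_parts pr_lin)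
    moreover have e: "s + t - a1 + a2 = s + (t - a1 + a2)" by (simp add: algebra_simps)
    ultimately show ?thesis unfolding e using p m(1,2,4) by (simp add: brW_E s t l0_E br_lin pr_lin) (simp add: br_EE s t' pr_lin E_parts)
  qed
  show "brW (Ee s) (Ee t) = sca (eps s t) (Ee (s + t))"
    if p: "ip s a1 = - 1" "ip s a2 = 0" "ip t a1 = 1" "ip t a2 = - 1" "ip s t = - 1"
  proof -
    have t': "t - a1 + a2 \<in> roots"
      using p t diff_root_iff[of t a1] add_root_iff[of "t - a1" a2] by (simp add: ip_lin)
    have m: "t \<in> S0" "s \<in> S1" "s + t \<in> S1" "s + (t - a1 + a2) \<notin> S1"
      using t s p st by (auto simp: S_type ip_lin)
    have "t - a1 + a2 \<noteq> - s" using ip_neq[of "t - a1 + a2" a1 "- s"] p by (simp add: ip_lin)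
    then have "pr1 (br (Ee s) (Ee (t - a1 + a2))) = 0" using m by (simp add: br_EE s t' E_parts pr_lin)
    then show ?thesis using p m by (simp add: brW_E s t l0_E br_lin pr_lin) (simp add: br_EE s t pr_lin E_parts)
  qed
qed

text \<open>The additional \<open>a\<close> comes from the \<open>dd\<close> inside the odd bracket.
  For two roots of equal type both terms give the same root vector and add up to a factor 2; for
  different types only one of the terms lands in \<open>S0\<close>.\<close>

lemma brW_sum_odd:
  assumes s: "s \<in> roots" and t: "t \<in> roots"
  shows "a \<in> {a1, a2} \<Longrightarrow> ip s a = - 1 \<Longrightarrow> ip t a = - 1 \<Longrightarrow> s \<in> S1 \<Longrightarrow> t \<in> S1 \<Longrightarrow> ip s t = 0 \<Longrightarrow>
      \<exists>c. c \<noteq> 0 \<and> brW (Ee s) (Ee t) = sca c (Ee (s + t + a))"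
    and "ip s a1 = - 1 \<Longrightarrow> ip s a2 = 0 \<Longrightarrow> ip t a1 = 0 \<Longrightarrow> ip t a2 = - 1 \<Longrightarrow> ip s t = - 1 \<Longrightarrow>
      \<exists>c. c \<noteq> 0 \<and> brW (Ee s) (Ee t) = sca c (Ee (s + t + a1))"
    and "ip s a1 = 0 \<Longrightarrow> ip s a2 = - 1 \<Longrightarrow> ip t a1 = - 1 \<Longrightarrow> ip t a2 = 0 \<Longrightarrow> ip s t = - 1 \<Longrightarrow>
      \<exists>c. c \<noteq> 0 \<and> brW (Ee s) (Ee t) = sca c (Ee (s + t + a1))"
proof -
  show "\<exists>c. c \<noteq> 0 \<and> brW (Ee s) (Ee t) = sca c (Ee (s + t + a))"
    if a: "a \<in> {a1, a2}" and p: "ip s a = - 1" "ip t a = - 1" "s \<in> S1" "t \<in> S1" "ip s t = 0"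
  proof -
    have ar: "a \<in> roots" "ip a a = 2" using a by auto
    have d: "dd (Ee s) = sca (eps a s) (Ee (s + a))" "dd (Ee t) = sca (eps a t) (Ee (t + a))"
      using a p s t dd_E by (auto simp: S_type)
    have r: "s + a \<in> roots" "t + a \<in> roots" using add_root_iff[OF s ar(1)] add_root_iff[OF t ar(1)] p by auto
    have i: "ip (s + a) t = - 1" "ip s (t + a) = - 1" using p by (simp_all add: ip_lin ip_commute[of a t])
    have "s + a + t \<in> S0" using add_root_iff[OF r(1) t] i p a by (auto simp: S_type ip_lin)
    then have m: "s + a + t \<in> S0" "s + (t + a) = s + a + t" "s + t + a = s + a + t" by (auto simp: ac_simps)
    \<comment> \<open>The product of \<open>s\<close> and \<open>a\<close> is odd, so exchanging the
      arguments of \<open>eps\<close> flips the sign, and the two terms add up instead of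
      cancelling.\<close>
    have e: "eps s a = (- eps a s :: 'k)" using eps_swap[of s a] p by (simp add: ip_commute[of a s])
    have "brW (Ee s) (Ee t) = sca (eps a s * eps (s + a) t - eps a t * eps s (t + a)) (Ee (s + a + t))"
      using p m(1) i by (simp add: brW_E s t d br_lin br_EE r m(2) E_parts pr_lin V.scale_left_diff_distrib)
    also have "eps a s * eps (s + a) t - eps a t * eps s (t + a) = (2 * (eps a s * eps s t * eps a t) :: 'k)"
      by (simp add: eps_lin e)
    finally show ?thesis unfolding m using two_nonzero by (intro exI[of _ "2 * (eps a s * eps s t * eps a t)"]) simp
  qed
  show "\<exists>c. c \<noteq> 0 \<and> brW (Ee s) (Ee t) = sca c (Ee (s + t + a1))"
    if p: "ip s a1 = - 1" "ip s a2 = 0" "ip t a1 = 0" "ip t a2 = - 1" "ip s t = - 1"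
  proof -
    have d: "dd (Ee s) = sca (eps a1 s) (Ee (s + a1))" "dd (Ee t) = sca (eps a2 t) (Ee (t + a2))"
      using p s t dd_E by auto
    have r: "s + a1 \<in> roots" "t + a2 \<in> roots" using add_root_iff[OF s a_roots(1)] add_root_iff[OF t a_roots(2)] p by auto
    have i: "ip (s + a1) t = - 1" "ip s (t + a2) = - 1" using p by (simp_all add: ip_lin ip_commute[of a1 t])
    have m: "s + a1 + t \<in> S0" "s + (t + a2) \<notin> S0" "s + t + a1 = s + a1 + t"
      using add_root_iff[OF r(1) t] i p by (auto simp: S_type ip_lin ac_simps)
    have "s \<in> S1" "t \<in> S1" using p s t by (auto simp: S_type)
    then have "brW (Ee s) (Ee t) = sca (eps a1 s * eps (s + a1) t) (Ee (s + a1 + t))"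
      using p m i by (simp add: brW_E s t d br_lin br_EE r E_parts pr_lin)
    then show ?thesis unfolding m(3) by (intro exI[of _ "eps a1 s * eps (s + a1) t"]) simp
  qed
  show "\<exists>c. c \<noteq> 0 \<and> brW (Ee s) (Ee t) = sca c (Ee (s + t + a1))"
    if p: "ip s a1 = 0" "ip s a2 = - 1" "ip t a1 = - 1" "ip t a2 = 0" "ip s t = - 1"
  proof -
    have d: "dd (Ee s) = sca (eps a2 s) (Ee (s + a2))" "dd (Ee t) = sca (eps a1 t) (Ee (t + a1))"
      using p s t dd_E by auto
    have r: "s + a2 \<in> roots" "t + a1 \<in> roots" using add_root_iff[OF s a_roots(2)] add_root_iff[OF t a_roots(1)] p by auto
    have i: "ip (s + a2) t = - 1" "ip s (t + a1) = - 1" using p by (simp_all add: ip_lin ip_commute[of a2 t])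
    have m: "s + (t + a1) \<in> S0" "s + a2 + t \<notin> S0" "s + t + a1 = s + (t + a1)"
      using add_root_iff[OF s r(2)] i p by (auto simp: S_type ip_lin ac_simps)
    have "s \<in> S1" "t \<in> S1" using p s t by (auto simp: S_type)
    then have "brW (Ee s) (Ee t) = sca (- (eps a1 t * eps s (t + a1))) (Ee (s + (t + a1)))"
      using p m i by (simp add: brW_E s t d br_lin br_EE r E_parts pr_lin)
    then show ?thesis unfolding m(3) by (intro exI[of _ "- (eps a1 t * eps s (t + a1))"]) simp
  qed
qed

text \<open>
  By \<open>pos\<close> the projections of \<open>s\<close> and \<open>r\<close> to the orthogonal complement of \<open>a1\<close> and \<open>a2\<close> have a positive inner product,
  as in the usual descent to the simple roots.
\<close>

lemma brW_step:
  assumes s: "s \<in> roots" "ip s a1 = 0 \<and> ip s a2 = 0 \<or> s \<in> S1" and r: "r \<in> S0 \<union> S1"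
    and pos: "2 * ip s r - ip s a1 * ip r a1 - ip s a2 * ip r a2 > 0" and ne: "r \<noteq> s"
  obtains t c where "t \<in> S0 \<union> S1" "c \<noteq> 0" "brW (Ee s) (Ee t) = sca c (Ee r)"
    "t \<in> {r - s, r - s - a1, r - s - a2, r - s + a1 - a2}"
proof -
  have rr: "r \<in> roots" using r by (auto simp: S_type)
  have "ip s r \<noteq> 2" using ip_eq_2[OF s(1) rr] ne by auto
  then have le1: "ip s r \<le> 1" using ip_bounds[OF s(1) rr] by auto
  have e: "eps x y \<noteq> (0::'k)" for x y by simp
  have sub: "ip s r = 1 \<Longrightarrow> r - s \<in> roots" using diff_root_iff[OF rr s(1)] by (simp add: ip_commute)
  have c: "ip r s = ip s r" "ip a1 s = ip s a1" "ip a2 s = ip s a2" by (simp_all add: ip_commute)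
  note ss = ip_self[OF s(1)]
  have fin: thesis if "t \<in> S0 \<union> S1" "\<exists>c. c \<noteq> 0 \<and> brW (Ee s) (Ee t) = sca c (Ee r)"
     "t \<in> {r - s, r - s - a1, r - s - a2, r - s + a1 - a2}" for t
    using that \<open>\<And>t c. \<lbrakk>t \<in> S0 \<union> S1; c \<noteq> 0; brW (Ee s) (Ee t) = sca c (Ee r); t \<in> {r - s, r - s - a1, r - s - a2, r - s + a1 - a2}\<rbrakk> \<Longrightarrow> thesis\<close> by blast
  have simple: thesis if "r - s \<in> S0 \<union> S1" "brW (Ee s) (Ee (r - s)) = sca (eps s (r - s)) (Ee (s + (r - s)))"
    using that by (intro fin[of "r - s"]) (auto intro!: exI[of _ "eps s (r - s)"])
  consider (Z) "ip s a1 = 0" "ip s a2 = 0" | (A) "ip s a1 = - 1" "ip s a2 = 0" | (B) "ip s a1 = 0" "ip s a2 = - 1"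
    using s by (auto simp: S_type)
  then show thesis
  proof cases
    case Z
    then have 1: "ip s r = 1" using pos le1 by simp
    have t: "r - s \<in> roots" "ip s (r - s) = - 1" using sub 1 ss by (auto simp: ip_lin)
    then have "r - s \<in> S0 \<union> S1" using r Z by (auto simp: S_type ip_lin)
    then show thesis using brW_sum_root(1)[OF s(1) t(1)] t Z by (intro simple) simp_all
  next
    case A
    then have sS: "s \<in> S1" using s by (auto simp: S_type)
    consider "ip r a1 = 0" "ip r a2 = 0" | "ip r a1 = 1" "ip r a2 = - 1" | "ip r a1 = - 1" "ip r a2 = 0" | "ip r a1 = 0" "ip r a2 = - 1"
      using r by (auto simp: S_type)
    then show thesis
    proof cases
      case 1
      then have 2: "ip s r = 1" using pos le1 A by simp
      have t: "r - s - a1 \<in> roots" using sub 2 diff_root_iff[of "r - s" a1] 1 A by (simp add: ip_lin)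
      then have "r - s - a1 \<in> S1" using 1 A by (auto simp: S_type ip_lin)
      moreover have "ip s (r - s - a1) = 0" using 2 A ss by (simp add: ip_lin)
      ultimately show thesis using brW_sum_odd(1)[OF s(1) t, of a1] 1 A sS by (intro fin[of "r - s - a1"]) (auto simp: ip_lin)
    next
      case 2
      then have 3: "ip s r = 0"
      proof -
        \<comment> \<open>Otherwise \<open>r - s\<close> would be a root having product 2 with
          \<open>a1\<close>, hence equal to \<open>a1\<close>, although its product with
          \<open>a2\<close> is -1.\<close>
        have "ip s r \<noteq> 1"
        proof
          assume "ip s r = 1"
          then have "r - s \<in> roots" by (rule sub)
          moreover have "ip (r - s) a1 = 2" using 2 A by (simp add: ip_lin)
          ultimately have "a1 = r - s" using ip_eq_2[OF _ a_roots(1), of "r - s"] by simp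
          then have "ip a1 a2 = ip (r - s) a2" by (rule arg_cong)
          then show False using 2 A by (simp add: ip_lin)
        qed
        then show ?thesis using pos le1 A 2 by simp
      qed
      have "r - a1 \<in> roots" using 2 diff_root_iff[OF rr a_roots(1)] by simp
      then have t: "r - s - a1 \<in> roots" using diff_root_iff[of "r - a1" s] 2 3 A s c by (simp add: ip_lin algebra_simps)
      moreover have "r - s - a1 \<in> S1" using t 2 A by (auto simp: S_type ip_lin)
      moreover have "ip s (r - s - a1) = - 1" using 2 3 A ss by (simp add: ip_lin)
      ultimately show thesis using brW_sum_odd(2)[OF s(1) t] 2 A sS by (intro fin[of "r - s - a1"]) (auto simp: ip_lin)
    next
      case 3
      then have 2: "ip s r = 1" using pos le1 A by simp
      then have t: "r - s \<in> roots" "ip s (r - s) = - 1" using sub ss by (auto simp: ip_lin)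
      then have "r - s \<in> S0 \<union> S1" using 3 A by (auto simp: S_type ip_lin)
      then show thesis using brW_sum_root(2)[OF s(1) t(1)] t 3 A sS by (intro simple) (simp_all add: ip_lin)
    next
      case 4
      then have 2: "ip s r = 1" using pos le1 A by simp
      then have t: "r - s \<in> roots" "ip s (r - s) = - 1" using sub ss by (auto simp: ip_lin)
      then have "r - s \<in> S0 \<union> S1" using 4 A by (auto simp: S_type ip_lin)
      then show thesis using brW_sum_root(4)[OF s(1) t(1)] t 4 A sS by (intro simple) (simp_all add: ip_lin)
    qed
  next
    case B
    then have sS: "s \<in> S1" using s by (auto simp: S_type)
    consider "ip r a1 = 0" "ip r a2 = 0" | "ip r a1 = 1" "ip r a2 = - 1" | "ip r a1 = 0" "ip r a2 = - 1" | "ip r a1 = - 1" "ip r a2 = 0"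
      using r by (auto simp: S_type)
    then show thesis
    proof cases
      case 1
      then have 2: "ip s r = 1" using pos le1 B by simp
      have t: "r - s - a2 \<in> roots" using sub 2 diff_root_iff[of "r - s" a2] 1 B by (simp add: ip_lin)
      then have "r - s - a2 \<in> S1" using 1 B by (auto simp: S_type ip_lin)
      moreover have "ip s (r - s - a2) = 0" using 2 B ss by (simp add: ip_lin)
      ultimately show thesis using brW_sum_odd(1)[OF s(1) t, of a2] 1 B sS by (intro fin[of "r - s - a2"]) (auto simp: ip_lin)
    next
      case 2
      then have 3: "ip s r = 1" using pos le1 B by simp
      then have t: "r - s - a1 \<in> roots" using sub diff_root_iff[of "r - s" a1] 2 B by (simp add: ip_lin)
      moreover have "r - s - a1 \<in> S1" using t 2 B by (auto simp: S_type ip_lin)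
      moreover have "ip s (r - s - a1) = - 1" using 2 3 B ss by (simp add: ip_lin)
      ultimately show thesis using brW_sum_odd(3)[OF s(1) t] 2 B sS by (intro fin[of "r - s - a1"]) (auto simp: ip_lin)
    next
      case 3
      then have 2: "ip s r = 1" using pos le1 B by simp
      then have t: "r - s \<in> roots" "ip s (r - s) = - 1" using sub ss by (auto simp: ip_lin)
      then have "r - s \<in> S0 \<union> S1" using 3 B by (auto simp: S_type ip_lin)
      then show thesis using brW_sum_root(2)[OF s(1) t(1)] t 3 B sS by (intro simple) (simp_all add: ip_lin)
    next
      case 4
      then have 2: "ip s r = 1" using pos le1 B by simp
      \<comment> \<open>Here \<open>r - s\<close> has type \<open>(-1,1)\<close>, which is not a
        label; its translate by \<open>a1 - a2\<close> is used instead, and the second term of its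
        lift leads back to \<open>r\<close>.\<close>
      have "r - s + a1 \<in> roots" using sub 2 add_root_iff[of "r - s" a1] 4 B by (simp add: ip_lin)
      then have t: "r - s + a1 - a2 \<in> roots" using diff_root_iff[of "r - s + a1" a2] 4 B by (simp add: ip_lin)
      have i: "ip (r - s + a1 - a2) a1 = 1" "ip (r - s + a1 - a2) a2 = - 1" using 4 B by (simp_all add: ip_lin)
      have a: "r - s + a1 - a2 - a1 + a2 = r - s" "s + (r - s + a1 - a2) - a1 + a2 = r" by (simp_all add: algebra_simps)
      have "ip s (r - s) = - 1" using 2 ss by (simp add: ip_lin)
      then show thesis using brW_sum_root(3)[OF s(1) t] i B t unfolding a
        by (intro fin[of "r - s + a1 - a2"]) (auto simp: S_type intro!: exI[of _ "eps a1 (r - s + a1 - a2) * eps a2 (r - s + a1 - a2) * eps s (r - s)"])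
    qed
  qed
qed

lemma fst_pr [simp]: "fst (pr0 x) = fst x" "fst (pr1 x) = 0" "fst (l0 x) = fst x"
  by (simp_all add: pr0_def pr1_def l0_def)

text \<open>Norms of the vectors whose coroots arise in \<open>brW_dual\<close>. What matters is
  that they are not divisible by 9.\<close>

lemma b_double:
  assumes x: "x \<in> roots"
  shows "a \<in> roots \<Longrightarrow> ip x a = - 1 \<Longrightarrow> b (x + x + a) (x + x + a) = 3"
    and "ip x a1 = 1 \<Longrightarrow> ip x a2 = - 1 \<Longrightarrow> b (x + x - a1 + a2) (x + x - a1 + a2) = 2"
proof -
  have z: "2 * b z z = ip z z" for z by (simp add: ip_def)
  show "b (x + x + a) (x + x + a) = 3" if "a \<in> roots" "ip x a = - 1"
    using z[of "x + x + a"] that ip_self[OF x] ip_self[of a] ip_commute[of a x] by (simp add: ip_lin)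
  show "b (x + x - a1 + a2) (x + x - a1 + a2) = 2" if "ip x a1 = 1" "ip x a2 = - 1"
    using z[of "x + x - a1 + a2"] that ip_self[OF x] ip_commute[of a1 x] ip_commute[of a2 x] by (simp add: ip_lin)
qed

lemma fst_sca: "fst (sca c x) = sc c (fst x)"
  by (simp add: sca_def)

text \<open>A root opposite to \<open>r\<close> in the subquotient is \<open>- r\<close>, shifted by
  \<open>a1\<close> and \<open>a2\<close> so as to return to \<open>S0\<close> or \<open>S1\<close>.
  The Cartan part of the bracket with its root vector isolates the coordinate of \<open>x\<close> at
  \<open>r\<close>. When the type of \<open>r\<close> is not \<open>(0,0)\<close> two terms
  contribute, with the coroots of \<open>r'\<close> and of \<open>- r\<close>, and \<open>z\<close>
  is the sum of these two vectors.\<close>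

lemma brW_dual:
  assumes r: "r \<in> S0 \<union> S1"
  obtains r' c z where "r' \<in> S0 \<union> S1" "r' \<in> {- r, - r - a1, - r - a2, a1 - r - a2}" "c \<noteq> 0"
    "\<And>x. fst (brW (Ee r') x) = sc (c * snd x r) (hm z)" "b z z \<in> {1, 2, 3}"
proof -
  have rr: "r \<in> roots" using r by (auto simp: S_type)
  consider (Z) "ip r a1 = 0" "ip r a2 = 0" | (C) "ip r a1 = 1" "ip r a2 = - 1" | (A) "ip r a1 = - 1" "ip r a2 = 0" | (B) "ip r a1 = 0" "ip r a2 = - 1"
    using r by (auto simp: S_type)
  then show thesis
  proof cases
    case Z
    then have m: "- r \<in> S0" "r \<in> S0" using rr by (auto simp: S_type ip_lin)
    then have "fst (brW (Ee (- r)) x) = sc (1 * snd x r) (hm r)" for x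
      using Z rr S01(1)[OF m(1)] by (simp add: brW_alt E_parts l0_E ip_lin odd_br_def dd_lin fst_br_E pr_lin) (simp add: l0_def)
    then show thesis using m rr by (intro that[of "- r" 1 r]) (auto simp: roots_def)
  next
    case C
    let ?r = "a1 - r - a2"
    have i: "ip ?r a1 = 1" "ip ?r a2 = - 1" using C by (simp_all add: ip_lin)
    have "a1 - r \<in> roots" using diff_root_iff[OF a_roots(1) rr] C by (simp add: ip_commute)
    then have R: "?r \<in> roots" using diff_root_iff[of "a1 - r" a2] C by (simp add: ip_lin)
    then have m: "?r \<in> S0" "r \<in> S0" using C i rr by (auto simp: S_type)
    have "r - a1 \<in> roots" using diff_root_iff[OF rr a_roots(1)] C by simp
    then have R': "r - a1 + a2 \<in> roots" using add_root_iff[of "r - a1" a2] C by (simp add: ip_lin)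
    have x1: "snd (l0 x) r = snd x r" for x using m by (simp add: l0_def)
    have "r - a1 + a2 \<notin> S0" using C by (simp add: S_type ip_lin)
    then have x2: "snd (l0 x) (r - a1 + a2) = eps a1 r * eps a2 r * snd x r" for x
      using C R' by (simp add: l0_def ip_lin eps_lin)
    have neg: "- (?r - a1 + a2) = r" "- ?r = r - a1 + a2" "a2 - (a1 - r) = r - a1 + a2" "?r - a1 + a2 = - r" by (simp_all add: algebra_simps)
    have "fst (brW (Ee ?r) x) = sc ((- (eps a1 r * eps a2 r)) * snd x r) (hm (?r + ?r - a1 + a2))" for x
    proof -
      have e: "eps a1 ?r * eps a2 ?r = (eps a1 r * eps a2 r :: 'k)" by (simp add: eps_lin)
      have "fst (brW (Ee ?r) x) = fst (br (l0 (Ee ?r)) (l0 x))"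
        using S01(1)[OF m(1)] by (simp add: brW_alt E_parts odd_br_def dd_lin pr_lin)
      also have "l0 (Ee ?r) = Ee ?r + sca (eps a1 r * eps a2 r) (Ee (- r))"
        using l0_E(3)[OF R i] unfolding e neg(4) .
      also have "fst (br \<dots> (l0 x)) = - sc (snd (l0 x) (r - a1 + a2)) (hm ?r) - sc (eps a1 r * eps a2 r * snd (l0 x) r) (hm (- r))"
        using fst_br_E[OF R, of "l0 x"] fst_br_E[of "- r" "l0 x"] rr by (simp add: br_lin fst_sca neg(3))
      also have "\<dots> = sc ((- (eps a1 r * eps a2 r)) * snd x r) (hm ?r + hm (- r))"
        unfolding x1 x2 by (simp add: scale_right_distrib scale_right_diff_distrib)
      also have "hm ?r + hm (- r) = hm (?r + - r)" by (rule hm_add[symmetric])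
      also have "?r + - r = ?r + ?r - a1 + a2" by (simp add: algebra_simps)
      finally show ?thesis .
    qed
    moreover have "b (?r + ?r - a1 + a2) (?r + ?r - a1 + a2) = 2"
      by (rule b_double(2)[OF R i])
    ultimately show thesis using m by (intro that[of ?r "- (eps a1 r * eps a2 r)" "?r + ?r - a1 + a2"]) auto
  next
    case A
    let ?r = "- r - a1"
    have i: "ip ?r a1 = - 1" "ip ?r a2 = 0" using A by (simp_all add: ip_lin)
    have R: "?r \<in> roots" "r + a1 \<in> roots" using add_root_iff[OF rr a_roots(1)] A roots_minus[of "r + a1"] by (simp_all only: minus_add_distrib diff_conv_add_uminus)
    have m: "?r \<in> S1" "r \<in> S1" using A i rr R by (auto simp: S_type)
    have x1: "snd (pr1 x) r = snd x r" for x using m by (simp add: pr1_def)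
    have x2: "snd (dd (pr1 x)) (r + a1) = eps a1 r * snd x r" for x
    proof -
      have "r + a1 \<noteq> a1" "r + a1 \<noteq> a2" using ip_neq[of "r + a1" a1 a1] ip_neq[of "r + a1" a1 a2] A
        ip_neq[of "r + a1" a2 a2] by (simp_all add: ip_lin)
      then show ?thesis using R A m by (simp add: snd_dd dd_coeff_def ip_lin eps_lin pr1_def)
    qed
    have "fst (brW (Ee ?r) x) = sc (eps a1 r * snd x r) (hm (?r + ?r + a1))" for x
    proof -
      have "fst (brW (Ee ?r) x) = fst (br (dd (Ee ?r)) (pr1 x)) - fst (br (Ee ?r) (dd (pr1 x)))"
        using m by (simp add: brW_alt E_parts l0_E(1) R odd_br_def)
      also have "dd (Ee ?r) = sca (- eps a1 r) (Ee (- r))" using dd_E(1)[OF R(1) i] by (simp add: eps_lin)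
      also have "fst (br \<dots> (pr1 x)) - fst (br (Ee ?r) (dd (pr1 x))) = sc (eps a1 r * snd x r) (hm (- r) + hm ?r)"
        using fst_br_E[OF R(1), of "dd (pr1 x)"] fst_br_E[of "- r" "pr1 x"] rr x2 by (simp add: br_lin fst_sca x1 scale_right_distrib scale_right_diff_distrib add.commute[of _ r])
      also have "hm (- r) + hm ?r = hm (- r + ?r)" by (rule hm_add[symmetric])
      also have "- r + ?r = ?r + ?r + a1" by (simp add: algebra_simps)
      finally show ?thesis .
    qed
    moreover have "b (?r + ?r + a1) (?r + ?r + a1) = 3"
      by (rule b_double(1)[OF R(1) a_roots(1) i(1)])
    ultimately show thesis using m by (intro that[of ?r "eps a1 r" "?r + ?r + a1"]) auto
  next
    case B
    let ?r = "- r - a2"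
    have i: "ip ?r a1 = 0" "ip ?r a2 = - 1" using B by (simp_all add: ip_lin)
    have R: "?r \<in> roots" "r + a2 \<in> roots" using add_root_iff[OF rr a_roots(2)] B roots_minus[of "r + a2"] by (simp_all only: minus_add_distrib diff_conv_add_uminus)
    have m: "?r \<in> S1" "r \<in> S1" using B i rr R by (auto simp: S_type)
    have x1: "snd (pr1 x) r = snd x r" for x using m by (simp add: pr1_def)
    have x2: "snd (dd (pr1 x)) (r + a2) = eps a2 r * snd x r" for x
    proof -
      have "r + a2 \<noteq> a1" "r + a2 \<noteq> a2" using ip_neq[of "r + a2" a2 a1] ip_neq[of "r + a2" a1 a1] B
        ip_neq[of "r + a2" a2 a2] by (simp_all add: ip_lin)
      then show ?thesis using R B m by (simp add: snd_dd dd_coeff_def ip_lin eps_lin pr1_def)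
    qed
    have "fst (brW (Ee ?r) x) = sc (eps a2 r * snd x r) (hm (?r + ?r + a2))" for x
    proof -
      have "fst (brW (Ee ?r) x) = fst (br (dd (Ee ?r)) (pr1 x)) - fst (br (Ee ?r) (dd (pr1 x)))"
        using m by (simp add: brW_alt E_parts l0_E(1) R odd_br_def)
      also have "dd (Ee ?r) = sca (- eps a2 r) (Ee (- r))" using dd_E(2)[OF R(1) i] by (simp add: eps_lin)
      also have "fst (br \<dots> (pr1 x)) - fst (br (Ee ?r) (dd (pr1 x))) = sc (eps a2 r * snd x r) (hm (- r) + hm ?r)"
        using fst_br_E[OF R(1), of "dd (pr1 x)"] fst_br_E[of "- r" "pr1 x"] rr x2 by (simp add: br_lin fst_sca x1 scale_right_distrib scale_right_diff_distrib add.commute[of _ r])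
      also have "hm (- r) + hm ?r = hm (- r + ?r)" by (rule hm_add[symmetric])
      also have "- r + ?r = ?r + ?r + a2" by (simp add: algebra_simps)
      finally show ?thesis .
    qed
    moreover have "b (?r + ?r + a2) (?r + ?r + a2) = 3"
      by (rule b_double(1)[OF R(1) a_roots(2) i(2)])
    ultimately show thesis using m by (intro that[of ?r "eps a2 r" "?r + ?r + a2"]) auto
  qed
qed

definition supp01 :: "'h \<times> ('q \<Rightarrow> 'k) \<Rightarrow> bool" where "supp01 x \<longleftrightarrow> (\<forall>q. q \<notin> S0 \<union> S1 \<longrightarrow> snd x q = 0)"

lemma supp01_sub: "V.subspace {x. supp01 x}"
  by (rule V.subspaceI) (auto simp: supp01_def sca_def)

lemma supp01_brW [simp]: "supp01 (brW x y)"
  by (simp add: supp01_def brW_def pr0_def pr1_def)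

lemma supp01_H [simp]: "supp01 (Hh h)" and supp01_E: "r \<in> S0 \<union> S1 \<Longrightarrow> supp01 (Ee r)"
  by (auto simp: supp01_def Hh_def Ee_def)

lemma WP_supp01: "x \<in> WP p \<Longrightarrow> supp01 x"
  by (auto simp: supp01_def WP_def split: if_splits)

lemma supp01_expand: "supp01 x \<Longrightarrow> x = Hh (fst x) + (\<Sum>r\<in>S0 \<union> S1. sca (snd x r) (Ee r))"
proof -
  assume x: "supp01 x"
  have S: "S0 \<union> S1 \<subseteq> roots" by (auto simp: S_type)
  have "supported x" using x S by (auto simp: supp01_def supported_def)
  then have "x = Hh (fst x) + (\<Sum>r\<in>roots. sca (snd x r) (Ee r))" by (rule supported_expand)
  also have "(\<Sum>r\<in>roots. sca (snd x r) (Ee r)) = (\<Sum>r\<in>S0 \<union> S1. sca (snd x r) (Ee r))"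
    by (rule sum.mono_neutral_right) (use x S in \<open>auto simp: supp01_def\<close>)
  finally show ?thesis .
qed

lemma WP_sub: "V.subspace (WP p)"
  by (rule V.subspaceI; cases p) (auto simp: WP_def sca_def wt_add2 wt_scale)

lemma WP_Int: "x \<in> WP 0 \<Longrightarrow> x \<in> WP 1 \<Longrightarrow> x = 0"
  using S01 by (auto simp: WP_def prod_eq_iff fun_eq_iff)

text \<open>A weight that vanishes on \<open>a1\<close> and \<open>a2\<close> is preserved by
  \<open>dd\<close> and by the translation by \<open>a1 - a2\<close> inside
  \<open>l0\<close>.\<close>

lemma graded_brW:
  assumes w: "\<And>x y. w (x + y) = w x + w y" "w a1 = 0" "w a2 = 0" and x: "x \<in> graded w z" and y: "y \<in> graded w z'"
  shows "brW x y \<in> graded w (z + z')"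
proof -
  have wd: "w (x - y) = w x - w y" for x y using w(1)[of "x - y" y] by simp
  have a: "Ee a1 + Ee a2 \<in> graded w 0"
    using V.subspace_add[OF graded_sub graded_E[of a1 w, unfolded w(2)] graded_E[of a2 w, unfolded w(3)]] .
  have d: "dd u \<in> graded w t" if "u \<in> graded w t" for u t
    using graded_br[OF w(1) a that] by (simp add: dd_def)
  have l: "l0 u \<in> graded w t" if "u \<in> graded w t" for u t
  proof -
    have "w q = t" if "snd u (q + a1 - a2) \<noteq> 0" for q
    proof -
      have "w (q + a1 - a2) = t" using \<open>u \<in> graded w t\<close> that by (simp add: graded_def)
      then show ?thesis by (simp add: wd w)
    qed
    moreover have "w q = t" if "snd u q \<noteq> 0" for q
      using \<open>u \<in> graded w t\<close> that by (simp add: graded_def)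
    moreover have "t \<noteq> 0 \<longrightarrow> fst u = 0" using that by (simp add: graded_def)
    ultimately show ?thesis by (simp add: graded_def l0_def)
  qed
  have p: "pr0 u \<in> graded w t" "pr1 u \<in> graded w t" if "u \<in> graded w t" for u t
    using that by (auto simp: graded_def pr0_def pr1_def)
  note B = graded_br[OF w(1)]
  note s = V.subspace_add[OF graded_sub] V.subspace_diff[OF graded_sub]
  show ?thesis unfolding brW_def
    by (rule s(1)[OF p(1)[OF s(1)[OF s(2)[OF B[OF l[OF x] l[OF y]] B[OF p(2)[OF x] d[OF p(2)[OF y]]]] B[OF d[OF p(2)[OF x]] p(2)[OF y]]]]
       p(2)[OF s(1)[OF B[OF l[OF x] p(2)[OF y]] B[OF p(2)[OF x] l[OF y]]]]])
qed

lemma sca_minus_one: "sca (- 1) x = - x"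
  by simp

lemma brW_zero [simp]: "brW 0 x = 0" "brW x 0 = 0"
  using brW_add(1)[of 0 0 x] brW_add(2)[of x 0 0] by auto

lemma brW_minus: "brW (- x) y = - brW x y" "brW x (- y) = - brW x y"
  using brW_scale(1)[of "- 1" x y] brW_scale(2)[of x "- 1" y]
  by (simp_all add: sca_minus_one)

lemma brW_self: "r \<in> S1 \<Longrightarrow> brW (Ee r) (Ee r) = 0"
proof -
  assume r: "r \<in> S1"
  then have rr: "r \<in> roots" by (simp add: S_type)
  then have ra: "br (Ee (r + a)) (Ee r) = 0" if a: "a \<in> roots" "ip r a = - 1" for a
  proof -
    have R: "r + a \<in> roots" using add_root_iff[OF rr a(1)] a by simp
    have i: "ip (r + a) r = 1" using a rr ip_self[OF rr] by (simp add: ip_lin ip_commute)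
    have "r \<noteq> - (r + a)"
    proof
      assume "r = - (r + a)"
      then have "ip r r = - ip (r + a) r" by (metis ip_lin(5))
      then show False using i ip_self[OF rr] by simp
    qed
    then show ?thesis using i by (simp add: br_EE R rr)
  qed
  have "br (dd (Ee r)) (Ee r) = 0" using r ra[of a1] ra[of a2] by (auto simp: S_type dd_E br_lin)
  moreover have "br (Ee r) (dd (Ee r)) = - br (dd (Ee r)) (Ee r)" by (rule br_antisym)
  ultimately show ?thesis using r by (simp add: brW_E rr pr_lin)
qed

text \<open>The mixed terms are twice \<open>[u,[u,v]]\<close> plus \<open>[v,[u,u]]\<close>, which
  is zero by the Jacobi identity. So the cube is additive on odd elements.\<close>

lemma brW_cube_add:
  assumes x: "x \<in> WP 1" and y: "y \<in> WP 1"
  shows "brW (x + y) (brW (x + y) (x + y)) = brW x (brW x x) + brW y (brW y y)"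
proof -
  have a: "brW u v = brW v u" if "u \<in> WP 1" "v \<in> WP 1" for u v
    using brW_antisym[OF that] by (simp add: koszul_sign_def)
  have e: "brW u v = - brW v u" if "u \<in> WP 1" "v \<in> WP 0" for u v
    using brW_antisym[OF that] by (simp add: koszul_sign_def eq_neg_iff_add_eq_0)
  have t: "brW u (brW u v) + brW u (brW u v) + brW v (brW u u) = 0" if u: "u \<in> WP 1" and v: "v \<in> WP 1" for u v
  proof -
    have "brW u u \<in> WP 0" using brW_WP[OF u u] by simp
    then have "brW v (brW u u) = - brW (brW u u) v" by (rule e[OF v])
    moreover have "brW u (brW u v) - brW (brW u u) v + brW u (brW u v) = 0"
      using brW_jacobi[OF u u v] by (simp add: koszul_sign_def)
    ultimately show ?thesis by (simp add: algebra_simps)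
  qed
  have "brW (x + y) (brW (x + y) (x + y)) = brW x (brW x x) + brW y (brW y y)
      + (brW x (brW x y) + brW x (brW x y) + brW y (brW x x)) + (brW y (brW y x) + brW y (brW y x) + brW x (brW y y))"
    unfolding brW_add a[OF y x] by (simp add: algebra_simps)
  then show ?thesis unfolding t[OF x y] t[OF y x] by simp
qed

text \<open>In characteristic 3 the Jacobi identity alone does not give this. Additivity reduces it
  to odd root vectors, whose brackets with themselves vanish by \<open>brW_self\<close>.\<close>

lemma brW_cube: "x \<in> WP 1 \<Longrightarrow> brW x (brW x x) = 0"
proof -
  assume x: "x \<in> WP 1"
  have E: "sca c (Ee r) \<in> WP 1" if "r \<in> S1" for c r using that by (auto simp: WP_def sca_def Ee_def)
  have all: "(\<Sum>r\<in>R. sca (snd x r) (Ee r)) \<in> WP 1 \<and> brW (\<Sum>r\<in>R. sca (snd x r) (Ee r)) (brW (\<Sum>r\<in>R. sca (snd x r) (Ee r)) (\<Sum>r\<in>R. sca (snd x r) (Ee r))) = 0"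
    if "finite R" "R \<subseteq> S1" for R
    using that
  proof (induction R rule: finite_induct)
    case empty
    then show ?case using V.subspace_0[OF WP_sub] by simp
  next
    case (insert r R)
    then have r: "r \<in> S1" by simp
    show ?case using insert V.subspace_add[OF WP_sub E[OF r]] brW_cube_add[OF E[OF r]]
      by (simp add: brW_scale brW_self[OF r])
  qed
  have fin: "finite S1" "finite S0" by (rule finite_subset[OF _ finite_roots], auto simp: S_type)+
  have "x = (\<Sum>r\<in>S1. sca (snd x r) (Ee r))"
  proof -
    have "x = Hh (fst x) + (\<Sum>r\<in>S0 \<union> S1. sca (snd x r) (Ee r))" by (rule supp01_expand[OF WP_supp01[OF x]])
    also have "(\<Sum>r\<in>S0 \<union> S1. sca (snd x r) (Ee r)) = (\<Sum>r\<in>S1. sca (snd x r) (Ee r))"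
      by (rule sum.mono_neutral_right) (use x S01 fin in \<open>auto simp: WP_def\<close>)
    finally show ?thesis using x by (simp add: WP_def Hh_def zero_prod_def[symmetric] zero_fun_def[symmetric])
  qed
  then show ?thesis using all[OF fin(1) order_refl] by simp
qed

lemma brW_HE: "r \<in> S0 \<union> S1 \<Longrightarrow> brW (Hh h) (Ee r) = sca (wt r h) (Ee r)"
proof -
  assume r: "r \<in> S0 \<union> S1"
  then have rr: "r \<in> roots" by (auto simp: S_type)
  have h: "l0 (Hh h) = Hh h" "pr1 (Hh h) = 0" by (auto simp: l0_def pr1_def Hh_def prod_eq_iff fun_eq_iff)
  consider (Z) "ip r a1 = 0" "ip r a2 = 0" | (C) "ip r a1 = 1" "ip r a2 = - 1" | (S) "r \<in> S1"
    using r by (auto simp: S_type)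
  then show ?thesis
  proof cases
    case Z
    then have "r \<in> S0" "r \<notin> S1" using rr by (auto simp: S_type)
    then show ?thesis using Z rr by (simp add: brW_alt h E_parts l0_E br_HE pr_lin odd_br_def)
  next
    case C
    then have m: "r \<in> S0" "r \<notin> S1" "r - a1 + a2 \<notin> S0" using rr by (auto simp: S_type ip_lin)
    have "r - a1 + a2 \<in> roots" using diff_root_iff[OF rr a_roots(1)] add_root_iff[of "r - a1" a2] C by (simp add: ip_lin)
    then show ?thesis using C rr m by (simp add: brW_alt h E_parts l0_E br_HE br_lin pr_lin odd_br_def dd_lin)
  next
    case S
    then show ?thesis using rr S01 by (simp add: brW_alt h E_parts l0_E br_HE pr_lin odd_br_def dd_lin)
  qed
qed

lemma brW_HH: "brW (Hh h) (Hh h') = 0"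
proof -
  have h: "l0 (Hh h) = Hh h" "pr1 (Hh h) = 0" for h by (auto simp: l0_def pr1_def Hh_def prod_eq_iff fun_eq_iff)
  show ?thesis by (simp add: brW_alt h br_HH pr_lin odd_br_def dd_lin)
qed

end

section \<open>The subquotient of e6 as a model of g(3,3)\<close>

lemma of_int_eq_0_char3:
  assumes "(3::'k::field) = 0" "(of_int n :: 'k) = 0"
  shows "3 dvd n"
proof (rule ccontr)
  assume n: "\<not> 3 dvd n"
  have "(of_int n :: 'k) = of_int (3 * (n div 3) + n mod 3)" by simp
  also have "\<dots> = of_int (n mod 3)" unfolding of_int_add of_int_mult by (simp add: assms)
  finally have 1: "(of_int (n mod 3) :: 'k) = 0" using assms by simp
  have "n mod 3 = 1 \<or> n mod 3 = 2" using n by presburger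
  moreover have "(2::'k) \<noteq> 0"
  proof
    assume "(2::'k) = 0"
    then have "(3::'k) - 2 = 0" using assms by simp
    then show False by simp
  qed
  ultimately show False using 1 by auto
qed

text \<open>If the coroots are independent, the coroot of \<open>x\<close> vanishes in
  characteristic 3 only if 3 divides all coordinates. The norm is then a multiple of 9, whereas the
  vectors that occur have norm 1, 2 or 3.\<close>

lemma e6_form_triple:
  assumes "\<And>i. i < 6 \<Longrightarrow> 3 dvd coord i x"
  shows "9 dvd e6_form x x"
proof -
  obtain x1 x2 x3 x4 x5 x6 where x: "x = (x1, x2, x3, x4, x5, x6)" by (cases x)
  have "3 dvd x1" "3 dvd x2" "3 dvd x3" "3 dvd x4" "3 dvd x5" "3 dvd x6"
    using assms[of 0] assms[of 1] assms[of 2] assms[of 3] assms[of 4] assms[of 5] by (simp_all add: x)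
  then obtain y1 y2 y3 y4 y5 y6 where "x1 = 3 * y1" "x2 = 3 * y2" "x3 = 3 * y3" "x4 = 3 * y4" "x5 = 3 * y5" "x6 = 3 * y6"
    by (elim dvdE) blast
  then have "e6_form x x = 9 * e6_form (y1, y2, y3, y4, y5, y6) (y1, y2, y3, y4, y5, y6)"
    unfolding x by (simp add: algebra_simps)
  then show ?thesis by simp
qed

text \<open>The projection of the E6 root lattice to its quotient by \<open>sA\<close> and
  \<open>sB\<close>, with the images of the other four simple roots as basis.\<close>

definition g33_weight :: "e6 \<Rightarrow> nat \<Rightarrow>\<^sub>0 int" where "g33_weight x = (\<Sum>i<4. Poly_Mapping.single i (coord (i + 2) x))"
definition g33_root :: "nat \<Rightarrow> e6" where "g33_root i = simple_root (i + 2)"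
text \<open>For the two odd indices the negative of the simple root has product 1 with
  \<open>sA\<close> or \<open>sB\<close>. Subtracting that root makes the product -1, as membership
  in \<open>S1\<close> requires.\<close>

definition g33_neg_root :: "nat \<Rightarrow> e6" where "g33_neg_root i = - simple_root (i + 2) - (if i = 0 then sA else if i = 1 then sB else 0)"

lemma g33_weight_add: "g33_weight (x + y) = g33_weight x + g33_weight y"
  by (simp add: g33_weight_def coord_add single_add sum.distrib)
lemma g33_weight_minus: "g33_weight (- x) = - g33_weight x"
  using g33_weight_add[of x "- x"] g33_weight_add[of 0 0] by (simp add: eq_neg_iff_add_eq_0 add.commute)
lemma g33_weight_diff: "g33_weight (x - y) = g33_weight x - g33_weight y"
  using g33_weight_add[of x "- y"] by (simp add: g33_weight_minus)
lemma g33_weight_simple_root: "i < 4 \<Longrightarrow> g33_weight (simple_root (i + 2)) = Poly_Mapping.single i 1"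
proof -
  assume i: "i < 4"
  have "g33_weight (simple_root (i + 2)) = (\<Sum>j<4. if j = i then Poly_Mapping.single i 1 else 0)"
    unfolding g33_weight_def by (rule sum.cong) (use i in \<open>auto simp: coord_simple_root\<close>)
  then show "g33_weight (simple_root (i + 2)) = Poly_Mapping.single i 1" using i by simp
qed
lemma g33_weight_sr01: "g33_weight sA = 0" "g33_weight sB = 0"
  unfolding g33_weight_def by (rule sum.neutral, simp add: sA_def sB_def coord_simple_root)+
lemma g33_weight_zero: "g33_weight 0 = 0" using g33_weight_add[of 0 0] by simp
lemma sr01: "simple_root 0 = sA" "simple_root 1 = sB" "simple_root (Suc 0) = sB" by (simp_all add: sA_def sB_def)
lemma g33_weight_g33_root: "i < 4 \<Longrightarrow> g33_weight (g33_root i) = Poly_Mapping.single i 1" and g33_weight_g33_neg_root: "i < 4 \<Longrightarrow> g33_weight (g33_neg_root i) = - Poly_Mapping.single i 1"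
  using g33_weight_simple_root[of i] by (simp_all add: g33_root_def g33_neg_root_def g33_weight_diff g33_weight_minus g33_weight_sr01 g33_weight_zero)

lemma less4: "i < 4 \<longleftrightarrow> i = 0 \<or> i = 1 \<or> i = 2 \<or> i = (3::nat)"
  by auto

lemma dim_g33: "dim_row cartan_g33 = 4"
  by (simp add: cartan_g33_def mat_of_rows_list_def)

lemma cartan_g33_entry: "i < 4 \<Longrightarrow> j < 4 \<Longrightarrow> cartan_g33 $$ (i, j) =
  [[0, -1, 0, 0], [-1, 0, -1, 0], [0, -1, 2, -1], [0, 0, -1, 2]] ! i ! j"
  by (simp add: cartan_g33_def mat_of_rows_list_def)

context e6_realization begin

lemma hmE_eq_0:
  assumes ind: "\<And>c i. (\<Sum>i<6. scl (c i) (hh i)) = 0 \<Longrightarrow> i < 6 \<Longrightarrow> c i = 0" and x: "hmE x = 0"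
  shows "9 dvd e6_form x x"
proof (rule e6_form_triple)
  fix i :: nat assume "i < 6"
  then have "(of_int (coord i x) :: 'k) = 0" using ind[of "\<lambda>i. of_int (coord i x)"] x by (simp add: hmE_def)
  then show "3 dvd coord i x" by (rule of_int_eq_0_char3[OF char3])
qed

lemma root_hmE_nonzero:
  assumes ind: "\<And>c i. (\<Sum>i<6. scl (c i) (hh i)) = 0 \<Longrightarrow> i < 6 \<Longrightarrow> c i = 0" and x: "e6_form x x \<in> {1, 2, 3}"
  shows "hmE x \<noteq> 0"
proof
  assume "hmE x = 0"
  then have "9 dvd e6_form x x" using hmE_eq_0[of x] ind by blast
  then show False using x by auto
qed

lemma ip_num [simp]:
  "E.ip (simple_root 2) sA = - 1" "E.ip (simple_root 3) sA = 0" "E.ip (simple_root 4) sA = 0" "E.ip (simple_root 5) sA = 0"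
  "E.ip (simple_root 2) sB = 0" "E.ip (simple_root 3) sB = - 1" "E.ip (simple_root 4) sB = 0" "E.ip (simple_root 5) sB = 0"
  "E.ip sA (simple_root 2) = - 1" "E.ip sA (simple_root 3) = 0" "E.ip sA (simple_root 4) = 0" "E.ip sA (simple_root 5) = 0"
  "E.ip sB (simple_root 2) = 0" "E.ip sB (simple_root 3) = - 1" "E.ip sB (simple_root 4) = 0" "E.ip sB (simple_root 5) = 0"
  "E.ip (simple_root 2) (simple_root 3) = - 1" "E.ip (simple_root 2) (simple_root 4) = 0" "E.ip (simple_root 2) (simple_root 5) = 0"
  "E.ip (simple_root 3) (simple_root 2) = - 1" "E.ip (simple_root 3) (simple_root 4) = - 1" "E.ip (simple_root 3) (simple_root 5) = 0"
  "E.ip (simple_root 4) (simple_root 2) = 0" "E.ip (simple_root 4) (simple_root 3) = - 1" "E.ip (simple_root 4) (simple_root 5) = - 1"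
  "E.ip (simple_root 5) (simple_root 2) = 0" "E.ip (simple_root 5) (simple_root 3) = 0" "E.ip (simple_root 5) (simple_root 4) = - 1"
  "E.ip sA sB = 0" "E.ip sB sA = 0"
  "E.ip sA sA = 2" "E.ip sB sB = 2" "E.ip (simple_root 2) (simple_root 2) = 2" "E.ip (simple_root 3) (simple_root 3) = 2"
  "E.ip (simple_root 4) (simple_root 4) = 2" "E.ip (simple_root 5) (simple_root 5) = 2"
  by (simp_all add: ip_simple_root cartan_e6_entry sA_def sB_def)

lemma g33_root_simps: "g33_root 0 = simple_root 2" "g33_root (Suc 0) = simple_root 3" "g33_root 2 = simple_root 4" "g33_root 3 = simple_root 5" "g33_neg_root 0 = - simple_root 2 - sA" "g33_neg_root (Suc 0) = - simple_root 3 - sB"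
    "g33_neg_root 2 = - simple_root 4" "g33_neg_root 3 = - simple_root 5"
  by (simp_all add: g33_root_def g33_neg_root_def eval_nat_numeral)

lemma g33_root_g33_neg_root_type:
  assumes "i < 4"
  shows "g33_root i \<in> S0 \<union> S1" "g33_neg_root i \<in> S0 \<union> S1" "g33_root i \<in> E.roots" "g33_neg_root i \<in> E.roots"
    "E.ip (g33_root i) sA = 0 \<and> E.ip (g33_root i) sB = 0 \<or> g33_root i \<in> S1"
    "E.ip (g33_neg_root i) sA = 0 \<and> E.ip (g33_neg_root i) sB = 0 \<or> g33_neg_root i \<in> S1"
proof -
  have e: "- simple_root 2 - sA = - (simple_root 2 + sA)" "- simple_root 3 - sB = - (simple_root 3 + sB)" by simp_all
  have r: "simple_root 2 \<in> E.roots" "simple_root 3 \<in> E.roots" "simple_root 4 \<in> E.roots" "simple_root 5 \<in> E.roots"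
    by (simp_all add: simple_root_root)
  have R: "- simple_root 2 - sA \<in> E.roots" "- simple_root 3 - sB \<in> E.roots"
    unfolding e E.roots_minus using E.add_root_iff r by simp_all
  show "g33_root i \<in> S0 \<union> S1" "g33_neg_root i \<in> S0 \<union> S1" "g33_root i \<in> E.roots" "g33_neg_root i \<in> E.roots"
    "E.ip (g33_root i) sA = 0 \<and> E.ip (g33_root i) sB = 0 \<or> g33_root i \<in> S1"
    "E.ip (g33_neg_root i) sA = 0 \<and> E.ip (g33_neg_root i) sB = 0 \<or> g33_neg_root i \<in> S1"
    using assms r R unfolding less4 by (elim disjE; simp add: g33_root_simps S_type E.ip_lin)+
qed

definition g33_e :: "nat \<Rightarrow> 'h \<times> (e6 \<Rightarrow> 'k)" where "g33_e i = Ee (g33_root i)"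
definition g33_f :: "nat \<Rightarrow> 'h \<times> (e6 \<Rightarrow> 'k)" where "g33_f i = - Ee (g33_neg_root i)"

lemma brEE_zero: "r \<in> E.roots \<Longrightarrow> s \<in> E.roots \<Longrightarrow> E.ip r s \<ge> 0 \<Longrightarrow> br (Ee r) (Ee s) = 0"
  using E.ip_eq_m2[of r s] by (auto simp: br_EE)

text \<open>Brackets of root vectors vanish when the inner product is nonnegative. For the two odd
  indices this is needed after the shift that \<open>dd\<close> performs on either factor.\<close>

lemma brW_EF_offdiag:
  assumes "i < 4" "j < 4" "i \<noteq> j"
  shows "brW (g33_e i) (g33_f j) = 0"
proof -
  have nn: "E.ip (g33_root i) (g33_neg_root j) \<ge> 0"
    using assms unfolding less4 by (elim disjE; simp add: g33_root_simps E.ip_lin)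
  note t = g33_root_g33_neg_root_type[OF assms(1)] g33_root_g33_neg_root_type[OF assms(2)]
  have 0: "br (Ee (g33_root i)) (Ee (g33_neg_root j)) = 0" by (rule brEE_zero[OF t(3,10) nn])
  have "brW (Ee (g33_root i)) (Ee (g33_neg_root j)) = 0"
  proof (cases "i < 2 \<and> j < 2")
    case False
    then consider "i = 2 \<or> i = 3" | "j = 2 \<or> j = 3" using assms by linarith
    then show ?thesis
    proof cases
      case 1
      then have i: "E.ip (g33_root i) sA = 0" "E.ip (g33_root i) sB = 0" by (auto simp: g33_root_simps)
      then have "g33_root i \<in> S0" using t(3) by (simp add: S_type)
      moreover have "l0 (Ee (g33_neg_root j)) = Ee (g33_neg_root j) \<or> g33_neg_root j \<in> S1" using l0_E(2)[OF t(10)] t(12) by blast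
      moreover have "g33_neg_root j \<notin> S1 \<Longrightarrow> g33_neg_root j \<in> S0" using t(8) by blast
      ultimately show ?thesis using 0 brW_E(1,2)[OF t(3,10)] l0_E(2)[OF t(3) i] by (cases "g33_neg_root j \<in> S1") (auto simp: pr_lin)
    next
      case 2
      then have i: "E.ip (g33_neg_root j) sA = 0" "E.ip (g33_neg_root j) sB = 0" by (auto simp: g33_root_simps E.ip_lin)
      then have "g33_neg_root j \<in> S0" using t(10) by (simp add: S_type)
      moreover have "l0 (Ee (g33_root i)) = Ee (g33_root i) \<or> g33_root i \<in> S1" using l0_E(2)[OF t(3)] t(5) by blast
      moreover have "g33_root i \<notin> S1 \<Longrightarrow> g33_root i \<in> S0" using t(1) by blast
      ultimately show ?thesis using 0 brW_E(1,3)[OF t(3,10)] l0_E(2)[OF t(10) i] by (cases "g33_root i \<in> S1") (auto simp: pr_lin)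
    qed
  next
    case True
    then consider "i = 0" "j = 1" | "i = 1" "j = 0" using assms by linarith
    then show ?thesis
    proof cases
      case 1
      have r: "g33_root i + sA \<in> E.roots" "g33_neg_root j + sB \<in> E.roots"
        using E.add_root_iff[OF t(3), of sA] E.add_root_iff[OF t(10), of sB] 1 by (simp_all add: g33_root_simps E.ip_lin)
      have d: "dd (Ee (g33_root i)) = sca (E.eps sA (g33_root i)) (Ee (g33_root i + sA))" "dd (Ee (g33_neg_root j)) = sca (E.eps sB (g33_neg_root j)) (Ee (g33_neg_root j + sB))"
        using dd_E(1)[OF t(3)] dd_E(2)[OF t(10)] 1 by (simp_all add: g33_root_simps E.ip_lin)
      have "br (Ee (g33_root i + sA)) (Ee (g33_neg_root j)) = 0" "br (Ee (g33_root i)) (Ee (g33_neg_root j + sB)) = 0"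
        by (rule brEE_zero, fact, fact, simp add: 1 g33_root_simps E.ip_lin)+
      moreover have "g33_root i \<in> S1" "g33_neg_root j \<in> S1" using t 1 by (auto simp: g33_root_simps E.ip_lin)
      ultimately show ?thesis by (simp add: brW_E t d br_lin pr_lin)
    next
      case 2
      have r: "g33_root i + sB \<in> E.roots" "g33_neg_root j + sA \<in> E.roots"
        using E.add_root_iff[OF t(3), of sB] E.add_root_iff[OF t(10), of sA] 2 by (simp_all add: g33_root_simps E.ip_lin)
      have d: "dd (Ee (g33_root i)) = sca (E.eps sB (g33_root i)) (Ee (g33_root i + sB))" "dd (Ee (g33_neg_root j)) = sca (E.eps sA (g33_neg_root j)) (Ee (g33_neg_root j + sA))"
        using dd_E(2)[OF t(3)] dd_E(1)[OF t(10)] 2 by (simp_all add: g33_root_simps E.ip_lin)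
      have "br (Ee (g33_root i + sB)) (Ee (g33_neg_root j)) = 0" "br (Ee (g33_root i)) (Ee (g33_neg_root j + sA)) = 0"
        by (rule brEE_zero, fact, fact, simp add: 2 g33_root_simps E.ip_lin)+
      moreover have "g33_root i \<in> S1" "g33_neg_root j \<in> S1" using t 2 by (auto simp: g33_root_simps E.ip_lin)
      ultimately show ?thesis by (simp add: brW_E t d br_lin pr_lin)
    qed
  qed
  then show ?thesis by (simp add: g33_e_def g33_f_def brW_minus)
qed

text \<open>For an odd index the two terms of the odd bracket contribute the coroots of
  \<open>g33_root i\<close> and of \<open>g33_root i + a\<close>, together twice the first coroot
  plus that of \<open>a\<close>. The two signs agree because \<open>eps\<close> takes opposite
  values at the two odd root vectors.\<close>

lemma brW_EF_diag:
  assumes i: "i < 4"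
  shows "brW (g33_e i) (g33_f i) = Hh (if i < 2 then - (scl 2 (hh (i + 2)) + hh i) else hh (i + 2))"
proof (cases "i < 2")
  case False
  then have j: "i = 2 \<or> i = 3" using i by linarith
  note t = g33_root_g33_neg_root_type[OF i]
  have z: "E.ip (g33_root i) sA = 0" "E.ip (g33_root i) sB = 0" "E.ip (g33_neg_root i) sA = 0" "E.ip (g33_neg_root i) sB = 0"
    and n: "g33_neg_root i = - g33_root i" using j by (auto simp: g33_root_simps E.ip_lin)
  have m: "g33_root i \<in> S0" "g33_neg_root i \<in> S0" using t z by (auto simp: S_type)
  have "E.ip (g33_root i) (- g33_root i) = - 2" using E.ip_self[OF t(3)] by (simp add: E.ip_lin)
  then have "br (Ee (g33_root i)) (Ee (g33_neg_root i)) = - Hh (hmE (g33_root i))" using t(3) by (simp add: br_EE n)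
  moreover have "pr0 (Hh h) = Hh h" for h by (simp add: pr0_def Hh_def prod_eq_iff fun_eq_iff)
  moreover have "hmE (g33_root i) = hh (i + 2)" using i by (simp add: g33_root_def hmE_simple_root)
  ultimately show ?thesis using False m z t(3,4) by (simp add: g33_e_def g33_f_def brW_minus brW_E l0_E pr_lin)
next
  case True
  note t = g33_root_g33_neg_root_type[OF i]
  define a where "a = (if i = 0 then sA else sB)"
  have a: "a = sA \<and> i = 0 \<or> a = sB \<and> i = 1" using True by (auto simp: a_def)
  have aR: "a \<in> E.roots" using a by auto
  have z: "E.ip (g33_root i) a = - 1" "E.ip (g33_neg_root i) a = - 1" using a by (auto simp: g33_root_simps E.ip_lin)
  have n: "g33_neg_root i = - g33_root i - a" using True by (auto simp: g33_neg_root_def g33_root_def a_def)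
  have m: "g33_root i \<in> S1" "g33_neg_root i \<in> S1" using t a by (auto simp: g33_root_simps E.ip_lin)
  have d: "dd (Ee (g33_root i)) = sca (E.eps a (g33_root i)) (Ee (g33_root i + a))" "dd (Ee (g33_neg_root i)) = sca (E.eps a (g33_neg_root i)) (Ee (g33_neg_root i + a))"
    using dd_E[OF t(3)] dd_E[OF t(4)] a by (auto simp: g33_root_simps E.ip_lin)
  \<comment> \<open>In \<open>e6_form\<close> the edge between these two simple roots carries its -1
    in this order.\<close>
  have "odd (e6_form a (g33_root i))" using a by (auto simp: g33_root_simps simple_root_def sA_def sB_def)
  then have e: "E.eps a (g33_root i) = (- 1 :: 'k)" by (simp add: E.eps_def)
  have ea: "E.eps a a = (- 1 :: 'k)" using aR by simp
  have e': "E.eps a (g33_neg_root i) = (1 :: 'k)" using e ea unfolding n by (simp add: E.eps_lin)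
  have R: "g33_root i + a \<in> E.roots" using E.add_root_iff[OF t(3) aR] z by simp
  have neg: "g33_neg_root i = - (g33_root i + a)" "g33_neg_root i + a = - g33_root i" using n by simp_all
  have nR: "- (g33_root i + a) \<in> E.roots" "- g33_root i \<in> E.roots" using R t(3) by (simp_all only: E.roots_minus)
  have i2: "E.ip (g33_root i + a) (- (g33_root i + a)) = - 2" "E.ip (g33_root i) (- g33_root i) = - 2"
    using E.ip_self[OF R] E.ip_self[OF t(3)] E.ip_lin(6)[of "g33_root i + a" "g33_root i + a"] E.ip_lin(6)[of "g33_root i" "g33_root i"] by simp_all
  have b: "br (Ee (g33_root i + a)) (Ee (g33_neg_root i)) = - Hh (hmE (g33_root i + a))" "br (Ee (g33_root i)) (Ee (g33_neg_root i + a)) = - Hh (hmE (g33_root i))"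
    unfolding neg using br_EE[OF R nR(1)] br_EE[OF t(3) nR(2)] unfolding i2 by simp_all
  have p: "pr0 (Hh h) = Hh h" for h by (simp add: pr0_def Hh_def prod_eq_iff fun_eq_iff)
  have "hmE (g33_root i) = hh (i + 2)" "hmE a = hh i" using a True hmE_simple_root[of 0] hmE_simple_root[of 1] by (auto simp: g33_root_def hmE_simple_root sr01)
  then have h: "hmE (g33_root i + a) + hmE (g33_root i) = scl 2 (hh (i + 2)) + hh i"
    by (simp add: hm_add) (simp add: scale_left_distrib[of 1 1, simplified] add_ac)
  have "brW (Ee (g33_root i)) (Ee (g33_neg_root i)) = Hh (hmE (g33_root i + a)) + Hh (hmE (g33_root i))"
    unfolding brW_E(4)[OF t(3,4) m] d by (simp add: br_lin b pr_lin p e e')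
  also have "\<dots> = Hh (scl 2 (hh (i + 2)) + hh i)" unfolding h[symmetric] by (simp add: Hh_def)
  finally show ?thesis using True by (simp add: g33_e_def g33_f_def brW_minus) (simp add: Hh_def)
qed

text \<open>The Cartan images \<open>Hc\<close> are left open, because the Cartan letters of
  \<open>g(3,3)\<close> range over a smaller space than the Cartan space of the surrounding
  realization.\<close>

definition reach4 :: "('z \<Rightarrow> 'h \<times> (e6 \<Rightarrow> 'k)) \<Rightarrow> e6 \<Rightarrow> bool"
  where "reach4 Hc r \<longleftrightarrow> (\<exists>m. letters m \<subseteq> gens 4 \<and> magma_deg gen_weight m = g33_weight r \<and>
    (\<exists>c. c \<noteq> 0 \<and> magma_eval brW (generator_image Hc g33_e g33_f) m = sca c (Ee r)))"

lemma reach4_letter: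
  assumes i: "i < 4" and x: "x = Egen i \<and> s = g33_root i \<and> c = 1 \<or> x = Fgen i \<and> s = g33_neg_root i \<and> c = - 1"
  shows "letters (Letter x) \<subseteq> gens 4" "magma_deg gen_weight (Letter x) = g33_weight s"
    "magma_eval brW (generator_image Hc g33_e g33_f) (Letter x) = sca c (Ee s)" "c \<noteq> 0"
  using x i by (auto simp: gens_def g33_weight_g33_root g33_weight_g33_neg_root g33_e_def g33_f_def)

lemma reach4_step:
  fixes Hc :: "'z \<Rightarrow> 'h \<times> (e6 \<Rightarrow> 'k)"
  assumes i: "i < 4" and s: "s = g33_root i \<or> s = g33_neg_root i" and t: "reach4 Hc t" and c: "c \<noteq> 0" "brW (Ee s) (Ee t) = sca c (Ee r)"
    and w: "g33_weight r = g33_weight s + g33_weight t"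
  shows "reach4 Hc r"
proof -
  obtain m c' where m: "letters m \<subseteq> gens 4" "magma_deg gen_weight m = g33_weight t" "c' \<noteq> 0"
    "magma_eval brW (generator_image Hc g33_e g33_f) m = sca c' (Ee t)" using t unfolding reach4_def by blast
  obtain x :: "'z generator" and c'' :: 'k where "x = Egen i \<and> s = g33_root i \<and> c'' = 1 \<or> x = Fgen i \<and> s = g33_neg_root i \<and> c'' = - 1" using s by blast
  note x = reach4_letter[OF i this]
  have "magma_eval brW (generator_image Hc g33_e g33_f) (MProd (Letter x) m) = brW (sca c'' (Ee s)) (sca c' (Ee t))"
    unfolding magma_eval.simps(2) x(3) m(4) ..
  also have "\<dots> = sca (c'' * c' * c) (Ee r)" by (simp add: brW_scale c mult_ac)
  finally show ?thesis unfolding reach4_def using x m c w by (intro exI[of _ "MProd (Letter x) m"] conjI exI[of _ "c'' * c' * c"]) auto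
qed

text \<open>\<open>P s\<close> is twice the inner product of the projections of \<open>s\<close> and
  \<open>r\<close> orthogonal to \<open>sA\<close> and \<open>sB\<close>. It vanishes on these two,
  so \<open>P r\<close> is a combination over the other four simple roots, and
  \<open>P r > 0\<close> yields one to which \<open>brW_step\<close> applies. The sum of the
  absolute values of the four coordinates decreases.\<close>

lemma reach4_all:
  fixes Hc :: "'z \<Rightarrow> 'h \<times> (e6 \<Rightarrow> 'k)"
  shows "r \<in> S0 \<union> S1 \<Longrightarrow> reach4 Hc r"
proof (induction "nat (\<Sum>i<4. \<bar>coord (i + 2) r\<bar>)" arbitrary: r rule: less_induct)
  case less
  then have rr: "r \<in> E.roots" by (auto simp: S_type)
  define P where "P s = 2 * E.ip s r - E.ip s sA * E.ip r sA - E.ip s sB * E.ip r sB" for s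
  have P_lin: "P (x + y) = P x + P y" "P (x - y) = P x - P y" "P (- x) = - P x" for x y
    by (simp_all add: P_def E.ip_lin algebra_simps)
  have P01: "P sA = 0" "P sB = 0" by (simp_all add: P_def E.ip_commute[of r])
  have ex: "E.ip r y = (\<Sum>i<6. coord i r * E.ip (simple_root i) y)" for y by (rule ip_expand)
  have "P r = (\<Sum>i<6. coord i r * P (simple_root i))"
    unfolding P_def ex[of r] ex[of sA] ex[of sB] sum6 by (simp add: algebra_simps)
  also have "\<dots> = (\<Sum>i<4. coord (i + 2) r * P (g33_root i))"
    unfolding sum6 using P01 by (simp add: eval_nat_numeral g33_root_def sr01)
  finally have sum: "P r = (\<Sum>i<4. coord (i + 2) r * P (g33_root i))" .
  have "P r > 0" using less.prems E.ip_self[OF rr] by (auto simp: P_def S_type)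
  then have "\<exists>i\<in>{..<4}. coord (i + 2) r * P (g33_root i) > 0" unfolding sum
    by (metis (no_types, lifting) linorder_not_less sum_nonpos)
  then obtain i where i: "i < 4" "coord (i + 2) r * P (g33_root i) > 0" by auto
  have PF: "P (g33_neg_root i) = - P (g33_root i)"
    using P01 P_lin(1)[of 0 0] by (simp add: g33_neg_root_def g33_root_def P_lin)
  obtain s where s: "s = g33_root i \<and> coord (i + 2) r > 0 \<or> s = g33_neg_root i \<and> coord (i + 2) r < 0" "P s > 0"
    using i(2)[unfolded zero_less_mult_iff] PF that[of "g33_root i"] that[of "g33_neg_root i"] by auto
  then have s': "s = g33_root i \<or> s = g33_neg_root i" by blast
  show ?case
  proof (cases "r = s")
    case True
    obtain x :: "'z generator" and c :: 'k where "x = Egen i \<and> s = g33_root i \<and> c = 1 \<or> x = Fgen i \<and> s = g33_neg_root i \<and> c = - 1" using s by blast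
    note x = reach4_letter[OF i(1) this]
    then show ?thesis unfolding reach4_def True by blast
  next
    case False
    have s1: "s \<in> E.roots" "E.ip s sA = 0 \<and> E.ip s sB = 0 \<or> s \<in> S1" using s' g33_root_g33_neg_root_type[OF i(1)] by blast+
    obtain t c where t: "t \<in> S0 \<union> S1" "c \<noteq> 0" "brW (Ee s) (Ee t) = sca c (Ee r)"
      "t \<in> {r - s, r - s - sA, r - s - sB, r - s + sA - sB}"
      using brW_step[OF s1 less.prems s(2)[unfolded P_def] False] by blast
    have w: "g33_weight r = g33_weight s + g33_weight t" using t(4) by (auto simp: g33_weight_diff g33_weight_add g33_weight_sr01)
    have cd: "coord k (x - y) = coord k x - coord k y" for k x y using coord_add[of k "x - y" y] by simp
    have coord_t: "coord (k + 2) t = coord (k + 2) r - coord (k + 2) s" for k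
      using t(4) by (auto simp: cd coord_add coord_simple_root sA_def sB_def)
    have coord_s: "coord (k + 2) s = (if k = i then if s = g33_root i \<and> coord (i + 2) r > 0 then 1 else - 1 else 0)" for k
      using s(1) i(1) by (auto simp: g33_root_def g33_neg_root_def cd coord_minus coord_simple_root coord_zero sA_def sB_def)
    have "(\<Sum>k<4. \<bar>coord (k + 2) t\<bar>) < (\<Sum>k<4. \<bar>coord (k + 2) r\<bar>)"
    proof (rule sum_strict_mono_ex1)
      show "\<forall>k\<in>{..<4}. \<bar>coord (k + 2) t\<bar> \<le> \<bar>coord (k + 2) r\<bar>" unfolding coord_t coord_s using s(1) by auto
      show "\<exists>k\<in>{..<4}. \<bar>coord (k + 2) t\<bar> < \<bar>coord (k + 2) r\<bar>" unfolding coord_t coord_s using s(1) i by (intro bexI[of _ i]) auto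
    qed simp
    moreover have "0 \<le> (\<Sum>k<4. \<bar>coord (k + 2) t\<bar>)" by (intro sum_nonneg) simp
    ultimately have "nat (\<Sum>k<4. \<bar>coord (k + 2) t\<bar>) < nat (\<Sum>k<4. \<bar>coord (k + 2) r\<bar>)" by linarith
    then have "reach4 Hc t" using less.hyps t(1) by blast
    then show ?thesis by (rule reach4_step[OF i(1) s' _ t(2,3) w])
  qed
qed

definition g33_component :: "(nat \<Rightarrow>\<^sub>0 int) \<Rightarrow> ('h \<times> (e6 \<Rightarrow> 'k)) set" where "g33_component q = {x. supp01 x} \<inter> graded g33_weight q"

text \<open>Any root \<open>r\<close> in the support of \<open>v\<close> will do:
  \<open>brW_dual\<close> provides an opposite root vector, reached by a monomial, and the Cartan
  part of its bracket with \<open>v\<close> is a nonzero multiple of a nonzero coroot.\<close>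

lemma g33_component_nondegenerate:
  assumes ind: "\<And>c i. (\<Sum>i<6. scl (c i) (hh i)) = 0 \<Longrightarrow> i < 6 \<Longrightarrow> c i = 0"
    and v: "q \<noteq> 0" "v \<in> g33_component q" "v \<noteq> 0"
  shows "\<exists>m. letters m \<subseteq> gens 4 \<and> magma_deg gen_weight m = - q \<and>
      brW (magma_eval brW (generator_image Hc g33_e g33_f) m) v \<noteq> 0"
proof -
  have "fst v = 0" using v by (auto simp: g33_component_def graded_def)
  then have "snd v \<noteq> 0" using v by (auto simp: prod_eq_iff)
  then obtain r where r: "snd v r \<noteq> 0" by (auto simp: fun_eq_iff)
  have w: "g33_weight r = q" using r v(2) unfolding g33_component_def graded_def by blast
  have rS: "r \<in> S0 \<union> S1" using r v(2) unfolding g33_component_def supp01_def by blast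
  obtain r' c z where r': "r' \<in> S0 \<union> S1" "r' \<in> {- r, - r - sA, - r - sB, sA - r - sB}" "c \<noteq> 0"
    "\<And>x. fst (brW (Ee r') x) = scl (c * snd x r) (hmE z)" "e6_form z z \<in> {1, 2, 3}"
  proof (rule brW_dual[OF rS], goal_cases)
    case (1 r' c z) show ?case by (rule 1(1)[OF 1(2-6)])
  qed
  obtain m c' where m: "letters m \<subseteq> gens 4" "magma_deg gen_weight m = g33_weight r'" "c' \<noteq> 0"
    "magma_eval brW (generator_image Hc g33_e g33_f) m = sca c' (Ee r')" using reach4_all[OF r'(1), of Hc] unfolding reach4_def by blast
  have "g33_weight r' = - q" using r'(2) unfolding w[symmetric]
    by (elim insertE emptyE) (simp_all add: g33_weight_diff g33_weight_add g33_weight_minus g33_weight_sr01)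
  moreover have "hmE z \<noteq> 0" using root_hmE_nonzero[of z] ind r'(5) by blast
  then have "fst (brW (magma_eval brW (generator_image Hc g33_e g33_f) m) v) \<noteq> 0"
    unfolding m(4) using r' r m(3) by (simp add: brW_scale fst_sca)
  ultimately show ?thesis using m by (intro exI[of _ m]) auto
qed

end

text \<open>
  The values of \<open>\<alpha>W 0\<close> and \<open>\<alpha>W 1\<close> on \<open>(h, a, b)\<close> are \<open>2a\<close> and \<open>2b\<close>, so the elements killed by them form the Cartan space of
  \<open>g(3,3)\<close>; the other entries make \<open>hhW\<close> and \<open>\<alpha>W\<close> a realization of the Cartan matrix of E6 in characteristic 3.
\<close>

locale g33_realization = vector_space scl for scl :: "'k::field \<Rightarrow> 'h::ab_group_add \<Rightarrow> 'h" +
  fixes hh :: "nat \<Rightarrow> 'h" and \<alpha> :: "nat \<Rightarrow> 'h \<Rightarrow> 'k"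
  assumes char3: "(3::'k) = 0"
    and \<alpha>_add: "j < 4 \<Longrightarrow> \<alpha> j (x + y) = \<alpha> j x + \<alpha> j y"
    and \<alpha>_scale: "j < 4 \<Longrightarrow> \<alpha> j (scl c x) = c * \<alpha> j x"
    and \<alpha>_hh: "i < 4 \<Longrightarrow> j < 4 \<Longrightarrow> \<alpha> j (hh i) = of_int (cartan_g33 $$ (i, j))"
    and hh_indep: "(\<Sum>i<4. scl (f i) (hh i)) = 0 \<Longrightarrow> i < 4 \<Longrightarrow> f i = 0"
begin

definition sclW :: "'k \<Rightarrow> 'h \<times> 'k \<times> 'k \<Rightarrow> 'h \<times> 'k \<times> 'k"
  where "sclW c x = (scl c (fst x), c * fst (snd x), c * snd (snd x))"
text \<open>Two new coroots are adjoined for the indices 0 and 1, and the coroots 2 and 3 are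
  corrected by them, so that \<open>hhW (i + 2) - hhW i\<close> is \<open>(hh i, 0, 0)\<close> for
  \<open>i < 2\<close>: in the form found in \<open>brW_EF_diag\<close>, the odd coroots of
  \<open>g(3,3)\<close> are recovered.\<close>

definition hhW :: "nat \<Rightarrow> 'h \<times> 'k \<times> 'k"
  where "hhW i = (if i < 2 then 0 else hh (i - 2), if i = 0 \<or> i = 2 then 1 else 0, if i = 1 \<or> i = 3 then 1 else 0)"
definition \<alpha>W :: "nat \<Rightarrow> 'h \<times> 'k \<times> 'k \<Rightarrow> 'k"
  where "\<alpha>W j x = (if j = 0 then 2 * fst (snd x) else if j = 1 then 2 * snd (snd x)
     else \<alpha> (j - 2) (fst x) - (if j = 2 then fst (snd x) else if j = 3 then snd (snd x) else 0))"
definition g33_h :: "'h \<Rightarrow> ('h \<times> 'k \<times> 'k) \<times> (e6 \<Rightarrow> 'k)" where "g33_h h = ((h, 0, 0), 0)"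

lemma two_eq: "(2::'k) = - 1"
proof -
  have "(2::'k) + 1 = 0" using char3 by simp
  then show ?thesis by (simp add: eq_neg_iff_add_eq_0)
qed

lemma \<alpha>_zero: "j < 4 \<Longrightarrow> \<alpha> j 0 = 0"
  using \<alpha>_scale[of j 0 0] by simp

lemma \<alpha>W_hhW:
  assumes "i < 6" "j < 6"
  shows "\<alpha>W j (hhW i) = of_int (cartan_e6 $$ (i, j))"
proof -
  have a: "\<alpha> 0 (hh i) = of_int ([0,-1,0,0] ! i)" "\<alpha> 1 (hh i) = of_int ([-1,0,-1,0] ! i)"
    "\<alpha> 2 (hh i) = of_int ([0,-1,2,-1] ! i)" "\<alpha> 3 (hh i) = of_int ([0,0,-1,2] ! i)" if "i < 4" for i
    using that unfolding less4 by (elim disjE; simp add: \<alpha>_hh cartan_g33_entry)+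
  have row: "\<forall>j<6. \<alpha>W j (hhW i) = of_int ([[2, 0, -1, 0, 0, 0], [0, 2, 0, -1, 0, 0], [-1, 0, 2, -1, 0, 0], [0, -1, -1, 2, -1, 0],
   [0, 0, 0, -1, 2, -1], [0, 0, 0, 0, -1, 2 :: int]] ! i ! j)"
    using assms(1) unfolding less6
    by (elim disjE; simp only:; simp add: all_conj_distrib imp_disjL \<alpha>W_def hhW_def two_eq \<alpha>_zero a a[simplified])
  then show ?thesis using assms by (simp add: cartan_e6_entry)
qed

sublocale X: e6_realization sclW hhW \<alpha>W
proof
  fix x y :: "'h \<times> 'k \<times> 'k" and c d :: 'k and i j :: nat
  show "sclW c (x + y) = sclW c x + sclW c y" "sclW (c + d) x = sclW c x + sclW d x" "sclW c (sclW d x) = sclW (c * d) x" "sclW 1 x = x"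
    by (simp_all add: sclW_def algebra_simps)
  show "(3::'k) = 0" by (rule char3)
  show "j < 6 \<Longrightarrow> \<alpha>W j (x + y) = \<alpha>W j x + \<alpha>W j y" by (simp add: \<alpha>W_def \<alpha>_add algebra_simps)
  show "j < 6 \<Longrightarrow> \<alpha>W j (sclW c x) = c * \<alpha>W j x" by (simp add: \<alpha>W_def sclW_def \<alpha>_scale algebra_simps)
  show "i < 6 \<Longrightarrow> j < 6 \<Longrightarrow> \<alpha>W j (hhW i) = of_int (cartan_e6 $$ (i, j))" by (rule \<alpha>W_hhW)
qed

lemma sum_sclW: "(\<Sum>i<6. sclW (c i) (hhW i)) = (\<Sum>i<4. scl (c (i + 2)) (hh i), c 0 + c 2, c 1 + c 3)"
  by (simp add: sum6 sclW_def hhW_def eval_nat_numeral add_ac)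

lemma hhW_indep: "(\<Sum>i<6. sclW (c i) (hhW i)) = 0 \<Longrightarrow> i < 6 \<Longrightarrow> c i = 0"
proof -
  assume *: "(\<Sum>i<6. sclW (c i) (hhW i)) = 0" and i: "i < 6"
  have "c (k + 2) = 0" if "k < 4" for k
    using hh_indep[of "\<lambda>i. c (i + 2)" k] * that by (simp add: sum_sclW zero_prod_def)
  from this[of 0] this[of 1] this[of 2] this[of 3] have z: "c 2 = 0" "c 3 = 0" "c 4 = 0" "c 5 = 0"
    by (simp_all add: eval_nat_numeral)
  moreover have "c 0 + c 2 = 0" "c 1 + c 3 = 0" using * by (simp_all add: sum_sclW zero_prod_def)
  ultimately have "c 0 = 0" "c 1 = 0" by simp_all
  then show "c i = 0" using i z unfolding less6 by (elim disjE) simp_all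
qed

lemma g33_model:
  "contragredient_model scl cartan_g33 parity_g33 hh \<alpha> X.sca X.brW g33_h X.g33_e X.g33_f X.WP X.g33_component (X.grade_proj g33_weight)"
proof
  fix x y z :: "('h \<times> 'k \<times> 'k) \<times> (e6 \<Rightarrow> 'k)" and a a' :: 'h and c :: 'k and i j :: nat and p p' r :: bit and q q' :: "nat \<Rightarrow>\<^sub>0 int"
  have g33_h: "g33_h a = X.Hh (a, 0, 0)" for a by (simp add: g33_h_def X.Hh_def)
  show "g33_h (a + a') = g33_h a + g33_h a'" "g33_h (scl c a) = X.sca c (g33_h a)" by (simp_all add: g33_h_def X.sca_def sclW_def fun_eq_iff)
  show "g33_h a = 0 \<Longrightarrow> a = 0" by (simp add: g33_h_def prod_eq_iff)
  show "X.V.subspace (X.WP p)" by (rule X.WP_sub)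
  show "x \<in> X.WP p \<Longrightarrow> y \<in> X.WP p' \<Longrightarrow> X.brW x y \<in> X.WP (p + p')" by (rule X.brW_WP)
  have wt0: "X.wtE sA (a, 0, 0) = 0" "X.wtE sB (a, 0, 0) = 0" for a
    using X.wtE_simple_root[of 0] X.wtE_simple_root[of 1] by (simp_all add: \<alpha>W_def sr01)
  show "g33_h a \<in> X.WP 0" using wt0 by (simp add: g33_h_def X.WP_def)
  show "i < dim_row cartan_g33 \<Longrightarrow> X.g33_e i \<in> X.WP (parity_g33 i)" "i < dim_row cartan_g33 \<Longrightarrow> X.g33_f i \<in> X.WP (parity_g33 i)"
  proof -
    assume "i < dim_row cartan_g33"
    then have i: "i < 4" by (simp add: dim_g33)
    have E: "X.Ee u \<in> X.WP p" if "u \<in> (if p = 0 then X.S0 else X.S1)" for u p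
      using that by (auto simp: X.WP_def X.Ee_def split: if_splits)
    have "g33_root i \<in> (if parity_g33 i = 0 then X.S0 else X.S1)" "g33_neg_root i \<in> (if parity_g33 i = 0 then X.S0 else X.S1)"
      using i X.g33_root_g33_neg_root_type(1-4)[OF i] unfolding less4
      by (elim disjE; simp add: parity_g33_def X.g33_root_simps X.S_type E.ip_lin)+
    then show "X.g33_e i \<in> X.WP (parity_g33 i)" "X.g33_f i \<in> X.WP (parity_g33 i)"
      using E X.V.subspace_neg[OF X.WP_sub] by (auto simp: X.g33_e_def X.g33_f_def)
  qed
  show "x \<in> X.WP p \<Longrightarrow> y \<in> X.WP p' \<Longrightarrow> X.brW x y + X.sca (koszul_sign p p') (X.brW y x) = 0" by (rule X.brW_antisym)
  show "x \<in> X.WP p \<Longrightarrow> y \<in> X.WP p' \<Longrightarrow> z \<in> X.WP r \<Longrightarrow>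
     X.brW x (X.brW y z) - X.brW (X.brW x y) z - X.sca (koszul_sign p p') (X.brW y (X.brW x z)) = 0" by (rule X.brW_jacobi)
  show "x \<in> X.WP 1 \<Longrightarrow> X.brW x (X.brW x x) = 0" by (rule X.brW_cube)
  { assume ij: "i < dim_row cartan_g33" "j < dim_row cartan_g33"
    then have "i < 4" "j < 4" by (simp_all add: dim_g33)
    \<comment> \<open>As 2 = -1, the Cartan element of \<open>brW_EF_diag\<close> is
      \<open>hhW (i + 2) - hhW i\<close>, whose two additional coordinates cancel.\<close>
    moreover have "(if i < 2 then - (sclW 2 (hhW (i + 2)) + hhW i) else hhW (i + 2)) = (hh i, 0, 0)"
      using calculation(1) unfolding less4 by (auto simp: hhW_def sclW_def two_eq)
    ultimately show "X.brW (X.g33_e i) (X.g33_f j) = (if i = j then g33_h (hh i) else 0)"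
      using X.brW_EF_offdiag[of i j] X.brW_EF_diag[of i] by (cases "i = j") (simp_all add: g33_h) }
  { assume "j < dim_row cartan_g33"
    then have j: "j < 4" by (simp add: dim_g33)
    have 1: "X.wtE (g33_root j) (a, 0, 0) = \<alpha> j a" using j X.wtE_simple_root[of "j + 2"] by (simp add: g33_root_def \<alpha>W_def)
    have 2: "X.wtE (g33_neg_root j) (a, 0, 0) = - \<alpha> j a"
      using 1 wt0 by (simp add: g33_neg_root_def g33_root_def X.wt_diff)
    show "X.brW (g33_h a) (X.g33_e j) = X.sca (\<alpha> j a) (X.g33_e j)" "X.brW (g33_h a) (X.g33_f j) = - X.sca (\<alpha> j a) (X.g33_f j)"
      using X.brW_HE[of "g33_root j" "(a, 0, 0)"] X.brW_HE[of "g33_neg_root j" "(a, 0, 0)"] X.g33_root_g33_neg_root_type[OF j] 1 2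
      by (simp_all add: g33_h X.g33_e_def X.g33_f_def X.brW_minus) }
  show "X.brW (g33_h a) (g33_h a') = 0" by (simp add: g33_h X.brW_HH)
  show "X.V.subspace (X.g33_component q)" unfolding X.g33_component_def by (intro X.V.subspace_inter X.supp01_sub X.graded_sub)
  show "x \<in> X.g33_component q \<Longrightarrow> y \<in> X.g33_component q' \<Longrightarrow> X.brW x y \<in> X.g33_component (q + q')"
    unfolding X.g33_component_def using X.graded_brW[OF g33_weight_add g33_weight_sr01] by simp
  show "g33_h a \<in> X.g33_component 0" unfolding g33_h by (simp add: X.g33_component_def X.graded_H)
  { assume "i < dim_row cartan_g33"
    then have i: "i < 4" by (simp add: dim_g33)
    note t = X.g33_root_g33_neg_root_type[OF i]
    show "X.g33_e i \<in> X.g33_component (Poly_Mapping.single i 1)"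
      using X.graded_E[of "g33_root i" g33_weight] X.supp01_E[OF t(1)] g33_weight_g33_root[OF i] by (simp add: X.g33_component_def X.g33_e_def)
    have "X.Ee (g33_neg_root i) \<in> X.g33_component (- Poly_Mapping.single i 1)"
      using X.graded_E[of "g33_neg_root i" g33_weight] X.supp01_E[OF t(2)] g33_weight_g33_neg_root[OF i] by (simp add: X.g33_component_def)
    moreover have "X.V.subspace (X.g33_component q)" for q unfolding X.g33_component_def by (intro X.V.subspace_inter X.supp01_sub X.graded_sub)
    ultimately show "X.g33_f i \<in> X.g33_component (- Poly_Mapping.single i 1)" unfolding X.g33_f_def by (metis X.V.subspace_neg) }
  show "X.grade_proj g33_weight q (x + y) = X.grade_proj g33_weight q x + X.grade_proj g33_weight q y" by (rule X.grade_proj_add)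
  show "x \<in> X.g33_component q \<Longrightarrow> X.grade_proj g33_weight q' x = (if q = q' then x else 0)" unfolding X.g33_component_def by (simp add: X.grade_proj_graded)
  show "q \<noteq> 0 \<Longrightarrow> x \<in> X.g33_component q \<Longrightarrow> x \<noteq> 0 \<Longrightarrow> \<exists>m. letters m \<subseteq> gens (dim_row cartan_g33) \<and> magma_deg gen_weight m = - q \<and>
      X.brW (magma_eval X.brW (generator_image g33_h X.g33_e X.g33_f) m) x \<noteq> 0"
    unfolding dim_g33 using X.g33_component_nondegenerate[of q x g33_h] hhW_indep by blast
qed (simp_all add: X.brW_add X.brW_scale)

end

section \<open>Derived algebras modulo their centers, computed in a model\<close>

context presentation begin

text \<open>A map on representatives with kernel \<open>N\<close> descends to the record of cosets.
  The chosen representative is immaterial on the carrier.\<close>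

lemma model_map:
  fixes \<Psi> :: "'f \<Rightarrow> 'd::ab_group_add"
  assumes diff: "\<And>x y. \<Psi> (x - y) = \<Psi> x - \<Psi> y" and ker: "\<And>x. x \<in> S \<Longrightarrow> \<Psi> x = 0 \<longleftrightarrow> x \<in> N"
  obtains \<psi> where "\<And>x. x \<in> S \<Longrightarrow> \<psi> (\<pi> x) = \<Psi> x" "bij_betw \<psi> (carrier L) (\<Psi> ` S)"
proof -
  define \<psi> where "\<psi> v = \<Psi> (SOME x. x \<in> S \<and> \<pi> x = v)" for v
  have eq: "\<Psi> x = \<Psi> y \<longleftrightarrow> \<pi> x = \<pi> y" if "x \<in> S" "y \<in> S" for x y
    using ker[of "x - y"] \<pi>_eq[OF that] that by (simp add: diff)
  have 1: "\<psi> (\<pi> x) = \<Psi> x" if x: "x \<in> S" for x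
  proof -
    have "(SOME y. y \<in> S \<and> \<pi> y = \<pi> x) \<in> S \<and> \<pi> (SOME y. y \<in> S \<and> \<pi> y = \<pi> x) = \<pi> x"
      by (rule someI[of "\<lambda>y. y \<in> S \<and> \<pi> y = \<pi> x" x]) (simp add: x)
    then show ?thesis unfolding \<psi>_def using eq x by blast
  qed
  moreover have "bij_betw \<psi> (carrier L) (\<Psi> ` S)"
    unfolding bij_betw_def inj_on_def carrier using 1 eq by (auto simp: image_iff)
  ultimately show thesis using that by blast
qed

end

context contragredient_model begin

lemma lift_hom: "Modules.module_hom free_scale sc lift"
  by (intro module_hom.intro free.module_axioms module_axioms module_hom_axioms.intro) (simp_all add: lift_simps)

definition derived_image :: "'c set" where "derived_image = span {br a b | a b. a \<in> lift ` Car \<and> b \<in> lift ` Car}"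

lemma lift_image_sub: "subspace (lift ` Car)"
  using module_hom.subspace_image[OF lift_hom Car_sub] .

lemma lift_image_subset:
  assumes "subspace T" "\<And>p. Cp p \<subseteq> T"
  shows "lift ` Car \<subseteq> T"
proof -
  have "lift p \<in> T" if "p \<in> Car" for p
    unfolding lift_def by (rule lift_in_subspace[OF assms(1)]) (rule subsetD[OF assms(2) ev_Cp], use that in \<open>auto simp: Car_def\<close>)
  then show ?thesis by blast
qed

lemma ev_lift_image: "letters m \<subseteq> gens n \<Longrightarrow> ev m \<in> lift ` Car"
  using mono_Car[of m] lift_simps(3)[of m] by (metis imageI)

lemma derived_image_br: "a \<in> lift ` Car \<Longrightarrow> b \<in> lift ` Car \<Longrightarrow> br a b \<in> derived_image"
  unfolding derived_image_def by (rule span_base) blast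

lemma derived_image_subset: "derived_image \<subseteq> lift ` Car"
  unfolding derived_image_def
proof (rule span_minimal[OF _ lift_image_sub], safe)
  fix p q assume "p \<in> Car" "q \<in> Car"
  then show "br (lift p) (lift q) \<in> lift ` Car" using Car_mult[of p q] lift_simps(7)[of p q] by (metis imageI)
qed

lemma Hc_derived: "i < n \<Longrightarrow> Hc (hh i) \<in> derived_image"
  using derived_image_br[of "Ec i" "Fc i"] ev_lift_image[of "Letter (Egen i)"] ev_lift_image[of "Letter (Fgen i)"] rel_EF[of i i]
  by (simp add: gens_def)

text \<open>A product of monomials evaluates to a bracket. A letter \<open>e\<close> or
  \<open>f\<close> is recovered from its bracket with a Cartan element at which its root does not
  vanish.\<close>

lemma ev_derived:
  assumes \<alpha>: "\<And>j. j < n \<Longrightarrow> \<exists>a. \<alpha> j a \<noteq> 0" and m: "letters m \<subseteq> gens n" "\<And>a. m \<noteq> Letter (Hgen a)"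
  shows "ev m \<in> derived_image"
proof (cases m)
  case (MProd a b)
  then show ?thesis using derived_image_br[OF ev_lift_image ev_lift_image, of a b] m by simp
next
  case (Letter x)
  have H: "Hc a \<in> lift ` Car" for a using ev_lift_image[of "Letter (Hgen a)"] by (simp add: gens_def)
  have scl: "x \<in> derived_image" if "sc c x \<in> derived_image" "c \<noteq> 0" for c x
    using span_scale[of "sc c x" _ "inverse c"] that unfolding derived_image_def by simp
  obtain j where j: "j < n" "x = Egen j \<or> x = Fgen j" using m unfolding Letter by (auto simp: gens_def)
  obtain a where a: "\<alpha> j a \<noteq> 0" using \<alpha> j by blast
  have "ev m \<in> lift ` Car" by (rule ev_lift_image[OF m(1)])
  then have "br (Hc a) (ev m) \<in> derived_image" by (rule derived_image_br[OF H])
  moreover have "br (Hc a) (ev m) = sc (\<alpha> j a) (ev m) \<or> br (Hc a) (ev m) = sc (- \<alpha> j a) (ev m)"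
    using j rel_HE[OF j(1), of a] rel_HF[OF j(1), of a] unfolding Letter by auto
  ultimately have "sc (\<alpha> j a) (ev m) \<in> derived_image \<or> sc (- \<alpha> j a) (ev m) \<in> derived_image" by metis
  then show ?thesis using scl a by (metis neg_equal_0_iff_equal)
qed

lemma Fpart_decompose:
  assumes "p \<in> Car"
  obtains p0 p1 where "p0 \<in> Fpart 0" "p1 \<in> Fpart 1" "p = p0 + p1"
proof -
  have "p \<in> {x + y | x y. x \<in> Fpart 0 \<and> y \<in> Fpart 1}"
  proof (rule Car_induct[OF free.subspace_sums[OF Fpart_sub Fpart_sub] _ assms])
    fix m :: "'h generator magma" assume m: "letters m \<subseteq> gens n"
    note f = mon_Fpart[OF m] free.subspace_0[OF Fpart_sub]
    show "mon m \<in> {x + y | x y. x \<in> Fpart 0 \<and> y \<in> Fpart 1}"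
    proof (cases "magma_deg (gen_parity par) m")
      case zero
      then have "mon m \<in> Fpart 0" "mon m = mon m + 0" using f by simp_all
      then show ?thesis using f(2)[of 1] by blast
    next
      case one
      then have "mon m \<in> Fpart 1" "mon m = 0 + mon m" using f by simp_all
      then show ?thesis using f(2)[of 0] by blast
    qed
  qed
  then show thesis using that by blast
qed

abbreviation "derived_alg \<equiv> derived_algebra (contragredient A par scl hh \<alpha>)"
abbreviation "derived_quot \<equiv> sa_quotient derived_alg (sa_center derived_alg)"
definition derived_car :: "('k, 'h generator) free_alg set" where "derived_car = {x \<in> Car. lift x \<in> derived_image}"
definition derived_class :: "('k, 'h generator) free_alg \<Rightarrow> ('k, 'h generator) free_alg set set set"
  where "derived_class x = sa_center derived_alg +>\<^bsub>derived_alg\<^esub> cg x"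

lemma derived_presentation: "presentation free_scale derived_alg free_mult derived_car K (\<lambda>p. Fpart p \<inter> derived_car) cg"
proof -
  interpret C: presentation free_scale "contragredient A par scl hh \<alpha>" free_mult Car K Fpart cg
    by (rule contragredient_presentation)
  have "lift ` free.span {free_mult a b | a b. a \<in> Car \<and> b \<in> Car} = span (lift ` {free_mult a b | a b. a \<in> Car \<and> b \<in> Car})"
    by (rule module_hom.span_image[OF lift_hom, symmetric])
  also have "lift ` {free_mult a b | a b. a \<in> Car \<and> b \<in> Car} = {br a b | a b. a \<in> lift ` Car \<and> b \<in> lift ` Car}"
  proof (intro equalityI subsetI)
    fix z assume "z \<in> {br a b | a b. a \<in> lift ` Car \<and> b \<in> lift ` Car}"
    then obtain p q where pq: "p \<in> Car" "q \<in> Car" "z = br (lift p) (lift q)" by blast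
    then have "free_mult p q \<in> {free_mult a b | a b. a \<in> Car \<and> b \<in> Car}" "z = lift (free_mult p q)"
      by (auto simp: lift_simps)
    then show "z \<in> lift ` {free_mult a b | a b. a \<in> Car \<and> b \<in> Car}" by blast
  next
    fix z assume "z \<in> lift ` {free_mult a b | a b. a \<in> Car \<and> b \<in> Car}"
    then obtain p q where pq: "p \<in> Car" "q \<in> Car" "z = lift (free_mult p q)" by blast
    then have "z = br (lift p) (lift q)" by (simp add: lift_simps)
    then show "z \<in> {br a b | a b. a \<in> lift ` Car \<and> b \<in> lift ` Car}" using pq by blast
  qed
  finally have sp: "lift ` free.span {free_mult a b | a b. a \<in> Car \<and> b \<in> Car} = derived_image"
    unfolding derived_image_def .
  have "C.derived_preimage = derived_car"
    unfolding C.derived_preimage_def derived_car_def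
  proof (rule Collect_cong, rule conj_cong[OF refl])
    fix x assume x: "x \<in> Car"
    have "x - y \<in> K \<longleftrightarrow> lift x = lift y" if "y \<in> free.span {free_mult a b | a b. a \<in> Car \<and> b \<in> Car}" for y
      using x that C.derived_span_subset free.subspace_diff[OF Car_sub x, of y] by (auto simp: K_def lift_simps)
    then show "(\<exists>y\<in>free.span {free_mult a b | a b. a \<in> Car \<and> b \<in> Car}. x - y \<in> K) \<longleftrightarrow> lift x \<in> derived_image"
      unfolding sp[symmetric] image_iff by (rule bex_cong[OF refl])
  qed
  then show ?thesis using C.derived by simp
qed

lemma lift_derived_car: "lift ` derived_car = derived_image"
  using derived_image_subset by (auto simp: derived_car_def)

text \<open>\<open>\<kappa>\<close> stands for the passage to the adjoint representation. Its kernel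
  on the derived algebra is the center, so the quotient by the center is presented by the kernel of
  \<open>\<kappa>\<close> after \<open>lift\<close>. Compatibility of \<open>\<kappa>\<close> with
  products supplies the left stability required by \<open>center_quotient\<close>.\<close>

lemma derived_quotient:
  fixes \<kappa> :: "'c \<Rightarrow> 'd::ab_group_add"
  assumes diff: "\<And>x y. \<kappa> (x - y) = \<kappa> x - \<kappa> y"
    and center: "\<And>x. x \<in> derived_image \<Longrightarrow> \<kappa> x = 0 \<longleftrightarrow> (\<forall>y\<in>derived_image. br x y = 0)"
    and mult: "\<And>x y. \<kappa> (br x y) = br' (\<kappa> x) (\<kappa> y)" and zero: "\<And>x. br' x 0 = 0"
  shows "presentation free_scale derived_quot free_mult derived_car {x \<in> derived_car. \<kappa> (lift x) = 0} (\<lambda>p. Fpart p \<inter> derived_car) derived_class"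
proof -
  interpret D: presentation free_scale derived_alg free_mult derived_car K "\<lambda>p. Fpart p \<inter> derived_car" cg
    by (rule derived_presentation)
  have m: "x \<in> derived_car \<Longrightarrow> y \<in> derived_car \<Longrightarrow> free_mult x y \<in> K \<longleftrightarrow> br (lift x) (lift y) = 0" for x y
    using D.mul_closed[of x y] by (auto simp: K_def derived_car_def lift_simps)
  have "presentation free_scale derived_quot free_mult derived_car {x \<in> derived_car. \<kappa> (lift x) = 0} (\<lambda>p. Fpart p \<inter> derived_car)
      (\<lambda>x. sa_center derived_alg +>\<^bsub>derived_alg\<^esub> cg x)"
  proof (rule D.center_quotient)
    show "{x \<in> derived_car. \<kappa> (lift x) = 0} = {x \<in> derived_car. \<forall>y\<in>derived_car. free_mult x y \<in> K}"
    proof (rule Collect_cong, rule conj_cong[OF refl])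
      fix x assume x: "x \<in> derived_car"
      then have "\<kappa> (lift x) = 0 \<longleftrightarrow> (\<forall>y\<in>lift ` derived_car. br (lift x) y = 0)"
        using center[of "lift x"] unfolding lift_derived_car by (simp add: derived_car_def)
      then show "\<kappa> (lift x) = 0 \<longleftrightarrow> (\<forall>y\<in>derived_car. free_mult x y \<in> K)" using m[OF x] by simp
    qed
    fix x y assume "x \<in> derived_car" "y \<in> {x \<in> derived_car. \<kappa> (lift x) = 0}"
    then show "free_mult x y \<in> {x \<in> derived_car. \<kappa> (lift x) = 0}" using D.mul_closed[of x y] by (simp add: lift_simps mult zero)
  qed
  then show ?thesis unfolding derived_class_def[abs_def] .
qed

lemma derived_quotient_model:
  fixes \<kappa> :: "'c \<Rightarrow> 'd::ab_group_add"
  assumes diff: "\<And>x y. \<kappa> (x - y) = \<kappa> x - \<kappa> y"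
    and center: "\<And>x. x \<in> derived_image \<Longrightarrow> \<kappa> x = 0 \<longleftrightarrow> (\<forall>y\<in>derived_image. br x y = 0)"
    and mult: "\<And>x y. \<kappa> (br x y) = br' (\<kappa> x) (\<kappa> y)" and zero: "\<And>x. br' x 0 = 0"
    and scale: "\<And>c x. \<kappa> (sc c x) = sc' c (\<kappa> x)"
    and indep: "\<And>x. x \<in> Cp 0 \<Longrightarrow> x \<in> Cp 1 \<Longrightarrow> x = 0"
  obtains \<psi> where "vectorspace class_ring derived_quot" "bij_betw \<psi> (carrier derived_quot) (\<kappa> ` derived_image)"
    "\<And>x. x \<in> derived_car \<Longrightarrow> derived_class x \<in> carrier derived_quot \<and> \<psi> (derived_class x) = \<kappa> (lift x)"
    "\<And>v w. v \<in> carrier derived_quot \<Longrightarrow> w \<in> carrier derived_quot \<Longrightarrow> v \<oplus>\<^bsub>derived_quot\<^esub> w \<in> carrier derived_quot \<and> \<psi> (v \<oplus>\<^bsub>derived_quot\<^esub> w) = \<psi> v + \<psi> w"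
    "\<And>v w. v \<in> carrier derived_quot \<Longrightarrow> w \<in> carrier derived_quot \<Longrightarrow> v \<otimes>\<^bsub>derived_quot\<^esub> w \<in> carrier derived_quot \<and> \<psi> (v \<otimes>\<^bsub>derived_quot\<^esub> w) = br' (\<psi> v) (\<psi> w)"
    "\<And>c v. v \<in> carrier derived_quot \<Longrightarrow> c \<odot>\<^bsub>derived_quot\<^esub> v \<in> carrier derived_quot \<and> \<psi> (c \<odot>\<^bsub>derived_quot\<^esub> v) = sc' c (\<psi> v)"
    "\<And>p. part derived_quot p \<subseteq> carrier derived_quot \<and> \<psi> ` part derived_quot p = \<kappa> ` (derived_image \<inter> Cp p)"
proof -
  interpret Q: presentation free_scale derived_quot free_mult derived_car "{x \<in> derived_car. \<kappa> (lift x) = 0}" "\<lambda>p. Fpart p \<inter> derived_car" derived_class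
    by (rule derived_quotient[OF diff center mult zero])
  obtain \<psi> where \<psi>: "\<And>x. x \<in> derived_car \<Longrightarrow> \<psi> (derived_class x) = \<kappa> (lift x)" "bij_betw \<psi> (carrier derived_quot) ((\<lambda>x. \<kappa> (lift x)) ` derived_car)"
    by (rule Q.model_map[of "\<lambda>x. \<kappa> (lift x)"]) (auto simp: lift_simps diff)
  have add: "\<kappa> (x + y) = \<kappa> x + \<kappa> y" for x y using diff[of "x + y" y] by simp
  have C: "v \<in> carrier derived_quot \<longleftrightarrow> (\<exists>x\<in>derived_car. v = derived_class x)" for v by (auto simp: Q.carrier)
  \<comment> \<open>A preimage of \<open>y\<close> in the free algebra need not be homogeneous, but
    its component of the wrong parity is mapped into both \<open>Cp 0\<close> and
    \<open>Cp 1\<close>, hence to zero.\<close>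
  have LF: "lift ` (Fpart p \<inter> derived_car) = derived_image \<inter> Cp p" for p
  proof
    show "lift ` (Fpart p \<inter> derived_car) \<subseteq> derived_image \<inter> Cp p" using lift_Fpart by (auto simp: derived_car_def)
    show "derived_image \<inter> Cp p \<subseteq> lift ` (Fpart p \<inter> derived_car)"
    proof
      fix y assume y: "y \<in> derived_image \<inter> Cp p"
      then obtain x where x: "x \<in> Car" "lift x = y" using derived_image_subset by blast
      obtain x0 x1 where x01: "x0 \<in> Fpart 0" "x1 \<in> Fpart 1" "x = x0 + x1" using Fpart_decompose[OF x(1)] by blast
      have l: "lift x0 \<in> Cp 0" "lift x1 \<in> Cp 1" "y = lift x0 + lift x1"
        using lift_Fpart x01 x(2) by (simp_all add: lift_simps)
      have "\<exists>z\<in>Fpart p. lift z = y"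
      proof (cases p)
        case zero
        have "lift x1 = y - lift x0" using l by simp
        moreover have "y - lift x0 \<in> Cp 0" using subspace_diff[OF Cp_sub, of y 0 "lift x0"] y l zero by blast
        ultimately have "lift x1 = 0" using indep l by metis
        then show ?thesis using x01 l zero by (intro bexI[of _ x0]) auto
      next
        case one
        have "lift x0 = y - lift x1" using l by simp
        moreover have "y - lift x1 \<in> Cp 1" using subspace_diff[OF Cp_sub, of y 1 "lift x1"] y l one by blast
        ultimately have "lift x0 = 0" using indep l by metis
        then show ?thesis using x01 l one by (intro bexI[of _ x1]) auto
      qed
      then show "y \<in> lift ` (Fpart p \<inter> derived_car)" using y Fpart_Car by (fastforce simp: derived_car_def)
    qed
  qed
  show thesis
  proof (rule that)
    show "vectorspace class_ring derived_quot" by (rule Q.vs)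
    show "bij_betw \<psi> (carrier derived_quot) (\<kappa> ` derived_image)" using \<psi>(2) unfolding lift_derived_car[symmetric] image_image .
    show "derived_class x \<in> carrier derived_quot \<and> \<psi> (derived_class x) = \<kappa> (lift x)" if "x \<in> derived_car" for x using that \<psi>(1) C by blast
    fix v assume "v \<in> carrier derived_quot"
    then obtain x where x: "x \<in> derived_car" "v = derived_class x" using C by blast
    show "c \<odot>\<^bsub>derived_quot\<^esub> v \<in> carrier derived_quot \<and> \<psi> (c \<odot>\<^bsub>derived_quot\<^esub> v) = sc' c (\<psi> v)" for c
      using x C by (auto simp: Q.\<pi>_smult \<psi> lift_simps scale)
    fix w assume "w \<in> carrier derived_quot"
    then obtain y where y: "y \<in> derived_car" "w = derived_class y" using C by blast
    show "v \<oplus>\<^bsub>derived_quot\<^esub> w \<in> carrier derived_quot \<and> \<psi> (v \<oplus>\<^bsub>derived_quot\<^esub> w) = \<psi> v + \<psi> w"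
      using x y C by (auto simp: Q.\<pi>_add \<psi> lift_simps add)
    show "v \<otimes>\<^bsub>derived_quot\<^esub> w \<in> carrier derived_quot \<and> \<psi> (v \<otimes>\<^bsub>derived_quot\<^esub> w) = br' (\<psi> v) (\<psi> w)"
      using x y C Q.mul_closed[of x y] by (auto simp: Q.\<pi>_mult \<psi> lift_simps mult)
  next
    fix p
    have "\<psi> ` part derived_quot p = (\<lambda>x. \<kappa> (lift x)) ` (Fpart p \<inter> derived_car)"
      unfolding Q.part image_image by (rule image_cong) (auto simp: \<psi>)
    also have "\<dots> = \<kappa> ` (derived_image \<inter> Cp p)" unfolding LF[symmetric] image_image ..
    finally show "part derived_quot p \<subseteq> carrier derived_quot \<and> \<psi> ` part derived_quot p = \<kappa> ` (derived_image \<inter> Cp p)"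
      using Q.part C by auto
  qed
qed

end

section \<open>The derived algebra of E6 type and its subquotient\<close>

context e6_realization begin

definition coroot_span :: "'h set" where "coroot_span = span (hh ` {..<6})"
text \<open>Over a Cartan space with independent coroots this turns out to be the derived algebra;
  over the adjoint Cartan space it is the derived algebra modulo its center.\<close>

definition adjoint_e6 :: "('h \<times> (e6 \<Rightarrow> 'k)) set" where "adjoint_e6 = {x. fst x \<in> coroot_span \<and> supported x}"
definition adjoint_g33 :: "('h \<times> (e6 \<Rightarrow> 'k)) set"
  where "adjoint_g33 = {x. fst x \<in> coroot_span \<and> wtE sA (fst x) = 0 \<and> wtE sB (fst x) = 0 \<and> supp01 x}"

lemma coroot_span_sub: "subspace coroot_span"
  by (simp add: coroot_span_def)

lemma coroot_span_expand:
  assumes "h \<in> coroot_span"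
  obtains c where "h = (\<Sum>i<6. scl (c i) (hh i))"
proof -
  interpret vf: vector_families scl by unfold_locales
  show thesis using vf.family_span[of "{..<6}" h hh] assms that by (auto simp: coroot_span_def)
qed

lemma coroot_span_comb: "(\<Sum>i<6. scl (c i) (hh i)) \<in> coroot_span"
  unfolding coroot_span_def by (intro span_sum span_scale span_base) auto

lemma hm_coroot_span: "hmE r \<in> coroot_span"
  unfolding hmE_def by (rule coroot_span_comb)

lemma fst_br_coroot_span: "fst (br x y) \<in> coroot_span"
  unfolding br_def fst_conv by (intro subspace_sum[OF coroot_span_sub] subspace_scale[OF coroot_span_sub] hm_coroot_span)

lemma br_adjoint_e6 [simp]: "br x y \<in> adjoint_e6"
  by (simp add: adjoint_e6_def fst_br_coroot_span)

lemma dd_adjoint_e6 [simp]: "dd x \<in> adjoint_e6"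
  by (simp add: dd_def)

lemma adjoint_e6_sub: "V.subspace adjoint_e6"
  by (rule V.subspaceI)
    (auto simp: adjoint_e6_def supported_lin fst_sca subspace_0[OF coroot_span_sub] subspace_add[OF coroot_span_sub] subspace_scale[OF coroot_span_sub])

lemma supp01_supported: "supp01 x \<Longrightarrow> supported x"
  by (auto simp: supp01_def supported_def S_type)

lemma adjoint_g33_even: "adjoint_g33 \<inter> WP 0 = pr0 ` {u \<in> adjoint_e6. dd u = 0}"
proof (intro equalityI subsetI)
  fix x assume x: "x \<in> adjoint_g33 \<inter> WP 0"
  then have "dd (l0 x) = 0" by (intro dd_l0) (simp_all add: WP_0)
  moreover have "supported (l0 x)" by (auto simp: supported_def l0_def S0_def)
  then have "l0 x \<in> adjoint_e6" using x by (simp add: adjoint_e6_def adjoint_g33_def)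
  moreover have "pr0 (l0 x) = x" using x by (simp add: WP_0)
  ultimately have "l0 x \<in> {u \<in> adjoint_e6. dd u = 0}" "x = pr0 (l0 x)" by simp_all
  then show "x \<in> pr0 ` {u \<in> adjoint_e6. dd u = 0}" by (rule rev_image_eqI)
next
  fix x assume "x \<in> pr0 ` {u \<in> adjoint_e6. dd u = 0}"
  then obtain u where u: "u \<in> adjoint_e6" "dd u = 0" "x = pr0 u" by blast
  have "x \<in> WP 0" unfolding u(3) by (rule pr0_WP[OF u(2)])
  then show "x \<in> adjoint_g33 \<inter> WP 0" using u WP_supp01[of x 0] by (simp add: adjoint_g33_def adjoint_e6_def WP_0)
qed

lemma adjoint_g33_odd: "adjoint_g33 \<inter> WP 1 = pr1 ` {u \<in> adjoint_e6. dd (dd u) = 0}"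
proof (intro equalityI subsetI)
  fix x assume x: "x \<in> adjoint_g33 \<inter> WP 1"
  then have p: "x = pr1 x" by (simp add: WP_1)
  have "dd (dd x) = 0" using dd_pr1[of x] p by simp
  moreover have "x \<in> adjoint_e6" using x supp01_supported by (simp add: adjoint_e6_def adjoint_g33_def)
  ultimately have "x \<in> {u \<in> adjoint_e6. dd (dd u) = 0}" by simp
  then show "x \<in> pr1 ` {u \<in> adjoint_e6. dd (dd u) = 0}" using p by (rule rev_image_eqI)
next
  fix x assume "x \<in> pr1 ` {u \<in> adjoint_e6. dd (dd u) = 0}"
  then obtain u where u: "x = pr1 u" by blast
  then show "x \<in> adjoint_g33 \<inter> WP 1"
    using pr1_WP[of u] WP_supp01[OF pr1_WP] subspace_0[OF coroot_span_sub] by (simp add: adjoint_g33_def)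
qed

lemma adjoint_g33_sum: "{a + b | a b. a \<in> adjoint_g33 \<inter> WP 0 \<and> b \<in> adjoint_g33 \<inter> WP 1} = adjoint_g33"
proof (intro equalityI subsetI)
  fix x assume "x \<in> {a + b | a b. a \<in> adjoint_g33 \<inter> WP 0 \<and> b \<in> adjoint_g33 \<inter> WP 1}"
  then obtain a b where "x = a + b" "a \<in> adjoint_g33" "b \<in> adjoint_g33" by blast
  then show "x \<in> adjoint_g33"
    using V.subspace_add[OF supp01_sub, of a b] by (simp add: adjoint_g33_def subspace_add[OF coroot_span_sub] wt_add2)
next
  fix x assume x: "x \<in> adjoint_g33"
  have "x = pr0 x + pr1 x" using x S01 by (auto simp: adjoint_g33_def supp01_def pr0_def pr1_def prod_eq_iff fun_eq_iff)
  moreover have "pr0 x \<in> adjoint_g33 \<inter> WP 0" using x by (simp add: adjoint_g33_def WP_0) (simp add: supp01_def pr0_def)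
  moreover have "pr1 x \<in> adjoint_g33 \<inter> WP 1"
    using pr1_WP[of x] WP_supp01[OF pr1_WP] subspace_0[OF coroot_span_sub] by (simp add: adjoint_g33_def)
  ultimately show "x \<in> {a + b | a b. a \<in> adjoint_g33 \<inter> WP 0 \<and> b \<in> adjoint_g33 \<inter> WP 1}" by blast
qed

lemma target: "semisimplification_target sca adjoint_e6 dd sca br pr0 pr1 brW (adjoint_g33 \<inter> WP 0) (adjoint_g33 \<inter> WP 1)"
proof unfold_locales
  fix x y u v u' k a b :: "'h \<times> (e6 \<Rightarrow> 'k)" and c
  show "V.subspace adjoint_e6" by (rule adjoint_e6_sub)
  show "dd x \<in> adjoint_e6" by simp
  show "adjoint_g33 \<inter> WP 0 = pr0 ` {u \<in> adjoint_e6. dd u = 0}" by (rule adjoint_g33_even)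
  show "adjoint_g33 \<inter> WP 1 = pr1 ` {u \<in> adjoint_e6. dd (dd u) = 0}" by (rule adjoint_g33_odd)
  have "0 \<in> adjoint_g33" by (simp add: adjoint_g33_def subspace_0[OF coroot_span_sub] V.subspace_0[OF supp01_sub, simplified])
  then show "adjoint_g33 \<inter> WP 0 \<inter> (adjoint_g33 \<inter> WP 1) = {0}" using WP_Int V.subspace_0[OF WP_sub] by blast
  show "\<exists>v\<in>adjoint_e6. u = dd v" if u: "u \<in> adjoint_e6" "dd u = 0" "pr0 u = 0"
  proof -
    obtain g where g: "rs u = dd (scl (snd u sA) (hmE sA) + scl (snd u sB) (hmE sB), g)" "\<And>q. q \<notin> E.roots \<Longrightarrow> g q = 0"
      using K1_pr0_zero[OF u(2,3)] by blast
    have "rs u = u" using u(1) by (auto simp: adjoint_e6_def supported_def rs_def prod_eq_iff fun_eq_iff)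
    moreover have "(scl (snd u sA) (hmE sA) + scl (snd u sB) (hmE sB), g) \<in> adjoint_e6"
      using g(2) by (simp add: adjoint_e6_def supported_def subspace_add[OF coroot_span_sub] subspace_scale[OF coroot_span_sub] hm_coroot_span)
    ultimately show ?thesis using g(1) by metis
  qed
  show "\<exists>k\<in>adjoint_e6. \<exists>v\<in>adjoint_e6. dd k = 0 \<and> u = k + dd v" if u: "u \<in> adjoint_e6" "dd (dd u) = 0" "pr1 u = 0"
  proof -
    obtain v where v: "dd (dd v) = dd u" using K2_pr1_zero[OF u(2,3)] by blast
    \<comment> \<open>The square of \<open>dd\<close> kills Cartan elements, so removing the Cartan
      part of \<open>v\<close> keeps the equation and brings the element into
      \<open>adjoint_e6\<close>.\<close>
    define v' where "v' = rs v - Hh (fst v)"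
    have "fst v' = 0" "supported v'" by (auto simp: v'_def rs_def Hh_def supported_def)
    then have v'L: "v' \<in> adjoint_e6" by (simp add: adjoint_e6_def subspace_0[OF coroot_span_sub])
    have "dd (dd (Hh h)) = 0" for h
      by (simp add: dd_dd_eq_0_iff) (simp add: Hh_def)
    then have "dd (dd v') = dd u" using v by (simp add: v'_def dd_lin) (simp add: dd_def br_rs)
    then have "dd (u - dd v') = 0" "u = (u - dd v') + dd v'" by (simp_all add: dd_lin)
    moreover have "u - dd v' \<in> adjoint_e6" using V.subspace_diff[OF adjoint_e6_sub u(1)] by simp
    ultimately show ?thesis using v'L by blast
  qed
  show "dd (dd v) = 0 \<Longrightarrow> pr0 (dd v) = 0" by (rule pr0_dd)
  show "pr1 (dd v) = 0" by (rule pr1_dd)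
  show "dd k = 0 \<Longrightarrow> pr1 k = 0" by (rule pr1_K1)
  show "br u u' \<in> adjoint_e6 \<and> dd (br u u') = 0 \<and> pr0 (br u u') = brW (pr0 u) (pr0 u')" if "dd u = 0" "dd u' = 0"
    using that by (simp add: compat Kclosed)
  show "br u x \<in> adjoint_e6 \<and> dd (dd (br u x)) = 0 \<and> pr1 (br u x) = brW (pr0 u) (pr1 x)" if "dd u = 0" "dd (dd x) = 0"
    using that by (simp add: compat Kclosed)
  show "br x u \<in> adjoint_e6 \<and> dd (dd (br x u)) = 0 \<and> pr1 (br x u) = brW (pr1 x) (pr0 u)" if "dd u = 0" "dd (dd x) = 0"
    using that by (simp add: compat Kclosed)
  show "- br x (dd y) + br (dd x) y \<in> adjoint_e6 \<and> dd (- br x (dd y) + br (dd x) y) = 0 \<and>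
      pr0 (- br x (dd y) + br (dd x) y) = brW (pr1 x) (pr1 y)" if xy: "dd (dd x) = 0" "dd (dd y) = 0"
  proof -
    have "- br x (dd y) + br (dd x) y = odd_br x y" by (simp add: odd_br_def)
    moreover have "odd_br x y \<in> adjoint_e6" unfolding odd_br_def by (rule V.subspace_diff[OF adjoint_e6_sub]) simp_all
    ultimately show ?thesis using xy by (simp add: compat Kclosed)
  qed
qed (simp_all add: dd_lin pr_lin brW_add brW_scale)

lemma adjoint_e6_finite_span: "\<exists>F. finite F \<and> adjoint_e6 \<subseteq> V.span F"
proof (intro exI conjI subsetI)
  let ?F = "Hh ` hh ` {..<6} \<union> Ee ` E.roots"
  show "finite ?F" by simp
  fix x assume x: "x \<in> adjoint_e6"
  obtain c where c: "fst x = (\<Sum>i<6. scl (c i) (hh i))" using coroot_span_expand[of "fst x"] x by (auto simp: adjoint_e6_def)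
  have "Hh (\<Sum>i\<in>I. scl (c i) (hh i)) = (\<Sum>i\<in>I. sca (c i) (Hh (hh i)))" if "finite I" for I
  proof -
    have "Hh 0 = 0" "Hh (a + b) = Hh a + Hh b" "Hh (scl k a) = sca k (Hh a)" for a b k
      by (simp_all add: Hh_def sca_def prod_eq_iff fun_eq_iff)
    note H = this
    show ?thesis using that by (induction I rule: finite_induct) (simp_all add: H)
  qed
  then have h: "Hh (fst x) = (\<Sum>i<6. sca (c i) (Hh (hh i)))" unfolding c by simp
  have "x = Hh (fst x) + (\<Sum>r\<in>E.roots. sca (snd x r) (Ee r))" using x by (intro supported_expand) (simp add: adjoint_e6_def)
  also have "\<dots> \<in> V.span ?F" unfolding h
    by (intro V.span_add V.span_sum V.span_scale V.span_base) auto
  finally show "x \<in> V.span ?F" .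
qed

end

section \<open>Change of the Cartan space, and the adjoint Cartan space\<close>

locale e6_morphism = X: e6_realization scl hh \<alpha> + Y: e6_realization scl' hh' \<alpha>'
  for scl :: "'k::field \<Rightarrow> 'h::ab_group_add \<Rightarrow> 'h" and hh \<alpha>
    and scl' :: "'k \<Rightarrow> 'i::ab_group_add \<Rightarrow> 'i" and hh' \<alpha>' +
  fixes f :: "'h \<Rightarrow> 'i"
  assumes f_add: "f (x + y) = f x + f y" and f_scale: "f (scl c x) = scl' c (f x)"
    and f_hh: "i < 6 \<Longrightarrow> f (hh i) = hh' i" and f_\<alpha>: "j < 6 \<Longrightarrow> \<alpha>' j (f x) = \<alpha> j x"
begin

definition morph :: "'h \<times> (e6 \<Rightarrow> 'k) \<Rightarrow> 'i \<times> (e6 \<Rightarrow> 'k)" where "morph x = (f (fst x), snd x)"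

lemma f_zero [simp]: "f 0 = 0" using f_add[of 0 0] by simp
lemma f_minus: "f (- x) = - f x" using f_add[of x "- x"] by (simp add: eq_neg_iff_add_eq_0 add.commute)
lemma f_diff: "f (x - y) = f x - f y" using f_add[of x "- y"] by (simp add: f_minus)
lemma f_sum: "f (\<Sum>i\<in>I. g i) = (\<Sum>i\<in>I. f (g i))"
  by (induction I rule: infinite_finite_induct) (auto simp: f_add)

lemma f_hm: "f (X.hmE r) = Y.hmE r"
  by (simp add: X.hmE_def Y.hmE_def f_sum f_scale f_hh)
lemma f_wt: "Y.wtE r (f x) = X.wtE r x"
  by (simp add: X.wtE_def Y.wtE_def f_\<alpha>)

lemma morph_lin: "morph (x + y) = morph x + morph y" "morph (x - y) = morph x - morph y" "morph (- x) = - morph x"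
  "morph (X.sca c x) = Y.sca c (morph x)" "morph 0 = 0"
  by (simp_all add: morph_def f_add f_diff f_minus f_scale X.sca_def Y.sca_def prod_eq_iff)

lemma morph_fst_snd [simp]: "fst (morph x) = f (fst x)" "snd (morph x) = snd x"
  by (simp_all add: morph_def)

lemma morph_E: "morph (X.Ee r) = Y.Ee r" and morph_H: "morph (X.Hh h) = Y.Hh (f h)"
  by (simp_all add: morph_def X.Ee_def Y.Ee_def X.Hh_def Y.Hh_def)

lemma morph_br: "morph (X.br x y) = Y.br (morph x) (morph y)"
  by (simp add: prod_eq_iff X.br_def Y.br_def f_sum f_scale f_hm f_wt f_minus cong: if_cong)

lemma morph_dd: "morph (X.dd x) = Y.dd (morph x)"
  by (simp add: X.dd_def Y.dd_def morph_br morph_lin morph_E)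

lemma morph_pr: "morph (X.pr0 x) = Y.pr0 (morph x)" "morph (X.pr1 x) = Y.pr1 (morph x)" "morph (X.l0 x) = Y.l0 (morph x)"
  by (simp_all add: prod_eq_iff X.pr0_def Y.pr0_def X.pr1_def Y.pr1_def X.l0_def Y.l0_def cong: if_cong)

lemma morph_brW: "morph (X.brW x y) = Y.brW (morph x) (morph y)"
  by (simp add: X.brW_def Y.brW_def morph_lin morph_pr morph_br morph_dd)

end

text \<open>In the adjoint representation a Cartan element is known by its eigenvalues on the simple
  root vectors, so it is represented by the tuple of its values under the simple roots. The Cartan
  space of \<open>e6\<close> and the enlarged one for \<open>g(3,3)\<close> are both mapped to this
  space.\<close>

definition ad_scl :: "'k::field \<Rightarrow> (nat \<Rightarrow> 'k) \<Rightarrow> nat \<Rightarrow> 'k" where "ad_scl c f = (\<lambda>j. c * f j)"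
definition ad_hh :: "nat \<Rightarrow> nat \<Rightarrow> 'k::field" where "ad_hh i = (\<lambda>j. if j < 6 then of_int (cartan_e6 $$ (i, j)) else 0)"
definition ad_\<alpha> :: "nat \<Rightarrow> (nat \<Rightarrow> 'k) \<Rightarrow> 'k" where "ad_\<alpha> j f = f j"

lemma ad_realization: "(3::'k::field) = 0 \<Longrightarrow> e6_realization (ad_scl :: 'k \<Rightarrow> _) ad_hh ad_\<alpha>"
  by unfold_locales (simp_all add: ad_scl_def ad_hh_def ad_\<alpha>_def fun_eq_iff algebra_simps)

context e6_realization begin

definition ad_map :: "'h \<Rightarrow> nat \<Rightarrow> 'k" where "ad_map h = (\<lambda>j. if j < 6 then \<alpha> j h else 0)"

lemma ad_morphism: "e6_morphism scl hh \<alpha> ad_scl ad_hh ad_\<alpha> ad_map"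
proof -
  interpret R: e6_realization "ad_scl :: 'k \<Rightarrow> _" ad_hh ad_\<alpha> by (rule ad_realization[OF char3])
  show ?thesis
    by unfold_locales (simp_all add: ad_map_def ad_scl_def ad_hh_def ad_\<alpha>_def fun_eq_iff \<alpha>_add \<alpha>_scale \<alpha>_hh)
qed

end

section \<open>The derived algebra of \<open>e6\<close> modulo its center\<close>

locale independent_e6_realization = e6_realization +
  assumes hh_indep: "(\<Sum>i<6. scl (f i) (hh i)) = 0 \<Longrightarrow> i < 6 \<Longrightarrow> f i = 0"
begin

lemma root_hm_nonzero: "r \<in> E.roots \<Longrightarrow> hmE r \<noteq> 0"
  using root_hmE_nonzero[of r] hh_indep by (simp add: E.roots_def)

sublocale C: contragredient_model scl cartan_e6 parity_e6 hh \<alpha> sca br Hh e6_e e6_f e6_parity e6_component "grade_proj e6_weight"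
  by (rule e6_model) (rule root_hm_nonzero)

sublocale ad: e6_morphism scl hh \<alpha> ad_scl ad_hh ad_\<alpha> ad_map
  by (rule ad_morphism)

lemma C_derived_sub: "V.subspace C.derived_image"
  by (simp add: C.derived_image_def)

lemma derived_image_eq: "C.derived_image = adjoint_e6"
proof
  show "C.derived_image \<subseteq> adjoint_e6"
    unfolding C.derived_image_def by (rule V.span_minimal[OF _ adjoint_e6_sub]) auto
  show "adjoint_e6 \<subseteq> C.derived_image"
  proof
    fix x assume x: "x \<in> adjoint_e6"
    obtain c where c: "fst x = (\<Sum>i<6. scl (c i) (hh i))" using coroot_span_expand[of "fst x"] x by (auto simp: adjoint_e6_def)
    have Hl: "Hh 0 = 0" "Hh (a + b) = Hh a + Hh b" "Hh (scl k a) = sca k (Hh a)" for a b k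
      by (simp_all add: Hh_def sca_def prod_eq_iff fun_eq_iff)
    have "I \<subseteq> {..<6} \<Longrightarrow> Hh (\<Sum>i\<in>I. scl (c i) (hh i)) \<in> C.derived_image" if "finite I" for I
      using that
    proof (induction I rule: finite_induct)
      case (insert i I)
      then have "Hh (hh i) \<in> C.derived_image" by (intro C.Hc_derived) (simp add: dim_e6)
      then show ?case using insert by (simp add: Hl V.subspace_add[OF C_derived_sub] V.subspace_scale[OF C_derived_sub])
    qed (simp add: Hl V.subspace_0[OF C_derived_sub])
    then have H: "Hh (fst x) \<in> C.derived_image" unfolding c by simp
    have E: "Ee r \<in> C.derived_image" if r: "r \<in> E.roots" for r
    proof -
      obtain m k where m: "letters m \<subseteq> gens 6" "k \<noteq> 0"
        "magma_eval br (generator_image Hh e6_e e6_f) m = sca k (Ee r)"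
        using reach6_all[OF r] unfolding reach6_def by blast
      have nH: "m \<noteq> Letter (Hgen a)" for a
      proof
        assume "m = Letter (Hgen a)"
        then have "Hh a = sca k (Ee r)" using m(3) by simp
        then have "snd (Hh a) r = snd (sca k (Ee r)) r" by simp
        then show False using m(2) by (simp add: Hh_def sca_def Ee_def)
      qed
      have "\<exists>a. \<alpha> j a \<noteq> 0" if "j < dim_row cartan_e6" for j
      proof (rule exI[of _ "hh j"])
        have j: "j < 6" using that by (simp add: dim_e6)
        have "cartan_e6 $$ (j, j) = 2" using ip_simple_root[OF j j] E.ip_self[OF simple_root_root[OF j]] by simp
        then show "\<alpha> j (hh j) \<noteq> 0" using \<alpha>_hh[OF j j] by simp
      qed
      then have "sca k (Ee r) \<in> C.derived_image" using C.ev_derived[of m] nH m by (simp add: dim_e6)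
      then have "sca (inverse k) (sca k (Ee r)) \<in> C.derived_image" by (rule V.subspace_scale[OF C_derived_sub])
      then show ?thesis using m(2) by simp
    qed
    have "x = Hh (fst x) + (\<Sum>r\<in>E.roots. sca (snd x r) (Ee r))" using x by (intro supported_expand) (simp add: adjoint_e6_def)
    also have "\<dots> \<in> C.derived_image"
      using C_derived_sub H E by (intro V.subspace_add V.subspace_sum V.subspace_scale)
    finally show "x \<in> C.derived_image" .
  qed
qed

text \<open>The bracket with \<open>E (- r)\<close> has as Cartan part the coefficient at
  \<open>r\<close> times a nonzero coroot, so a central element is a Cartan element. The simple root
  vectors test it by the values of the simple roots, which is what \<open>ad_map\<close>
  records.\<close>

lemma center:
  assumes x: "x \<in> adjoint_e6"
  shows "ad.morph x = 0 \<longleftrightarrow> (\<forall>y\<in>adjoint_e6. br x y = 0)"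
proof
  assume "ad.morph x = 0"
  then have f: "ad_map (fst x) = 0" and s: "snd x = 0" by (simp_all add: ad.morph_def zero_prod_def)
  have "wtE q (fst x) = 0" for q using ad.f_wt[of q "fst x"] by (simp add: f)
  then have "br x y = 0" for y by (simp add: br_def s prod_eq_iff fun_eq_iff)
  then show "\<forall>y\<in>adjoint_e6. br x y = 0" by blast
next
  assume c: "\<forall>y\<in>adjoint_e6. br x y = 0"
  have EL: "Ee r \<in> adjoint_e6" if "r \<in> E.roots" for r
    using supported_E[OF that] subspace_0[OF coroot_span_sub] by (simp add: adjoint_e6_def) (simp add: Ee_def)
  have "snd x r = 0" for r
  proof (cases "r \<in> E.roots")
    case True
    then have m: "- r \<in> E.roots" by simp
    have "br (Ee (- r)) x = 0" using c EL[OF m] br_antisym[of "Ee (- r)" x] by simp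
    then have "scl (snd x r) (hmE (- r)) = 0" using fst_br_E[OF m, of x] by simp
    then show ?thesis using root_hm_nonzero[OF m] by (simp only: scale_eq_0_iff simp_thms)
  qed (use x in \<open>unfold adjoint_e6_def supported_def, blast\<close>)
  then have s: "snd x = 0" by (intro ext) simp
  then have xH: "x = Hh (fst x)" by (simp add: Hh_def prod_eq_iff)
  have "\<alpha> j (fst x) = 0" if j: "j < 6" for j
  proof -
    have "br (Hh (fst x)) (Ee (simple_root j)) = 0" using c EL[OF simple_root_root[OF j]] xH by metis
    then have "sca (\<alpha> j (fst x)) (Ee (simple_root j)) = 0" using br_HE[OF simple_root_root[OF j], of "fst x"] by (simp add: wtE_simple_root[OF j])
    from arg_cong[OF this, of "\<lambda>x. snd x (simple_root j)"] show ?thesis by (simp add: sca_def Ee_def)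
  qed
  then show "ad.morph x = 0" using s by (simp add: ad.morph_def zero_prod_def ad_map_def fun_eq_iff)
qed

lemma morph_image: "ad.morph ` adjoint_e6 = ad.Y.adjoint_e6"
proof (intro equalityI subsetI)
  fix y assume "y \<in> ad.morph ` adjoint_e6"
  then obtain x where x: "x \<in> adjoint_e6" "y = ad.morph x" by blast
  obtain c where c: "fst x = (\<Sum>i<6. scl (c i) (hh i))" using coroot_span_expand[of "fst x"] x by (auto simp: adjoint_e6_def)
  have "ad_map (fst x) = (\<Sum>i<6. ad_scl (c i) (ad_hh i))" unfolding c by (simp add: ad.f_sum ad.f_scale ad.f_hh)
  then show "y \<in> ad.Y.adjoint_e6" using x ad.Y.coroot_span_comb[of c] by (simp add: adjoint_e6_def ad.Y.adjoint_e6_def supported_def ad.Y.supported_def)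
next
  fix y assume y: "y \<in> ad.Y.adjoint_e6"
  obtain c where c: "fst y = (\<Sum>i<6. ad_scl (c i) (ad_hh i))" using ad.Y.coroot_span_expand[of "fst y"] y by (auto simp: ad.Y.adjoint_e6_def)
  let ?x = "(\<Sum>i<6. scl (c i) (hh i), snd y)"
  have "?x \<in> adjoint_e6" using y coroot_span_comb[of c] by (simp add: adjoint_e6_def ad.Y.adjoint_e6_def supported_def ad.Y.supported_def)
  moreover have "y = ad.morph ?x" by (simp add: prod_eq_iff c ad.f_sum ad.f_scale ad.f_hh)
  ultimately show "y \<in> ad.morph ` adjoint_e6" by blast
qed

end

section \<open>The derived algebra of \<open>g(3,3)\<close> modulo its center\<close>

context g33_realization begin

sublocale C: contragredient_model scl cartan_g33 parity_g33 hh \<alpha> X.sca X.brW g33_h X.g33_e X.g33_f X.WP X.g33_component "X.grade_proj g33_weight"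
  by (rule g33_model)

sublocale ad: e6_morphism sclW hhW \<alpha>W ad_scl ad_hh ad_\<alpha> X.ad_map
  by (rule X.ad_morphism)

definition g33_coroot_span :: "'h set" where "g33_coroot_span = span (hh ` {..<4})"
definition g33_derived :: "(('h \<times> 'k \<times> 'k) \<times> (e6 \<Rightarrow> 'k)) set"
  where "g33_derived = {x. fst (fst x) \<in> g33_coroot_span \<and> snd (fst x) = 0 \<and> X.supp01 x}"

lemma g33_coroot_span_expand:
  assumes "h \<in> g33_coroot_span"
  obtains c where "h = (\<Sum>i<4. scl (c i) (hh i))"
proof -
  interpret vf: vector_families scl by unfold_locales
  show thesis using vf.family_span[of "{..<4}" h hh] assms that by (auto simp: g33_coroot_span_def)
qed

lemma g33_coroot_span_comb: "(\<Sum>i<4. scl (c i) (hh i)) \<in> g33_coroot_span"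
  unfolding g33_coroot_span_def by (intro span_sum span_scale span_base) auto

lemma g33_coroot_span_sub: "subspace g33_coroot_span" by (simp add: g33_coroot_span_def)

lemma g33_coroot_span_coroot_span: "(h, 0) \<in> X.coroot_span \<longleftrightarrow> h \<in> g33_coroot_span"
proof
  assume "(h, 0) \<in> X.coroot_span"
  then obtain c where "(h, 0) = (\<Sum>i<6. sclW (c i) (hhW i))" using X.coroot_span_expand by blast
  then have "h = (\<Sum>i<4. scl (c (i + 2)) (hh i))" unfolding sum_sclW by simp
  then show "h \<in> g33_coroot_span" by (simp add: g33_coroot_span_comb del: add_2_eq_Suc')
next
  assume "h \<in> g33_coroot_span"
  then obtain c where c: "h = (\<Sum>i<4. scl (c i) (hh i))" using g33_coroot_span_expand by blast
  \<comment> \<open>The coefficients at \<open>hhW 0\<close> and \<open>hhW 1\<close> cancel the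
    additional coordinates of \<open>hhW 2\<close> and \<open>hhW 3\<close>.\<close>
  let ?c = "\<lambda>i. if i = 0 then - c 0 else if i = 1 then - c 1 else c (i - 2)"
  have "(\<Sum>i<6. sclW (?c i) (hhW i)) = (h, 0)" unfolding sum_sclW c by (simp add: zero_prod_def)
  then show "(h, 0) \<in> X.coroot_span" using X.coroot_span_comb[of ?c] by simp
qed

lemma wt_ab: "X.wtE sA x = 2 * fst (snd x)" "X.wtE sB x = 2 * snd (snd x)"
  using X.wtE_simple_root[of 0] X.wtE_simple_root[of 1] by (simp_all add: \<alpha>W_def sr01)

lemma g33_derived_alt: "x \<in> g33_derived \<longleftrightarrow> fst x \<in> X.coroot_span \<and> X.wtE sA (fst x) = 0 \<and> X.wtE sB (fst x) = 0 \<and> X.supp01 x"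
proof -
  obtain h a b f where x: "x = ((h, a, b), f)" by (metis prod.exhaust)
  show ?thesis unfolding x using g33_coroot_span_coroot_span[of h] by (auto simp: g33_derived_def wt_ab zero_prod_def two_eq)
qed

lemma g33_derived_adjoint_g33: "g33_derived = X.adjoint_g33"
  by (auto simp: g33_derived_alt X.adjoint_g33_def)

lemma g33_derived_sub: "X.V.subspace g33_derived"
proof -
  have "g33_derived = {a + b | a b. a \<in> X.adjoint_g33 \<inter> X.WP 0 \<and> b \<in> X.adjoint_g33 \<inter> X.WP 1}" by (simp only: g33_derived_adjoint_g33 X.adjoint_g33_sum)
  have T: "X.V.subspace {x. fst x \<in> X.coroot_span}"
    by (rule X.V.subspaceI) (auto simp: X.fst_sca X.subspace_0[OF X.coroot_span_sub] X.subspace_add[OF X.coroot_span_sub] X.subspace_scale[OF X.coroot_span_sub])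
  have "X.V.subspace {x. X.wtE sA (fst x) = 0 \<and> X.wtE sB (fst x) = 0}"
    by (rule X.V.subspaceI) (auto simp: X.fst_sca X.wt_add2 X.wt_scale)
  then have "X.V.subspace ({x. fst x \<in> X.coroot_span} \<inter> ({x. X.wtE sA (fst x) = 0 \<and> X.wtE sB (fst x) = 0} \<inter> {x. X.supp01 x}))"
    by (intro X.V.subspace_inter T X.supp01_sub)
  moreover have "{x. fst x \<in> X.coroot_span} \<inter> ({x. X.wtE sA (fst x) = 0 \<and> X.wtE sB (fst x) = 0} \<inter> {x. X.supp01 x}) = g33_derived"
    by (auto simp: g33_derived_alt)
  ultimately show ?thesis by simp
qed

lemma fst_brW_coroot_span: "fst (X.brW x y) \<in> X.coroot_span"
  unfolding X.brW_def
  by (simp add: X.subspace_add[OF X.coroot_span_sub] X.subspace_diff[OF X.coroot_span_sub] X.fst_br_coroot_span)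

lemma split01: "X.supp01 x \<Longrightarrow> X.wtE sA (fst x) = 0 \<Longrightarrow> X.wtE sB (fst x) = 0 \<Longrightarrow>
    x = X.pr0 x + X.pr1 x \<and> X.pr0 x \<in> X.WP 0 \<and> X.pr1 x \<in> X.WP 1"
  using X.S01 by (auto simp: X.supp01_def X.WP_0 X.WP_1 X.pr0_def X.pr1_def prod_eq_iff fun_eq_iff)

lemma C_derived_sub: "X.V.subspace C.derived_image"
  by (simp add: C.derived_image_def)

lemma derived_image_eq: "C.derived_image = g33_derived"
proof
  \<comment> \<open>The product \<open>brW\<close> is controlled on sums of homogeneous elements of
    \<open>WP\<close>, so the image of \<open>lift\<close> is first confined to such sums.\<close>
  let ?U = "{x. X.wtE sA (fst x) = 0 \<and> X.wtE sB (fst x) = 0} \<inter> {x. X.supp01 x}"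
  have "X.V.subspace {x. X.wtE sA (fst x) = 0 \<and> X.wtE sB (fst x) = 0}"
    by (rule X.V.subspaceI) (auto simp: X.fst_sca X.wt_add2 X.wt_scale)
  then have U: "X.V.subspace ?U" by (intro X.V.subspace_inter X.supp01_sub)
  have WU: "X.WP p \<subseteq> ?U" for p
  proof
    fix y assume y: "y \<in> X.WP p"
    then have "X.supp01 y" by (rule X.WP_supp01)
    moreover have "X.wtE sA (fst y) = 0 \<and> X.wtE sB (fst y) = 0" using y by (cases p) (simp_all add: X.WP_def)
    ultimately show "y \<in> ?U" by simp
  qed
  have LU: "C.lift ` C.Car \<subseteq> ?U" by (rule C.lift_image_subset[OF U WU])
  have "X.brW a b \<in> ?U" if "a \<in> ?U" "b \<in> ?U" for a b
  proof -
    have s: "a = X.pr0 a + X.pr1 a" "X.pr0 a \<in> X.WP 0" "X.pr1 a \<in> X.WP 1"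
      "b = X.pr0 b + X.pr1 b" "X.pr0 b \<in> X.WP 0" "X.pr1 b \<in> X.WP 1"
      using split01[of a] split01[of b] that by blast+
    have "X.brW (X.pr0 a + X.pr1 a) (X.pr0 b + X.pr1 b) \<in> ?U"
      unfolding X.brW_add
      by (intro X.V.subspace_add[OF U] subsetD[OF WU[of "_ + _"]]; rule X.brW_WP; fact s)
    then show ?thesis using s(1,4) by simp
  qed
  then have "X.brW a b \<in> g33_derived" if "a \<in> C.lift ` C.Car" "b \<in> C.lift ` C.Car" for a b
    using LU that fst_brW_coroot_span[of a b] unfolding g33_derived_alt by blast
  then show "C.derived_image \<subseteq> g33_derived"
    unfolding C.derived_image_def by (intro X.V.span_minimal[OF _ g33_derived_sub]) blast
  show "g33_derived \<subseteq> C.derived_image"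
  proof
    fix x assume x: "x \<in> g33_derived"
    obtain c where c: "fst (fst x) = (\<Sum>i<4. scl (c i) (hh i))" using g33_coroot_span_expand[of "fst (fst x)"] x by (auto simp: g33_derived_def)
    have Hl: "g33_h 0 = 0" "g33_h (a + b) = g33_h a + g33_h b" "g33_h (scl k a) = X.sca k (g33_h a)" for a b k
      by (simp_all add: g33_h_def X.sca_def sclW_def prod_eq_iff fun_eq_iff)
    have "I \<subseteq> {..<4} \<Longrightarrow> g33_h (\<Sum>i\<in>I. scl (c i) (hh i)) \<in> C.derived_image" if "finite I" for I
      using that
    proof (induction I rule: finite_induct)
      case (insert i I)
      then have "g33_h (hh i) \<in> C.derived_image" by (intro C.Hc_derived) (simp add: dim_g33)
      then show ?case using insert by (simp add: Hl X.V.subspace_add[OF C_derived_sub] X.V.subspace_scale[OF C_derived_sub])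
    qed (simp add: Hl X.V.subspace_0[OF C_derived_sub])
    then have "g33_h (fst (fst x)) \<in> C.derived_image" unfolding c by simp
    moreover have "g33_h (fst (fst x)) = X.Hh (fst x)" using x by (simp add: g33_h_def X.Hh_def g33_derived_def prod_eq_iff)
    ultimately have H: "X.Hh (fst x) \<in> C.derived_image" by simp
    have E: "X.Ee r \<in> C.derived_image" if r: "r \<in> X.S0 \<union> X.S1" for r
    proof -
      obtain m k where m: "letters m \<subseteq> gens 4" "k \<noteq> 0"
        "magma_eval X.brW (generator_image g33_h X.g33_e X.g33_f) m = X.sca k (X.Ee r)"
        using X.reach4_all[OF r, of g33_h] unfolding X.reach4_def by blast
      have nH: "m \<noteq> Letter (Hgen a)" for a
      proof
        assume "m = Letter (Hgen a)"
        then have "g33_h a = X.sca k (X.Ee r)" using m(3) by simp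
        then have "snd (g33_h a) r = snd (X.sca k (X.Ee r)) r" by simp
        then show False using m(2) by (simp add: g33_h_def X.sca_def X.Ee_def)
      qed
      have "\<exists>a. \<alpha> j a \<noteq> 0" if "j < dim_row cartan_g33" for j
      proof -
        have j: "j < 4" using that by (simp add: dim_g33)
        have "\<alpha> 0 (hh 1) \<noteq> 0" "\<alpha> 1 (hh 0) \<noteq> 0" "\<alpha> 2 (hh 1) \<noteq> 0" "\<alpha> 3 (hh 2) \<noteq> 0"
          using \<alpha>_hh[of 1 0] \<alpha>_hh[of 0 1] \<alpha>_hh[of 1 2] \<alpha>_hh[of 2 3] by (simp_all add: cartan_g33_entry)
        then show ?thesis using j unfolding less4 by blast
      qed
      then have "X.sca k (X.Ee r) \<in> C.derived_image" using C.ev_derived[of m] nH m by (simp add: dim_g33)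
      then have "X.sca (inverse k) (X.sca k (X.Ee r)) \<in> C.derived_image" by (rule X.V.subspace_scale[OF C_derived_sub])
      then show ?thesis using m(2) by simp
    qed
    have "x = X.Hh (fst x) + (\<Sum>r\<in>X.S0 \<union> X.S1. X.sca (snd x r) (X.Ee r))" using x by (intro X.supp01_expand) (simp add: g33_derived_def)
    also have "\<dots> \<in> C.derived_image"
      using C_derived_sub H E by (intro X.V.subspace_add X.V.subspace_sum X.V.subspace_scale)
    finally show "x \<in> C.derived_image" .
  qed
qed

lemma center:
  assumes x: "x \<in> g33_derived"
  shows "ad.morph x = 0 \<longleftrightarrow> (\<forall>y\<in>g33_derived. X.brW x y = 0)"
proof
  assume "ad.morph x = 0"
  then have f: "X.ad_map (fst x) = 0" and s: "snd x = 0" by (simp_all add: ad.morph_def zero_prod_def)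
  have w: "X.wtE q (fst x) = 0" for q using ad.f_wt[of q "fst x"] by (simp add: f)
  have xH: "x = X.Hh (fst x)" using s by (simp add: X.Hh_def prod_eq_iff)
  have sum: "X.brW x (\<Sum>r\<in>R. X.sca (u r) (X.Ee r)) = 0" if "finite R" "R \<subseteq> X.S0 \<union> X.S1" for R u
    using that
  proof (induction R rule: finite_induct)
    case (insert r R)
    have "X.brW x (X.Ee r) = 0" using X.brW_HE[of r "fst x"] insert.prems w xH by simp
    then show ?case using insert by (simp add: X.brW_add X.brW_scale)
  qed simp
  show "\<forall>y\<in>g33_derived. X.brW x y = 0"
  proof
    fix y assume y: "y \<in> g33_derived"
    have fin: "finite (X.S0 \<union> X.S1)" by (rule finite_subset[OF _ E.finite_roots]) (auto simp: X.S_type)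
    have "y = X.Hh (fst y) + (\<Sum>r\<in>X.S0 \<union> X.S1. X.sca (snd y r) (X.Ee r))" using y by (intro X.supp01_expand) (simp add: g33_derived_def)
    also have "X.brW x \<dots> = X.brW x (X.Hh (fst y))" unfolding X.brW_add sum[OF fin order_refl] by simp
    also have "\<dots> = 0" using X.brW_HH[of "fst x" "fst y"] xH by simp
    finally show "X.brW x y = 0" .
  qed
next
  assume c: "\<forall>y\<in>g33_derived. X.brW x y = 0"
  have W: "X.wtE sA (fst x) = 0" "X.wtE sB (fst x) = 0" "X.supp01 x" using x by (simp_all add: g33_derived_alt)
  define x0 x1 where "x0 = X.pr0 x" and "x1 = X.pr1 x"
  have x01: "x = x0 + x1" "x0 \<in> X.WP 0" "x1 \<in> X.WP 1" using split01[OF W(3,1,2)] by (simp_all add: x0_def x1_def)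
  have ED: "X.Ee r \<in> g33_derived" if "r \<in> X.S0 \<union> X.S1" for r
    using X.supp01_E[OF that] subspace_0[OF g33_coroot_span_sub] by (simp add: g33_derived_def) (simp add: X.Ee_def)
  \<comment> \<open>The center is defined by products with \<open>x\<close> on the left, while
    \<open>brW_dual\<close> has \<open>x\<close> on the right. As \<open>x\<close> has no definite
    parity, it is split: its two components have products with a homogeneous \<open>y\<close> of
    different parities, so both products vanish, and each can be reversed.\<close>
  have comm: "X.brW y x = 0" if y: "y \<in> X.WP q" "X.brW x y = 0" for y q
  proof -
    have s: "X.brW x0 y + X.brW x1 y = 0" using y(2) x01(1) by (simp add: X.brW_add)
    have p: "X.brW x0 y \<in> X.WP (0 + q)" "X.brW x1 y \<in> X.WP (1 + q)"
      by (rule X.brW_WP[OF x01(2) y(1)] X.brW_WP[OF x01(3) y(1)])+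
    have "X.brW x0 y = - X.brW x1 y" using s by (simp add: eq_neg_iff_add_eq_0)
    then have "X.brW x0 y \<in> X.WP (1 + q)" using X.V.subspace_neg[OF X.WP_sub p(2)] by simp
    then have z: "X.brW x0 y = 0" using p(1) X.WP_Int[of "X.brW x0 y"] by (cases q) auto
    then have z1: "X.brW x1 y = 0" using s by simp
    have "X.brW y x0 + X.sca (koszul_sign q 0) (X.brW x0 y) = 0" "X.brW y x1 + X.sca (koszul_sign q 1) (X.brW x1 y) = 0"
      using X.brW_antisym[OF y(1) x01(2)] X.brW_antisym[OF y(1) x01(3)] by simp_all
    then show ?thesis using z z1 x01(1) by (simp add: X.brW_add)
  qed
  have EW: "\<exists>q. X.Ee r \<in> X.WP q" if "r \<in> X.S0 \<union> X.S1" for r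
  proof (cases "r \<in> X.S0")
    case True then show ?thesis by (intro exI[of _ 0]) (simp add: X.WP_0 X.E_parts, simp add: X.Ee_def)
  next
    case False then show ?thesis using that by (intro exI[of _ 1]) (simp add: X.WP_1 X.E_parts)
  qed
  have "snd x r = 0" for r
  proof (cases "r \<in> X.S0 \<union> X.S1")
    case True
    have "\<exists>r' c z. r' \<in> X.S0 \<union> X.S1 \<and> c \<noteq> 0 \<and> (\<forall>x. fst (X.brW (X.Ee r') x) = sclW (c * snd x r) (X.hmE z)) \<and> e6_form z z \<in> {1, 2, 3}"
      by (rule X.brW_dual[OF True]) blast
    then obtain r' c z where r': "r' \<in> X.S0 \<union> X.S1" "c \<noteq> 0" "fst (X.brW (X.Ee r') x) = sclW (c * snd x r) (X.hmE z)" "e6_form z z \<in> {1, 2, 3}"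
      by blast
    obtain q where "X.Ee r' \<in> X.WP q" using EW[OF r'(1)] by blast
    then have "X.brW (X.Ee r') x = 0" using comm c ED[OF r'(1)] by blast
    then have "sclW (c * snd x r) (X.hmE z) = 0" using r'(3) by simp
    moreover have "X.hmE z \<noteq> 0" using X.root_hmE_nonzero[of z] hhW_indep r'(4) by blast
    ultimately have "c * snd x r = 0" by (simp only: X.scale_eq_0_iff simp_thms)
    then show ?thesis using r'(2) by simp
  qed (use W in \<open>unfold X.supp01_def, blast\<close>)
  then have s: "snd x = 0" by (intro ext) simp
  then have xH: "x = X.Hh (fst x)" by (simp add: X.Hh_def prod_eq_iff)
  have w: "\<alpha>W (j + 2) (fst x) = 0" if j: "j < 4" for j
  proof -
    note t = X.g33_root_g33_neg_root_type(1)[OF j]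
    have "X.brW (X.Hh (fst x)) (X.Ee (g33_root j)) = 0" using c ED[OF t] xH by metis
    then have "X.sca (\<alpha>W (j + 2) (fst x)) (X.Ee (g33_root j)) = 0"
      using X.brW_HE[OF t, of "fst x"] X.wtE_simple_root[of "j + 2"] j by (simp add: g33_root_def)
    from arg_cong[OF this, of "\<lambda>x. snd x (g33_root j)"] show ?thesis by (simp add: X.sca_def X.Ee_def)
  qed
  have "\<alpha>W 0 (fst x) = 0" "\<alpha>W 1 (fst x) = 0" using W by (simp_all add: wt_ab \<alpha>W_def)
  then have "\<alpha>W j (fst x) = 0" if "j < 6" for j
    using that w[of 0] w[of 1] w[of 2] w[of 3] unfolding less6 by (auto simp: eval_nat_numeral)
  then show "ad.morph x = 0" using s by (simp add: ad.morph_def zero_prod_def X.ad_map_def fun_eq_iff)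
qed

lemma morph_image: "ad.morph ` g33_derived = ad.Y.adjoint_g33" "ad.morph ` (g33_derived \<inter> X.WP p) = ad.Y.adjoint_g33 \<inter> ad.Y.WP p"
proof -
  have into: "ad.morph x \<in> ad.Y.adjoint_g33" if x: "x \<in> g33_derived" for x
  proof -
    have "fst x \<in> X.coroot_span" using x by (simp add: g33_derived_alt)
    then obtain c where c: "fst x = (\<Sum>i<6. sclW (c i) (hhW i))" using X.coroot_span_expand by blast
    have "X.ad_map (fst x) = (\<Sum>i<6. ad_scl (c i) (ad_hh i))" unfolding c by (simp add: ad.f_sum ad.f_scale ad.f_hh)
    then have "X.ad_map (fst x) \<in> ad.Y.coroot_span" by (simp add: ad.Y.coroot_span_comb)
    then show ?thesis using x by (simp add: g33_derived_alt ad.Y.adjoint_g33_def ad.f_wt X.supp01_def ad.Y.supp01_def)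
  qed
  \<comment> \<open>A preimage of an odd element has to be odd, so its Cartan part must be 0 and not
    merely lie in the kernel of the adjoint map. The last clause provides this.\<close>
  have onto: "\<exists>x\<in>g33_derived. y = ad.morph x \<and> (fst y = 0 \<longrightarrow> fst x = 0)" if y: "y \<in> ad.Y.adjoint_g33" for y
  proof (cases "fst y = 0")
    case True
    have "(0, snd y) \<in> g33_derived" using y subspace_0[OF g33_coroot_span_sub] by (simp add: g33_derived_def ad.Y.adjoint_g33_def X.supp01_def ad.Y.supp01_def)
    then show ?thesis using True by (intro bexI[of _ "(0, snd y)"]) (auto simp: prod_eq_iff)
  next
    case False
    obtain c where c: "fst y = (\<Sum>i<6. ad_scl (c i) (ad_hh i))" using ad.Y.coroot_span_expand[of "fst y"] y by (auto simp: ad.Y.adjoint_g33_def)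
    define t where "t = (\<Sum>i<6. sclW (c i) (hhW i))"
    have ft: "X.ad_map t = fst y" unfolding t_def c by (simp add: ad.f_sum ad.f_scale ad.f_hh)
    have "X.wtE sA t = 0" "X.wtE sB t = 0" using y unfolding ad.f_wt[symmetric] ft by (simp_all add: ad.Y.adjoint_g33_def)
    then have "(t, snd y) \<in> g33_derived" using y X.coroot_span_comb[of c]
      by (simp add: g33_derived_alt t_def[symmetric] ad.Y.adjoint_g33_def X.supp01_def ad.Y.supp01_def)
    then show ?thesis using False ft by (intro bexI[of _ "(t, snd y)"]) (auto simp: prod_eq_iff)
  qed
  show "ad.morph ` g33_derived = ad.Y.adjoint_g33" using into onto by blast
  show "ad.morph ` (g33_derived \<inter> X.WP p) = ad.Y.adjoint_g33 \<inter> ad.Y.WP p"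
  proof (intro equalityI subsetI)
    fix y assume "y \<in> ad.morph ` (g33_derived \<inter> X.WP p)"
    then obtain x where x: "x \<in> g33_derived" "x \<in> X.WP p" "y = ad.morph x" by blast
    have "ad.morph x \<in> ad.Y.WP p" using x(2) by (auto simp: X.WP_def ad.Y.WP_def ad.f_wt split: if_splits)
    then show "y \<in> ad.Y.adjoint_g33 \<inter> ad.Y.WP p" using into x by blast
  next
    fix y assume y: "y \<in> ad.Y.adjoint_g33 \<inter> ad.Y.WP p"
    then obtain x where x: "x \<in> g33_derived" "y = ad.morph x" "fst y = 0 \<longrightarrow> fst x = 0" using onto[of y] by blast
    have "x \<in> X.WP p" using x y by (auto simp: X.WP_def ad.Y.WP_def ad.f_wt split: if_splits)
    then show "y \<in> ad.morph ` (g33_derived \<inter> X.WP p)" using x by blast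
  qed
qed

end

section \<open>Comparison of the two quotients\<close>

lemma realization_data:
  fixes scl :: "'k::field \<Rightarrow> 'h::ab_group_add \<Rightarrow> 'h"
  assumes "realization A scl hh \<alpha>" "dim_row A = n" "dim_col A = n"
  shows "vector_space scl"
    and "j < n \<Longrightarrow> \<alpha> j (x + y) = \<alpha> j x + \<alpha> j y" "j < n \<Longrightarrow> \<alpha> j (scl c x) = c * \<alpha> j x"
    and "i < n \<Longrightarrow> j < n \<Longrightarrow> \<alpha> j (hh i) = of_int (A $$ (i, j))"
    and "(\<Sum>i<n. scl (f i) (hh i)) = 0 \<Longrightarrow> i < n \<Longrightarrow> f i = 0"
proof -
  note r = assms(1)[unfolded realization_def Let_def assms(2)]
  show vs: "vector_space scl" using r unfolding finite_dimensional_vector_space_def by blast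
  have l: "Vector_Spaces.linear scl (*) (\<alpha> j)" if "j < n" for j using r that by blast
  show "\<alpha> j (x + y) = \<alpha> j x + \<alpha> j y" if "j < n"
    using l[OF that] unfolding linear_iff_module_hom by (rule module_hom.add)
  show "\<alpha> j (scl c x) = c * \<alpha> j x" if "j < n"
    using l[OF that] unfolding linear_iff_module_hom by (rule module_hom.scale)
  show "\<alpha> j (hh i) = of_int (A $$ (i, j))" if "i < n" "j < n"
    using r that assms(2,3) by (simp add: index_map_mat)
  show "f i = 0" if "(\<Sum>i<n. scl (f i) (hh i)) = 0" "i < n"
  proof -
    interpret vf: vector_families scl unfolding vector_families_def by (rule vs)
    have "inj_on hh {..<n}" "vf.independent (hh ` {..<n})" using r by blast+
    then have "vf.family_indep {..<n} hh" using vf.family_indep_iff[of "{..<n}" hh] by simp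
    then show ?thesis using vf.family_indepD[of "{..<n}" hh f i] that by simp
  qed
qed

theorem corollary4p4p2:
  fixes scl1 :: "'k::alg_closed_field \<Rightarrow> 'h1::ab_group_add \<Rightarrow> 'h1"
    and hh1 :: "nat \<Rightarrow> 'h1" and \<alpha>1 :: "nat \<Rightarrow> 'h1 \<Rightarrow> 'k"
    and scl2 :: "'k \<Rightarrow> 'h2::ab_group_add \<Rightarrow> 'h2"
    and hh2 :: "nat \<Rightarrow> 'h2" and \<alpha>2 :: "nat \<Rightarrow> 'h2 \<Rightarrow> 'k"
  assumes "CHAR('k) = 3"
    and "realization cartan_e6 scl1 hh1 \<alpha>1"
    and "realization cartan_g33 scl2 hh2 \<alpha>2"
  shows
    "let e = chevalley_e cartan_e6 parity_e6 scl1 hh1 \<alpha>1;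
         E = derived_algebra (contragredient cartan_e6 parity_e6 scl1 hh1 \<alpha>1);
         L = sa_quotient E (sa_center E);
         u = sa_center E +>\<^bsub>E\<^esub> (e 0 \<oplus>\<^bsub>E\<^esub> e 1);
         d = (\<lambda>v. u \<otimes>\<^bsub>L\<^esub> v);
         G = derived_algebra (contragredient cartan_g33 parity_g33 scl2 hh2 \<alpha>2);
         M = sa_quotient G (sa_center G)
     in (\<exists>n1 n2 n3 x. jordan_decomposition L d n1 n2 n3 x) \<and>
        (\<forall>n1 n2 n3 x. jordan_decomposition L d n1 n2 n3 x \<longrightarrow>
           sa_isomorphic (semisimplification L d n1 n2 n3 x) M)"
proof -
  have char3: "(3::'k) = 0" using of_nat_CHAR[where 'a = 'k] unfolding assms(1) by simp
  have col: "dim_col cartan_e6 = 6" "dim_col cartan_g33 = 4"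
    by (simp_all add: cartan_e6_def cartan_g33_def mat_of_rows_list_def)
  note d1 = realization_data[OF assms(2) dim_e6 col(1)] and d2 = realization_data[OF assms(3) dim_g33 col(2)]
  \<comment> \<open>Both quotients are compared inside the adjoint realization, which depends on
    neither of the two given Cartan spaces.\<close>
  interpret R: e6_realization "ad_scl :: 'k \<Rightarrow> _" ad_hh ad_\<alpha> by (rule ad_realization[OF char3])
  interpret A: independent_e6_realization scl1 hh1 \<alpha>1
    by (intro independent_e6_realization.intro e6_realization.intro e6_realization_axioms.intro independent_e6_realization_axioms.intro) (fact d1 char3)+
  interpret B: g33_realization scl2 hh2 \<alpha>2
    by (intro g33_realization.intro g33_realization_axioms.intro) (fact d2 char3)+
  let ?E = "derived_algebra (contragredient cartan_e6 parity_e6 scl1 hh1 \<alpha>1)"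
  let ?L = "sa_quotient ?E (sa_center ?E)"
  let ?G = "derived_algebra (contragredient cartan_g33 parity_g33 scl2 hh2 \<alpha>2)"
  let ?M = "sa_quotient ?G (sa_center ?G)"
  let ?e = "chevalley_e cartan_e6 parity_e6 scl1 hh1 \<alpha>1"
  let ?u = "sa_center ?E +>\<^bsub>?E\<^esub> (?e 0 \<oplus>\<^bsub>?E\<^esub> ?e 1)"
  let ?d = "\<lambda>v. ?u \<otimes>\<^bsub>?L\<^esub> v"
  obtain \<psi> where \<psi>: "vectorspace class_ring ?L" "bij_betw \<psi> (carrier ?L) (A.ad.morph ` A.C.derived_image)"
    "\<And>x. x \<in> A.C.derived_car \<Longrightarrow> A.C.derived_class x \<in> carrier ?L \<and> \<psi> (A.C.derived_class x) = A.ad.morph (A.C.lift x)"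
    "\<And>v w. v \<in> carrier ?L \<Longrightarrow> w \<in> carrier ?L \<Longrightarrow> v \<oplus>\<^bsub>?L\<^esub> w \<in> carrier ?L \<and> \<psi> (v \<oplus>\<^bsub>?L\<^esub> w) = \<psi> v + \<psi> w"
    "\<And>v w. v \<in> carrier ?L \<Longrightarrow> w \<in> carrier ?L \<Longrightarrow> v \<otimes>\<^bsub>?L\<^esub> w \<in> carrier ?L \<and> \<psi> (v \<otimes>\<^bsub>?L\<^esub> w) = R.br (\<psi> v) (\<psi> w)"
    "\<And>c v. v \<in> carrier ?L \<Longrightarrow> c \<odot>\<^bsub>?L\<^esub> v \<in> carrier ?L \<and> \<psi> (c \<odot>\<^bsub>?L\<^esub> v) = R.sca c (\<psi> v)"
  proof (rule A.C.derived_quotient_model[of A.ad.morph R.br R.sca])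
    show "A.ad.morph x = 0 \<longleftrightarrow> (\<forall>y\<in>A.C.derived_image. A.br x y = 0)" if "x \<in> A.C.derived_image" for x
      using A.center[of x] that unfolding A.derived_image_eq by blast
    show "x \<in> A.e6_parity 0 \<Longrightarrow> x \<in> A.e6_parity 1 \<Longrightarrow> x = 0" for x by (simp add: A.e6_parity_def)
  qed (simp_all add: A.ad.morph_lin A.ad.morph_br)
  obtain \<phi> where \<phi>: "bij_betw \<phi> (carrier ?M) (B.ad.morph ` B.C.derived_image)"
    "\<And>v w. v \<in> carrier ?M \<Longrightarrow> w \<in> carrier ?M \<Longrightarrow> v \<oplus>\<^bsub>?M\<^esub> w \<in> carrier ?M \<and> \<phi> (v \<oplus>\<^bsub>?M\<^esub> w) = \<phi> v + \<phi> w"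
    "\<And>v w. v \<in> carrier ?M \<Longrightarrow> w \<in> carrier ?M \<Longrightarrow> v \<otimes>\<^bsub>?M\<^esub> w \<in> carrier ?M \<and> \<phi> (v \<otimes>\<^bsub>?M\<^esub> w) = R.brW (\<phi> v) (\<phi> w)"
    "\<And>c v. v \<in> carrier ?M \<Longrightarrow> c \<odot>\<^bsub>?M\<^esub> v \<in> carrier ?M \<and> \<phi> (c \<odot>\<^bsub>?M\<^esub> v) = R.sca c (\<phi> v)"
    "\<And>p. part ?M p \<subseteq> carrier ?M \<and> \<phi> ` part ?M p = B.ad.morph ` (B.C.derived_image \<inter> B.X.WP p)"
  proof (rule B.C.derived_quotient_model[of B.ad.morph R.brW R.sca])
    show "B.ad.morph x = 0 \<longleftrightarrow> (\<forall>y\<in>B.C.derived_image. B.X.brW x y = 0)" if "x \<in> B.C.derived_image" for x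
      using B.center[of x] that unfolding B.derived_image_eq by blast
    show "x \<in> B.X.WP 0 \<Longrightarrow> x \<in> B.X.WP 1 \<Longrightarrow> x = 0" for x by (rule B.X.WP_Int)
  qed (simp_all add: B.ad.morph_lin B.ad.morph_brW)
  have \<psi>_bij: "bij_betw \<psi> (carrier ?L) R.adjoint_e6" using \<psi>(2) unfolding A.derived_image_eq A.morph_image .
  have \<phi>_bij: "bij_betw \<phi> (carrier ?M) R.adjoint_g33" using \<phi>(1) unfolding B.derived_image_eq B.morph_image .
  have \<phi>_part: "part ?M p \<subseteq> carrier ?M" "\<phi> ` part ?M p = R.adjoint_g33 \<inter> R.WP p" for p
    using \<phi>(5)[of p] unfolding B.derived_image_eq B.morph_image by simp_all
  have u: "?u \<in> carrier ?L" "\<psi> ?u = R.Ee sA + R.Ee sB"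
  proof -
    interpret D: presentation free_scale ?E free_mult A.C.derived_car A.C.K "\<lambda>p. A.C.Fpart p \<inter> A.C.derived_car" A.C.cg
      by (rule A.C.derived_presentation)
    have l: "A.C.lift (free_letter (Egen i)) = A.e6_e i" for i
      using A.C.lift_simps(3)[of "Letter (Egen i)"] by (simp add: free_letter_def)
    have e: "free_letter (Egen i) \<in> A.C.derived_car" if i: "i < 6" for i
    proof -
      have "A.Ee (simple_root i) \<in> A.adjoint_e6"
        using A.supported_E[OF simple_root_root[OF i]] A.subspace_0[OF A.coroot_span_sub] by (simp add: A.adjoint_e6_def) (simp add: A.Ee_def)
      then show ?thesis using A.C.free_letter_Car(2)[of i] i
        by (simp add: A.C.derived_car_def l A.derived_image_eq A.e6_e_def dim_e6)
    qed
    have "?e 0 \<oplus>\<^bsub>?E\<^esub> ?e 1 = A.C.cg (free_letter (Egen 0) + free_letter (Egen 1))"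
      unfolding A.C.chevalley_e_eq using e[of 0] e[of 1] by (simp add: D.\<pi>_add)
    then have "?u = A.C.derived_class (free_letter (Egen 0) + free_letter (Egen 1))" unfolding A.C.derived_class_def by simp
    moreover have "free_letter (Egen 0) + free_letter (Egen 1) \<in> A.C.derived_car" using e[of 0] e[of 1] by (simp add: D.S_closed)
    ultimately show "?u \<in> carrier ?L" "\<psi> ?u = R.Ee sA + R.Ee sB"
      using \<psi>(3) by (simp_all add: A.C.lift_simps l A.e6_e_def A.ad.morph_lin A.ad.morph_E sr01)
  qed
  \<comment> \<open>The coordinates of the second quotient are inverted, because the isomorphism
    ends in the record \<open>?M\<close>.\<close>
  define \<rho> where "\<rho> = inv_into (carrier ?M) \<phi>"
  have \<rho>: "bij_betw \<rho> R.adjoint_g33 (carrier ?M)" unfolding \<rho>_def by (rule bij_betw_inv_into[OF \<phi>_bij])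
  have \<rho>C: "r \<in> R.adjoint_g33 \<Longrightarrow> \<rho> r \<in> carrier ?M" for r using \<rho> by (auto simp: bij_betw_def)
  have \<phi>\<rho>: "r \<in> R.adjoint_g33 \<Longrightarrow> \<phi> (\<rho> r) = r" for r unfolding \<rho>_def by (rule bij_betw_inv_into_right[OF \<phi>_bij])
  have \<rho>\<phi>: "v \<in> carrier ?M \<Longrightarrow> \<rho> (\<phi> v) = v" for v unfolding \<rho>_def by (rule bij_betw_inv_into_left[OF \<phi>_bij])
  have \<rho>_part: "part ?M p = \<rho> ` (R.adjoint_g33 \<inter> R.WP p)" for p
    unfolding \<phi>_part(2)[symmetric] image_image using \<phi>_part(1)[of p] \<rho>\<phi> by force
  interpret I: semisimplification_iso R.sca R.adjoint_e6 R.dd R.sca R.br R.pr0 R.pr1 R.brW "R.adjoint_g33 \<inter> R.WP 0" "R.adjoint_g33 \<inter> R.WP 1"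
    ?L ?d \<psi> ?M \<rho>
  proof (intro semisimplification_iso.intro semisimplification_iso_axioms.intro R.target, unfold R.adjoint_g33_sum)
    fix c :: 'k and r r' x y
    show "vectorspace class_ring ?L" by (rule \<psi>(1))
    show "bij_betw \<psi> (carrier ?L) R.adjoint_e6" by (rule \<psi>_bij)
    show "x \<in> carrier ?L \<Longrightarrow> y \<in> carrier ?L \<Longrightarrow> \<psi> (x \<oplus>\<^bsub>?L\<^esub> y) = \<psi> x + \<psi> y" using \<psi>(4) by blast
    show "x \<in> carrier ?L \<Longrightarrow> \<psi> (c \<odot>\<^bsub>?L\<^esub> x) = R.sca c (\<psi> x)" using \<psi>(6) by blast
    show "x \<in> carrier ?L \<Longrightarrow> y \<in> carrier ?L \<Longrightarrow> x \<otimes>\<^bsub>?L\<^esub> y \<in> carrier ?L \<and> \<psi> (x \<otimes>\<^bsub>?L\<^esub> y) = R.br (\<psi> x) (\<psi> y)"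
      by (rule \<psi>(5))
    show "x \<in> carrier ?L \<Longrightarrow> ?d x \<in> carrier ?L \<and> \<psi> (?d x) = R.dd (\<psi> x)"
      using \<psi>(5)[OF u(1), of x] unfolding u(2) R.dd_def .
    show "bij_betw \<rho> R.adjoint_g33 (carrier ?M)" by (rule \<rho>)
    show "r \<in> R.adjoint_g33 \<Longrightarrow> r' \<in> R.adjoint_g33 \<Longrightarrow> \<rho> (r + r') = \<rho> r \<oplus>\<^bsub>?M\<^esub> \<rho> r'"
      using \<phi>(2)[OF \<rho>C \<rho>C] \<phi>\<rho> \<rho>\<phi> by metis
    show "r \<in> R.adjoint_g33 \<Longrightarrow> r' \<in> R.adjoint_g33 \<Longrightarrow> \<rho> (R.brW r r') = \<rho> r \<otimes>\<^bsub>?M\<^esub> \<rho> r'"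
      using \<phi>(3)[OF \<rho>C \<rho>C] \<phi>\<rho> \<rho>\<phi> by metis
    show "r \<in> R.adjoint_g33 \<Longrightarrow> \<rho> (R.sca c r) = c \<odot>\<^bsub>?M\<^esub> \<rho> r"
      using \<phi>(4)[OF \<rho>C] \<phi>\<rho> \<rho>\<phi> by metis
    show "part ?M 0 = \<rho> ` (R.adjoint_g33 \<inter> R.WP 0)" "part ?M 1 = \<rho> ` (R.adjoint_g33 \<inter> R.WP 1)" by (rule \<rho>_part)+
  qed
  obtain F where F: "finite F" "R.adjoint_e6 \<subseteq> R.V.span F" using R.adjoint_e6_finite_span by blast
  have "\<exists>n1 n2 n3 x. jordan_decomposition ?L ?d n1 n2 n3 x" by (rule I.jordan_exists[OF R.dd3 F])
  moreover have "\<forall>n1 n2 n3 x. jordan_decomposition ?L ?d n1 n2 n3 x \<longrightarrow> sa_isomorphic (semisimplification ?L ?d n1 n2 n3 x) ?M"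
    using I.semisimplification_isomorphic by blast
  ultimately show ?thesis unfolding Let_def by blast
qed

end
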